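(* Let $\Bbbk = \overline{\mathbb F}_2$. There exists a $G_{\Bbbk}$-equivariant flat family $\pi : \mathcal N_S \longrightarrow \mathbb A^1_{\Bbbk}$ (with $G_{\Bbbk}$ acting trivially on $\mathbb A^1_{\Bbbk}$) with the following properties: 1. $\pi^{-1}(t) \cong \mathcal N_{\Bbbk}$ for $t \neq 0$; 2. there exists an isogeny $\mathsf F_1 : \mathfrak N_{\Bbbk} \longrightarrow \pi^{-1}(0)$, which is an endomorphism as varieties (i.e. after forgetting the $G_{\Bbbk}$-actions, $\pi^{-1}(0)$ is identified with the variety $\mathfrak N_{\Bbbk}$). Moreover, for each $G_{\Bbbk}$-orbit $\mathcal O_{\Bbbk} \subset \mathfrak N_{\Bbbk}$, there exists a flat subfamily of single $G_{\Bbbk}$-orbits $\mathcal O_S \subset \mathcal N_S$ (a subfamily flat over $\mathbb A^1_{\Bbbk}$, each fibre of which is a single $G_{\Bbbk}$-orbit) such that $\mathcal O_S \cap \pi^{-1}(0) = \mathsf F_1(\mathcal O_{\Bbbk})$.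
   Context: $G = \mathrm{Sp}(2n)$ is the symplectic group over $\mathbb Z$ and $\mathfrak g$ its Lie algebra over $\mathbb Z$; $\mathcal N$ is the subscheme of nilpotent elements of $\mathfrak g$. $V_1$ is the vector representation of $G$ (free of rank $2n$), $V_2 := \wedge^2 V_1$, $\mathbb V := V_1 \oplus V_2$, and $\mathfrak N \subset \mathbb V$ is the closed subscheme defined by the ideal generated by the $G$-invariant polynomials on $\mathbb V$ without constant term. A subscript $\Bbbk$ denotes base change to $\Bbbk$; in particular $\mathcal N_{\Bbbk}$ is the variety of nilpotent elements of $\mathfrak{sp}_{2n}(\Bbbk)$ with the adjoint action. "Isogeny" means a finite $G_{\Bbbk}$-equivariant morphism which is bijective on $\Bbbk$-points. *)

theory Defs
  imports
    "HOL-Analysis.Analysis"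
    "HOL-Library.Poly_Mapping"
    "HOL-Library.Z2"
    "HOL-Algebra.Algebraic_Closure_Type"
begin

section \<open>Polynomials and ideals\<close>

text \<open>Polynomials in variables from an arbitrary type, as finitely supported functions on
  monomials.\<close>

type_synonym ('v, 'a) mpoly = "('v \<Rightarrow>\<^sub>0 nat) \<Rightarrow>\<^sub>0 'a"

definition Const :: "'a::comm_ring_1 \<Rightarrow> ('v, 'a) mpoly" where
  "Const c = Poly_Mapping.single 0 c"

definition Var :: "'v \<Rightarrow> ('v, 'a::comm_ring_1) mpoly" where
  "Var v = Poly_Mapping.single (Poly_Mapping.single v 1) 1"

text \<open>Evaluation along a ring homomorphism \<open>h\<close> of the coefficients.\<close>

definition eval_hom :: "('a::comm_ring_1 \<Rightarrow> 'r::comm_ring_1) \<Rightarrow> ('v \<Rightarrow> 'r) \<Rightarrow> ('v, 'a) mpoly \<Rightarrow> 'r" where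
  "eval_hom h x p =
     (\<Sum>m\<in>Poly_Mapping.keys p. h (Poly_Mapping.lookup p m) *
        (\<Prod>v\<in>Poly_Mapping.keys m. x v ^ Poly_Mapping.lookup m v))"

definition eval_at :: "('v \<Rightarrow> 'a::comm_ring_1) \<Rightarrow> ('v, 'a) mpoly \<Rightarrow> 'a" where
  "eval_at = eval_hom (\<lambda>c. c)"

definition subst :: "('v \<Rightarrow> ('w, 'a::comm_ring_1) mpoly) \<Rightarrow> ('v, 'a) mpoly \<Rightarrow> ('w, 'a) mpoly" where
  "subst = eval_hom Const"

abbreviation is_ideal :: "'r::comm_ring_1 set \<Rightarrow> bool" where
  "is_ideal \<equiv> Modules.module.subspace (*)"

abbreviation ideal_gen :: "'r::comm_ring_1 set \<Rightarrow> 'r set" where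
  "ideal_gen \<equiv> Modules.module.span (*)"

definition radical_ideal :: "'r::comm_ring_1 set \<Rightarrow> 'r set" where
  "radical_ideal I = {p. \<exists>n. p ^ n \<in> I}"


section \<open>Affine schemes\<close>

text \<open>An ideal \<open>I\<close> of a polynomial ring \<open>k[x\<^sub>v : v \<in> 'v]\<close> over an algebraically closed field
  stands for the affine scheme \<open>Spec (k[x]/I)\<close>. Its closed points are the zeros of \<open>I\<close>. A morphism
  into the scheme of \<open>J\<close> is a tuple of polynomials, one for each coordinate of the target; it is
  determined by their classes modulo \<open>I\<close>. The reduced subscheme is given by \<open>radical_ideal I\<close>.\<close>

definition points :: "('v, 'k::field) mpoly set \<Rightarrow> ('v \<Rightarrow> 'k) set" where
  "points I = {x. \<forall>p\<in>I. eval_at x p = 0}"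

definition vanishing_ideal :: "('v \<Rightarrow> 'k::field) set \<Rightarrow> ('v, 'k) mpoly set" where
  "vanishing_ideal S = {p. \<forall>x\<in>S. eval_at x p = 0}"

definition morphism ::
  "('v, 'k::field) mpoly set \<Rightarrow> ('w, 'k) mpoly set \<Rightarrow> ('w \<Rightarrow> ('v, 'k) mpoly) \<Rightarrow> bool" where
  "morphism I J f \<longleftrightarrow> (\<forall>p\<in>J. subst f p \<in> I)"

definition point_map :: "('w \<Rightarrow> ('v, 'k::field) mpoly) \<Rightarrow> ('v \<Rightarrow> 'k) \<Rightarrow> ('w \<Rightarrow> 'k)" where
  "point_map f x = (\<lambda>w. eval_at x (f w))"

definition inverse_morphisms ::
  "('v, 'k::field) mpoly set \<Rightarrow> ('w, 'k) mpoly set \<Rightarrow>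
   ('w \<Rightarrow> ('v, 'k) mpoly) \<Rightarrow> ('v \<Rightarrow> ('w, 'k) mpoly) \<Rightarrow> bool" where
  "inverse_morphisms I J f f' \<longleftrightarrow> morphism I J f \<and> morphism J I f' \<and>
     (\<forall>v. subst f (f' v) - Var v \<in> I) \<and> (\<forall>w. subst f' (f w) - Var w \<in> J)"

definition isomorphic :: "('v, 'k::field) mpoly set \<Rightarrow> ('w, 'k) mpoly set \<Rightarrow> bool" where
  "isomorphic I J \<longleftrightarrow> (\<exists>f f'. inverse_morphisms I J f f')"

text \<open>\<open>k[x]/I\<close> is generated by the classes of a finite set \<open>B\<close> as a module over \<open>k[y]/J\<close>.\<close>

definition finite_morphism ::
  "('v, 'k::field) mpoly set \<Rightarrow> ('w, 'k) mpoly set \<Rightarrow> ('w \<Rightarrow> ('v, 'k) mpoly) \<Rightarrow> bool" where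
  "finite_morphism I J f \<longleftrightarrow> morphism I J f \<and>
     (\<exists>B. finite B \<and> (\<forall>p. \<exists>c. p - (\<Sum>b\<in>B. subst f (c b) * b) \<in> I))"

text \<open>Closed subschemes of some affine space \<open>\<A>\<^sup>m\<close>, with coordinates \<open>x\<^sub>0, \<dots>, x\<^sub>m\<^sub>-\<^sub>1\<close>.\<close>

definition affine_finite_type :: "(nat, 'k::field) mpoly set \<Rightarrow> bool" where
  "affine_finite_type I \<longleftrightarrow> is_ideal I \<and> (\<exists>m. \<forall>i\<ge>m. Var i \<in> I)"


section \<open>Flatness\<close>

text \<open>For a ring homomorphism \<open>h : R \<rightarrow> P\<close> and ideals \<open>a\<close> of \<open>R\<close> and \<open>N\<close> of \<open>P\<close>, the tensor product
  \<open>a \<otimes>\<^sub>R (P/N)\<close> is the free abelian group on \<open>a \<times> P\<close> modulo the following subgroup.\<close>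

inductive_set tensor_relations ::
    "('r::comm_ring_1 \<Rightarrow> 'p::comm_ring_1) \<Rightarrow> 'r set \<Rightarrow> 'p set \<Rightarrow> ('r \<times> 'p \<Rightarrow>\<^sub>0 int) set"
  for h a N where
  zero: "0 \<in> tensor_relations h a N"
| diff: "u \<in> tensor_relations h a N \<Longrightarrow> w \<in> tensor_relations h a N \<Longrightarrow>
    u - w \<in> tensor_relations h a N"
| add_left: "x \<in> a \<Longrightarrow> y \<in> a \<Longrightarrow>
    Poly_Mapping.single (x + y, m) 1 - Poly_Mapping.single (x, m) 1 - Poly_Mapping.single (y, m) 1
      \<in> tensor_relations h a N"
| add_right: "x \<in> a \<Longrightarrow>
    Poly_Mapping.single (x, m + m') 1 - Poly_Mapping.single (x, m) 1 - Poly_Mapping.single (x, m') 1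
      \<in> tensor_relations h a N"
| scale: "x \<in> a \<Longrightarrow>
    Poly_Mapping.single (r * x, m) 1 - Poly_Mapping.single (x, h r * m) 1 \<in> tensor_relations h a N"
| quotient: "x \<in> a \<Longrightarrow> m \<in> N \<Longrightarrow> Poly_Mapping.single (x, m) 1 \<in> tensor_relations h a N"

text \<open>\<open>P/N\<close> is flat over \<open>R\<close>: the multiplication map \<open>a \<otimes>\<^sub>R (P/N) \<rightarrow> P/N\<close> is injective for every
  ideal \<open>a\<close> of \<open>R\<close>.\<close>

definition flat :: "('r::comm_ring_1 \<Rightarrow> 'p::comm_ring_1) \<Rightarrow> 'p set \<Rightarrow> bool" where
  "flat h N \<longleftrightarrow> (\<forall>a. is_ideal a \<longrightarrow>
     (\<forall>z. Poly_Mapping.keys z \<subseteq> a \<times> UNIV \<longrightarrow>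
        (\<Sum>(x, m)\<in>Poly_Mapping.keys z. of_int (Poly_Mapping.lookup z (x, m)) * (h x * m)) \<in> N \<longrightarrow>
        z \<in> tensor_relations h a N))"

text \<open>A polynomial \<open>\<pi>\<close> is a morphism from the scheme of \<open>I\<close> to \<open>\<A>\<^sup>1 = Spec k[t]\<close>, through
  \<open>t \<mapsto> \<pi>\<close>.\<close>

definition flat_over_line :: "('v, 'k::field) mpoly set \<Rightarrow> ('v, 'k) mpoly \<Rightarrow> bool" where
  "flat_over_line I \<pi> \<longleftrightarrow> flat (\<lambda>r :: 'k poly. poly (map_poly Const r) \<pi>) I"

definition fibre :: "('v, 'k::field) mpoly set \<Rightarrow> ('v, 'k) mpoly \<Rightarrow> 'k \<Rightarrow> ('v, 'k) mpoly set" where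
  "fibre I \<pi> c = ideal_gen (insert (\<pi> - Const c) I)"


section \<open>Locally closed subschemes\<close>

text \<open>The pair \<open>(J, U)\<close> stands for the open subscheme of the closed subscheme given by \<open>J\<close>
  that is the union of the principal open sets \<open>D(f)\<close>, \<open>f \<in> U\<close>. The coordinate ring of the piece
  \<open>D(f)\<close> is \<open>(k[x]/J)[y]/(y f - 1)\<close>, where \<open>y\<close> is the variable \<open>None\<close>.\<close>

definition lc_points :: "('v, 'k::field) mpoly set \<Rightarrow> ('v, 'k) mpoly set \<Rightarrow> ('v \<Rightarrow> 'k) set" where
  "lc_points J U = {x \<in> points J. \<exists>f\<in>U. eval_at x f \<noteq> 0}"

definition extend_var :: "('v, 'k::field) mpoly \<Rightarrow> ('v option, 'k) mpoly" where
  "extend_var = subst (\<lambda>v. Var (Some v))"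

definition principal_open ::
  "('v, 'k::field) mpoly set \<Rightarrow> ('v, 'k) mpoly \<Rightarrow> ('v option, 'k) mpoly set" where
  "principal_open J f = ideal_gen (insert (Var None * extend_var f - 1) (extend_var ` J))"

definition lc_flat_over_line ::
  "('v, 'k::field) mpoly set \<Rightarrow> ('v, 'k) mpoly set \<Rightarrow> ('v, 'k) mpoly \<Rightarrow> bool" where
  "lc_flat_over_line J U \<pi> \<longleftrightarrow>
     (\<forall>f\<in>U. flat_over_line (principal_open J f) (extend_var \<pi>))"


section \<open>The symplectic group and its actions\<close>

definition symplectic_form :: "'r::comm_ring_1 ^ ('n + 'n::finite) ^ ('n + 'n)" where
  "symplectic_form = (\<chi> i j. case (i, j) of
       (Inl a, Inr b) \<Rightarrow> if a = b then 1 else 0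
     | (Inr a, Inl b) \<Rightarrow> if a = b then - 1 else 0
     | _ \<Rightarrow> 0)"

definition Sp :: "('r::comm_ring_1 ^ ('n + 'n::finite) ^ ('n + 'n)) set" where
  "Sp = {g. transpose g ** symplectic_form ** g = symplectic_form}"

definition matrix_const :: "'k::field ^ 'i ^ 'i \<Rightarrow> ('v, 'k) mpoly ^ 'i ^ 'i" where
  "matrix_const g = (\<chi> i j. Const (g $ i $ j))"

text \<open>An action assigns to each \<open>g\<close> the endomorphism \<open>x \<mapsto> g x\<close>, as a tuple of polynomials. The
  group \<open>Sp\<close> over an algebraically closed field is identified with its group of rational points; the
  last condition says that the action is a morphism of schemes jointly in \<open>g\<close> and \<open>x\<close>.\<close>

type_synonym ('k, 'n, 'v) action = "'k ^ ('n + 'n) ^ ('n + 'n) \<Rightarrow> 'v \<Rightarrow> ('v, 'k) mpoly"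

definition algebraic_action ::
  "('v, 'k::field) mpoly set \<Rightarrow> ('k, 'n::finite, 'v) action \<Rightarrow> bool" where
  "algebraic_action I act \<longleftrightarrow>
     (\<forall>g\<in>Sp. morphism I I (act g)) \<and>
     (\<forall>v. act (mat 1) v - Var v \<in> I) \<and>
     (\<forall>g\<in>Sp. \<forall>h\<in>Sp. \<forall>v. act (g ** h) v - subst (act h) (act g v) \<in> I) \<and>
     (\<forall>v. \<exists>a. \<forall>g\<in>Sp.
        act g v - subst (case_sum (\<lambda>(i, j). Const (g $ i $ j)) Var) a \<in> I)"

definition invariant_function ::
  "('v, 'k::field) mpoly set \<Rightarrow> ('k, 'n::finite, 'v) action \<Rightarrow> ('v, 'k) mpoly \<Rightarrow> bool" where
  "invariant_function I act p \<longleftrightarrow> (\<forall>g\<in>Sp. subst (act g) p - p \<in> I)"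

text \<open>\<open>f (g x) = g (f x)\<close>\<close>

definition equivariant ::
  "('v, 'k::field) mpoly set \<Rightarrow> ('k, 'n::finite, 'v) action \<Rightarrow> ('k, 'n, 'w) action \<Rightarrow>
   ('w \<Rightarrow> ('v, 'k) mpoly) \<Rightarrow> bool" where
  "equivariant I act act' f \<longleftrightarrow>
     (\<forall>g\<in>Sp. \<forall>w. subst (act g) (f w) - subst f (act' g w) \<in> I)"

definition equivariantly_isomorphic ::
  "('v, 'k::field) mpoly set \<Rightarrow> ('k, 'n::finite, 'v) action \<Rightarrow>
   ('w, 'k) mpoly set \<Rightarrow> ('k, 'n, 'w) action \<Rightarrow> bool" where
  "equivariantly_isomorphic I act J act' \<longleftrightarrow>
     (\<exists>f f'. inverse_morphisms I J f f' \<and> equivariant I act act' f)"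

definition isogeny ::
  "('v, 'k::field) mpoly set \<Rightarrow> ('k, 'n::finite, 'v) action \<Rightarrow>
   ('w, 'k) mpoly set \<Rightarrow> ('k, 'n, 'w) action \<Rightarrow> ('w \<Rightarrow> ('v, 'k) mpoly) \<Rightarrow> bool" where
  "isogeny I act J act' f \<longleftrightarrow> finite_morphism I J f \<and> equivariant I act act' f \<and>
     bij_betw (point_map f) (points I) (points J)"

definition orbit :: "('k::field, 'n::finite, 'v) action \<Rightarrow> ('v \<Rightarrow> 'k) \<Rightarrow> ('v \<Rightarrow> 'k) set" where
  "orbit act x = {point_map (act g) x | g. g \<in> Sp}"


section \<open>The nilpotent cone of \<open>\<s>\<p>\<^sub>2\<^sub>n\<close>\<close>

definition nilpotent_matrix :: "'r::comm_ring_1 ^ 'i::finite ^ 'i \<Rightarrow> bool" where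
  "nilpotent_matrix A \<longleftrightarrow> (\<exists>m. ((**) A ^^ m) (mat 1) = 0)"

definition sp_Lie :: "('r::comm_ring_1 ^ ('n + 'n::finite) ^ ('n + 'n)) set" where
  "sp_Lie = {A. transpose A ** symplectic_form + symplectic_form ** A = 0}"

definition nilcone :: "(('n::finite + 'n) \<times> ('n + 'n), 'k::field) mpoly set" where
  "nilcone = vanishing_ideal {\<lambda>(i, j). A $ i $ j | A. A \<in> sp_Lie \<and> nilpotent_matrix A}"

definition adjoint_action :: "('k::field, 'n::finite, ('n + 'n) \<times> ('n + 'n)) action" where
  "adjoint_action g = (\<lambda>(i, j).
     (matrix_const g ** (\<chi> k l. Var (k, l)) ** matrix_const (matrix_inv g)) $ i $ j)"


section \<open>The exotic nilpotent cone\<close>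

text \<open>The coordinate \<open>Inl i\<close> belongs to \<open>V\<^sub>1\<close>. The module \<open>V\<^sub>2 = \<And>\<^sup>2 V\<^sub>1\<close> is embedded in
  \<open>V\<^sub>1 \<otimes> V\<^sub>1\<close>, that is, in the square matrices \<open>x\<close> with \<open>g\<close> acting by \<open>g x g\<^sup>T\<close>, through
  \<open>v \<and> w \<mapsto> v \<otimes> w - w \<otimes> v\<close>; over every ring its image consists of the alternating matrices. The
  coordinate \<open>Inr (i, j)\<close> is the \<open>(i, j)\<close> entry of \<open>x\<close>.\<close>

type_synonym 'n exotic_coord = "('n + 'n) + ('n + 'n) \<times> ('n + 'n)"

definition exotic_act ::
  "'r::comm_ring_1 ^ ('n + 'n::finite) ^ ('n + 'n) \<Rightarrow> ('n exotic_coord \<Rightarrow> 'r) \<Rightarrow> ('n exotic_coord \<Rightarrow> 'r)"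
  where
  "exotic_act g x = case_sum
     (\<lambda>i. (g *v (\<chi> k. x (Inl k))) $ i)
     (\<lambda>(i, j). (g ** (\<chi> k l. x (Inr (k, l))) ** transpose g) $ i $ j)"

definition alternating_relations :: "('n exotic_coord, 'r::comm_ring_1) mpoly set" where
  "alternating_relations =
     {Var (Inr (i, i)) | i. True} \<union> {Var (Inr (i, j)) + Var (Inr (j, i)) | i j. True}"

text \<open>In the next two definitions \<open>Inl (i, j)\<close> is a coordinate of the group and \<open>Inr c\<close> a coordinate
  of the representation. Over the integers, invariance of \<open>p\<close> means that \<open>p (g x) = p x\<close> for the
  universal \<open>g\<close> and \<open>x\<close>, that is, in the coordinate ring of \<open>Sp \<times> V\<close>.\<close>

definition generic_matrix :: "(('i \<times> 'i) + 'c, int) mpoly ^ 'i ^ 'i" where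
  "generic_matrix = (\<chi> i j. Var (Inl (i, j)))"

definition exotic_invariant :: "('n::finite exotic_coord, int) mpoly \<Rightarrow> bool" where
  "exotic_invariant p \<longleftrightarrow>
     subst (exotic_act generic_matrix (\<lambda>c. Var (Inr c))) p - subst (\<lambda>c. Var (Inr c)) p
       \<in> ideal_gen
           ({(transpose generic_matrix ** symplectic_form ** generic_matrix - symplectic_form) $ i $ j
              | i j. True}
            \<union> subst (\<lambda>c. Var (Inr c)) ` alternating_relations)"

definition exotic_nilcone_int :: "('n::finite exotic_coord, int) mpoly set" where
  "exotic_nilcone_int =
     ideal_gen (alternating_relations \<union> {p. exotic_invariant p \<and> Poly_Mapping.lookup p 0 = 0})"

definition exotic_nilcone :: "('n::finite exotic_coord, 'k::field) mpoly set" where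
  "exotic_nilcone = ideal_gen (eval_hom (\<lambda>c. Const (of_int c)) Var ` exotic_nilcone_int)"

definition exotic_action :: "('k::field, 'n::finite, 'n exotic_coord) action" where
  "exotic_action g = exotic_act (matrix_const g) Var"


section \<open>The base field\<close>

type_synonym F2_bar = "bit alg_closure"

end

theory Submission
  imports Defs
begin

text \<open>An element of \<open>\<s>\<p>\<^sub>2\<^sub>n\<close> is \<open>X J\<close> with \<open>X\<close> symmetric, and a point of the exotic nilpotent cone is
  a pair \<open>(v, x)\<close> with \<open>x\<close> alternating and \<open>x J\<close> nilpotent. In characteristic \<open>2\<close> every symmetric
  \<open>X\<close> is \<open>x + v v\<^sup>T\<close> for a unique pair, with \<open>v\<^sub>i\<^sup>2 = X\<^sub>i\<^sub>i\<close>, and as \<open>v\<^sup>T J (x J)\<^sup>i v = 0\<close> the rank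
  one term does not affect nilpotency. Hence \<open>(v, x, t) \<mapsto> (v\<^sub>1\<^sup>2, \<dots>, v\<^sub>2\<^sub>n\<^sup>2, x + t v v\<^sup>T, t)\<close> is
  an injection of the product of the exotic cone and the line whose image is closed, given by
  \<open>X\<^sub>i\<^sub>i = t d\<^sub>i\<close> and the nilpotency of \<open>X J\<close>. This image is the family: the fibre over \<open>t \<noteq> 0\<close> is the
  nilpotent cone, and over \<open>0\<close> the injection becomes the Frobenius isogeny on \<open>v\<close>. The images
  of the products of orbits with the line are the orbit families. Everything is flat since each
  point moves along a polynomial section over the line, so that functions have no \<open>k[t]\<close>-torsion.

  That the invariant-theoretic ideal of the exotic cone is the full vanishing ideal rests on two
  facts. Invariants without constant term vanish at nilpotent pairs, because a torus contracts these
  to the origin. Conversely, the coefficients of the Pfaffian of \<open>\<lambda> J + x\<close> are invariants with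
  pairwise coprime squarefree leading monomials for a suitable weight, so that they generate a
  radical ideal, and the Nullstellensatz applies. Orbits are open in their closures because the
  symplectic group is the image of an affine space, by products of boundedly many transvections.\<close>

text \<open>In characteristic two the injection \<open>deform\<close> has no polynomial inverse, but
  it has one after squaring. A polynomial in \<open>(v, x)\<close> is in general not a polynomial
  function on the family, while its square is, because \<open>t^2 d_i d_j\<close> is the square of
  \<open>t v_i v_j\<close>. This \<open>square_lift\<close> carries equations and open conditions
  from the exotic cone to the family. For the same reason the equations of the cone are found in the
  ideal of the special fibre after squaring, so that the cone is compared with the radical of this
  ideal. The classical Pfaffian divides a sum over permutations by the number of representatives of
  a matching, which is zero in characteristic two. It is therefore taken as a sum over matchings;
  its congruence law is proved for generic integral matrices, where that number cancels, and then
  specialised. Bounding the number of transvections matters since the image of one affine space is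
  irreducible: the elimination argument for images can then be run with a single prime
  ideal.\<close>

no_notation fps_nth (infixl "$" 75)

section \<open>Polynomials\<close>

text \<open>A bare predicate on functions: evaluation, substitution, coefficient maps and the
  Frobenius map then share the same transfer rules.\<close>

definition ring_hom_on :: "('a::comm_ring_1 \<Rightarrow> 'b::comm_ring_1) \<Rightarrow> bool" where
  "ring_hom_on h \<longleftrightarrow> (\<forall>a b. h (a + b) = h a + h b) \<and> (\<forall>a b. h (a * b) = h a * h b) \<and> h 1 = 1"

lemma ring_hom_onI:
  "(\<And>a b. h (a + b) = h a + h b) \<Longrightarrow> (\<And>a b. h (a * b) = h a * h b) \<Longrightarrow> h 1 = 1 \<Longrightarrow> ring_hom_on h"
  by (simp add: ring_hom_on_def)

lemma ring_hom_onD: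
  assumes "ring_hom_on h"
  shows "h (a + b) = h a + h b" "h (a * b) = h a * h b" "h 1 = 1" "h 0 = 0" "h (- a) = - h a"
    "h (a - b) = h a - h b" "h (sum f A) = (\<Sum>x\<in>A. h (f x))" "h (prod f A) = (\<Prod>x\<in>A. h (f x))"
    "h (a ^ n) = h a ^ n" "h (of_nat n) = of_nat n" "h (of_int z) = of_int z"
proof -
  show add: "h (a + b) = h a + h b" and mult: "h (a * b) = h a * h b" and one: "h 1 = 1" for a b
    using assms by (auto simp: ring_hom_on_def)
  show zero: "h 0 = 0" using add[of 0 0] by simp
  show neg: "h (- a) = - h a" for a using add[of a "- a"] zero by (simp add: eq_neg_iff_add_eq_0 add.commute)
  show "h (a - b) = h a - h b" using add[of a "- b"] neg by simp
  show "h (sum f A) = (\<Sum>x\<in>A. h (f x))"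
    by (induction A rule: infinite_finite_induct) (auto simp: zero add)
  show "h (prod f A) = (\<Prod>x\<in>A. h (f x))"
    by (induction A rule: infinite_finite_induct) (auto simp: one mult)
  show "h (a ^ n) = h a ^ n" by (induction n) (auto simp: one mult)
  show nat: "h (of_nat n) = of_nat n" for n by (induction n) (auto simp: zero one add)
  show "h (of_int z) = of_int z" by (cases z rule: int_cases2) (auto simp: nat neg)
qed

lemma ring_hom_on_comp: "ring_hom_on g \<Longrightarrow> ring_hom_on h \<Longrightarrow> ring_hom_on (\<lambda>x. g (h x))"
  by (simp add: ring_hom_on_def)

lemma ring_hom_on_id [simp]: "ring_hom_on (\<lambda>x. x)" by (simp add: ring_hom_on_def)

lemma ring_hom_on_of_int [simp]: "ring_hom_on of_int" by (simp add: ring_hom_on_def)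

lemma ring_hom_on_Const [simp]: "ring_hom_on Const"
  by (simp add: ring_hom_on_def Const_def single_add mult_single)

lemmas Const_hom = ring_hom_onD[OF ring_hom_on_Const]

lemma Const_0 [simp]: "Const 0 = 0" and Const_1 [simp]: "Const 1 = 1"
  by (rule Const_hom)+

definition monom_eval :: "('v \<Rightarrow> 'r::comm_ring_1) \<Rightarrow> ('v \<Rightarrow>\<^sub>0 nat) \<Rightarrow> 'r" where
  "monom_eval x m = (\<Prod>v\<in>Poly_Mapping.keys m. x v ^ Poly_Mapping.lookup m v)"

lemma monom_eval_superset:
  "finite A \<Longrightarrow> Poly_Mapping.keys m \<subseteq> A \<Longrightarrow> monom_eval x m = (\<Prod>v\<in>A. x v ^ Poly_Mapping.lookup m v)"
  unfolding monom_eval_def by (rule prod.mono_neutral_left) (auto simp: in_keys_iff)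

lemma monom_eval_0 [simp]: "monom_eval x 0 = 1"
  by (simp add: monom_eval_def)

lemma monom_eval_add: "monom_eval x (m + m') = monom_eval x m * monom_eval x m'"
proof -
  let ?A = "Poly_Mapping.keys m \<union> Poly_Mapping.keys m'"
  have "Poly_Mapping.keys (m + m') \<subseteq> ?A" by (rule keys_add)
  then show ?thesis
    by (simp add: monom_eval_superset[of ?A] lookup_add power_add prod.distrib)
qed

lemma monom_eval_single [simp]: "monom_eval x (Poly_Mapping.single v n) = x v ^ n"
  by (cases "n = 0") (auto simp: monom_eval_def)

lemma eval_hom_superset:
  assumes "finite A" "Poly_Mapping.keys p \<subseteq> A" "h 0 = 0"
  shows "eval_hom h x p = (\<Sum>m\<in>A. h (Poly_Mapping.lookup p m) * monom_eval x m)"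
  unfolding eval_hom_def monom_eval_def[symmetric] using assms
  by (intro sum.mono_neutral_left) (auto simp: in_keys_iff)

lemma eval_hom_add:
  assumes "ring_hom_on h"
  shows "eval_hom h x (p + q) = eval_hom h x p + eval_hom h x q"
proof -
  let ?A = "Poly_Mapping.keys p \<union> Poly_Mapping.keys q"
  note h = ring_hom_onD[OF assms]
  have "Poly_Mapping.keys (p + q) \<subseteq> ?A" by (rule keys_add)
  then show ?thesis
    by (simp add: eval_hom_superset[of ?A] h lookup_add distrib_right sum.distrib)
qed

lemma eval_hom_single:
  assumes "h 0 = 0"
  shows "eval_hom h x (Poly_Mapping.single m c) = h c * monom_eval x m"
  using assms by (cases "c = 0") (auto simp: eval_hom_def monom_eval_def)

lemma mpoly_single_induct [case_names single add]:
  assumes "\<And>m c. P (Poly_Mapping.single m c)" "\<And>p q. P p \<Longrightarrow> P q \<Longrightarrow> P (p + q)"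
  shows "P (p :: ('v, 'a::comm_ring_1) mpoly)"
proof -
  have "P (\<Sum>m\<in>A. Poly_Mapping.single m (Poly_Mapping.lookup p m))" if "finite A" for A
    using that by (induction A) (use assms(1)[of 0 0] in \<open>auto intro: assms\<close>)
  from this[of "Poly_Mapping.keys p"]
  have "P (\<Sum>m\<in>Poly_Mapping.keys p. Poly_Mapping.single m (Poly_Mapping.lookup p m))" by simp
  also have "(\<Sum>m\<in>Poly_Mapping.keys p. Poly_Mapping.single m (Poly_Mapping.lookup p m)) = p"
    by (rule poly_mapping_eqI) (auto simp: lookup_sum lookup_single when_def in_keys_iff)
  finally show ?thesis .
qed

lemma eval_hom_0 [simp]: "eval_hom h x 0 = 0"
  by (simp add: eval_hom_def)

lemma ring_hom_on_eval_hom [simp]: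
  assumes "ring_hom_on h"
  shows "ring_hom_on (eval_hom h x)"
proof (rule ring_hom_onI)
  note h = ring_hom_onD[OF assms]
  show add: "eval_hom h x (p + q) = eval_hom h x p + eval_hom h x q" for p q
    by (rule eval_hom_add[OF assms])
  show "eval_hom h x (p * q) = eval_hom h x p * eval_hom h x q" for p q
  proof (induction p rule: mpoly_single_induct)
    case (single m c)
    show ?case
      by (induction q rule: mpoly_single_induct)
        (simp_all add: mult_single eval_hom_single h monom_eval_add add distrib_left mult.assoc
          mult.left_commute)
  qed (simp add: add distrib_right)
  show "eval_hom h x 1 = 1"
    using eval_hom_single[of h x 0 1] h by (simp add: single_one)
qed

lemma eval_hom_Const: "ring_hom_on h \<Longrightarrow> eval_hom h x (Const c) = h c"
  by (simp add: Const_def eval_hom_single ring_hom_onD)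

lemma eval_hom_Var: "ring_hom_on h \<Longrightarrow> eval_hom h x (Var v) = x v"
  by (simp add: Var_def eval_hom_single ring_hom_onD)

lemma monom_conv: "Poly_Mapping.single m (c::'a::comm_ring_1) = Const c * monom_eval Var m"
proof -
  have "monom_eval Var m = Poly_Mapping.single m (1::'a)"
  proof (induction m rule: update_induct)
    case const
    then show ?case by (simp add: single_one)
  next
    case (update f a b)
    have "Poly_Mapping.update a b f = f + Poly_Mapping.single a b"
      using update(1)
      by (intro poly_mapping_eqI) (auto simp: lookup_update lookup_add lookup_single when_def in_keys_iff)
    moreover have "Var a ^ b = (Poly_Mapping.single (Poly_Mapping.single a b) 1 :: ('b, 'a) mpoly)"
      by (induction b) (simp_all add: single_one Var_def mult_single flip: single_add)
    ultimately show ?case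
      using update by (simp add: monom_eval_add mult_single)
  qed
  then show ?thesis by (simp add: Const_def mult_single)
qed

lemma mpoly_induct [case_names Const Var add mult]:
  assumes "\<And>c. P (Const c)" "\<And>v. P (Var v)" "\<And>p q. P p \<Longrightarrow> P q \<Longrightarrow> P (p + q)"
    "\<And>p q. P p \<Longrightarrow> P q \<Longrightarrow> P (p * q)"
  shows "P (p :: ('v, 'a::comm_ring_1) mpoly)"
proof (induction p rule: mpoly_single_induct)
  case (single m c)
  have one: "P 1" using assms(1)[of 1] by simp
  have pow: "P (Var v ^ k)" for v k by (induction k) (auto intro: assms one)
  have "P (\<Prod>v\<in>A. Var v ^ Poly_Mapping.lookup m v)" if "finite A" for A
    using that by (induction A) (auto intro: assms one pow)
  then show ?case unfolding monom_conv monom_eval_def by (intro assms) auto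
qed (rule assms(3))

text \<open>Identities between composites of evaluations and substitutions all reduce to this check
  on constants and variables.\<close>

lemma hom_unique:
  assumes "ring_hom_on f" "ring_hom_on g" "\<And>c. f (Const c) = g (Const c)" "\<And>v. f (Var v) = g (Var v)"
  shows "f p = g p"
  by (induction p rule: mpoly_induct)
    (simp_all add: assms(3,4) ring_hom_onD[OF assms(1)] ring_hom_onD[OF assms(2)])

lemma hom_eval_hom:
  assumes "ring_hom_on g" "ring_hom_on h"
  shows "g (eval_hom h x p) = eval_hom (\<lambda>c. g (h c)) (\<lambda>v. g (x v)) p"
  by (rule hom_unique[where f = "\<lambda>p. g (eval_hom h x p)"])
    (simp_all add: assms ring_hom_on_comp[of g] ring_hom_on_comp[of g h] eval_hom_Const eval_hom_Var)

lemma eval_at_hom [simp]: "ring_hom_on (eval_at x)"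
  by (simp add: eval_at_def)

lemma subst_hom [simp]: "ring_hom_on (subst f)"
  by (simp add: subst_def)

lemmas eval_at_simps = ring_hom_onD[OF eval_at_hom]
lemmas subst_simps = ring_hom_onD[OF subst_hom]
lemmas eval_hom_simps = ring_hom_onD[OF ring_hom_on_eval_hom]

lemma eval_at_Const [simp]: "eval_at x (Const c) = c" and eval_at_Var [simp]: "eval_at x (Var v) = x v"
  by (simp_all add: eval_at_def eval_hom_Const eval_hom_Var)

lemma subst_Const [simp]: "subst f (Const c) = Const c" and subst_Var [simp]: "subst f (Var v) = f v"
  by (simp_all add: subst_def eval_hom_Const eval_hom_Var)

lemma eval_at_subst: "eval_at x (subst f p) = eval_at (\<lambda>v. eval_at x (f v)) p"
  by (rule hom_unique[where f = "\<lambda>p. eval_at x (subst f p)"]) (simp_all add: ring_hom_on_comp)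

lemma eval_at_subst_point_map: "eval_at x (subst f p) = eval_at (point_map f x) p"
  by (simp add: eval_at_subst point_map_def[abs_def])

lemma subst_Var_id [simp]: "subst Var p = p"
  by (rule hom_unique[where g = "\<lambda>p. p"]) simp_all

text \<open>Makes the absence of a constant term a statement about the value at the origin, where
  the contraction argument ends.\<close>

lemma lookup_0_eval: "Poly_Mapping.lookup p 0 = eval_at (\<lambda>_. 0) p"
proof (rule hom_unique[where f = "\<lambda>p. Poly_Mapping.lookup p 0"])
  show "ring_hom_on (\<lambda>p. Poly_Mapping.lookup (p::('v,'a) mpoly) 0)"
  proof (rule ring_hom_onI)
    fix p q :: "('v, 'a) mpoly"
    show "Poly_Mapping.lookup (p * q) 0 = Poly_Mapping.lookup p 0 * Poly_Mapping.lookup q 0"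
    proof (induction p rule: mpoly_single_induct)
      case (single m c)
      show ?case
      proof (induction q rule: mpoly_single_induct)
        case (single m' c')
        have "m + m' = 0 \<longleftrightarrow> m = 0 \<and> m' = 0"
          by (auto simp: poly_mapping_eq_iff lookup_add fun_eq_iff)
        then show ?case by (auto simp: mult_single lookup_single when_def)
      qed (simp add: lookup_add distrib_left)
    qed (simp add: lookup_add distrib_right)
  qed (simp_all add: lookup_add)
qed (simp_all add: Const_def Var_def lookup_single eval_at_def eval_hom_single, auto simp: when_def poly_mapping_eq_iff fun_eq_iff lookup_single)

section \<open>Ideals\<close>

interpretation ideal: Modules.module "(*) :: 'r::comm_ring_1 \<Rightarrow> 'r \<Rightarrow> 'r"
  by unfold_locales (simp_all add: algebra_simps)

declare ideal.scale_scale [simp del]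

lemma is_idealI:
  "0 \<in> I \<Longrightarrow> (\<And>a b. a \<in> I \<Longrightarrow> b \<in> I \<Longrightarrow> a + b \<in> I) \<Longrightarrow> (\<And>r a. a \<in> I \<Longrightarrow> r * a \<in> I) \<Longrightarrow> is_ideal I"
  by (rule ideal.subspaceI)

lemma ideal_mult_right: "is_ideal I \<Longrightarrow> a \<in> I \<Longrightarrow> a * r \<in> I"
  using ideal.subspace_scale[of I a r] by (simp add: mult.commute)

lemma hom_ideal_gen:
  assumes "ring_hom_on g" "is_ideal J" "\<And>p. p \<in> S \<Longrightarrow> g p \<in> J" "p \<in> ideal_gen S"
  shows "g p \<in> J"
  using assms(4)
proof (induction rule: ideal.span_induct_alt)
  case base
  then show ?case using assms(1,2) by (simp add: ring_hom_onD ideal.subspace_0)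
next
  case (step c x y)
  then show ?case using assms
    by (simp add: ring_hom_onD ideal.subspace_add ideal.subspace_scale)
qed

lemma is_ideal_zero: "is_ideal {0}" by (rule ideal.subspace_single_0)

lemma eval_at_ideal_gen: "p \<in> ideal_gen S \<Longrightarrow> (\<And>q. q \<in> S \<Longrightarrow> eval_at x q = 0) \<Longrightarrow> eval_at x p = 0"
  using hom_ideal_gen[OF eval_at_hom is_ideal_zero, of S x p] by auto

lemma points_ideal_gen: "points (ideal_gen S) = points S"
  by (auto simp: points_def intro: ideal.span_base eval_at_ideal_gen)

lemma is_ideal_vanishing_ideal [simp]: "is_ideal (vanishing_ideal S)"
  by (rule is_idealI) (auto simp: vanishing_ideal_def eval_at_simps)

lemma ideal_cong_sum:
  assumes "is_ideal I" "\<And>x. x \<in> A \<Longrightarrow> f x - g x \<in> I"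
  shows "sum f A - sum g A \<in> I"
  using assms by (simp flip: sum_subtractf add: ideal.subspace_sum)

lemma ideal_cong_mult:
  assumes "is_ideal I" "a - a' \<in> I" "b - b' \<in> I"
  shows "a * b - a' * b' \<in> I"
proof -
  have "a * b - a' * b' = b * (a - a') + a' * (b - b')" by (simp add: algebra_simps)
  then show ?thesis using assms by (simp add: ideal.subspace_add ideal.subspace_scale)
qed

lemma ideal_cong_prod:
  assumes "is_ideal I" "\<And>x. x \<in> A \<Longrightarrow> f x - g x \<in> I"
  shows "prod f A - prod g A \<in> I"
  using assms(2)
  by (induction A rule: infinite_finite_induct)
    (auto simp: ideal.subspace_0[OF assms(1)] intro!: ideal_cong_mult assms(1))

lemma ideal_cong_subst:
  assumes "is_ideal I" "\<And>v. f v - g v \<in> I"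
  shows "subst f p - subst g p \<in> I"
proof (induction p rule: mpoly_induct)
  case (add p q)
  have "subst f (p + q) - subst g (p + q) = (subst f p - subst g p) + (subst f q - subst g q)"
    by (simp add: subst_simps)
  then show ?case using add by (simp add: ideal.subspace_add[OF assms(1)])
next
  case (mult p q)
  then show ?case by (auto simp: subst_simps intro: ideal_cong_mult assms)
qed (simp_all add: assms ideal.subspace_0)

lemma radical_vanishing_ideal: "radical_ideal (vanishing_ideal S) = vanishing_ideal S"
proof -
  have "p \<in> vanishing_ideal S" if "p ^ n \<in> vanishing_ideal S" for p n
    using that by (cases "n = 0") (auto simp: vanishing_ideal_def eval_at_simps)
  moreover have "p ^ 1 \<in> vanishing_ideal S" if "p \<in> vanishing_ideal S" for p using that by simp
  ultimately show ?thesis unfolding radical_ideal_def by blast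
qed

section \<open>Polynomial functions over an infinite field\<close>

text \<open>Euclid's argument: the product of all \<open>X - a\<close>, plus one, would have no
  root.\<close>

lemma infinite_alg_closed: "infinite (UNIV :: 'k::alg_closed_field set)"
proof
  assume fin: "finite (UNIV :: 'k set)"
  define p :: "'k poly" where "p = (\<Prod>a\<in>UNIV. [:- a, 1:]) + 1"
  have "Polynomial.degree (\<Prod>a\<in>(UNIV::'k set). [:- a, 1:]) = card (UNIV :: 'k set)"
    by (subst degree_prod_eq_sum_degree) auto
  moreover have "card (UNIV :: 'k set) > 0" using fin by (simp add: finite_UNIV_card_ge_0)
  ultimately have "Polynomial.degree p > 0" unfolding p_def by (subst degree_add_eq_left) auto
  then obtain x where "poly p x = 0" using alg_closed_imp_poly_has_root by blast
  moreover have "poly (\<Prod>a\<in>(UNIV::'k set). [:- a, 1:]) x = 0"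
    using fin by (simp add: poly_prod)
  ultimately show False by (simp add: p_def)
qed

lemma poly_cofinite_nonzero:
  assumes "p \<noteq> (0 :: 'k::alg_closed_field poly)" "finite F"
  shows "\<exists>c. c \<notin> F \<and> poly p c \<noteq> 0"
proof -
  have "finite ({c. poly p c = 0} \<union> F)" using poly_roots_finite[OF assms(1)] assms(2) by simp
  then have "UNIV \<noteq> {c. poly p c = 0} \<union> F" using infinite_alg_closed[where 'k='k] by metis
  then show ?thesis by blast
qed

text \<open>Restriction of a polynomial to the parametrised curve \<open>y\<close>.\<close>

definition along :: "('v \<Rightarrow> 'k::comm_ring_1 poly) \<Rightarrow> ('v, 'k) mpoly \<Rightarrow> 'k poly" where
  "along = eval_hom (\<lambda>c. [:c:])"

lemma ring_hom_on_const_poly: "ring_hom_on (\<lambda>c. [:c:])"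
  by (auto intro!: ring_hom_onI simp: one_pCons)

lemma ring_hom_on_poly: "ring_hom_on (\<lambda>p. poly p x)"
  by (auto intro!: ring_hom_onI)

lemma poly_along: "poly (along y p) s = eval_at (\<lambda>v. poly (y v) s) p"
  unfolding along_def eval_at_def
  by (subst hom_eval_hom[OF ring_hom_on_poly ring_hom_on_const_poly]) simp

lemma poly_zero_infinite:
  assumes "\<And>c. c \<notin> F \<Longrightarrow> poly p c = 0" "finite F"
  shows "p = (0 :: 'k::alg_closed_field poly)"
  using poly_cofinite_nonzero[of p F] assms by blast

text \<open>Induction on the variables: as a polynomial in \<open>v\<close>, \<open>p\<close> has a
  nonzero coefficient \<open>part d\<close>, which is nonzero at some point by induction; the value
  of \<open>v\<close> is then chosen off finitely many roots.\<close>

lemma mpoly_nonzero_point: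
  fixes p :: "('v, 'k::alg_closed_field) mpoly"
  assumes "p \<noteq> 0"
  shows "\<exists>x. eval_at x p \<noteq> 0"
proof -
  define V where "V = (\<Union>m\<in>Poly_Mapping.keys p. Poly_Mapping.keys m)"
  have fV: "finite V" by (simp add: V_def)
  have "\<exists>x. eval_at x p \<noteq> 0" if "finite V" "p \<noteq> 0" "\<And>m. m \<in> Poly_Mapping.keys p \<Longrightarrow> Poly_Mapping.keys m \<subseteq> V"
    for V and p :: "('v, 'k) mpoly"
    using that
  proof (induction V arbitrary: p)
    case empty
    then have "Poly_Mapping.keys p \<subseteq> {0}" by fastforce
    then have "p = Const (Poly_Mapping.lookup p 0)"
      by (intro poly_mapping_eqI) (auto simp: Const_def lookup_single when_def in_keys_iff)
    then show ?case using empty(1) by (metis Const_0 eval_at_Const)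
  next
    case (insert v V)
    obtain m0 where m0: "m0 \<in> Poly_Mapping.keys p" using insert.prems by force
    \<comment> \<open>Any exponent of \<open>v\<close> that occurs will do: removing
      \<open>v\<close> is injective on monomials with this exponent, so the term of
      \<open>m0\<close> survives in \<open>part d\<close>.\<close>
    define d where "d = Poly_Mapping.lookup m0 v"
    define rest where "rest m = m - Poly_Mapping.single v (Poly_Mapping.lookup m v)" for m :: "'v \<Rightarrow>\<^sub>0 nat"
    define part where "part e = (\<Sum>m\<in>{m \<in> Poly_Mapping.keys p. Poly_Mapping.lookup m v = e}.
        Poly_Mapping.single (rest m) (Poly_Mapping.lookup p m))" for e
    have rest: "m = rest m + Poly_Mapping.single v (Poly_Mapping.lookup m v)" for m
      by (rule poly_mapping_eqI) (auto simp: rest_def lookup_add lookup_minus lookup_single when_def)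
    have rest_v: "Poly_Mapping.lookup (rest m) v = 0" for m
      by (simp add: rest_def lookup_minus)
    have rest_keys: "Poly_Mapping.keys (rest m) \<subseteq> V" if "m \<in> Poly_Mapping.keys p" for m
    proof
      fix u assume u: "u \<in> Poly_Mapping.keys (rest m)"
      then have "u \<noteq> v" using rest_v[of m] by (auto simp: in_keys_iff)
      moreover from this u have "u \<in> Poly_Mapping.keys m"
        by (auto simp: in_keys_iff rest_def lookup_minus lookup_single when_def)
      ultimately show "u \<in> V" using insert.prems(2)[OF that] by auto
    qed
    have pkeys: "Poly_Mapping.keys m \<subseteq> V" if "m \<in> Poly_Mapping.keys (part e)" for m e
    proof -
      have "Poly_Mapping.keys (part e) \<subseteq> rest ` Poly_Mapping.keys p"
        unfolding part_def
        by (rule order.trans[OF keys_sum]) auto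
      then show ?thesis using that rest_keys by auto
    qed
    have "Poly_Mapping.lookup (part d) (rest m0) = Poly_Mapping.lookup p m0"
    proof -
      have "Poly_Mapping.lookup (part d) (rest m0) =
        (\<Sum>m\<in>{m \<in> Poly_Mapping.keys p. Poly_Mapping.lookup m v = d}. if m = m0 then Poly_Mapping.lookup p m else 0)"
        unfolding part_def lookup_sum
      proof (rule sum.cong[OF refl])
        fix m assume "m \<in> {m \<in> Poly_Mapping.keys p. Poly_Mapping.lookup m v = d}"
        then have "rest m = rest m0 \<longleftrightarrow> m = m0" by (metis (mono_tags, lifting) d_def rest mem_Collect_eq)
        then show "Poly_Mapping.lookup (Poly_Mapping.single (rest m) (Poly_Mapping.lookup p m)) (rest m0) =
          (if m = m0 then Poly_Mapping.lookup p m else 0)"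
          by (auto simp: lookup_single when_def)
      qed
      also have "\<dots> = Poly_Mapping.lookup p m0" using m0 by (simp add: d_def)
      finally show ?thesis .
    qed
    then have "part d \<noteq> 0" using m0 by (auto simp: in_keys_iff)
    then obtain x where x: "eval_at x (part d) \<noteq> 0" using insert.IH[of "part d"] pkeys by blast
    define q where "q = along (\<lambda>u. if u = v then [:0, 1:] else [:x u:]) p"
    define D where "D = (\<lambda>m. Poly_Mapping.lookup m v) ` Poly_Mapping.keys p"
    have ev: "eval_at (\<lambda>u. if u = v then c else x u) p = (\<Sum>e\<in>D. c ^ e * eval_at x (part e))" for c
    proof -
      have *: "monom_eval (\<lambda>u. if u = v then c else x u) m = c ^ Poly_Mapping.lookup m v * monom_eval x (rest m)"
        for m
      proof -
        have "monom_eval (\<lambda>u. if u = v then c else x u) (rest m) = monom_eval x (rest m)"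
          unfolding monom_eval_def using rest_v[of m] by (intro prod.cong) (auto simp: in_keys_iff)
        then show ?thesis by (subst rest[of m]) (simp add: monom_eval_add mult.commute)
      qed
      have "eval_at (\<lambda>u. if u = v then c else x u) p =
        (\<Sum>m\<in>Poly_Mapping.keys p. Poly_Mapping.lookup p m * (c ^ Poly_Mapping.lookup m v * monom_eval x (rest m)))"
        unfolding eval_at_def by (subst eval_hom_superset[of "Poly_Mapping.keys p"]) (simp_all add: *)
      also have "\<dots> = (\<Sum>e\<in>D. \<Sum>m\<in>{m \<in> Poly_Mapping.keys p. Poly_Mapping.lookup m v = e}.
          Poly_Mapping.lookup p m * (c ^ Poly_Mapping.lookup m v * monom_eval x (rest m)))"
        unfolding D_def by (rule sum.image_gen) simp
      also have "\<dots> = (\<Sum>e\<in>D. c ^ e * eval_at x (part e))"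
      proof (rule sum.cong[OF refl])
        fix e
        have A: "eval_at x (part e) = (\<Sum>m\<in>{m \<in> Poly_Mapping.keys p. Poly_Mapping.lookup m v = e}.
          Poly_Mapping.lookup p m * monom_eval x (rest m))"
          by (simp add: part_def eval_at_simps(7)) (simp add: eval_at_def eval_hom_single)
        show "(\<Sum>m\<in>{m \<in> Poly_Mapping.keys p. Poly_Mapping.lookup m v = e}.
          Poly_Mapping.lookup p m * (c ^ Poly_Mapping.lookup m v * monom_eval x (rest m))) =
          c ^ e * eval_at x (part e)"
          unfolding A sum_distrib_left by (rule sum.cong) auto
      qed
      finally show ?thesis .
    qed
    have "q = (\<Sum>e\<in>D. Polynomial.monom (eval_at x (part e)) e)"
    proof -
      have "poly q c = poly (\<Sum>e\<in>D. Polynomial.monom (eval_at x (part e)) e) c" for c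
      proof -
        have "(\<lambda>u. poly (if u = v then [:0, 1:] else [:x u:]) c) = (\<lambda>u. if u = v then c else x u)"
          by auto
        then show ?thesis
          by (simp add: q_def poly_along ev poly_sum poly_monom mult.commute)
      qed
      then have "q - (\<Sum>e\<in>D. Polynomial.monom (eval_at x (part e)) e) = 0"
        by (intro poly_zero_infinite[of "{}"]) auto
      then show ?thesis by simp
    qed
    then have "Polynomial.coeff q d = eval_at x (part d)"
      using m0 by (auto simp: Polynomial.coeff_sum D_def d_def)
    then have "q \<noteq> 0" using x by auto
    then obtain c where "poly q c \<noteq> 0" using poly_cofinite_nonzero[of q "{}"] by auto
    moreover have "poly q c = eval_at (\<lambda>u. poly (if u = v then [:0, 1:] else [:x u:]) c) p"
      by (simp add: q_def poly_along)
    ultimately show ?case by metis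
  qed
  from this[OF fV assms] show ?thesis by (auto simp: V_def)
qed

section \<open>Extension of points\<close>

text \<open>The subring generated by the variables in \<open>W\<close>. It serves as coefficient
  ring, so that a further variable can be adjoined without a change of type.\<close>

inductive_set polys_in :: "'v set \<Rightarrow> ('v, 'k::comm_ring_1) mpoly set" for W where
  Const: "Const c \<in> polys_in W"
| Var: "v \<in> W \<Longrightarrow> Var v \<in> polys_in W"
| add: "p \<in> polys_in W \<Longrightarrow> q \<in> polys_in W \<Longrightarrow> p + q \<in> polys_in W"
| mult: "p \<in> polys_in W \<Longrightarrow> q \<in> polys_in W \<Longrightarrow> p * q \<in> polys_in W"

lemma polys_in_UNIV [simp]: "polys_in UNIV = UNIV"
proof -
  have "p \<in> polys_in UNIV" for p :: "('v, 'k::comm_ring_1) mpoly"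
    by (induction p rule: mpoly_induct) (auto intro: polys_in.intros)
  then show ?thesis by blast
qed

lemma polys_in_0 [simp]: "0 \<in> polys_in W" and polys_in_1 [simp]: "1 \<in> polys_in W"
  using polys_in.Const[of 0 W] polys_in.Const[of 1 W] by simp_all

lemma polys_in_uminus: "p \<in> polys_in W \<Longrightarrow> - p \<in> polys_in W"
  using polys_in.mult[OF polys_in.Const[of "- 1"], of p W] by (simp add: Const_hom)

lemma polys_in_diff: "p \<in> polys_in W \<Longrightarrow> q \<in> polys_in W \<Longrightarrow> p - q \<in> polys_in W"
  using polys_in.add[OF _ polys_in_uminus] by fastforce

lemma polys_in_sum: "(\<And>i. i \<in> A \<Longrightarrow> f i \<in> polys_in W) \<Longrightarrow> sum f A \<in> polys_in W"
  by (induction A rule: infinite_finite_induct) (auto intro: polys_in.add)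

lemma polys_in_power: "p \<in> polys_in W \<Longrightarrow> p ^ n \<in> polys_in W"
  by (induction n) (auto intro: polys_in.mult)

lemma polys_in_mono: "p \<in> polys_in W \<Longrightarrow> W \<subseteq> W' \<Longrightarrow> p \<in> polys_in W'"
  by (induction rule: polys_in.induct) (auto intro: polys_in.intros)

lemma polys_in_eval_cong:
  "p \<in> polys_in W \<Longrightarrow> (\<And>v. v \<in> W \<Longrightarrow> x v = y v) \<Longrightarrow> eval_at x p = eval_at y p"
  by (induction rule: polys_in.induct) (auto simp: eval_at_simps)

lemma polys_in_empty: "p \<in> polys_in {} \<Longrightarrow> \<exists>c. p = Const c"
proof (induction rule: polys_in.induct)
  case (add p q)
  then show ?case by (metis Const_hom(1))
next
  case (mult p q)
  then show ?case by (metis Const_hom(2))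
qed auto

text \<open>Used in two ways: for a subring \<open>A\<close> this is the polynomial ring over
  \<open>A\<close>, for an ideal it is the ideal extended to univariate polynomials.\<close>

definition coeffs_in :: "'a::comm_ring_1 set \<Rightarrow> 'a poly set" where
  "coeffs_in A = {q. \<forall>i. Polynomial.coeff q i \<in> A}"

context
  fixes W :: "'v set" and A :: "('v, 'k::comm_ring_1) mpoly set"
  defines "A \<equiv> polys_in W"
begin

lemma coeffs_in_0: "0 \<in> coeffs_in A" by (simp add: coeffs_in_def A_def)

lemma coeffs_in_add: "p \<in> coeffs_in A \<Longrightarrow> q \<in> coeffs_in A \<Longrightarrow> p + q \<in> coeffs_in A"
  by (simp add: coeffs_in_def A_def polys_in.add)

lemma coeffs_in_diff: "p \<in> coeffs_in A \<Longrightarrow> q \<in> coeffs_in A \<Longrightarrow> p - q \<in> coeffs_in A"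
  by (simp add: coeffs_in_def A_def polys_in_diff)

lemma coeffs_in_mult: "p \<in> coeffs_in A \<Longrightarrow> q \<in> coeffs_in A \<Longrightarrow> p * q \<in> coeffs_in A"
  by (simp add: coeffs_in_def A_def coeff_mult polys_in_sum polys_in.mult)

lemma coeffs_in_monom: "a \<in> A \<Longrightarrow> Polynomial.monom a n \<in> coeffs_in A"
  by (simp add: coeffs_in_def A_def)

lemma coeffs_in_smult: "a \<in> A \<Longrightarrow> q \<in> coeffs_in A \<Longrightarrow> Polynomial.smult a q \<in> coeffs_in A"
  by (simp add: coeffs_in_def A_def polys_in.mult)

lemma polys_in_insert:
  assumes "p \<in> polys_in (insert u W)"
  shows "\<exists>q\<in>coeffs_in A. p = poly q (Var u)"
  using assms
proof (induction rule: polys_in.induct)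
  case (Const c)
  show ?case
    by (rule bexI[of _ "Polynomial.monom (Const c) 0"])
      (auto intro!: coeffs_in_monom simp: poly_monom, simp add: A_def polys_in.Const)
next
  case (Var v)
  show ?case
  proof (cases "v = u")
    case True
    then show ?thesis
      by (intro bexI[of _ "Polynomial.monom 1 1"])
        (auto intro!: coeffs_in_monom simp: poly_monom, simp add: A_def)
  next
    case False
    then show ?thesis using Var
      by (intro bexI[of _ "Polynomial.monom (Var v) 0"])
        (auto intro!: coeffs_in_monom simp: poly_monom, simp add: A_def polys_in.Var)
  qed
next
  case (add p q)
  then show ?case by (metis coeffs_in_add poly_add)
next
  case (mult p q)
  then show ?case by (metis coeffs_in_mult poly_mult)
qed

lemma poly_in_polys_in: "q \<in> coeffs_in A \<Longrightarrow> poly q (Var u) \<in> polys_in (insert u W)"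
  unfolding poly_altdef
  by (intro polys_in_sum polys_in.mult polys_in_power polys_in.Var)
    (auto simp: coeffs_in_def A_def intro: polys_in_mono)

text \<open>Pseudo-division: the leading coefficient of \<open>m\<close> need not be invertible, so
  each step multiplies by it before cancelling the top term.\<close>

lemma coeffs_in_divide:
  assumes m: "m \<in> coeffs_in A" "Polynomial.degree m > 0" and q: "q \<in> coeffs_in A"
  shows "\<exists>k s r. s \<in> coeffs_in A \<and> r \<in> coeffs_in A \<and>
    Polynomial.smult (Polynomial.lead_coeff m ^ k) q = m * s + r \<and>
    Polynomial.degree r < Polynomial.degree m"
  using q
proof (induction "Polynomial.degree q" arbitrary: q rule: less_induct)
  case less
  let ?a = "Polynomial.lead_coeff m" and ?d = "Polynomial.degree m"
  show ?case
  proof (cases "Polynomial.degree q < ?d")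
    case True
    then show ?thesis using less.prems coeffs_in_0
      by (intro exI[of _ 0] exI[of _ 0] exI[of _ q]) auto
  next
    case False
    define t where "t = Polynomial.monom (Polynomial.lead_coeff q) (Polynomial.degree q - ?d)"
    define q' where "q' = Polynomial.smult ?a q - m * t"
    have lc: "Polynomial.lead_coeff q \<in> A" "?a \<in> A" using less.prems m by (auto simp: coeffs_in_def)
    have t: "t \<in> coeffs_in A" unfolding t_def by (rule coeffs_in_monom[OF lc(1)])
    have q': "q' \<in> coeffs_in A"
      unfolding q'_def by (intro coeffs_in_diff coeffs_in_smult coeffs_in_mult lc less.prems m t)
    have "Polynomial.coeff q' i = 0" if "i \<ge> Polynomial.degree q" for i
    proof (cases "i = Polynomial.degree q")
      case True
      have "Polynomial.coeff (m * t) (?d + (Polynomial.degree q - ?d)) = ?a * Polynomial.lead_coeff q"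
        unfolding t_def mult.commute[of m] coeff_monom_mult by simp
      then show ?thesis using True False by (simp add: q'_def)
    next
      case i: False
      have "Polynomial.degree (m * t) \<le> ?d + (Polynomial.degree q - ?d)"
        by (rule order.trans[OF degree_mult_le]) (simp add: t_def degree_monom_le)
      then show ?thesis using i that False by (simp add: q'_def Polynomial.coeff_eq_0)
    qed
    moreover have "Polynomial.degree q > 0" using False m by simp
    ultimately have "Polynomial.degree q' < Polynomial.degree q"
      by (cases "q' = 0") (simp, meson leading_coeff_0_iff not_less)
    from less.hyps[OF this q'] obtain k s r where
      *: "s \<in> coeffs_in A" "r \<in> coeffs_in A" "Polynomial.smult (?a ^ k) q' = m * s + r"
        "Polynomial.degree r < ?d" by blast
    have "Polynomial.smult (?a ^ Suc k) q = m * (Polynomial.smult (?a ^ k) t + s) + r"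
      using *(3) by (simp add: q'_def Polynomial.smult_diff_right algebra_simps)
    moreover have "Polynomial.smult (?a ^ k) t + s \<in> coeffs_in A"
      by (intro coeffs_in_add coeffs_in_smult t *) (simp add: A_def polys_in_power lc[unfolded A_def])
    ultimately show ?thesis using *(2,4) by blast
  qed
qed

end

section \<open>Extending points modulo a prime ideal\<close>

definition prime_ideal :: "'r::comm_ring_1 set \<Rightarrow> bool" where
  "prime_ideal P \<longleftrightarrow> is_ideal P \<and> 1 \<notin> P \<and> (\<forall>a b. a * b \<in> P \<longrightarrow> a \<in> P \<or> b \<in> P)"

lemma prime_ideal_power: "prime_ideal P \<Longrightarrow> a \<notin> P \<Longrightarrow> a ^ n \<notin> P"
  by (induction n) (auto simp: prime_ideal_def)

lemma ideal_diff_mem_iff: "is_ideal I \<Longrightarrow> a - b \<in> I \<Longrightarrow> a \<in> I \<longleftrightarrow> b \<in> I"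
  using ideal.subspace_add[of I "a - b" b] ideal.subspace_diff[of I a "a - b"] by auto

lemma poly_in_ideal:
  assumes "is_ideal P" "q \<in> coeffs_in P"
  shows "poly q b \<in> P"
  unfolding poly_altdef using assms
  by (intro ideal.subspace_sum ideal_mult_right) (auto simp: coeffs_in_def)

lemma coeffs_in_ideal_mult: "is_ideal P \<Longrightarrow> q \<in> coeffs_in P \<Longrightarrow> Polynomial.coeff (r * q) i \<in> P"
  by (auto simp: coeffs_in_def coeff_mult intro!: ideal.subspace_sum ideal.subspace_scale)

text \<open>Drops the top coefficients that lie in \<open>P\<close>, so that the degree becomes the
  degree modulo \<open>P\<close>.\<close>

lemma truncate_mod_ideal:
  assumes P: "is_ideal P" and q: "q \<in> coeffs_in (polys_in W)" "q \<notin> coeffs_in P"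
  shows "\<exists>q'\<in>coeffs_in (polys_in W). Polynomial.lead_coeff q' \<notin> P \<and>
    Polynomial.degree q' \<le> Polynomial.degree q \<and> q - q' \<in> coeffs_in P"
proof -
  define i where "i = (GREATEST i. Polynomial.coeff q i \<notin> P)"
  have ex: "\<exists>i. Polynomial.coeff q i \<notin> P" using q by (auto simp: coeffs_in_def)
  have bd: "j \<le> Polynomial.degree q" if "Polynomial.coeff q j \<notin> P" for j
    using that ideal.subspace_0[OF P] by (metis Polynomial.coeff_eq_0 linorder_not_less)
  have i: "Polynomial.coeff q i \<notin> P"
    unfolding i_def using ex bd by (metis (mono_tags, lifting) GreatestI_ex_nat)
  have imax: "Polynomial.coeff q j \<in> P" if "j > i" for j
    using that bd Greatest_le_nat[of "\<lambda>i. Polynomial.coeff q i \<notin> P" j] unfolding i_def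
    by (metis linorder_not_less)
  define q' where "q' = (\<Sum>j\<le>i. Polynomial.monom (Polynomial.coeff q j) j)"
  have co: "Polynomial.coeff q' j = (if j \<le> i then Polynomial.coeff q j else 0)" for j
    by (simp add: q'_def Polynomial.coeff_sum)
  have nz: "Polynomial.coeff q i \<noteq> 0" using i ideal.subspace_0[OF P] by metis
  have deg: "Polynomial.degree q' = i"
    by (rule antisym[OF degree_le le_degree]) (auto simp: co nz)
  show ?thesis
  proof (intro bexI conjI)
    show "Polynomial.lead_coeff q' \<notin> P" using i by (simp add: deg co)
    show "Polynomial.degree q' \<le> Polynomial.degree q" using bd[OF i] deg by simp
    show "q - q' \<in> coeffs_in P" using imax ideal.subspace_0[OF P] by (auto simp: coeffs_in_def co)
    show "q' \<in> coeffs_in (polys_in W)" using q by (auto simp: coeffs_in_def co)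
  qed
qed

text \<open>Let b be the class of \<open>Var u\<close> modulo \<open>P\<close>. If b is
  transcendental over the polynomials in \<open>W\<close>, any coefficient of \<beta> outside
  \<open>P\<close> serves as \<alpha>, and \<open>c\<close> has to avoid finitely many roots. If b
  is algebraic, \<alpha> is the product of the leading coefficient of a minimal relation
  \<open>m\<close> and a polynomial in \<open>W\<close> outside \<open>P\<close> that \<beta>
  divides modulo \<open>P\<close>; then \<open>c\<close> is a root of \<open>m\<close> specialised
  at \<open>x\<close>.\<close>

lemma extend_point_step:
  fixes P :: "('v, 'k::alg_closed_field) mpoly set"
  assumes P: "prime_ideal P" and u: "u \<notin> W" and \<beta>: "\<beta> \<in> polys_in (insert u W)" "\<beta> \<notin> P"
  shows "\<exists>\<alpha>\<in>polys_in W - P. \<forall>x. (\<forall>p\<in>polys_in W \<inter> P. eval_at x p = 0) \<longrightarrow> eval_at x \<alpha> \<noteq> 0 \<longrightarrow>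
    (\<exists>c. (\<forall>p\<in>polys_in (insert u W) \<inter> P. eval_at (x(u := c)) p = 0) \<and> eval_at (x(u := c)) \<beta> \<noteq> 0)"
proof -
  let ?A = "polys_in W :: ('v, 'k) mpoly set"
  let ?b = "Var u :: ('v, 'k) mpoly"
  have I: "is_ideal P" and one: "1 \<notin> P" and pr: "\<And>a b. a * b \<in> P \<Longrightarrow> a \<in> P \<or> b \<in> P"
    using P by (auto simp: prime_ideal_def)
  have zero: "0 \<in> P" using I by (rule ideal.subspace_0)
  define ev where "ev x q = map_poly (eval_at x) q" for x :: "'v \<Rightarrow> 'k" and q
  have ev_coeff: "Polynomial.coeff (ev x q) i = eval_at x (Polynomial.coeff q i)" for x q i
    by (simp add: ev_def coeff_map_poly eval_at_simps)
  have ev: "poly (ev x q) c = eval_at (x(u := c)) (poly q ?b)" if "q \<in> coeffs_in ?A" for x q c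
  proof -
    have *: "eval_at (x(u := c)) (Polynomial.coeff q i) = eval_at x (Polynomial.coeff q i)" for i
      using that u by (intro polys_in_eval_cong[of _ W]) (auto simp: coeffs_in_def)
    have "Polynomial.degree (ev x q) \<le> Polynomial.degree q"
      by (rule degree_le) (simp add: ev_coeff Polynomial.coeff_eq_0 eval_at_simps)
    then have "poly (ev x q) c = (\<Sum>i\<le>Polynomial.degree q. Polynomial.coeff (ev x q) i * c ^ i)"
      unfolding poly_altdef by (intro sum.mono_neutral_left) (auto simp: Polynomial.coeff_eq_0)
    also have "\<dots> = (\<Sum>i\<le>Polynomial.degree q. eval_at x (Polynomial.coeff q i) * c ^ i)"
      by (simp add: ev_coeff)
    also have "\<dots> = eval_at (x(u := c)) (poly q ?b)"
      by (simp add: poly_altdef eval_at_simps *)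
    finally show ?thesis .
  qed
  obtain q\<beta> where q\<beta>: "q\<beta> \<in> coeffs_in ?A" "\<beta> = poly q\<beta> ?b" using polys_in_insert[OF \<beta>(1)] by blast
  have ev0: "ev x q = 0" if "q \<in> coeffs_in ?A" "q \<in> coeffs_in P" "\<forall>p\<in>?A \<inter> P. eval_at x p = 0" for q x
    using that by (intro poly_eqI) (auto simp: ev_coeff coeffs_in_def)
  show ?thesis
  proof (cases "\<forall>q\<in>coeffs_in ?A. poly q ?b \<in> P \<longrightarrow> q \<in> coeffs_in P")
    case True
    have "q\<beta> \<notin> coeffs_in P" using poly_in_ideal[OF I] q\<beta> \<beta> by blast
    then obtain i where i: "Polynomial.coeff q\<beta> i \<notin> P" by (auto simp: coeffs_in_def)
    show ?thesis
    proof (intro bexI allI impI)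
      show "Polynomial.coeff q\<beta> i \<in> ?A - P" using i q\<beta> by (auto simp: coeffs_in_def)
      fix x assume x: "\<forall>p\<in>?A \<inter> P. eval_at x p = 0" "eval_at x (Polynomial.coeff q\<beta> i) \<noteq> 0"
      have "ev x q\<beta> \<noteq> 0" using x(2) ev_coeff[of x q\<beta> i] by auto
      then obtain c where c: "poly (ev x q\<beta>) c \<noteq> 0" using poly_cofinite_nonzero[of _ "{}"] by blast
      have "eval_at (x(u := c)) p = 0" if p: "p \<in> polys_in (insert u W) \<inter> P" for p
      proof -
        obtain q where q: "q \<in> coeffs_in ?A" "p = poly q ?b" using polys_in_insert[of p u W] p by blast
        then have "ev x q = 0" using True that x(1) by (intro ev0) auto
        then show ?thesis using ev[OF q(1), of x c] q(2) by simp
      qed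
      then show "\<exists>c. (\<forall>p\<in>polys_in (insert u W) \<inter> P. eval_at (x(u := c)) p = 0) \<and> eval_at (x(u := c)) \<beta> \<noteq> 0"
        using c ev[OF q\<beta>(1)] q\<beta>(2) by auto
    qed
  next
    case False
    \<comment> \<open>Relations of \<open>Var u\<close> whose leading coefficient stays nonzero
      modulo \<open>P\<close>; one of least degree plays the minimal polynomial.\<close>
    define M where "M = {q\<in>coeffs_in ?A. poly q ?b \<in> P \<and> Polynomial.lead_coeff q \<notin> P}"
    have trunc_b: "poly q' ?b \<in> P \<longleftrightarrow> poly q ?b \<in> P" if "q - q' \<in> coeffs_in P" for q q'
    proof -
      have "poly q ?b - poly q' ?b \<in> P" using poly_in_ideal[OF I that, of ?b] by simp
      then show ?thesis using ideal_diff_mem_iff[OF I] by blast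
    qed
    have "M \<noteq> {}"
    proof -
      obtain q where q: "q \<in> coeffs_in ?A" "poly q ?b \<in> P" "q \<notin> coeffs_in P" using False by blast
      obtain q' where q': "q' \<in> coeffs_in ?A" "Polynomial.lead_coeff q' \<notin> P" "q - q' \<in> coeffs_in P"
        using truncate_mod_ideal[OF I q(1,3)] by blast
      then have "q' \<in> M" using trunc_b[OF q'(3)] q(2) by (simp add: M_def)
      then show ?thesis by blast
    qed
    then obtain m where mM: "m \<in> M" and mmin: "\<And>q. q \<in> M \<Longrightarrow> Polynomial.degree m \<le> Polynomial.degree q"
      using ex_has_least_nat[of "\<lambda>q. q \<in> M" _ Polynomial.degree] by (metis ex_in_conv)
    let ?d = "Polynomial.degree m"
    define a where "a = Polynomial.lead_coeff m"
    have m: "m \<in> coeffs_in ?A" "poly m ?b \<in> P" "a \<notin> P" "a \<in> ?A" using mM by (auto simp: M_def a_def coeffs_in_def)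
    have d: "?d > 0"
    proof (rule ccontr)
      assume "\<not> ?d > 0"
      then have "poly m ?b = a" by (auto simp: a_def elim!: degree_eq_zeroE)
      then show False using m by simp
    qed
    have Min: "r \<in> coeffs_in P" if r: "r \<in> coeffs_in ?A" "Polynomial.degree r < ?d" "poly r ?b \<in> P" for r
    proof (rule ccontr)
      assume "r \<notin> coeffs_in P"
      from truncate_mod_ideal[OF I r(1) this] obtain r' where
        r': "r' \<in> coeffs_in ?A" "Polynomial.lead_coeff r' \<notin> P" "r - r' \<in> coeffs_in P"
        "Polynomial.degree r' \<le> Polynomial.degree r" by blast
      then have "r' \<in> M" using trunc_b[OF r'(3)] r(3) by (simp add: M_def)
      then show False using mmin r(2) r'(4) by fastforce
    qed
    \<comment> \<open>Representatives, of degree below that of \<open>m\<close>, of multiples of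
      \<beta>. One of least degree will be constant, so that \<beta> divides a polynomial in
      \<open>W\<close> outside \<open>P\<close>.\<close>
    define R where "R = {r. r \<in> coeffs_in ?A \<and> Polynomial.lead_coeff r \<notin> P \<and>
        Polynomial.degree r < Polynomial.degree m \<and>
        (\<exists>y. y \<in> coeffs_in ?A \<and> poly r ?b - \<beta> * poly y ?b \<in> P)}"
    have XI: "\<exists>r'\<in>R. Polynomial.degree r' \<le> Polynomial.degree r"
      if r: "r \<in> coeffs_in ?A" "r \<notin> coeffs_in P" "Polynomial.degree r < ?d" "y \<in> coeffs_in ?A"
        "poly r ?b - \<beta> * poly y ?b \<in> P" for r y
    proof -
      from truncate_mod_ideal[OF I r(1,2)] obtain r' where
        r': "r' \<in> coeffs_in ?A" "Polynomial.lead_coeff r' \<notin> P" "r - r' \<in> coeffs_in P"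
        "Polynomial.degree r' \<le> Polynomial.degree r" by blast
      have "(poly r ?b - \<beta> * poly y ?b) - poly (r - r') ?b \<in> P"
        by (intro ideal.subspace_diff[OF I] r poly_in_ideal[OF I] r')
      then have "poly r' ?b - \<beta> * poly y ?b \<in> P" by (simp add: algebra_simps)
      then show ?thesis using r r' by (intro bexI[of _ r']) (auto simp: R_def)
    qed
    have "R \<noteq> {}"
    proof -
      obtain k s r where *: "s \<in> coeffs_in ?A" "r \<in> coeffs_in ?A"
        "Polynomial.smult (a ^ k) q\<beta> = m * s + r" "Polynomial.degree r < ?d"
        using coeffs_in_divide[OF m(1) d q\<beta>(1)] unfolding a_def by blast
      have e: "a ^ k * \<beta> = poly m ?b * poly s ?b + poly r ?b"
        using arg_cong[OF *(3), of "\<lambda>q. poly q ?b"] q\<beta>(2) by simp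
      have "poly r ?b - \<beta> * poly (Polynomial.monom (a ^ k) 0) ?b = - (poly m ?b * poly s ?b)"
        using e by (simp add: poly_monom algebra_simps)
      also have "\<dots> \<in> P" by (intro ideal.subspace_neg[OF I] ideal_mult_right[OF I] m)
      finally have 1: "poly r ?b - \<beta> * poly (Polynomial.monom (a ^ k) 0) ?b \<in> P" .
      have "r \<notin> coeffs_in P"
      proof
        assume "r \<in> coeffs_in P"
        then have "a ^ k * \<beta> \<in> P" unfolding e
          by (intro ideal.subspace_add[OF I] ideal_mult_right[OF I] m poly_in_ideal[OF I])
        then show False using pr prime_ideal_power[OF P m(3)] \<beta> by blast
      qed
      then show ?thesis using XI[OF *(2) _ *(4) _ 1] coeffs_in_monom[OF polys_in_power[OF m(4)]] by blast
    qed
    then obtain r where rX: "r \<in> R" and rmin: "\<And>q. q \<in> R \<Longrightarrow> Polynomial.degree r \<le> Polynomial.degree q"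
      using ex_has_least_nat[of "\<lambda>q. q \<in> R" _ Polynomial.degree] by (metis ex_in_conv)
    then obtain y where r: "r \<in> coeffs_in ?A" "Polynomial.lead_coeff r \<notin> P" "Polynomial.degree r < ?d"
      and y: "y \<in> coeffs_in ?A" "poly r ?b - \<beta> * poly y ?b \<in> P" by (auto simp: R_def)
    define \<sigma> where "\<sigma> = Polynomial.lead_coeff r"
    have \<sigma>: "\<sigma> \<in> ?A" "\<sigma> \<notin> P" using r by (auto simp: \<sigma>_def coeffs_in_def)
    \<comment> \<open>Pseudo-dividing \<open>m\<close> by \<open>r\<close> leaves a multiple of
      \<beta> of smaller degree, hence zero modulo \<open>P\<close>. As the value of
      \<open>r\<close> at \<open>Var u\<close> is outside \<open>P\<close>, that of the quotient
      \<open>s\<close> is in \<open>P\<close>, so modulo \<open>P\<close> either \<open>s\<close> is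
      zero or its degree is at least that of \<open>m\<close>. Both contradict the degree of
      \<open>m\<close>, which modulo \<open>P\<close> is that of \<open>r * s\<close>.\<close>
    have deg_r: "Polynomial.degree r = 0"
    proof (rule ccontr)
      assume "Polynomial.degree r \<noteq> 0"
      then obtain k s t where *: "s \<in> coeffs_in ?A" "t \<in> coeffs_in ?A"
        "Polynomial.smult (\<sigma> ^ k) m = r * s + t" "Polynomial.degree t < Polynomial.degree r"
        using coeffs_in_divide[OF r(1) _ m(1)] unfolding \<sigma>_def by blast
      have e: "\<sigma> ^ k * poly m ?b = poly r ?b * poly s ?b + poly t ?b"
        using arg_cong[OF *(3), of "\<lambda>q. poly q ?b"] by simp
      have "poly t ?b - \<beta> * poly (- (y * s)) ?b =
          \<sigma> ^ k * poly m ?b - poly s ?b * (poly r ?b - \<beta> * poly y ?b)"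
        unfolding e by (simp add: algebra_simps)
      also have "\<dots> \<in> P"
        by (intro ideal.subspace_diff[OF I] ideal.subspace_scale[OF I] m y)
      finally have 1: "poly t ?b - \<beta> * poly (- (y * s)) ?b \<in> P" .
      have "- (y * s) \<in> coeffs_in ?A"
        using coeffs_in_diff[OF coeffs_in_0 coeffs_in_mult[OF y(1) *(1)]] by simp
      then have tP: "t \<in> coeffs_in P"
        using XI[OF *(2) _ _ _ 1] rmin *(4) r(3) by (meson leD less_trans order.trans not_less)
      have "poly r ?b * poly s ?b = \<sigma> ^ k * poly m ?b - poly t ?b" using e by simp
      also have "\<dots> \<in> P"
        by (intro ideal.subspace_diff[OF I] ideal.subspace_scale[OF I] m poly_in_ideal[OF I] tP)
      finally have "poly s ?b \<in> P" using pr Min[OF r(1,3)] r(2) by (auto simp: coeffs_in_def)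
      show False
      proof (cases "s \<in> coeffs_in P")
        case True
        have "Polynomial.coeff (r * s + t) ?d \<in> P"
          using coeffs_in_ideal_mult[OF I True, of r ?d] tP
          by (auto simp: coeffs_in_def intro!: ideal.subspace_add[OF I])
        moreover have "Polynomial.coeff (r * s + t) ?d = \<sigma> ^ k * a" by (simp add: a_def flip: *(3))
        ultimately show False using pr prime_ideal_power[OF P \<sigma>(2)] m(3) by metis
      next
        case False
        from truncate_mod_ideal[OF I *(1) this] obtain s' where
          s': "s' \<in> coeffs_in ?A" "Polynomial.lead_coeff s' \<notin> P" "s - s' \<in> coeffs_in P" by blast
        have "poly s' ?b \<in> P" using trunc_b[OF s'(3)] \<open>poly s ?b \<in> P\<close> by simp
        then have ds: "Polynomial.degree s' \<ge> ?d" using s' mmin by (auto simp: M_def)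
        let ?e = "Polynomial.degree r + Polynomial.degree s'"
        have "r * s' = Polynomial.smult (\<sigma> ^ k) m - t - r * (s - s')"
          unfolding *(3) by (simp add: algebra_simps)
        then have "Polynomial.coeff (r * s') ?e = \<sigma> ^ k * Polynomial.coeff m ?e
            - Polynomial.coeff t ?e - Polynomial.coeff (r * (s - s')) ?e" by simp
        also have "Polynomial.coeff m ?e = 0"
          using ds \<open>Polynomial.degree r \<noteq> 0\<close> by (intro Polynomial.coeff_eq_0) auto
        also have "\<sigma> ^ k * 0 - Polynomial.coeff t ?e - Polynomial.coeff (r * (s - s')) ?e \<in> P"
          using tP zero
          by (intro ideal.subspace_diff[OF I] coeffs_in_ideal_mult[OF I] s'(3)) (auto simp: coeffs_in_def)
        finally have "Polynomial.lead_coeff r * Polynomial.lead_coeff s' \<in> P"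
          by (simp add: coeff_mult_degree_sum)
        then show False using pr s'(2) r(2) by blast
      qed
    qed
    then have r\<sigma>: "poly r ?b = \<sigma>" by (auto simp: \<sigma>_def elim!: degree_eq_zeroE)
    show ?thesis
    proof (intro bexI allI impI)
      show "a * \<sigma> \<in> ?A - P" using m \<sigma> pr by (auto intro: polys_in.mult)
      fix x assume x: "\<forall>p\<in>?A \<inter> P. eval_at x p = 0" "eval_at x (a * \<sigma>) \<noteq> 0"
      \<comment> \<open>The leading coefficient \<open>a\<close> survives at \<open>x\<close>, so
        \<open>m\<close> specialises to a polynomial of positive degree and has a root.\<close>
      have "Polynomial.coeff (ev x m) ?d \<noteq> 0" using x(2) by (auto simp: ev_coeff a_def eval_at_simps)
      then have "Polynomial.degree (ev x m) > 0" using d le_degree by (metis less_le_trans)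
      then obtain c where c: "poly (ev x m) c = 0" using alg_closed_imp_poly_has_root by blast
      have z: "eval_at (x(u := c)) p = 0" if p: "p \<in> polys_in (insert u W) \<inter> P" for p
      proof -
        obtain q where q: "q \<in> coeffs_in ?A" "p = poly q ?b" using polys_in_insert[of p u W] p by blast
        obtain k s t where *: "s \<in> coeffs_in ?A" "t \<in> coeffs_in ?A"
          "Polynomial.smult (a ^ k) q = m * s + t" "Polynomial.degree t < ?d"
          using coeffs_in_divide[OF m(1) d q(1)] unfolding a_def by blast
        have e: "a ^ k * p = poly m ?b * poly s ?b + poly t ?b"
          using arg_cong[OF *(3), of "\<lambda>q. poly q ?b"] q(2) by simp
        then have "poly t ?b = a ^ k * p - poly m ?b * poly s ?b" by simp
        also have "\<dots> \<in> P" using p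
          by (intro ideal.subspace_diff[OF I] ideal.subspace_scale[OF I] ideal_mult_right[OF I] m) auto
        finally have "ev x t = 0" using Min[OF *(2,4)] by (intro ev0[OF *(2) _ x(1)])
        then have "eval_at (x(u := c)) (poly t ?b) = 0" using ev[OF *(2), of x c] by simp
        moreover have "eval_at (x(u := c)) (poly m ?b) = 0" using c ev[OF m(1)] by simp
        ultimately have "eval_at (x(u := c)) (a ^ k * p) = 0" unfolding e by (simp add: eval_at_simps)
        moreover have "eval_at (x(u := c)) a = eval_at x a"
          using m(4) u by (intro polys_in_eval_cong[of _ W]) auto
        ultimately show ?thesis using x(2) by (simp add: eval_at_simps)
      qed
      have "\<sigma> - \<beta> * poly y ?b \<in> polys_in (insert u W) \<inter> P"
        using y r\<sigma> \<sigma>(1) poly_in_polys_in[OF y(1)] \<beta>(1)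
        by (auto intro!: polys_in_diff polys_in.mult intro: polys_in_mono)
      then have "eval_at (x(u := c)) \<sigma> = eval_at (x(u := c)) \<beta> * eval_at (x(u := c)) (poly y ?b)"
        using z by (fastforce simp: eval_at_simps)
      moreover have "eval_at (x(u := c)) \<sigma> = eval_at x \<sigma>"
        using \<sigma>(1) u by (intro polys_in_eval_cong[of _ W]) auto
      ultimately have "eval_at (x(u := c)) \<beta> \<noteq> 0" using x(2) by (auto simp: eval_at_simps)
      then show "\<exists>c. (\<forall>p\<in>polys_in (insert u W) \<inter> P. eval_at (x(u := c)) p = 0) \<and> eval_at (x(u := c)) \<beta> \<noteq> 0"
        using z by blast
    qed
  qed
qed

text \<open>One application of the single step for each variable of \<open>F\<close>: the \<alpha>
  obtained on removing a variable is the \<beta> for the remaining ones.\<close>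

lemma extend_point:
  fixes P :: "('v, 'k::alg_closed_field) mpoly set"
  assumes P: "prime_ideal P" and F: "finite F" "F \<inter> W = {}" and \<beta>: "\<beta> \<in> polys_in (F \<union> W) - P"
  shows "\<exists>\<alpha>\<in>polys_in W - P. \<forall>x. (\<forall>p\<in>polys_in W \<inter> P. eval_at x p = 0) \<longrightarrow> eval_at x \<alpha> \<noteq> 0 \<longrightarrow>
    (\<exists>y. (\<forall>v\<in>W. y v = x v) \<and> (\<forall>p\<in>polys_in (F \<union> W) \<inter> P. eval_at y p = 0) \<and> eval_at y \<beta> \<noteq> 0)"
  using F \<beta>
proof (induction F arbitrary: \<beta>)
  case empty
  then show ?case by (intro bexI[of _ \<beta>]) auto
next
  case (insert u F)
  obtain \<alpha>1 where \<alpha>1: "\<alpha>1 \<in> polys_in (F \<union> W) - P"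
    "\<And>x. (\<forall>p\<in>polys_in (F \<union> W) \<inter> P. eval_at x p = 0) \<Longrightarrow> eval_at x \<alpha>1 \<noteq> 0 \<Longrightarrow>
    (\<exists>c. (\<forall>p\<in>polys_in (insert u (F \<union> W)) \<inter> P. eval_at (x(u := c)) p = 0) \<and> eval_at (x(u := c)) \<beta> \<noteq> 0)"
    using extend_point_step[OF P, of u "F \<union> W" \<beta>] insert.hyps insert.prems by auto
  obtain \<alpha> where \<alpha>: "\<alpha> \<in> polys_in W - P"
    "\<And>x. (\<forall>p\<in>polys_in W \<inter> P. eval_at x p = 0) \<Longrightarrow> eval_at x \<alpha> \<noteq> 0 \<Longrightarrow>
    (\<exists>y. (\<forall>v\<in>W. y v = x v) \<and> (\<forall>p\<in>polys_in (F \<union> W) \<inter> P. eval_at y p = 0) \<and> eval_at y \<alpha>1 \<noteq> 0)"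
    using insert.IH[OF _ \<alpha>1(1)] insert.prems by auto
  show ?case
  proof (intro bexI[OF _ \<alpha>(1)] allI impI)
    fix x assume "\<forall>p\<in>polys_in W \<inter> P. eval_at x p = 0" "eval_at x \<alpha> \<noteq> 0"
    from \<alpha>(2)[OF this] obtain y where y: "\<forall>v\<in>W. y v = x v"
      "\<forall>p\<in>polys_in (F \<union> W) \<inter> P. eval_at y p = 0" "eval_at y \<alpha>1 \<noteq> 0" by blast
    from \<alpha>1(2)[OF this(2,3)] obtain c where
      c: "\<forall>p\<in>polys_in (insert u (F \<union> W)) \<inter> P. eval_at (y(u := c)) p = 0" "eval_at (y(u := c)) \<beta> \<noteq> 0"
      by blast
    moreover have "\<forall>v\<in>W. (y(u := c)) v = x v" using y(1) insert.prems by auto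
    ultimately show "\<exists>y. (\<forall>v\<in>W. y v = x v) \<and>
      (\<forall>p\<in>polys_in (insert u F \<union> W) \<inter> P. eval_at y p = 0) \<and> eval_at y \<beta> \<noteq> 0"
      unfolding Un_insert_left by blast
  qed
qed

text \<open>An ideal maximal among those containing \<open>I\<close> and no power of
  \<open>f\<close> is prime: if neither factor of a product in it were a member, adjoining either
  factor would bring in a power of \<open>f\<close>, and the product of these two powers would lie
  in the ideal.\<close>

lemma prime_ideal_avoiding:
  fixes I :: "'r::comm_ring_1 set"
  assumes I: "is_ideal I" and f: "\<And>n. f ^ n \<notin> I"
  shows "\<exists>P. prime_ideal P \<and> I \<subseteq> P \<and> f \<notin> P"
proof -
  define A where "A = {J. is_ideal J \<and> I \<subseteq> J \<and> (\<forall>n. f ^ n \<notin> J)}"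
  have "\<exists>M\<in>A. (\<forall>R\<in>A. M \<subseteq> R \<longrightarrow> R = M)"
  proof (rule subset_Zorn_nonempty)
    show "A \<noteq> {}" using I f by (auto simp: A_def)
    fix C assume C: "C \<noteq> {}" "subset.chain A C"
    have "is_ideal (\<Union>C)"
    proof (rule is_idealI)
      obtain Z where "Z \<in> C" "Z \<in> A" using C by (auto simp: subset.chain_def)
      then show "0 \<in> \<Union>C" using ideal.subspace_0[of Z] by (auto simp: A_def)
      fix a b assume "a \<in> \<Union>C" "b \<in> \<Union>C"
      then obtain R Y where XY: "R \<in> C" "Y \<in> C" "a \<in> R" "b \<in> Y" by blast
      then have "R \<subseteq> Y \<or> Y \<subseteq> R" using C by (auto simp: subset.chain_def)
      then obtain Z where "Z \<in> C" "a \<in> Z" "b \<in> Z" using XY by blast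
      moreover from this have "is_ideal Z" using C by (auto simp: A_def subset.chain_def)
      ultimately show "a + b \<in> \<Union>C" using ideal.subspace_add by blast
    next
      fix r a assume "a \<in> \<Union>C"
      then obtain Z where "Z \<in> C" "a \<in> Z" by blast
      moreover from this have "is_ideal Z" using C by (auto simp: A_def subset.chain_def)
      ultimately show "r * a \<in> \<Union>C" using ideal.subspace_scale by blast
    qed
    moreover obtain Z where "Z \<in> C" "Z \<in> A" using C by (auto simp: subset.chain_def)
    ultimately show "\<Union>C \<in> A" using C unfolding A_def subset.chain_def by blast
  qed
  then obtain M where M: "is_ideal M" "I \<subseteq> M" "\<And>n. f ^ n \<notin> M" and max: "\<And>R. R \<in> A \<Longrightarrow> M \<subseteq> R \<Longrightarrow> R = M"
    by (auto simp: A_def)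
  have meet: "\<exists>n r m. m \<in> M \<and> f ^ n = m + r * a" if "a \<notin> M" for a
  proof (rule ccontr)
    assume no: "\<not> ?thesis"
    define R where "R = {m + r * a | m r. m \<in> M}"
    have "is_ideal R"
    proof (rule is_idealI)
      show "0 \<in> R" unfolding R_def using ideal.subspace_0[OF M(1)] by (metis (mono_tags, lifting) add.left_neutral mem_Collect_eq mult_zero_left)
      fix p q assume "p \<in> R" "q \<in> R"
      then obtain m r m' r' where "p = m + r * a" "q = m' + r' * a" "m \<in> M" "m' \<in> M" by (auto simp: R_def)
      then have "p + q = (m + m') + (r + r') * a" "m + m' \<in> M"
        by (auto simp: algebra_simps ideal.subspace_add[OF M(1)])
      then show "p + q \<in> R" unfolding R_def by blast
    next
      fix s p assume "p \<in> R"
      then obtain m r where "p = m + r * a" "m \<in> M" by (auto simp: R_def)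
      then have "s * p = s * m + (s * r) * a" "s * m \<in> M"
        by (simp add: algebra_simps) (rule ideal.subspace_scale[OF M(1) \<open>m \<in> M\<close>])
      then show "s * p \<in> R" unfolding R_def by blast
    qed
    moreover have "M \<subseteq> R" unfolding R_def by (force intro: exI[of _ 0])
    moreover have "f ^ n \<notin> R" for n using no by (auto simp: R_def)
    ultimately have "R = M" using M by (intro max) (auto simp: A_def)
    moreover have "a = 0 + 1 * a" by simp
    then have "a \<in> R" unfolding R_def using ideal.subspace_0[OF M(1)] by blast
    ultimately show False using that by simp
  qed
  have "prime_ideal M" unfolding prime_ideal_def
  proof (intro conjI allI impI M(1))
    show "1 \<notin> M" using M(3)[of 0] by simp
    fix a b assume ab: "a * b \<in> M"
    show "a \<in> M \<or> b \<in> M"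
    proof (rule ccontr)
      assume "\<not> ?thesis"
      then obtain n r m n' r' m' where *: "m \<in> M" "f ^ n = m + r * a" "m' \<in> M" "f ^ n' = m' + r' * b"
        using meet by meson
      have "f ^ (n + n') = m' * m + (r' * b) * m + (r * a) * m' + (r * r') * (a * b)"
        by (simp add: power_add * algebra_simps)
      also have "\<dots> \<in> M"
        by (intro ideal.subspace_add[OF M(1)] ideal.subspace_scale[OF M(1)] * ab)
      finally show False using M(3) by blast
    qed
  qed
  then show ?thesis using M(2) M(3)[of 1] by auto
qed

text \<open>Extension of points with \<open>W\<close> empty: there \<alpha> is a nonzero constant,
  so a prime ideal containing \<open>I\<close> but not \<open>f\<close> has a zero at which
  \<open>f\<close> does not vanish.\<close>

theorem nullstellensatz:
  fixes I :: "('v::finite, 'k::alg_closed_field) mpoly set"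
  assumes "is_ideal I"
  shows "vanishing_ideal (points I) = radical_ideal I"
proof (intro equalityI subsetI)
  fix f assume f: "f \<in> vanishing_ideal (points I)"
  show "f \<in> radical_ideal I"
  proof (rule ccontr)
    assume "f \<notin> radical_ideal I"
    then obtain P where P: "prime_ideal P" "I \<subseteq> P" "f \<notin> P"
      using prime_ideal_avoiding[OF assms, of f] by (auto simp: radical_ideal_def)
    have "\<exists>\<alpha>\<in>polys_in {} - P. \<forall>x. (\<forall>p\<in>polys_in {} \<inter> P. eval_at x p = 0) \<longrightarrow> eval_at x \<alpha> \<noteq> 0 \<longrightarrow>
      (\<exists>y. (\<forall>v\<in>{}. y v = x v) \<and> (\<forall>p\<in>polys_in (UNIV \<union> {}) \<inter> P. eval_at y p = 0) \<and> eval_at y f \<noteq> 0)"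
      by (rule extend_point[OF P(1)]) (use P(3) in auto)
    then obtain \<alpha> where \<alpha>: "\<alpha> \<in> polys_in {} - P"
      and \<alpha>_ext: "\<forall>x. (\<forall>p\<in>polys_in {} \<inter> P. eval_at x p = 0) \<longrightarrow> eval_at x \<alpha> \<noteq> 0 \<longrightarrow>
      (\<exists>y. (\<forall>v\<in>{}. y v = x v) \<and> (\<forall>p\<in>polys_in (UNIV \<union> {}) \<inter> P. eval_at y p = 0) \<and> eval_at y f \<noteq> 0)"
      by (rule bexE)
    obtain c where c: "\<alpha> = Const c" using \<alpha> polys_in_empty by blast
    have unit: "Const c' \<in> P \<Longrightarrow> c' = 0" for c'
    proof (rule ccontr)
      assume "Const c' \<in> P" "c' \<noteq> 0"
      then have "Const (inverse c') * Const c' \<in> P"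
        using P(1) by (auto simp: prime_ideal_def intro: ideal.subspace_scale)
      then show False using P(1) \<open>c' \<noteq> 0\<close> by (simp add: prime_ideal_def flip: Const_hom(2))
    qed
    have "eval_at (\<lambda>_. 0) p = 0" if "p \<in> polys_in {} \<inter> P" for p
      using that polys_in_empty[of p] unit by auto
    moreover have "c \<noteq> 0"
      using \<alpha> c P(1) ideal.subspace_0[of P] by (auto simp: prime_ideal_def)
    ultimately obtain y where "\<forall>p\<in>P. eval_at y p = 0" "eval_at y f \<noteq> 0"
      using \<alpha>_ext[rule_format, of "\<lambda>_. 0"] c by auto
    then show False using f P(2) by (auto simp: vanishing_ideal_def points_def)
  qed
next
  fix f assume "f \<in> radical_ideal I"
  then obtain n where "f ^ n \<in> I" by (auto simp: radical_ideal_def)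
  then have "eval_at x f ^ n = 0" if "x \<in> points I" for x
    using that by (auto simp: points_def simp flip: eval_at_simps)
  then show "f \<in> vanishing_ideal (points I)"
    by (auto simp: vanishing_ideal_def)
qed

section \<open>Ideals with coprime squarefree leading monomials\<close>

definition weight :: "('v \<Rightarrow> nat) \<Rightarrow> ('v \<Rightarrow>\<^sub>0 nat) \<Rightarrow> nat" where
  "weight w m = (\<Sum>v\<in>Poly_Mapping.keys m. Poly_Mapping.lookup m v * w v)"

lemma weight_superset:
  "finite A \<Longrightarrow> Poly_Mapping.keys m \<subseteq> A \<Longrightarrow> weight w m = (\<Sum>v\<in>A. Poly_Mapping.lookup m v * w v)"
  unfolding weight_def by (rule sum.mono_neutral_left) (auto simp: in_keys_iff)

lemma weight_add: "weight w (m + m') = weight w m + weight w m'"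
proof -
  let ?A = "Poly_Mapping.keys m \<union> Poly_Mapping.keys m'"
  have "Poly_Mapping.keys (m + m') \<subseteq> ?A" by (rule keys_add)
  then show ?thesis
    by (simp add: weight_superset[of ?A] lookup_add distrib_right sum.distrib)
qed

lemma weight_0 [simp]: "weight w 0 = 0" by (simp add: weight_def)

lemma weight_sum: "weight w (sum f A) = (\<Sum>i\<in>A. weight w (f i))"
  by (induction A rule: infinite_finite_induct) (auto simp: weight_add)

lemma weight_single [simp]: "weight w (Poly_Mapping.single v n) = n * w v"
  by (cases "n = 0") (auto simp: weight_def)

definition weight_below :: "('v \<Rightarrow> nat) \<Rightarrow> nat \<Rightarrow> ('v, 'k::comm_ring_1) mpoly set" where
  "weight_below w d = {p. \<forall>m\<in>Poly_Mapping.keys p. weight w m < d}"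

lemma weight_below_0 [simp]: "0 \<in> weight_below w d" by (simp add: weight_below_def)

lemma weight_below_add: "p \<in> weight_below w d \<Longrightarrow> q \<in> weight_below w d \<Longrightarrow> p + q \<in> weight_below w d"
  using keys_add[of p q] by (auto simp: weight_below_def)

lemma weight_below_mono: "p \<in> weight_below w d \<Longrightarrow> d \<le> e \<Longrightarrow> p \<in> weight_below w e"
  by (auto simp: weight_below_def)

lemma weight_below_mult:
  assumes "p \<in> weight_below w (Suc d)" "q \<in> weight_below w e"
  shows "p * q \<in> weight_below w (d + e)"
proof -
  have "weight w m < d + e" if "m \<in> Poly_Mapping.keys (p * q)" for m
    using that keys_mult[of p q] assms
    by (fastforce simp: weight_below_def weight_add less_Suc_eq_le intro: add_le_less_mono)
  then show ?thesis by (simp add: weight_below_def)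
qed

text \<open>A weight replaces the monomial order: ties are allowed among other monomials, but
  \<open>m\<close> must be the only one of top weight and have coefficient one.\<close>

definition leading :: "('v \<Rightarrow> nat) \<Rightarrow> ('v \<Rightarrow>\<^sub>0 nat) \<Rightarrow> ('v, 'k::comm_ring_1) mpoly \<Rightarrow> bool" where
  "leading w m p \<longleftrightarrow> p - Poly_Mapping.single m 1 \<in> weight_below w (weight w m)"

lemma leadingE:
  assumes "leading w m p"
  obtains r where "p = Poly_Mapping.single m 1 + r" "r \<in> weight_below w (weight w m)"
  using assms that[of "p - Poly_Mapping.single m 1"] by (simp add: leading_def)

lemma leading_single [simp]: "leading w m (Poly_Mapping.single m 1)"
  by (simp add: leading_def)

lemma leading_1: "leading w 0 1"
  using leading_single[of w 0] by (simp add: single_one)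

lemma leading_mult:
  assumes "leading w m p" "leading w n q"
  shows "leading w (m + n) (p * q)"
proof -
  obtain r s where r: "p = Poly_Mapping.single m 1 + r" "r \<in> weight_below w (weight w m)"
    and s: "q = Poly_Mapping.single n 1 + s" "s \<in> weight_below w (weight w n)"
    using assms by (meson leadingE)
  have sm: "Poly_Mapping.single m (1::'b) \<in> weight_below w (Suc (weight w m))" for m
    by (simp add: weight_below_def)
  have "p * q - Poly_Mapping.single (m + n) 1 =
      Poly_Mapping.single m 1 * s + (Poly_Mapping.single n 1 * r + r * s)"
    by (simp add: r s algebra_simps mult_single)
  also have "\<dots> \<in> weight_below w (weight w m + weight w n)"
    using weight_below_mult[OF sm[of m] s(2)] weight_below_mult[OF sm[of n] r(2)]
      weight_below_mult[OF weight_below_mono[OF r(2), of "Suc (weight w m)"] s(2)]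
    by (intro weight_below_add) (auto simp: add.commute)
  finally show ?thesis by (simp add: leading_def weight_add)
qed

text \<open>The constant sum is \<open>n\<close> times the exponent vector \<open>m\<close>.\<close>

lemma leading_power: "leading w m p \<Longrightarrow> leading w (\<Sum>_\<in>{..<n::nat}. m) (p ^ n)"
proof (induction n)
  case (Suc n)
  have "{..<Suc n} = insert n {..<n}" by auto
  then show ?case using leading_mult[OF Suc.prems Suc.IH[OF Suc.prems]] by simp
qed (simp add: leading_1)

lemma leading_prod:
  "(\<And>i. i \<in> A \<Longrightarrow> leading w (m i) (p i)) \<Longrightarrow> leading w (sum m A) (prod p A)"
  by (induction A rule: infinite_finite_induct) (auto simp: leading_1 leading_mult)

section \<open>Weight-homogeneous parts\<close>

definition hom_part :: "('v \<Rightarrow> nat) \<Rightarrow> nat \<Rightarrow> ('v, 'k::comm_ring_1) mpoly \<Rightarrow> ('v, 'k) mpoly" where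
  "hom_part w d p = (\<Sum>m\<in>{m\<in>Poly_Mapping.keys p. weight w m = d}. Poly_Mapping.single m (Poly_Mapping.lookup p m))"

lemma lookup_hom_part: "Poly_Mapping.lookup (hom_part w d p) m = (if weight w m = d then Poly_Mapping.lookup p m else 0)"
  by (auto simp: hom_part_def lookup_sum lookup_single when_def in_keys_iff)

lemma keys_hom_part: "Poly_Mapping.keys (hom_part w d p) \<subseteq> Poly_Mapping.keys p"
  by (auto simp: in_keys_iff lookup_hom_part split: if_splits)

lemma hom_part_add: "hom_part w d (p + q) = hom_part w d p + hom_part w d q"
  by (rule poly_mapping_eqI) (simp add: lookup_hom_part lookup_add)

lemma hom_part_eq_0: "p \<in> weight_below w d \<Longrightarrow> d \<le> e \<Longrightarrow> hom_part w e p = 0"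
  by (rule poly_mapping_eqI) (force simp: lookup_hom_part weight_below_def in_keys_iff)

lemma hom_part_single: "hom_part w d (Poly_Mapping.single m c) = (if weight w m = d then Poly_Mapping.single m c else 0)"
  by (rule poly_mapping_eqI) (auto simp: lookup_hom_part lookup_single when_def)

lemma diff_hom_part_weight_below:
  "p \<in> weight_below w (Suc d) \<Longrightarrow> p - hom_part w d p \<in> weight_below w d"
  by (auto simp: weight_below_def in_keys_iff lookup_hom_part lookup_minus less_Suc_eq split: if_splits)

lemma hom_part_in_weight_below: "hom_part w d p \<in> weight_below w (Suc d)"
  by (auto simp: weight_below_def in_keys_iff lookup_hom_part split: if_splits)

lemma hom_part_mult:
  assumes "p \<in> weight_below w (Suc d)" "q \<in> weight_below w (Suc e)"
  shows "hom_part w (d + e) (p * q) = hom_part w d p * hom_part w e q"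
proof -
  let ?p = "hom_part w d p" and ?q = "hom_part w e q"
  have *: "hom_part w (d + e) (?p * ?q) = ?p * ?q"
  proof (rule poly_mapping_eqI)
    fix m
    have "Poly_Mapping.lookup (?p * ?q) m = 0" if "weight w m \<noteq> d + e"
    proof (rule ccontr)
      assume "Poly_Mapping.lookup (?p * ?q) m \<noteq> 0"
      then have "m \<in> Poly_Mapping.keys (?p * ?q)" by (simp add: in_keys_iff)
      then obtain a b where "m = a + b" "a \<in> Poly_Mapping.keys ?p" "b \<in> Poly_Mapping.keys ?q"
        using keys_mult[of ?p ?q] by auto
      then show False using that by (auto simp: weight_add in_keys_iff lookup_hom_part split: if_splits)
    qed
    then show "Poly_Mapping.lookup (hom_part w (d + e) (?p * ?q)) m = Poly_Mapping.lookup (?p * ?q) m"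
      by (simp add: lookup_hom_part)
  qed
  define r where "r = ?p * (q - ?q) + q * (p - ?p)"
  have "p * q = ?p * ?q + r" by (simp add: r_def algebra_simps)
  moreover have "r \<in> weight_below w (d + e)" unfolding r_def
    using weight_below_mult[OF hom_part_in_weight_below diff_hom_part_weight_below[OF assms(2)], of d p]
      weight_below_mult[OF assms(2) diff_hom_part_weight_below[OF assms(1)]]
    by (intro weight_below_add) (auto simp: add.commute)
  ultimately show ?thesis using * by (simp add: hom_part_add hom_part_eq_0)
qed

lemma hom_part_power:
  assumes "p \<in> weight_below w (Suc d)"
  shows "p ^ n \<in> weight_below w (Suc (n * d)) \<and> hom_part w (n * d) (p ^ n) = hom_part w d p ^ n"
proof (induction n)
  case 0
  have "hom_part w 0 1 = (1 :: ('a, 'b) mpoly)"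
    using hom_part_single[of w 0 0 1] by (simp add: single_one)
  then show ?case by (auto simp: weight_below_def)
next
  case (Suc n)
  have "p * p ^ n \<in> weight_below w (d + Suc (n * d))"
    using weight_below_mult[OF assms] Suc by blast
  then show ?case using hom_part_mult[OF assms, of "p ^ n" "n * d"] Suc by simp
qed

text \<open>Disjoint supports let every monomial split uniquely into powers of the leading monomials
  and a rest divisible by none of them. That the leading monomials are squarefree is used for
  radicality, in \<open>standard_point\<close>.\<close>

locale coprime_leading =
  fixes w :: "'v \<Rightarrow> nat" and T :: "'i set" and q :: "'i \<Rightarrow> ('v, 'k::alg_closed_field) mpoly"
    and S :: "'i \<Rightarrow> 'v set"
  assumes finT: "finite T" and finS: "\<And>i. i \<in> T \<Longrightarrow> finite (S i)" and neS: "\<And>i. i \<in> T \<Longrightarrow> S i \<noteq> {}"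
    and disj: "\<And>i j. i \<in> T \<Longrightarrow> j \<in> T \<Longrightarrow> i \<noteq> j \<Longrightarrow> S i \<inter> S j = {}"
    and lead: "\<And>i. i \<in> T \<Longrightarrow> leading w (\<Sum>v\<in>S i. Poly_Mapping.single v 1) (q i)"
begin

section \<open>Splitting monomials along the leading monomials\<close>

definition mon :: "'i \<Rightarrow> 'v \<Rightarrow>\<^sub>0 nat" where "mon i = (\<Sum>v\<in>S i. Poly_Mapping.single v 1)"

lemma lookup_mon: "i \<in> T \<Longrightarrow> Poly_Mapping.lookup (mon i) v = (if v \<in> S i then 1 else 0)"
  using finS by (auto simp: mon_def lookup_sum lookup_single when_def)

definition expo :: "('v \<Rightarrow>\<^sub>0 nat) \<Rightarrow> 'i \<Rightarrow> nat" where
  "expo M i = Min (Poly_Mapping.lookup M ` S i)"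

definition base :: "('v \<Rightarrow>\<^sub>0 nat) \<Rightarrow> 'v \<Rightarrow>\<^sub>0 nat" where
  "base M = M - (\<Sum>i\<in>T. \<Sum>_\<in>{..<expo M i}. mon i)"

definition standard :: "('v \<Rightarrow>\<^sub>0 nat) \<Rightarrow> bool" where
  "standard M \<longleftrightarrow> (\<forall>i\<in>T. expo M i = 0)"

lemma expo_le: "i \<in> T \<Longrightarrow> v \<in> S i \<Longrightarrow> expo M i \<le> Poly_Mapping.lookup M v"
  unfolding expo_def using finS by (intro Min_le) auto

lemma expo_attained: "i \<in> T \<Longrightarrow> \<exists>v\<in>S i. Poly_Mapping.lookup M v = expo M i"
  unfolding expo_def using finS neS Min_in[of "Poly_Mapping.lookup M ` S i"] by fastforce

lemma lookup_expo_sum: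
  "Poly_Mapping.lookup (\<Sum>i\<in>T. \<Sum>_\<in>{..<e i}. mon i) v = (\<Sum>i\<in>T. if v \<in> S i then e i else 0)"
  by (auto simp: lookup_sum lookup_mon intro!: sum.cong)

lemma sum_disjoint: "i \<in> T \<Longrightarrow> v \<in> S i \<Longrightarrow> (\<Sum>i\<in>T. if v \<in> S i then e i else 0) = (e i :: nat)"
proof -
  assume i: "i \<in> T" "v \<in> S i"
  have "(\<Sum>j\<in>T. if v \<in> S j then e j else 0) = (\<Sum>j\<in>T. if j = i then e i else 0)"
    using disj i by (intro sum.cong) auto
  then show ?thesis using i finT by simp
qed

lemma base_expo: "base M + (\<Sum>i\<in>T. \<Sum>_\<in>{..<expo M i}. mon i) = M"
proof (rule poly_mapping_eqI)
  fix v
  have "(\<Sum>i\<in>T. if v \<in> S i then expo M i else 0) \<le> Poly_Mapping.lookup M v"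
  proof (cases "\<exists>i\<in>T. v \<in> S i")
    case True
    then show ?thesis using sum_disjoint[of _ v "expo M"] expo_le by auto
  qed (auto intro!: sum.neutral)
  then show "Poly_Mapping.lookup (base M + (\<Sum>i\<in>T. \<Sum>_\<in>{..<expo M i}. mon i)) v = Poly_Mapping.lookup M v"
    by (simp add: base_def lookup_add lookup_minus lookup_expo_sum)
qed

lemma expo_add_mon:
  assumes "i \<in> T" "j \<in> T"
  shows "expo (M + mon i) j = expo M j + (if j = i then 1 else 0)"
proof -
  have *: "Poly_Mapping.lookup (M + mon i) v = Poly_Mapping.lookup M v + (if j = i then 1 else 0)" if "v \<in> S j" for v
    using that disj[OF assms] by (auto simp: lookup_add lookup_mon assms)
  obtain v where v: "v \<in> S j" "Poly_Mapping.lookup M v = expo M j" using expo_attained assms by blast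
  obtain u where u: "u \<in> S j" "Poly_Mapping.lookup (M + mon i) u = expo (M + mon i) j"
    using expo_attained assms by blast
  have "expo M j \<le> Poly_Mapping.lookup M u" "expo (M + mon i) j \<le> Poly_Mapping.lookup (M + mon i) v"
    using expo_le[OF assms(2)] u v by auto
  then show ?thesis using u v *[OF u(1)] *[OF v(1)] by linarith
qed

lemma base_add_mon: "i \<in> T \<Longrightarrow> base (M + mon i) = base M"
proof -
  assume i: "i \<in> T"
  have "(\<Sum>j\<in>T. \<Sum>_\<in>{..<expo (M + mon i) j}. mon j) = (\<Sum>j\<in>T. (\<Sum>_\<in>{..<expo M j}. mon j) + (if j = i then mon i else 0))"
    by (rule sum.cong) (auto simp: expo_add_mon[OF i] lessThan_Suc add.commute)
  also have "\<dots> = (\<Sum>j\<in>T. \<Sum>_\<in>{..<expo M j}. mon j) + mon i"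
    using finT i by (simp add: sum.distrib)
  finally have "base (M + mon i) + ((\<Sum>j\<in>T. \<Sum>_\<in>{..<expo M j}. mon j) + mon i) = M + mon i"
    using base_expo[of "M + mon i"] by simp
  also have "\<dots> = base M + ((\<Sum>j\<in>T. \<Sum>_\<in>{..<expo M j}. mon j) + mon i)"
    using base_expo[of M] by (simp flip: add.assoc)
  finally show ?thesis by (rule add_right_imp_eq)
qed

text \<open>The monomial \<open>M\<close> with its leading monomials replaced by the
  \<open>q i\<close>. Since \<open>M\<close> leads \<open>\<Theta> M\<close>, passing from monomials
  to these products is triangular for the weight.\<close>

definition \<Theta> :: "('v \<Rightarrow>\<^sub>0 nat) \<Rightarrow> ('v, 'k) mpoly" where
  "\<Theta> M = Poly_Mapping.single (base M) 1 * (\<Prod>i\<in>T. q i ^ expo M i)"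

lemma leading_\<Theta>: "leading w M (\<Theta> M)"
proof -
  have "leading w (base M + (\<Sum>i\<in>T. \<Sum>_\<in>{..<expo M i}. mon i)) (\<Theta> M)"
    unfolding \<Theta>_def by (intro leading_mult leading_prod leading_power leading_single) (unfold mon_def, rule lead)
  then show ?thesis by (simp add: base_expo)
qed

lemma \<Theta>_add_mon: "i \<in> T \<Longrightarrow> \<Theta> (M + mon i) = q i * \<Theta> M"
proof -
  assume i: "i \<in> T"
  have "(\<Prod>j\<in>T. q j ^ expo (M + mon i) j) = (\<Prod>j\<in>T. q j ^ expo M j * (if j = i then q i else 1))"
    by (rule prod.cong) (auto simp: expo_add_mon[OF i])
  also have "\<dots> = (\<Prod>j\<in>T. q j ^ expo M j) * q i" using finT i by (simp add: prod.distrib)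
  finally show ?thesis by (simp add: \<Theta>_def base_add_mon[OF i] mult_ac)
qed

lemma \<Theta>_standard: "standard M \<Longrightarrow> \<Theta> M = Poly_Mapping.single M 1"
  using base_expo[of M] by (simp add: \<Theta>_def standard_def)

section \<open>The change of basis and membership in the ideal\<close>

definition \<Theta>l :: "('v, 'k) mpoly \<Rightarrow> ('v, 'k) mpoly" where
  "\<Theta>l g = (\<Sum>M\<in>Poly_Mapping.keys g. Const (Poly_Mapping.lookup g M) * \<Theta> M)"

lemma \<Theta>l_superset:
  "finite A \<Longrightarrow> Poly_Mapping.keys g \<subseteq> A \<Longrightarrow> \<Theta>l g = (\<Sum>M\<in>A. Const (Poly_Mapping.lookup g M) * \<Theta> M)"
  unfolding \<Theta>l_def by (rule sum.mono_neutral_left) (auto simp: in_keys_iff)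

lemma \<Theta>l_add: "\<Theta>l (g + h) = \<Theta>l g + \<Theta>l h"
proof -
  let ?A = "Poly_Mapping.keys g \<union> Poly_Mapping.keys h"
  have "Poly_Mapping.keys (g + h) \<subseteq> ?A" by (rule keys_add)
  then show ?thesis
    by (simp add: \<Theta>l_superset[of ?A] lookup_add Const_hom distrib_right sum.distrib)
qed

lemma \<Theta>l_single [simp]: "\<Theta>l (Poly_Mapping.single M c) = Const c * \<Theta> M"
  by (cases "c = 0") (auto simp: \<Theta>l_def)

lemma \<Theta>l_0 [simp]: "\<Theta>l 0 = 0" by (simp add: \<Theta>l_def)

lemma \<Theta>l_mult_mon: "i \<in> T \<Longrightarrow> \<Theta>l (Poly_Mapping.single (mon i) 1 * g) = q i * \<Theta>l g"
  by (induction g rule: mpoly_single_induct)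
    (simp_all add: mult_single add.commute[of "mon i"] \<Theta>_add_mon distrib_left \<Theta>l_add mult.left_commute)

lemma weight_below_Const_mult: "p \<in> weight_below w d \<Longrightarrow> Const c * p \<in> weight_below w d"
  using weight_below_mult[of "Const c" w 0 p d] by (auto simp: weight_below_def Const_def split: if_splits)

lemma single_in_range: "\<exists>g. Poly_Mapping.single M c = \<Theta>l g"
proof (induction "weight w M" arbitrary: M c rule: less_induct)
  case less
  have "\<exists>g. p = \<Theta>l g" if "p \<in> weight_below w (weight w M)" for p
  proof -
    have "\<exists>g. (\<Sum>m\<in>A. Poly_Mapping.single m (Poly_Mapping.lookup p m)) = \<Theta>l g"
      if "finite A" "A \<subseteq> Poly_Mapping.keys p" for A
      using that
    proof (induction A)
      case empty
      show ?case by (auto intro: exI[of _ 0])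
    next
      case (insert m A)
      obtain g where g: "(\<Sum>m\<in>A. Poly_Mapping.single m (Poly_Mapping.lookup p m)) = \<Theta>l g"
        using insert by auto
      have "weight w m < weight w M"
        using insert.prems \<open>p \<in> weight_below w (weight w M)\<close> by (auto simp: weight_below_def)
      from less[OF this, of "Poly_Mapping.lookup p m"]
      obtain h where "Poly_Mapping.single m (Poly_Mapping.lookup p m) = \<Theta>l h" by blast
      then show ?case using g insert.hyps by (auto simp flip: \<Theta>l_add)
    qed
    from this[of "Poly_Mapping.keys p"]
    obtain g where "(\<Sum>m\<in>Poly_Mapping.keys p. Poly_Mapping.single m (Poly_Mapping.lookup p m)) = \<Theta>l g" by auto
    moreover have "(\<Sum>m\<in>Poly_Mapping.keys p. Poly_Mapping.single m (Poly_Mapping.lookup p m)) = p"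
      by (rule poly_mapping_eqI) (auto simp: lookup_sum lookup_single when_def in_keys_iff)
    ultimately show ?thesis by auto
  qed
  moreover have "Const (- c) * (\<Theta> M - Poly_Mapping.single M 1) \<in> weight_below w (weight w M)"
    using leading_\<Theta>[of M] by (intro weight_below_Const_mult) (simp add: leading_def)
  ultimately obtain g where "Const (- c) * (\<Theta> M - Poly_Mapping.single M 1) = \<Theta>l g" by blast
  then have "\<Theta>l (g + Poly_Mapping.single M c) = Const c * Poly_Mapping.single M 1"
    by (simp add: \<Theta>l_add Const_hom algebra_simps flip: \<open>_ = \<Theta>l g\<close>)
  also have "\<dots> = Poly_Mapping.single M c" by (simp add: Const_def mult_single)
  finally show ?case by metis
qed

lemma \<Theta>l_surj: "\<exists>g. p = \<Theta>l g"
proof (induction p rule: mpoly_single_induct)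
  case (add p q)
  then show ?case by (metis \<Theta>l_add)
qed (rule single_in_range)

definition nonstandard :: "('v, 'k) mpoly \<Rightarrow> bool" where
  "nonstandard g \<longleftrightarrow> (\<forall>M\<in>Poly_Mapping.keys g. \<not> standard M)"

text \<open>Multiplication by \<open>q i\<close> after \<open>\<Theta>l\<close> is multiplication by
  the monomial \<open>mon i\<close> before it, so the ideal corresponds to a monomial ideal.\<close>

lemma ideal_in_nonstandard:
  assumes "p \<in> ideal_gen (q ` T)"
  shows "\<exists>g. nonstandard g \<and> p = \<Theta>l g"
  using assms
proof (induction rule: ideal.span_induct_alt)
  case base
  show ?case by (rule exI[of _ 0]) (simp add: nonstandard_def)
next
  case (step c x y)
  then obtain i g h where i: "i \<in> T" "x = q i" and g: "nonstandard g" "y = \<Theta>l g" and h: "c = \<Theta>l h"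
    using \<Theta>l_surj by blast
  have "nonstandard (Poly_Mapping.single (mon i) 1 * h)" unfolding nonstandard_def
  proof
    fix M assume "M \<in> Poly_Mapping.keys (Poly_Mapping.single (mon i) 1 * h)"
    then obtain N where "M = N + mon i"
      using keys_mult[of "Poly_Mapping.single (mon i) 1" h] by (auto simp: add.commute)
    then have "expo M i > 0" using i by (simp add: expo_add_mon)
    then show "\<not> standard M" using i by (auto simp: standard_def)
  qed
  then have "nonstandard (Poly_Mapping.single (mon i) 1 * h + g)"
    using g keys_add[of "Poly_Mapping.single (mon i) 1 * h" g] by (auto simp: nonstandard_def)
  moreover have "c * x + y = \<Theta>l (Poly_Mapping.single (mon i) 1 * h + g)"
    using i g h \<Theta>l_mult_mon[OF i(1), of h] by (simp add: \<Theta>l_add mult.commute)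
  ultimately show ?case by blast
qed

lemma \<Theta>_nonstandard: "\<not> standard M \<Longrightarrow> \<Theta> M \<in> ideal_gen (q ` T)"
proof -
  assume "\<not> standard M"
  then obtain i where i: "i \<in> T" "expo M i > 0" by (auto simp: standard_def)
  have "(\<Prod>j\<in>T. q j ^ expo M j) = q i ^ expo M i * (\<Prod>j\<in>T - {i}. q j ^ expo M j)"
    using finT i by (simp add: prod.remove)
  moreover have "q i ^ expo M i = q i ^ (expo M i - 1) * q i" using i by (cases "expo M i") auto
  ultimately have "\<Theta> M = (Poly_Mapping.single (base M) 1 * q i ^ (expo M i - 1) *
      (\<Prod>j\<in>T - {i}. q j ^ expo M j)) * q i" by (simp add: \<Theta>_def mult_ac)
  then show ?thesis using i by (auto intro: ideal.span_scale ideal.span_base)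
qed

lemma reduce: "\<exists>g. (\<forall>M\<in>Poly_Mapping.keys g. standard M) \<and> p - g \<in> ideal_gen (q ` T)"
proof -
  obtain g where "p = \<Theta>l g" using \<Theta>l_surj by blast
  moreover have "\<exists>s. (\<forall>M\<in>Poly_Mapping.keys s. standard M) \<and> \<Theta>l g - s \<in> ideal_gen (q ` T)"
  proof (induction g rule: mpoly_single_induct)
    case (single M c)
    show ?case
    proof (cases "standard M")
      case True
      then show ?thesis
        by (intro exI[of _ "Poly_Mapping.single M c"])
          (auto simp: \<Theta>_standard Const_def mult_single ideal.span_zero split: if_splits)
    next
      case False
      then show ?thesis
        by (intro exI[of _ 0]) (auto intro!: ideal.span_scale \<Theta>_nonstandard)
    qed
  next
    case (add g h)
    then obtain s t where st: "\<forall>M\<in>Poly_Mapping.keys s. standard M" "\<Theta>l g - s \<in> ideal_gen (q ` T)"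
      "\<forall>M\<in>Poly_Mapping.keys t. standard M" "\<Theta>l h - t \<in> ideal_gen (q ` T)" by blast
    have "\<Theta>l (g + h) - (s + t) = (\<Theta>l g - s) + (\<Theta>l h - t)" by (simp add: \<Theta>l_add)
    also have "\<dots> \<in> ideal_gen (q ` T)" by (intro ideal.span_add st)
    finally show ?case using keys_add[of s t] st(1,3) by (intro exI[of _ "s + t"]) blast
  qed
  ultimately show ?thesis by blast
qed

text \<open>Each monomial is altered only by terms of lower weight.\<close>

lemma hom_part_\<Theta>l:
  "g \<in> weight_below w (Suc d) \<Longrightarrow> hom_part w d (\<Theta>l g) = hom_part w d g"
proof -
  assume g: "g \<in> weight_below w (Suc d)"
  have "hom_part w d (\<Sum>M\<in>A. Const (Poly_Mapping.lookup g M) * \<Theta> M) =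
      hom_part w d (\<Sum>M\<in>A. Poly_Mapping.single M (Poly_Mapping.lookup g M))"
    if "finite A" "A \<subseteq> Poly_Mapping.keys g" for A
    using that
  proof (induction A)
    case (insert M A)
    have wM: "weight w M \<le> d" using insert.prems g by (auto simp: weight_below_def less_Suc_eq_le)
    have "Const (Poly_Mapping.lookup g M) * (\<Theta> M - Poly_Mapping.single M 1) \<in> weight_below w (weight w M)"
      using leading_\<Theta>[of M] by (intro weight_below_Const_mult) (simp add: leading_def)
    then have "hom_part w d (Const (Poly_Mapping.lookup g M) * (\<Theta> M - Poly_Mapping.single M 1)) = 0"
      using wM by (intro hom_part_eq_0)
    moreover have "Const (Poly_Mapping.lookup g M) * \<Theta> M = Poly_Mapping.single M (Poly_Mapping.lookup g M) +
        Const (Poly_Mapping.lookup g M) * (\<Theta> M - Poly_Mapping.single M 1)"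
      by (simp add: algebra_simps Const_def mult_single)
    ultimately have "hom_part w d (Const (Poly_Mapping.lookup g M) * \<Theta> M) =
        hom_part w d (Poly_Mapping.single M (Poly_Mapping.lookup g M))"
      by (simp only: hom_part_add) simp
    then show ?case using insert by (simp add: hom_part_add)
  qed simp
  from this[of "Poly_Mapping.keys g"]
  have "hom_part w d (\<Theta>l g) = hom_part w d (\<Sum>M\<in>Poly_Mapping.keys g. Poly_Mapping.single M (Poly_Mapping.lookup g M))"
    by (simp add: \<Theta>l_def)
  also have "(\<Sum>M\<in>Poly_Mapping.keys g. Poly_Mapping.single M (Poly_Mapping.lookup g M)) = g"
    by (rule poly_mapping_eqI) (auto simp: lookup_sum lookup_single when_def in_keys_iff)
  finally show ?thesis .
qed

text \<open>A standard monomial of \<open>F\<close> misses some variable of every leading monomial; setting these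
  variables to \<open>0\<close> kills all nonstandard monomials, but not \<open>F\<close>.\<close>

lemma standard_point:
  assumes F: "F \<noteq> 0" "\<forall>M\<in>Poly_Mapping.keys F. standard M"
  shows "\<exists>z. eval_at z F \<noteq> 0 \<and> (\<forall>g. nonstandard g \<longrightarrow> eval_at z g = 0)"
proof -
  obtain M0 where M0: "M0 \<in> Poly_Mapping.keys F" using F by force
  have "\<forall>i\<in>T. \<exists>v\<in>S i. Poly_Mapping.lookup M0 v = 0"
    using expo_attained[of _ M0] F M0 by (metis standard_def)
  then obtain u where u: "\<And>i. i \<in> T \<Longrightarrow> u i \<in> S i \<and> Poly_Mapping.lookup M0 (u i) = 0" by metis
  define Z where "Z = u ` T"
  define F' where "F' = (\<Sum>M\<in>{M\<in>Poly_Mapping.keys F. Poly_Mapping.keys M \<inter> Z = {}}.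
      Poly_Mapping.single M (Poly_Mapping.lookup F M))"
  have "Poly_Mapping.keys M0 \<inter> Z = {}" using u by (auto simp: Z_def in_keys_iff)
  then have "Poly_Mapping.lookup F' M0 = Poly_Mapping.lookup F M0"
    using M0 by (auto simp: F'_def lookup_sum lookup_single when_def in_keys_iff)
  then have "F' \<noteq> 0" using M0 by (auto simp: in_keys_iff)
  then obtain x where x: "eval_at x F' \<noteq> 0" using mpoly_nonzero_point by blast
  define z where "z v = (if v \<in> Z then 0 else x v)" for v
  have ze: "monom_eval z M = 0" if "v \<in> Poly_Mapping.keys M" "v \<in> Z" for M v
    unfolding monom_eval_def using that by (intro prod_zero) (auto simp: z_def in_keys_iff)
  have zx: "monom_eval z M = monom_eval x M" if "Poly_Mapping.keys M \<inter> Z = {}" for M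
    unfolding monom_eval_def using that by (intro prod.cong) (auto simp: z_def)
  have ev: "eval_at y p = (\<Sum>m\<in>Poly_Mapping.keys p. Poly_Mapping.lookup p m * monom_eval y m)"
    for y and p :: "('v, 'k) mpoly"
    by (simp add: eval_at_def eval_hom_superset[of "Poly_Mapping.keys p"])
  have "eval_at z F = (\<Sum>M\<in>{M\<in>Poly_Mapping.keys F. Poly_Mapping.keys M \<inter> Z = {}}. Poly_Mapping.lookup F M * monom_eval x M)"
    unfolding ev by (rule sum.mono_neutral_cong_right) (auto simp: ze zx)
  also have "\<dots> = eval_at x F'"
    unfolding F'_def eval_at_simps(7) by (intro sum.cong refl) (simp add: eval_at_def eval_hom_single)
  finally have "eval_at z F \<noteq> 0" using x by simp
  moreover have "eval_at z g = 0" if g: "nonstandard g" for g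
    unfolding ev
  proof (rule sum.neutral, rule ballI)
    fix M assume "M \<in> Poly_Mapping.keys g"
    then obtain i where "i \<in> T" "expo M i > 0" using g by (auto simp: nonstandard_def standard_def)
    then have "u i \<in> Poly_Mapping.keys M" "u i \<in> Z"
      using u expo_le[of i "u i" M] by (auto simp: in_keys_iff Z_def)
    then show "Poly_Mapping.lookup g M * monom_eval z M = 0" using ze by simp
  qed
  ultimately show ?thesis by blast
qed

text \<open>Modulo the ideal an element has a representative \<open>s\<close> with standard
  monomials only. If a power of \<open>s\<close> lies in the ideal, the same power of its top part
  is a combination of nonstandard monomials, so it vanishes at the point of
  \<open>standard_point\<close>, where the top part does not.\<close>

theorem radical: "radical_ideal (ideal_gen (q ` T)) = ideal_gen (q ` T)"
proof (intro equalityI subsetI)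
  let ?I = "ideal_gen (q ` T)"
  have I: "is_ideal ?I" by (rule ideal.subspace_span)
  fix f assume "f \<in> radical_ideal ?I"
  then obtain n where n: "f ^ n \<in> ?I" by (auto simp: radical_ideal_def)
  obtain s where s: "\<forall>M\<in>Poly_Mapping.keys s. standard M" "f - s \<in> ?I" using reduce by blast
  have "f ^ n - s ^ n \<in> ?I" by (induction n) (auto simp: ideal.span_zero intro: ideal_cong_mult I s)
  then have "s ^ n \<in> ?I" using n ideal_diff_mem_iff[OF I] by blast
  then obtain g where g: "nonstandard g" "s ^ n = \<Theta>l g" using ideal_in_nonstandard by blast
  have "s = 0"
  proof (rule ccontr)
    assume "s \<noteq> 0"
    define d where "d = Max (weight w ` Poly_Mapping.keys s)"
    have "Poly_Mapping.keys s \<noteq> {}" using \<open>s \<noteq> 0\<close> by simp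
    then obtain m where m: "m \<in> Poly_Mapping.keys s" "weight w m = d"
      using Max_in[of "weight w ` Poly_Mapping.keys s"] unfolding d_def by fastforce
    have sb: "s \<in> weight_below w (Suc d)"
      by (auto simp: weight_below_def d_def less_Suc_eq_le)
    have "hom_part w d s \<noteq> 0" using m lookup_hom_part[of w d s m] by (auto simp: in_keys_iff)
    moreover have "\<forall>M\<in>Poly_Mapping.keys (hom_part w d s). standard M"
      using s(1) keys_hom_part by blast
    ultimately obtain z where z: "eval_at z (hom_part w d s) \<noteq> 0" "\<And>g. nonstandard g \<Longrightarrow> eval_at z g = 0"
      using standard_point by blast
    \<comment> \<open>A part of \<open>g\<close> of higher weight would reappear as a part of
      \<open>s ^ n\<close> above its top weight.\<close>
    have gb: "g \<in> weight_below w (Suc (n * d))"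
    proof (rule ccontr)
      assume no: "g \<notin> weight_below w (Suc (n * d))"
      define e where "e = Max (weight w ` Poly_Mapping.keys g)"
      have "Poly_Mapping.keys g \<noteq> {}" using no by auto
      then obtain m where m: "m \<in> Poly_Mapping.keys g" "weight w m = e"
        using Max_in[of "weight w ` Poly_Mapping.keys g"] unfolding e_def by fastforce
      have ge: "g \<in> weight_below w (Suc e)" by (auto simp: weight_below_def e_def less_Suc_eq_le)
      then have "e > n * d" using no weight_below_mono[OF ge] by (meson not_less Suc_le_mono)
      then have "hom_part w e (s ^ n) = 0"
        using hom_part_power[OF sb, of n] by (intro hom_part_eq_0[of _ _ "Suc (n * d)"]) auto
      then have "hom_part w e g = 0" using hom_part_\<Theta>l[OF ge] g by simp
      then show False using m lookup_hom_part[of w e g m] by (auto simp: in_keys_iff)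
    qed
    have "hom_part w d s ^ n = hom_part w (n * d) g"
      using hom_part_power[OF sb, of n] hom_part_\<Theta>l[OF gb] g by simp
    moreover have "nonstandard (hom_part w (n * d) g)"
      using g(1) keys_hom_part unfolding nonstandard_def by blast
    ultimately have "eval_at z (hom_part w d s ^ n) = 0" using z(2) by simp
    then show False using z(1) by (simp add: eval_at_simps)
  qed
  then show "f \<in> ?I" using s by simp
next
  fix f assume "f \<in> ideal_gen (q ` T)"
  then show "f \<in> radical_ideal (ideal_gen (q ` T))"
    unfolding radical_ideal_def by (auto intro: exI[of _ 1])
qed

end

section \<open>The Pfaffian\<close>

definition flip :: "'n + 'n \<Rightarrow> 'n + 'n" where "flip = case_sum Inr Inl"

lemma flip_simps [simp]: "flip (Inl a) = Inr a" "flip (Inr a) = Inl a" "flip (flip x) = x" "flip \<circ> flip = id"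
  by (auto simp: flip_def fun_eq_iff split: sum.splits)

definition alternating :: "'r::comm_ring_1 ^ 'i ^ 'i \<Rightarrow> bool" where
  "alternating y \<longleftrightarrow> (\<forall>i. y $ i $ i = 0) \<and> (\<forall>i j. y $ i $ j = - y $ j $ i)"

lemma alternatingD: "alternating y \<Longrightarrow> y $ i $ i = 0" "alternating y \<Longrightarrow> y $ i $ j = - y $ j $ i"
  unfolding alternating_def by blast+

definition pf_term :: "'r::comm_ring_1 ^ ('n + 'n::finite) ^ ('n + 'n) \<Rightarrow> ('n + 'n \<Rightarrow> 'n + 'n) \<Rightarrow> 'r" where
  "pf_term y \<pi> = of_int (sign \<pi>) * (\<Prod>a\<in>UNIV. y $ \<pi> (Inl a) $ \<pi> (Inr a))"

text \<open>A perfect matching is given by the fixed point free involution \<open>\<pi> flip \<pi>\<^sup>-\<^sup>1\<close>, and the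
  Pfaffian is a sum over matchings.\<close>

definition matching :: "('n + 'n \<Rightarrow> 'n + 'n) \<Rightarrow> 'n + 'n \<Rightarrow> 'n + 'n" where
  "matching \<pi> = \<pi> \<circ> flip \<circ> Hilbert_Choice.inv \<pi>"

definition matchings :: "('n + 'n \<Rightarrow> 'n + 'n) set" where
  "matchings = matching ` {\<pi>. bij \<pi>}"

text \<open>An arbitrary representative; by \<open>pf_term_flip_group\<close> the choice does not
  affect the terms of an alternating matrix.\<close>

definition match_perm :: "('n + 'n \<Rightarrow> 'n + 'n) \<Rightarrow> 'n + 'n \<Rightarrow> 'n + 'n" where
  "match_perm \<tau> = (SOME \<pi>. bij \<pi> \<and> matching \<pi> = \<tau>)"

text \<open>The sum over all permutations counts each matching \<open>2^n n!\<close> times for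
  \<open>n = CARD('n)\<close>, a number that cannot be divided out in characteristic two.\<close>

definition pf :: "'r::comm_ring_1 ^ ('n + 'n::finite) ^ ('n + 'n) \<Rightarrow> 'r" where
  "pf y = (\<Sum>\<tau>\<in>matchings. pf_term y (match_perm \<tau>))"

text \<open>The centraliser of \<open>flip\<close>, a hyperoctahedral group. Its left cosets are the
  sets of permutations with the same matching.\<close>

definition flip_group :: "('n + 'n \<Rightarrow> 'n + 'n) set" where
  "flip_group = {\<eta>. bij \<eta> \<and> \<eta> \<circ> flip = flip \<circ> \<eta>}"

section \<open>Signs and representatives of matchings\<close>

lemma match_perm: "\<tau> \<in> matchings \<Longrightarrow> bij (match_perm \<tau>) \<and> matching (match_perm \<tau>) = \<tau>"
  unfolding match_perm_def matchings_def
  using someI_ex[of "\<lambda>\<pi>. bij \<pi> \<and> matching \<pi> = \<tau>"] by blast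

lemma bij_permutation: "bij (p :: 'a::finite \<Rightarrow> 'a) \<Longrightarrow> permutation p"
  by (simp add: permutation)

lemma permutes_UNIV_iff: "p permutes UNIV \<longleftrightarrow> bij p"
  by (simp add: bij_def permutes_def bij_iff[unfolded bij_def])

lemma sign_comp: "bij (p :: 'a::finite \<Rightarrow> 'a) \<Longrightarrow> bij q \<Longrightarrow> sign (p \<circ> q) = sign p * sign q"
  by (simp add: sign_compose bij_permutation)

lemma transpose_comp:
  assumes "bij (p :: 'a::finite \<Rightarrow> 'a)" "a \<noteq> b"
  shows "bij (Transposition.transpose a b \<circ> p)" "sign (Transposition.transpose a b \<circ> p) = - sign p"
proof -
  have t: "bij (Transposition.transpose a b)" by (rule o_bij[of "Transposition.transpose a b"]) auto
  show "bij (Transposition.transpose a b \<circ> p)" using bij_comp[OF assms(1) t] .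
  show "sign (Transposition.transpose a b \<circ> p) = - sign p"
    using sign_comp[OF t assms(1)] assms(2) by (simp only: sign_swap_id if_False mult_minus_left mult_1_left)
qed

text \<open>The same permutation is carried out once on each side, so its sign is squared.\<close>

lemma sign_map_sum: 
  assumes "bij (\<sigma> :: 'n::finite \<Rightarrow> 'n)"
  shows "bij (map_sum \<sigma> \<sigma>)" "sign (map_sum \<sigma> \<sigma>) = 1"
proof -
  have "\<sigma> permutes UNIV" using assms by (simp add: permutes_UNIV_iff)
  from this finite have "bij (map_sum \<sigma> \<sigma>) \<and> sign (map_sum \<sigma> \<sigma>) = 1"
  proof (induction rule: permutes_induct)
    case id
    have "map_sum id id = (id :: 'n + 'n \<Rightarrow> 'n + 'n)" by (simp add: fun_eq_iff sum.map_id)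
    then show ?case by (metis bij_id sign_id)
  next
    case (swap a b p)
    have *: "map_sum (Transposition.transpose a b \<circ> p) (Transposition.transpose a b \<circ> p) =
      Transposition.transpose (Inl a) (Inl b) \<circ> (Transposition.transpose (Inr a) (Inr b) \<circ> map_sum p p)"
    proof
      fix x show "map_sum (Transposition.transpose a b \<circ> p) (Transposition.transpose a b \<circ> p) x =
        (Transposition.transpose (Inl a) (Inl b) \<circ> (Transposition.transpose (Inr a) (Inr b) \<circ> map_sum p p)) x"
        by (cases x) (auto simp: Transposition.transpose_def)
    qed
    have "bij (map_sum p p)" "sign (map_sum p p) = 1" using swap by auto
    then show ?case unfolding * using swap(3)
      by (simp only: transpose_comp sum.inject not_False_eq_True minus_minus)
  qed
  then show "bij (map_sum \<sigma> \<sigma>)" "sign (map_sum \<sigma> \<sigma>) = 1" by blast+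
qed

definition swap_on :: "'n set \<Rightarrow> 'n + 'n \<Rightarrow> 'n + 'n" where
  "swap_on E = case_sum (\<lambda>a. if a \<in> E then Inr a else Inl a) (\<lambda>a. if a \<in> E then Inl a else Inr a)"

lemma sign_swap_on: "bij (swap_on (E :: 'n::finite set)) \<and> sign (swap_on E) = (- 1) ^ card E"
proof -
  have "finite E" by simp
  then show ?thesis
  proof (induction E)
    case empty
    have "swap_on ({} :: 'n set) = id" by (auto simp: swap_on_def fun_eq_iff split: sum.splits)
    then show ?case by (simp add: bij_id[unfolded id_def])
  next
    case (insert a E)
    have *: "swap_on (insert a E) = Transposition.transpose (Inl a) (Inr a) \<circ> swap_on E"
    proof
      fix x show "swap_on (insert a E) x = (Transposition.transpose (Inl a) (Inr a) \<circ> swap_on E) x"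
        using insert(2) by (cases x) (auto simp: swap_on_def Transposition.transpose_def)
    qed
    have "bij (swap_on E)" "sign (swap_on E) = (- 1) ^ card E" using insert by auto
    then have "bij (swap_on (insert a E))" "sign (swap_on (insert a E)) = - ((- 1) ^ card E)"
      unfolding * by (simp_all only: transpose_comp sum.simps not_False_eq_True)
    then show ?case using insert by simp
  qed
qed

lemma flip_group_decomp:
  assumes "\<eta> \<in> flip_group"
  obtains \<sigma> E where "bij (\<sigma> :: 'n::finite \<Rightarrow> 'n)" "\<eta> = map_sum \<sigma> \<sigma> \<circ> swap_on E"
proof -
  have \<eta>: "bij \<eta>" and c: "\<eta> (flip x) = flip (\<eta> x)" for x
    using assms by (auto simp: flip_group_def fun_eq_iff)
  define strip where "strip = case_sum (\<lambda>a::'n. a) (\<lambda>a. a)"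
  define \<sigma> where "\<sigma> a = strip (\<eta> (Inl a))" for a
  define E where "E = {a. \<eta> (Inl a) = Inr (\<sigma> a)}"
  have l: "\<eta> (Inl a) = (if a \<in> E then Inr (\<sigma> a) else Inl (\<sigma> a))" for a
    by (cases "\<eta> (Inl a)") (auto simp: E_def \<sigma>_def strip_def)
  have r: "\<eta> (Inr a) = (if a \<in> E then Inl (\<sigma> a) else Inr (\<sigma> a))" for a
    using c[of "Inl a"] by (simp add: l)
  have eq: "\<eta> = map_sum \<sigma> \<sigma> \<circ> swap_on E"
  proof
    fix x show "\<eta> x = (map_sum \<sigma> \<sigma> \<circ> swap_on E) x" by (cases x) (auto simp: l r swap_on_def)
  qed
  have "inj \<sigma>"
  proof (rule injI)
    fix a b assume "\<sigma> a = \<sigma> b"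
    then have "\<eta> (Inl a) = \<eta> (Inl b) \<or> \<eta> (Inl a) = \<eta> (Inr b)" by (auto simp: l r)
    then show "a = b" using \<eta> by (auto simp: bij_def inj_def)
  qed
  then have "bij \<sigma>" by (simp add: finite_UNIV_inj_surj bij_def)
  then show ?thesis using that eq by blast
qed

lemma prod_swap_on:
  fixes y :: "'r::comm_ring_1 ^ 'i ^ 'i" and \<pi> :: "'n + 'n::finite \<Rightarrow> 'i"
  assumes "alternating y"
  shows "(\<Prod>a\<in>UNIV. y $ \<pi> (swap_on E (Inl a)) $ \<pi> (swap_on E (Inr a))) =
    of_int ((- 1) ^ card E) * (\<Prod>a\<in>UNIV. y $ \<pi> (Inl a) $ \<pi> (Inr a))"
proof -
  have "y $ \<pi> (swap_on E (Inl a)) $ \<pi> (swap_on E (Inr a)) = (if a \<in> E then - 1 else 1) * y $ \<pi> (Inl a) $ \<pi> (Inr a)" for a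
    using alternatingD(2)[OF assms, of "\<pi> (Inr a)" "\<pi> (Inl a)"] by (simp add: swap_on_def)
  then have "(\<Prod>a\<in>UNIV. y $ \<pi> (swap_on E (Inl a)) $ \<pi> (swap_on E (Inr a))) =
    (\<Prod>a\<in>UNIV. if a \<in> E then - 1 else 1) * (\<Prod>a\<in>UNIV. y $ \<pi> (Inl a) $ \<pi> (Inr a))"
    by (simp only: prod.distrib)
  also have "(\<Prod>a\<in>UNIV. if a \<in> E then - 1 else 1 :: 'r) = (\<Prod>a\<in>E. - 1)"
    by (simp add: prod.If_cases)
  finally show ?thesis by simp
qed

text \<open>Reversing the edges in \<open>E\<close> changes the sign of the permutation and, by skew
  symmetry, the product by the same factor; permuting the edges changes neither.\<close>

lemma pf_term_flip_group:
  assumes y: "alternating y" and \<pi>: "bij \<pi>" and \<eta>: "\<eta> \<in> flip_group"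
  shows "pf_term y (\<pi> \<circ> \<eta>) = pf_term y (\<pi> :: 'n + 'n::finite \<Rightarrow> _)"
proof -
  obtain \<sigma> E where \<sigma>: "bij (\<sigma> :: 'n \<Rightarrow> 'n)" and eq: "\<eta> = map_sum \<sigma> \<sigma> \<circ> swap_on E"
    using flip_group_decomp[OF \<eta>] by blast
  let ?\<rho> = "\<pi> \<circ> map_sum \<sigma> \<sigma>"
  have bE: "bij (swap_on E)" "sign (swap_on E) = (- 1) ^ card E" using sign_swap_on by auto
  have s: "sign (\<pi> \<circ> \<eta>) = sign \<pi> * (- 1) ^ card E"
    unfolding eq using sign_map_sum[OF \<sigma>] bE \<pi> by (simp add: sign_comp bij_comp)
  have "(\<Prod>a\<in>UNIV. y $ (\<pi> \<circ> \<eta>) (Inl a) $ (\<pi> \<circ> \<eta>) (Inr a)) =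
      of_int ((- 1) ^ card E) * (\<Prod>a\<in>UNIV. y $ ?\<rho> (Inl a) $ ?\<rho> (Inr a))"
    unfolding eq using prod_swap_on[OF y, of ?\<rho> E] by simp
  also have "(\<Prod>a\<in>UNIV. y $ ?\<rho> (Inl a) $ ?\<rho> (Inr a)) = (\<Prod>a\<in>UNIV. y $ \<pi> (Inl (\<sigma> a)) $ \<pi> (Inr (\<sigma> a)))"
    by simp
  also have "\<dots> = (\<Prod>a\<in>UNIV. y $ \<pi> (Inl a) $ \<pi> (Inr a))"
    using \<sigma> by (intro prod.reindex_bij_betw[where h = \<sigma>]) auto
  finally have "pf_term y (\<pi> \<circ> \<eta>) = of_int (sign \<pi> * ((- 1) ^ card E * (- 1) ^ card E)) *
      (\<Prod>a\<in>UNIV. y $ \<pi> (Inl a) $ \<pi> (Inr a))"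
    unfolding pf_term_def s by (simp add: mult_ac)
  also have "(- 1) ^ card E * (- 1) ^ card E = (1::int)" by (simp flip: power_mult_distrib)
  finally show ?thesis unfolding pf_term_def by simp
qed

lemma matching_comp_flip_group: "bij \<pi> \<Longrightarrow> \<eta> \<in> flip_group \<Longrightarrow> matching (\<pi> \<circ> \<eta>) = matching \<pi>"
proof -
  assume \<pi>: "bij \<pi>" and \<eta>: "\<eta> \<in> flip_group"
  then have c: "\<eta> (flip x) = flip (\<eta> x)" "bij \<eta>" for x by (auto simp: flip_group_def fun_eq_iff)
  have "Hilbert_Choice.inv (\<pi> \<circ> \<eta>) = Hilbert_Choice.inv \<eta> \<circ> Hilbert_Choice.inv \<pi>"
    using \<pi> c by (simp add: o_inv_distrib)
  then show ?thesis using c by (simp add: matching_def fun_eq_iff bij_is_surj surj_f_inv_f)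
qed

lemma matching_eq_flip_group:
  assumes "bij \<pi>" "bij \<rho>" "matching \<pi> = matching \<rho>"
  shows "Hilbert_Choice.inv \<pi> \<circ> \<rho> \<in> flip_group"
proof -
  have i: "Hilbert_Choice.inv \<pi> (\<pi> x) = x" "\<pi> (Hilbert_Choice.inv \<pi> x) = x" "Hilbert_Choice.inv \<rho> (\<rho> x) = x" for x
    using assms by (auto simp: bij_is_inj bij_is_surj surj_f_inv_f)
  have "\<pi> (flip (Hilbert_Choice.inv \<pi> x)) = \<rho> (flip (Hilbert_Choice.inv \<rho> x))" for x
    using assms(3) by (simp add: matching_def fun_eq_iff)
  from this[of "\<rho> _"] have "flip (Hilbert_Choice.inv \<pi> (\<rho> x)) = Hilbert_Choice.inv \<pi> (\<rho> (flip x))" for x by (metis i(1,3))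
  moreover have "bij (Hilbert_Choice.inv \<pi> \<circ> \<rho>)" using assms by (simp add: bij_comp bij_imp_bij_inv)
  ultimately show ?thesis by (simp add: flip_group_def fun_eq_iff)
qed

text \<open>Connects \<open>pf\<close> to the sum over all permutations, which transforms well under
  a change of basis: each matching contributes one coset of equal terms.\<close>

lemma sum_pf_term:
  fixes y :: "'r::comm_ring_1 ^ ('n + 'n::finite) ^ ('n + 'n)"
  assumes "alternating y"
  shows "(\<Sum>\<pi>\<in>{\<pi>. bij \<pi>}. pf_term y \<pi>) = of_nat (card (flip_group :: ('n + 'n \<Rightarrow> 'n + 'n) set)) * pf y"
proof -
  have "(\<Sum>\<pi>\<in>{\<pi>. bij \<pi>}. pf_term y \<pi>) =
      (\<Sum>\<tau>\<in>matchings. \<Sum>\<pi>\<in>{\<pi>\<in>{\<pi>. bij \<pi>}. matching \<pi> = \<tau>}. pf_term y \<pi>)"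
    unfolding matchings_def by (rule sum.image_gen) simp
  also have "\<dots> = (\<Sum>\<tau>\<in>matchings. of_nat (card (flip_group :: ('n + 'n \<Rightarrow> 'n + 'n) set)) * pf_term y (match_perm \<tau>))"
  proof (rule sum.cong[OF refl])
    fix \<tau> :: "'n + 'n \<Rightarrow> 'n + 'n" assume "\<tau> \<in> matchings"
    define \<rho> where "\<rho> = match_perm \<tau>"
    have \<rho>: "bij \<rho>" "matching \<rho> = \<tau>" using match_perm \<open>\<tau> \<in> matchings\<close> by (auto simp: \<rho>_def)
    have "bij_betw (\<lambda>\<eta>. \<rho> \<circ> \<eta>) flip_group {\<pi>\<in>{\<pi>. bij \<pi>}. matching \<pi> = \<tau>}"
    proof (rule bij_betw_byWitness[where f' = "\<lambda>\<pi>. Hilbert_Choice.inv \<rho> \<circ> \<pi>"])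
      have "Hilbert_Choice.inv \<rho> \<circ> \<rho> = id" "\<rho> \<circ> Hilbert_Choice.inv \<rho> = id" using \<rho>(1) by (auto simp: bij_def surj_iff)
      then show "\<forall>\<eta>\<in>flip_group. Hilbert_Choice.inv \<rho> \<circ> (\<rho> \<circ> \<eta>) = \<eta>"
        "\<forall>\<pi>\<in>{\<pi> \<in> {\<pi>. bij \<pi>}. matching \<pi> = \<tau>}. \<rho> \<circ> (Hilbert_Choice.inv \<rho> \<circ> \<pi>) = \<pi>"
        by (simp_all add: o_assoc)
      show "(\<circ>) \<rho> ` flip_group \<subseteq> {\<pi> \<in> {\<pi>. bij \<pi>}. matching \<pi> = \<tau>}"
        using \<rho> matching_comp_flip_group by (auto simp: flip_group_def bij_comp)
      show "(\<circ>) (Hilbert_Choice.inv \<rho>) ` {\<pi> \<in> {\<pi>. bij \<pi>}. matching \<pi> = \<tau>} \<subseteq> flip_group"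
        using \<rho> matching_eq_flip_group[OF \<rho>(1)] by blast
    qed
    then have "(\<Sum>\<pi>\<in>{\<pi>\<in>{\<pi>. bij \<pi>}. matching \<pi> = \<tau>}. pf_term y \<pi>) = (\<Sum>\<eta>\<in>flip_group. pf_term y (\<rho> \<circ> \<eta>))"
      by (simp add: sum.reindex_bij_betw)
    also have "\<dots> = (\<Sum>\<eta>\<in>(flip_group :: ('n + 'n \<Rightarrow> 'n + 'n) set). pf_term y \<rho>)"
      by (intro sum.cong refl pf_term_flip_group assms \<rho>)
    finally show "(\<Sum>\<pi>\<in>{\<pi>\<in>{\<pi>. bij \<pi>}. matching \<pi> = \<tau>}. pf_term y \<pi>) =
        of_nat (card (flip_group :: ('n + 'n \<Rightarrow> 'n + 'n) set)) * pf_term y (match_perm \<tau>)"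
      by (simp add: \<rho>_def)
  qed
  finally show ?thesis by (simp add: pf_def sum_distrib_left)
qed

text \<open>The left side is the determinant of \<open>g\<close> with its columns selected by
  \<open>f\<close>; two columns coincide unless \<open>f\<close> is injective.\<close>

lemma det_columns:
  fixes g :: "'r::comm_ring_1 ^ 'i::finite ^ 'i"
  shows "(\<Sum>\<pi>\<in>{\<pi>. bij \<pi>}. of_int (sign \<pi>) * (\<Prod>i\<in>UNIV. g $ \<pi> i $ f i)) =
    (if bij f then of_int (sign f) * det g else 0)"
proof -
  let ?M = "\<chi> i. transpose g $ f i"
  have "(\<Sum>\<pi>\<in>{\<pi>. bij \<pi>}. of_int (sign \<pi>) * (\<Prod>i\<in>UNIV. g $ \<pi> i $ f i)) = det ?M"
    by (simp add: det_def permutes_UNIV_iff transpose_def)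
  also have "\<dots> = (if bij f then of_int (sign f) * det g else 0)"
  proof (cases "bij f")
    case True
    then show ?thesis by (simp add: det_permute_rows permutes_UNIV_iff)
  next
    case False
    then have "\<not> inj f" using finite_UNIV_inj_surj[of f] by (auto simp: bij_def)
    then obtain i j where "i \<noteq> j" "f i = f j" by (auto simp: inj_def)
    then have "det ?M = 0" by (intro det_identical_rows[of i j]) (auto simp: row_def)
    then show ?thesis using False by simp
  qed
  finally show ?thesis .
qed

text \<open>Expanding the entries of \<open>g y g^T\<close> turns the product over pairs into a sum
  over all self-maps \<open>f\<close> of the indices. Summing over permutations first leaves the
  bijective \<open>f\<close>, each with a factor \<open>det g\<close>.\<close>

lemma sum_pf_term_congruence:
  fixes g y :: "'r::comm_ring_1 ^ ('n + 'n::finite) ^ ('n + 'n)"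
  shows "(\<Sum>\<pi>\<in>{\<pi>. bij \<pi>}. pf_term (g ** y ** transpose g) \<pi>) = det g * (\<Sum>\<pi>\<in>{\<pi>. bij \<pi>}. pf_term y \<pi>)"
proof -
  have entry: "(g ** y ** transpose g) $ i $ j = (\<Sum>p\<in>UNIV. g $ i $ fst p * y $ fst p $ snd p * g $ j $ snd p)" for i j
  proof -
    have "(g ** y ** transpose g) $ i $ j = (\<Sum>l\<in>UNIV. \<Sum>k\<in>UNIV. g $ i $ k * y $ k $ l * g $ j $ l)"
      by (simp add: matrix_matrix_mult_def transpose_def sum_distrib_right)
    also have "\<dots> = (\<Sum>k\<in>UNIV. \<Sum>l\<in>UNIV. g $ i $ k * y $ k $ l * g $ j $ l)" by (rule sum.swap)
    also have "\<dots> = (\<Sum>p\<in>UNIV \<times> UNIV. g $ i $ fst p * y $ fst p $ snd p * g $ j $ snd p)"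
      by (subst sum.cartesian_product) (simp add: case_prod_beta)
    finally show ?thesis by simp
  qed
  define F where "F f = (\<Prod>a\<in>UNIV. y $ f (Inl a) $ f (Inr a))" for f :: "'n + 'n \<Rightarrow> 'n + 'n"
  have UNIV_sum: "(UNIV :: ('n + 'n) set) = range Inl \<union> range Inr"
    by (auto simp: image_iff) (metis sumE)
  have prod_sum_type: "(\<Prod>i\<in>UNIV. h i) = (\<Prod>a\<in>UNIV. h (Inl a) * h (Inr a))" for h :: "'n + 'n \<Rightarrow> 'r"
    unfolding UNIV_sum by (subst prod.union_disjoint) (auto simp: prod.reindex inj_on_def prod.distrib)
  define conv where "conv p = case_sum (\<lambda>a. fst (p a)) (\<lambda>a. snd (p a))" for p :: "'n \<Rightarrow> ('n + 'n) \<times> ('n + 'n)"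
  have bij_conv: "bij conv"
    by (rule o_bij[where g = "\<lambda>f a. (f (Inl a), f (Inr a))"])
      (auto simp: conv_def fun_eq_iff split: sum.splits)
  have expand: "(\<Prod>a\<in>UNIV. (g ** y ** transpose g) $ \<pi> (Inl a) $ \<pi> (Inr a)) =
      (\<Sum>f\<in>UNIV. F f * (\<Prod>i\<in>UNIV. g $ \<pi> i $ f i))" for \<pi>
  proof -
    have "(\<Prod>a\<in>UNIV. (g ** y ** transpose g) $ \<pi> (Inl a) $ \<pi> (Inr a)) =
      (\<Sum>p\<in>UNIV. \<Prod>a\<in>UNIV. g $ \<pi> (Inl a) $ fst (p a) * y $ fst (p a) $ snd (p a) * g $ \<pi> (Inr a) $ snd (p a))"
      unfolding entry by (subst prod_sum_PiE) (simp_all add: PiE_UNIV_domain)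
    also have "\<dots> = (\<Sum>p\<in>UNIV. F (conv p) * (\<Prod>i\<in>UNIV. g $ \<pi> i $ conv p i))"
      unfolding prod_sum_type F_def conv_def prod.distrib[symmetric]
      by (intro sum.cong prod.cong refl) (simp add: mult_ac)
    also have "\<dots> = (\<Sum>f\<in>UNIV. F f * (\<Prod>i\<in>UNIV. g $ \<pi> i $ f i))"
      using bij_conv by (rule sum.reindex_bij_betw)
    finally show ?thesis .
  qed
  have "(\<Sum>\<pi>\<in>{\<pi>. bij \<pi>}. pf_term (g ** y ** transpose g) \<pi>) =
      (\<Sum>\<pi>\<in>{\<pi>. bij \<pi>}. \<Sum>f\<in>UNIV. F f * (of_int (sign \<pi>) * (\<Prod>i\<in>UNIV. g $ \<pi> i $ f i)))"
    unfolding pf_term_def expand by (simp add: sum_distrib_left mult.left_commute)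
  also have "\<dots> = (\<Sum>f\<in>UNIV. F f * (\<Sum>\<pi>\<in>{\<pi>. bij \<pi>}. of_int (sign \<pi>) * (\<Prod>i\<in>UNIV. g $ \<pi> i $ f i)))"
    by (subst sum.swap) (simp add: sum_distrib_left)
  also have "\<dots> = (\<Sum>f\<in>UNIV. if bij f then det g * (of_int (sign f) * F f) else 0)"
    unfolding det_columns by (intro sum.cong) auto
  also have "\<dots> = (\<Sum>f\<in>{f. bij f}. det g * (of_int (sign f) * F f))"
    by (simp add: sum.If_cases)
  finally show ?thesis by (simp add: pf_term_def F_def sum_distrib_left)
qed

section \<open>Base change and generic alternating matrices\<close>

definition map_mat :: "('a \<Rightarrow> 'b) \<Rightarrow> 'a ^ 'n ^ 'm \<Rightarrow> 'b ^ 'n ^ 'm" where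
  "map_mat h A = (\<chi> i j. h (A $ i $ j))"

lemma map_mat_nth [simp]: "map_mat h A $ i $ j = h (A $ i $ j)"
  by (simp add: map_mat_def)

lemma map_mat_mult: "ring_hom_on h \<Longrightarrow> map_mat h (A ** B) = map_mat h A ** map_mat h B"
  by (simp add: vec_eq_iff matrix_matrix_mult_def ring_hom_onD)

lemma map_mat_transpose: "map_mat h (transpose A) = transpose (map_mat h A)"
  by (simp add: vec_eq_iff transpose_def)

lemma map_mat_diff: "ring_hom_on h \<Longrightarrow> map_mat h (A - B) = map_mat h A - map_mat h B"
  by (simp add: vec_eq_iff ring_hom_onD)

lemma map_mat_symplectic [simp]: "ring_hom_on h \<Longrightarrow> map_mat h symplectic_form = symplectic_form"
  by (simp add: vec_eq_iff symplectic_form_def ring_hom_onD split: sum.splits)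

lemma hom_det: "ring_hom_on h \<Longrightarrow> h (det A) = det (map_mat h A)"
  by (simp add: det_def ring_hom_onD)

lemma hom_pf: "ring_hom_on h \<Longrightarrow> h (pf y) = pf (map_mat h y)"
  by (simp add: pf_def pf_term_def ring_hom_onD)

lemma sum_alternating:
  assumes "finite A" "\<And>k l. k \<in> A \<Longrightarrow> l \<in> A \<Longrightarrow> t k l = - t l k" "\<And>k. k \<in> A \<Longrightarrow> t k k = (0 :: 'r::comm_ring_1)"
  shows "(\<Sum>k\<in>A. \<Sum>l\<in>A. t k l) = 0"
  using assms
proof (induction A)
  case (insert a A)
  have "(\<Sum>l\<in>A. t a l) = - (\<Sum>k\<in>A. t k a)"
    unfolding sum_negf[symmetric] by (intro sum.cong refl insert.prems(1)) auto
  moreover have "(\<Sum>k\<in>A. \<Sum>l\<in>A. t k l) = 0" by (rule insert.IH) (use insert.prems in blast)+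
  moreover have "t a a = 0" using insert.prems(2) by blast
  ultimately show ?case using insert.hyps by (simp add: sum.distrib)
qed simp

lemma alternating_congruence:
  fixes g y :: "'r::comm_ring_1 ^ 'i::finite ^ 'i"
  assumes "alternating y"
  shows "alternating (g ** y ** transpose g)"
proof -
  have entry: "(g ** y ** transpose g) $ i $ j = (\<Sum>k\<in>UNIV. \<Sum>l\<in>UNIV. g $ i $ k * y $ k $ l * g $ j $ l)" for i j
    by (simp add: matrix_matrix_mult_def transpose_def sum_distrib_right) (rule sum.swap)
  have y: "y $ k $ l = - y $ l $ k" "y $ k $ k = 0" for k l using alternatingD[OF assms] by blast+
  show ?thesis unfolding alternating_def
  proof (intro conjI allI)
    fix i j
    show "(g ** y ** transpose g) $ i $ i = 0" unfolding entry
    proof (rule sum_alternating)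
      fix k l show "g $ i $ k * y $ k $ l * g $ i $ l = - (g $ i $ l * y $ l $ k * g $ i $ k)"
        by (subst y(1)) (simp add: mult_ac)
    qed (auto simp: y(2))
    have "(g ** y ** transpose g) $ i $ j = (\<Sum>k\<in>UNIV. \<Sum>l\<in>UNIV. - (g $ j $ k * y $ k $ l * g $ i $ l))"
      unfolding entry by (subst sum.swap) (intro sum.cong refl, subst y(1), simp add: mult_ac)
    also have "\<dots> = - (g ** y ** transpose g) $ j $ i" unfolding entry by (simp add: sum_negf)
    finally show "(g ** y ** transpose g) $ i $ j = - (g ** y ** transpose g) $ j $ i" .
  qed
qed

lemma ex_index: "\<exists>idx :: 'i::finite \<Rightarrow> nat. inj idx"
  using finite_imp_inj_to_nat_seg[of "UNIV :: 'i set"] by auto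

text \<open>An arbitrary numbering; it singles out the entries above the diagonal as the free
  coordinates of an alternating matrix.\<close>

definition idx :: "'i::finite \<Rightarrow> nat" where "idx = (SOME f. inj f)"

lemma inj_idx: "inj (idx :: 'i::finite \<Rightarrow> nat)"
  unfolding idx_def using ex_index by (rule someI_ex)

lemma idx_eq [simp]: "idx i = idx j \<longleftrightarrow> i = j" using inj_idx by (auto simp: inj_def)

definition alt_mat :: "('i \<Rightarrow> 'i \<Rightarrow> 'r) \<Rightarrow> 'r::comm_ring_1 ^ 'i::finite ^ 'i" where
  "alt_mat f = (\<chi> i j. if idx i < idx j then f i j else if idx j < idx i then - f j i else 0)"

lemma alternating_alt_mat [simp]: "alternating (alt_mat f)"
  by (auto simp: alternating_def alt_mat_def)

lemma alt_mat_alternating: "alternating y \<Longrightarrow> alt_mat (\<lambda>i j. y $ i $ j) = y"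
proof -
  assume y: "alternating y"
  have "alt_mat (\<lambda>i j. y $ i $ j) $ i $ j = y $ i $ j" for i j
  proof -
    show ?thesis using alternatingD(1)[OF y, of i] alternatingD(2)[OF y, of i j] by (cases "idx i = idx j") (simp_all add: alt_mat_def)
  qed
  then show ?thesis by (simp add: vec_eq_iff)
qed

lemma map_mat_alt_mat: "ring_hom_on h \<Longrightarrow> map_mat h (alt_mat f) = alt_mat (\<lambda>i j. h (f i j))"
  by (simp add: vec_eq_iff alt_mat_def ring_hom_onD)

text \<open>Proved first for generic matrices over integer polynomials, where the order of
  \<open>flip_group\<close> is cancelled from the two permutation sums, and then specialised to
  \<open>g\<close> and \<open>y\<close>.\<close>

lemma pf_congruence:
  fixes g y :: "'r::comm_ring_1 ^ ('n + 'n::finite) ^ ('n + 'n)"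
  assumes "alternating y"
  shows "pf (g ** y ** transpose g) = det g * pf y"
proof -
  let ?G = "\<chi> i j. (Var (Inl (i, j)) :: (('n + 'n) \<times> ('n + 'n) + ('n + 'n) \<times> ('n + 'n), int) mpoly)"
  let ?Y = "alt_mat (\<lambda>i j. Var (Inr (i, j))) :: (('n + 'n) \<times> ('n + 'n) + ('n + 'n) \<times> ('n + 'n), int) mpoly ^ ('n + 'n) ^ ('n + 'n)"
  let ?N = "card (flip_group :: ('n + 'n \<Rightarrow> 'n + 'n) set)"
  have "(id :: 'n + 'n \<Rightarrow> 'n + 'n) \<in> flip_group" by (auto simp: flip_group_def)
  then have N: "?N > 0" by (auto simp: card_gt_0_iff)
  have "of_nat ?N * pf (?G ** ?Y ** transpose ?G) = of_nat ?N * (det ?G * pf ?Y)"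
    using sum_pf_term_congruence[of ?G ?Y] sum_pf_term[of ?Y] sum_pf_term[of "?G ** ?Y ** transpose ?G"]
    by (simp add: alternating_congruence mult.left_commute)
  \<comment> \<open>Coefficientwise this is cancellation of a nonzero integer.\<close>
  moreover have "p = q" if pq: "of_nat ?N * p = of_nat ?N * q" for p q :: "('v, int) mpoly"
  proof (rule poly_mapping_eqI)
    fix m
    have c: "(of_nat ?N :: ('v, int) mpoly) = Poly_Mapping.single 0 (of_nat ?N)" by (simp add: single_of_nat)
    have l: "Poly_Mapping.lookup (of_nat ?N * p) m = of_nat ?N * Poly_Mapping.lookup p m" for p :: "('v, int) mpoly"
      unfolding c mult_map_scale_conv_mult[symmetric] by (simp add: Poly_Mapping.map.rep_eq when_def)
    have "int ?N * Poly_Mapping.lookup p m = int ?N * Poly_Mapping.lookup q m"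
      using l[of p] l[of q] unfolding pq by (simp only: of_nat_id)
    moreover have "int ?N \<noteq> 0" using N by linarith
    ultimately show "Poly_Mapping.lookup p m = Poly_Mapping.lookup q m"
      by (simp only: mult_cancel_left) blast
  qed
  ultimately have gen: "pf (?G ** ?Y ** transpose ?G) = det ?G * pf ?Y" by blast
  define h where "h = eval_hom of_int (case_sum (\<lambda>(i, j). g $ i $ j) (\<lambda>(i, j). y $ i $ j))"
  have h: "ring_hom_on h" by (simp add: h_def)
  have "map_mat h ?G = g" by (simp add: vec_eq_iff h_def eval_hom_Var)
  moreover have "map_mat h ?Y = y"
    unfolding map_mat_alt_mat[OF h] using alt_mat_alternating[OF assms] by (simp add: h_def eval_hom_Var)
  ultimately show ?thesis
    using arg_cong[OF gen, of h] by (simp add: hom_pf[OF h] ring_hom_onD[OF h] hom_det[OF h]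
      map_mat_mult[OF h] map_mat_transpose)
qed

section \<open>Normalisation of the Pfaffian and Cramer's rule\<close>

lemma alternating_symplectic [simp]: "alternating symplectic_form"
  by (auto simp: alternating_def symplectic_form_def split: sum.splits)

lemma symplectic_nonzero: "symplectic_form $ i $ j \<noteq> 0 \<Longrightarrow> j = flip i"
  by (auto simp: symplectic_form_def split: sum.splits if_splits)

text \<open>Nonzero entries of the symplectic form join \<open>x\<close> and \<open>flip x\<close>,
  so \<open>flip\<close> is the one contributing matching.\<close>

lemma pf_symplectic: "pf (symplectic_form :: 'r::comm_ring_1 ^ ('n + 'n::finite) ^ ('n + 'n)) = 1"
proof -
  let ?J = "symplectic_form :: 'r ^ ('n + 'n) ^ ('n + 'n)"
  have flip: "flip \<in> matchings" unfolding matchings_def by (intro image_eqI[of _ _ id]) (auto simp: matching_def)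
  have "pf_term ?J (match_perm \<tau>) = 0" if \<tau>: "\<tau> \<in> matchings - {flip}" for \<tau>
  proof -
    let ?\<pi> = "match_perm \<tau>"
    have \<pi>: "bij ?\<pi>" "matching ?\<pi> = \<tau>" using match_perm \<tau> by auto
    have "\<exists>a. ?J $ ?\<pi> (Inl a) $ ?\<pi> (Inr a) = 0"
    proof (rule ccontr)
      assume "\<not> ?thesis"
      then have e: "?\<pi> (Inr a) = flip (?\<pi> (Inl a))" for a using symplectic_nonzero by blast
      have "?\<pi> (flip x) = flip (?\<pi> x)" for x by (cases x) (auto simp: e)
      then have "?\<pi> \<in> flip_group" using \<pi> by (auto simp: flip_group_def)
      from matching_comp_flip_group[OF bij_id this] have "matching ?\<pi> = flip" by (simp add: matching_def)
      then show False using \<pi> \<tau> by simp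
    qed
    then have "(\<Prod>a\<in>UNIV. ?J $ ?\<pi> (Inl a) $ ?\<pi> (Inr a)) = 0" by (intro prod_zero) simp_all
    then show ?thesis by (simp add: pf_term_def)
  qed
  then have "pf ?J = pf_term ?J (match_perm flip)"
    unfolding pf_def using flip by (subst sum.remove[of _ flip]) auto
  also have "\<dots> = pf_term ?J (id \<circ> (Hilbert_Choice.inv id \<circ> match_perm flip))" by simp
  also have "\<dots> = pf_term ?J id"
  proof (rule pf_term_flip_group)
    show "Hilbert_Choice.inv id \<circ> match_perm flip \<in> flip_group"
      using match_perm[OF flip] by (intro matching_eq_flip_group) (auto simp: matching_def)
  qed auto
  also have "\<dots> = 1" by (simp add: pf_term_def symplectic_form_def)
  finally show ?thesis .
qed

lemma pf_cong_ideal: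
  fixes y z :: "'r::comm_ring_1 ^ ('n + 'n::finite) ^ ('n + 'n)"
  assumes "is_ideal I" "\<And>i j. y $ i $ j - z $ i $ j \<in> I"
  shows "pf y - pf z \<in> I"
  unfolding pf_def pf_term_def
  by (intro ideal_cong_sum ideal_cong_mult ideal_cong_prod assms)
    (simp_all add: ideal.subspace_0[OF assms(1)])

text \<open>With row \<open>l\<close> replaced by row \<open>i\<close>, the determinant is
  \<open>det A\<close> or has two equal rows.\<close>

lemma adjugate_exists: "\<exists>B. A ** B = mat (det (A :: 'r::comm_ring_1 ^ 'i::finite ^ 'i))"
proof -
  define C where "C j i = det (\<chi> k. if k = i then axis j 1 else A $ k)" for j i
  have "(\<Sum>j\<in>UNIV. A $ i $ j * C j l) = (if i = l then det A else 0)" for i l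
  proof -
    have "(\<Sum>j\<in>UNIV. A $ i $ j * C j l) = (\<Sum>j\<in>UNIV. det (\<chi> k. if k = l then A $ i $ j *s axis j 1 else A $ k))"
      unfolding C_def by (intro sum.cong refl) (rule det_row_mul[symmetric])
    also have "\<dots> = det (\<chi> k. if k = l then (\<Sum>j\<in>UNIV. A $ i $ j *s axis j 1) else A $ k)"
      by (rule det_linear_row_sum[symmetric]) simp
    also have "(\<Sum>j\<in>UNIV. A $ i $ j *s axis j 1) = A $ i"
      by (simp add: vec_eq_iff axis_def if_distrib cong: if_cong)
    also have "det (\<chi> k. if k = l then A $ i else A $ k) = (if i = l then det A else 0)"
    proof (cases "i = l")
      case True
      then have "(\<chi> k. if k = l then A $ i else A $ k) = A" by (simp add: vec_eq_iff)
      then show ?thesis using True by simp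
    next
      case False
      then have "det (\<chi> k. if k = l then A $ i else A $ k) = 0"
        by (intro det_identical_rows[of i l]) (auto simp: row_def)
      then show ?thesis using False by simp
    qed
    finally show ?thesis .
  qed
  then have "A ** (\<chi> j i. C j i) = mat (det A)"
    by (simp add: vec_eq_iff matrix_matrix_mult_def mat_def)
  then show ?thesis by blast
qed

section \<open>The characteristic Pfaffian\<close>

text \<open>For alternating \<open>y\<close> this monic polynomial is a square root of the
  characteristic polynomial of \<open>y J\<close>, with \<open>J\<close> the symplectic
  form.\<close>

definition char_pf :: "'r::comm_ring_1 ^ ('n + 'n::finite) ^ ('n + 'n) \<Rightarrow> 'r poly" where
  "char_pf y = pf (\<chi> i j. [:y $ i $ j, symplectic_form $ i $ j:])"

lemma poly_char_pf: "poly (char_pf y) c = pf (\<chi> i j. y $ i $ j + c * symplectic_form $ i $ j)"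
  unfolding char_pf_def hom_pf[OF ring_hom_on_poly]
  by (rule arg_cong[where f = pf]) (simp add: vec_eq_iff)

lemma ring_hom_on_map_poly: "ring_hom_on h \<Longrightarrow> ring_hom_on (map_poly h)"
proof (rule ring_hom_onI)
  assume h: "ring_hom_on h"
  note h' = ring_hom_onD[OF h]
  have [simp]: "h 0 = 0" by (rule h')
  show "map_poly h (p + q) = map_poly h p + map_poly h q" for p q
    by (rule poly_eqI) (simp add: coeff_map_poly h')
  show "map_poly h (p * q) = map_poly h p * map_poly h q" for p q
    by (rule poly_eqI) (simp add: coeff_map_poly coeff_mult h')
  show "map_poly h 1 = 1"
    by (rule poly_eqI) (simp add: coeff_map_poly h' Polynomial.coeff_1)
qed

lemma coeff_char_pf_hom:
  assumes h: "ring_hom_on h"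
  shows "h (Polynomial.coeff (char_pf y) m) = Polynomial.coeff (char_pf (map_mat h y)) m"
proof -
  have h0: "h 0 = 0" using h by (rule ring_hom_onD)
  have "map_poly h (char_pf y) = char_pf (map_mat h y)"
    unfolding char_pf_def hom_pf[OF ring_hom_on_map_poly[OF h]]
    by (rule arg_cong[where f = pf])
      (use map_mat_symplectic[OF h] in \<open>simp add: vec_eq_iff map_poly_pCons[of h, OF h0] h0\<close>)
  then show ?thesis by (metis coeff_map_poly h0)
qed

lemma coeff_prod_linear:
  assumes "finite A"
  shows "Polynomial.degree (\<Prod>a\<in>A. [:b a, c a:]) \<le> card A \<and>
    Polynomial.coeff (\<Prod>a\<in>A. [:b a, c a :: 'r::comm_ring_1:]) (card A) = (\<Prod>a\<in>A. c a)"
  using assms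
proof (induction A)
  case (insert a A)
  have "Polynomial.degree ([:b a, c a:] * (\<Prod>a\<in>A. [:b a, c a:])) \<le> 1 + card A"
    by (rule order.trans[OF degree_mult_le]) (use insert in \<open>auto intro!: add_mono\<close>)
  moreover have "Polynomial.coeff (\<Prod>a\<in>A. [:b a, c a:]) (Suc (card A)) = 0"
    using insert by (intro Polynomial.coeff_eq_0) auto
  ultimately show ?case using insert by (simp add: coeff_pCons)
qed simp

lemma char_pf_monic:
  fixes y :: "'r::comm_ring_1 ^ ('n + 'n::finite) ^ ('n + 'n)"
  shows "Polynomial.degree (char_pf y) \<le> CARD('n)" "Polynomial.coeff (char_pf y) CARD('n) = 1"
proof -
  let ?t = "\<lambda>\<tau>. Polynomial.smult (of_int (sign (match_perm \<tau>))) (\<Prod>a\<in>UNIV.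
    [:y $ match_perm \<tau> (Inl a) $ match_perm \<tau> (Inr a), symplectic_form $ match_perm \<tau> (Inl a) $ match_perm \<tau> (Inr a):])"
  have e: "char_pf y = (\<Sum>\<tau>\<in>matchings. ?t \<tau>)"
    by (simp add: char_pf_def pf_def pf_term_def of_int_poly)
  show "Polynomial.degree (char_pf y) \<le> CARD('n)" unfolding e
    by (intro degree_sum_le order.trans[OF degree_smult_le] coeff_prod_linear[THEN conjunct1]) simp_all
  have "Polynomial.coeff (char_pf y) CARD('n) = pf (symplectic_form :: 'r ^ ('n + 'n) ^ ('n + 'n))"
    unfolding e pf_def pf_term_def
    by (simp add: Polynomial.coeff_sum coeff_prod_linear[THEN conjunct2])
  then show "Polynomial.coeff (char_pf y) CARD('n) = 1" by (simp add: pf_symplectic)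
qed

lemma char_pf_0: "char_pf (0 :: 'r::comm_ring_1 ^ ('n + 'n::finite) ^ ('n + 'n)) = Polynomial.monom 1 CARD('n)"
proof -
  let ?J = "symplectic_form :: 'r poly ^ ('n + 'n) ^ ('n + 'n)"
  have *: "[:0, symplectic_form $ i $ j:] = Polynomial.monom 1 1 * ?J $ i $ j" for i j :: "'n + 'n"
    by (auto simp: symplectic_form_def Polynomial.monom_altdef one_pCons split: sum.splits)
  have "char_pf (0 :: 'r ^ ('n + 'n) ^ ('n + 'n)) = pf (\<chi> i j. Polynomial.monom 1 1 * ?J $ i $ j)"
    by (simp add: char_pf_def *)
  also have "\<dots> = Polynomial.monom 1 1 ^ CARD('n) * pf ?J"
    by (simp add: pf_def pf_term_def prod.distrib sum_distrib_left mult.left_commute)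
  finally show ?thesis by (simp add: pf_symplectic monom_power)
qed

section \<open>Pfaffian invariants over the integers\<close>

definition pf_invariant :: "nat \<Rightarrow> ('n::finite exotic_coord, int) mpoly" where
  "pf_invariant m = Polynomial.coeff (char_pf (\<chi> i j. Var (Inr (i, j)))) m"

lemma is_ideal_coeffs_in: "is_ideal I \<Longrightarrow> is_ideal (coeffs_in I)"
  by (rule is_idealI) (auto simp: coeffs_in_def coeff_mult ideal.subspace_0
    intro!: ideal.subspace_add ideal.subspace_sum ideal.subspace_scale)

lemma ring_hom_on_const: "ring_hom_on (\<lambda>c::'r::comm_ring_1. [:c:])"
  by (rule ring_hom_on_const_poly)

lemma symplectic_square: "symplectic_form ** symplectic_form = - (mat 1 :: 'r::comm_ring_1 ^ ('n + 'n::finite) ^ ('n + 'n))"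
proof -
  let ?J = "symplectic_form :: 'r ^ ('n + 'n) ^ ('n + 'n)"
  have "(?J ** ?J) $ i $ j = (- mat 1) $ i $ j" for i j
  proof -
    have z: "?J $ i $ k = 0" if "k \<noteq> flip i" for k using that symplectic_nonzero by blast
    have "(?J ** ?J) $ i $ j = (\<Sum>k\<in>UNIV. if k = flip i then ?J $ i $ k * ?J $ k $ j else 0)"
      unfolding matrix_matrix_mult_def vec_lambda_beta
      by (intro sum.cong refl) (simp add: z)
    also have "\<dots> = ?J $ i $ flip i * ?J $ flip i $ j" by simp
    also have "\<dots> = (- mat 1) $ i $ j"
      by (cases i; cases j) (auto simp: symplectic_form_def mat_def)
    finally show ?thesis .
  qed
  then show ?thesis by (simp add: vec_eq_iff)
qed

lemma transpose_symplectic: "transpose symplectic_form = - (symplectic_form :: 'r::comm_ring_1 ^ ('n + 'n::finite) ^ ('n + 'n))"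
  by (auto simp: vec_eq_iff transpose_def symplectic_form_def split: sum.splits)

lemma matrix_mult_neg: "A ** (- B) = - (A ** B)" "(- A) ** B = - (A ** B)" for A :: "'r::comm_ring_1 ^ 'n ^ 'm"
  by (simp_all add: vec_eq_iff matrix_matrix_mult_def sum_negf)

lemma matrix_add_rdistrib: "(A + B) ** C = A ** C + B ** C" for A :: "'r::comm_ring_1 ^ 'n ^ 'm"
  by (simp add: vec_eq_iff matrix_matrix_mult_def distrib_right sum.distrib)

definition mat_cong :: "'r::comm_ring_1 set \<Rightarrow> 'r ^ 'n ^ 'm \<Rightarrow> 'r ^ 'n ^ 'm \<Rightarrow> bool" where
  "mat_cong I A B \<longleftrightarrow> (\<forall>i j. A $ i $ j - B $ i $ j \<in> I)"

lemma mat_cong_mult: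
  assumes "is_ideal I" "mat_cong I A A'" "mat_cong I B B'"
  shows "mat_cong I (A ** B) (A' ** B')"
  using assms unfolding mat_cong_def matrix_matrix_mult_def
  by (auto intro!: ideal_cong_sum ideal_cong_mult)

lemma mat_cong_refl: "is_ideal I \<Longrightarrow> mat_cong I A A"
  by (simp add: mat_cong_def ideal.subspace_0)

lemma mat_cong_sym: "is_ideal I \<Longrightarrow> mat_cong I A B \<Longrightarrow> mat_cong I B A"
  unfolding mat_cong_def using ideal.subspace_neg by (metis minus_diff_eq)

lemma mat_cong_trans:
  assumes "is_ideal I" "mat_cong I A B" "mat_cong I B C" shows "mat_cong I A C"
  unfolding mat_cong_def
proof (intro allI)
  fix i j
  have "A $ i $ j - C $ i $ j = (A $ i $ j - B $ i $ j) + (B $ i $ j - C $ i $ j)" by simp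
  then show "A $ i $ j - C $ i $ j \<in> I"
    using assms ideal.subspace_add[OF assms(1)] unfolding mat_cong_def by metis
qed

text \<open>A left inverse of a square matrix over a commutative ring is a right inverse. This is needed
  modulo an ideal, since the coordinate ring of the symplectic group only imposes
  \<open>g\<^sup>T J g = J\<close>.\<close>

lemma symplectic_transpose_cong:
  fixes G :: "'r::comm_ring_1 ^ ('n + 'n::finite) ^ ('n + 'n)"
  assumes I: "is_ideal I" and G: "mat_cong I (transpose G ** symplectic_form ** G) symplectic_form"
  shows "det G - 1 \<in> I" "mat_cong I (G ** symplectic_form ** transpose G) symplectic_form"
proof -
  let ?J = "symplectic_form :: 'r ^ ('n + 'n) ^ ('n + 'n)"
  have "pf (transpose G ** ?J ** G) = det G"
    using pf_congruence[of ?J "transpose G"] by (simp add: pf_symplectic transpose_transpose det_transpose)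
  then show det: "det G - 1 \<in> I"
    using pf_cong_ideal[OF I, of "transpose G ** ?J ** G" ?J] G by (simp add: mat_cong_def pf_symplectic)
  obtain B where B: "G ** B = mat (det G)" using adjugate_exists by blast
  have detI: "mat_cong I (mat (det G)) (mat 1 :: 'r ^ ('n + 'n) ^ ('n + 'n))"
    using det I by (auto simp: mat_cong_def mat_def ideal.subspace_0)
  have "mat_cong I (G ** (?J ** (transpose G ** ?J ** G))) (G ** (?J ** ?J))"
    by (rule mat_cong_mult[OF I mat_cong_refl[OF I] mat_cong_mult[OF I mat_cong_refl[OF I] G]])
  then have "mat_cong I ((G ** (?J ** (transpose G ** ?J ** G))) ** B) ((G ** (?J ** ?J)) ** B)"
    by (rule mat_cong_mult[OF I _ mat_cong_refl[OF I]])
  then have 1: "mat_cong I (G ** ?J ** transpose G ** ?J ** mat (det G)) (- mat (det G))"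
    by (simp add: symplectic_square matrix_mult_neg B flip: matrix_mul_assoc)
  have 2: "mat_cong I (G ** ?J ** transpose G ** ?J ** mat (det G)) (G ** ?J ** transpose G ** ?J ** mat 1)"
    by (rule mat_cong_mult[OF I mat_cong_refl[OF I] detI])
  have 3: "mat_cong I (- mat (det G)) (- mat 1 :: 'r ^ ('n + 'n) ^ ('n + 'n))"
    using detI ideal.subspace_neg[OF I] unfolding mat_cong_def by (auto simp: algebra_simps) (metis minus_diff_eq)
  have "mat_cong I (G ** ?J ** transpose G ** ?J) (- mat 1)"
    using mat_cong_trans[OF I mat_cong_sym[OF I 2] mat_cong_trans[OF I 1 3]] by simp
  then have "mat_cong I ((G ** ?J ** transpose G ** ?J) ** ?J) (- mat 1 ** ?J)"
    by (rule mat_cong_mult[OF I _ mat_cong_refl[OF I]])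
  then have "mat_cong I (- (G ** ?J ** transpose G)) (- ?J)"
    by (simp add: symplectic_square matrix_mult_neg flip: matrix_mul_assoc)
  then show "mat_cong I (G ** ?J ** transpose G) ?J"
    using ideal.subspace_neg[OF I] unfolding mat_cong_def by (auto simp: algebra_simps) (metis minus_diff_eq add.commute uminus_add_conv_diff)
qed

lemma char_pf_cong:
  assumes I: "is_ideal I" and "mat_cong I y z"
  shows "Polynomial.coeff (char_pf y) m - Polynomial.coeff (char_pf z) m \<in> I"
proof -
  have "char_pf y - char_pf z \<in> coeffs_in I"
    unfolding char_pf_def using assms
    by (intro pf_cong_ideal is_ideal_coeffs_in)
      (auto simp: coeffs_in_def mat_cong_def coeff_pCons ideal.subspace_0 split: nat.splits)
  then show ?thesis by (simp add: coeffs_in_def)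
qed

lemma alternating_linear:
  assumes "alternating y" "alternating z"
  shows "alternating (\<chi> i j. [:y $ i $ j, z $ i $ j:])"
  unfolding alternating_def
proof (intro conjI allI)
  fix i j
  show "(\<chi> i j. [:y $ i $ j, z $ i $ j:]) $ i $ j = - (\<chi> i j. [:y $ i $ j, z $ i $ j:]) $ j $ i"
    using alternatingD(2)[OF assms(1), of i j] alternatingD(2)[OF assms(2), of i j] by simp
qed (simp add: alternatingD(1)[OF assms(1)] alternatingD(1)[OF assms(2)])

text \<open>Congruence by \<open>G\<close> turns the pencil \<open>y + X J\<close> into
  \<open>G y G^T + X G J G^T\<close> and multiplies the Pfaffian by \<open>det G\<close>; modulo
  \<open>I\<close> the matrix \<open>G J G^T\<close> is \<open>J\<close> and \<open>det G\<close> is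
  one.\<close>

lemma char_pf_congruence:
  fixes G :: "'r::comm_ring_1 ^ ('n + 'n::finite) ^ ('n + 'n)"
  assumes I: "is_ideal I" and G: "mat_cong I (transpose G ** symplectic_form ** G) symplectic_form"
    and y: "alternating y"
  shows "Polynomial.coeff (char_pf (G ** y ** transpose G)) m - Polynomial.coeff (char_pf y) m \<in> I"
proof -
  let ?J = "symplectic_form :: 'r ^ ('n + 'n) ^ ('n + 'n)"
  let ?c = "\<lambda>c::'r. [:c:]"
  let ?G = "map_mat ?c G"
  let ?Y = "\<chi> i j. [:y $ i $ j, ?J $ i $ j:]"
  let ?K = "coeffs_in I"
  have K: "is_ideal ?K" by (rule is_ideal_coeffs_in[OF I])
  note c = ring_hom_on_const
  \<comment> \<open>\<open>s A\<close> is \<open>X A\<close> for the polynomial variable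
    \<open>X\<close>, a scalar multiple, so it passes through the congruence by
    \<open>?G\<close>.\<close>
  define s where "s = (\<lambda>A :: 'r ^ ('n + 'n) ^ ('n + 'n). map_mat (\<lambda>a. [:0, a:]) A)"
  have split: "(\<chi> i j. [:z $ i $ j, A $ i $ j:]) = map_mat ?c z + s A" for z A :: "'r ^ ('n + 'n) ^ ('n + 'n)"
    by (simp add: vec_eq_iff s_def)
  have sG: "?G ** s ?J ** transpose ?G = s (G ** ?J ** transpose G)"
  proof -
    have s': "s A = map_mat ?c A ** mat [:0, 1:]" for A
      by (simp add: vec_eq_iff s_def matrix_matrix_mult_def mat_def if_distrib cong: if_cong)
    have com: "mat a ** B = B ** mat a" for a :: "'r poly" and B :: "'r poly ^ ('n + 'n) ^ ('n + 'n)"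
      by (simp add: vec_eq_iff matrix_matrix_mult_def mat_def if_distrib if_distribR mult.commute cong: if_cong)
    show ?thesis unfolding s'
      by (simp add: map_mat_mult[OF c] map_mat_transpose com flip: matrix_mul_assoc)
  qed
  have alt: "alternating ?Y"
    by (rule alternating_linear[OF y alternating_symplectic])
  have "pf (?G ** ?Y ** transpose ?G) = det ?G * pf ?Y" by (rule pf_congruence[OF alt])
  also have "?G ** ?Y ** transpose ?G = (\<chi> i j. [:(G ** y ** transpose G) $ i $ j, (G ** ?J ** transpose G) $ i $ j:])"
    unfolding split sG[symmetric]
    by (simp add: matrix_add_ldistrib matrix_add_rdistrib map_mat_mult[OF c] map_mat_transpose)
  finally have e: "pf (\<chi> i j. [:(G ** y ** transpose G) $ i $ j, (G ** ?J ** transpose G) $ i $ j:]) = [:det G:] * char_pf y"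
    by (simp add: char_pf_def hom_det[OF c])
  have "char_pf (G ** y ** transpose G) - pf (\<chi> i j. [:(G ** y ** transpose G) $ i $ j, (G ** ?J ** transpose G) $ i $ j:]) \<in> ?K"
    unfolding char_pf_def
    using mat_cong_sym[OF I symplectic_transpose_cong(2)[OF I G]]
    by (intro pf_cong_ideal K) (auto simp: coeffs_in_def mat_cong_def coeff_pCons ideal.subspace_0[OF I] split: nat.splits)
  moreover have "[:det G:] * char_pf y - char_pf y \<in> ?K"
    using ideal.subspace_scale[OF I symplectic_transpose_cong(1)[OF I G]]
    by (auto simp: coeffs_in_def right_diff_distrib mult.commute[of _ "det G"])
  ultimately have "(char_pf (G ** y ** transpose G) - [:det G:] * char_pf y) + ([:det G:] * char_pf y - char_pf y) \<in> ?K"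
    unfolding e using ideal.subspace_add[OF K] by blast
  then show ?thesis by (simp add: coeffs_in_def)
qed

text \<open>The coordinate matrix \<open>?Y\<close> is alternating only modulo the relations. It is
  exchanged for the honestly alternating \<open>?Z\<close>, to which the congruence law applies, and
  then exchanged back.\<close>

lemma exotic_invariant_pf: "exotic_invariant (pf_invariant m :: ('n::finite exotic_coord, int) mpoly)"
proof -
  let ?R = "\<lambda>c. Var (Inr c) :: (('n + 'n) \<times> ('n + 'n) + 'n exotic_coord, int) mpoly"
  let ?G = "generic_matrix :: (('n + 'n) \<times> ('n + 'n) + 'n exotic_coord, int) mpoly ^ ('n + 'n) ^ ('n + 'n)"
  let ?S = "{(transpose ?G ** symplectic_form ** ?G - symplectic_form) $ i $ j | i j. True}
            \<union> subst ?R ` alternating_relations"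
  let ?I = "ideal_gen ?S"
  let ?Y = "\<chi> i j. ?R (Inr (i, j))"
  let ?Z = "alt_mat (\<lambda>i j. ?R (Inr (i, j)))"
  have I: "is_ideal ?I" by (rule ideal.subspace_span)
  have "transpose ?G ** symplectic_form ** ?G - symplectic_form \<in> {A. \<forall>i j. A $ i $ j \<in> ?I}"
    by (auto intro!: ideal.span_base)
  then have G: "mat_cong ?I (transpose ?G ** symplectic_form ** ?G) symplectic_form"
    by (simp add: mat_cong_def)
  have r1: "?R (Inr (i, i)) \<in> ?I" for i
  proof -
    have "subst ?R (Var (Inr (i, i))) \<in> subst ?R ` alternating_relations"
      by (rule imageI) (auto simp: alternating_relations_def)
    then show ?thesis by (intro ideal.span_base) simp
  qed
  have r2: "?R (Inr (i, j)) + ?R (Inr (j, i)) \<in> ?I" for i j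
  proof -
    have "subst ?R (Var (Inr (i, j)) + Var (Inr (j, i))) \<in> subst ?R ` alternating_relations"
      by (rule imageI) (auto simp: alternating_relations_def)
    then show ?thesis by (intro ideal.span_base) (simp add: subst_simps)
  qed
  have YZ: "mat_cong ?I ?Y ?Z"
    using r1 r2 by (auto simp: mat_cong_def alt_mat_def ideal.span_zero not_less order.order_iff_strict)
  have s1: "subst (exotic_act ?G ?R) (pf_invariant m) = Polynomial.coeff (char_pf (?G ** ?Y ** transpose ?G)) m"
    unfolding pf_invariant_def coeff_char_pf_hom[OF subst_hom]
    by (rule arg_cong[where f = "\<lambda>A. Polynomial.coeff (char_pf A) m"]) (simp add: vec_eq_iff exotic_act_def)
  have s2: "subst ?R (pf_invariant m) = Polynomial.coeff (char_pf ?Y) m"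
    unfolding pf_invariant_def coeff_char_pf_hom[OF subst_hom]
    by (rule arg_cong[where f = "\<lambda>A. Polynomial.coeff (char_pf A) m"]) (simp add: vec_eq_iff)
  let ?p = "\<lambda>A. Polynomial.coeff (char_pf A) m"
  have a: "?p (?G ** ?Y ** transpose ?G) - ?p (?G ** ?Z ** transpose ?G) \<in> ?I"
    by (rule char_pf_cong[OF I mat_cong_mult[OF I mat_cong_mult[OF I mat_cong_refl[OF I] YZ] mat_cong_refl[OF I]]])
  have b: "?p (?G ** ?Z ** transpose ?G) - ?p ?Z \<in> ?I"
    by (intro char_pf_congruence[OF I] G alternating_alt_mat)
  have c: "?p ?Z - ?p ?Y \<in> ?I"
    by (rule char_pf_cong[OF I mat_cong_sym[OF I YZ]])
  have "?p (?G ** ?Y ** transpose ?G) - ?p ?Y = (?p (?G ** ?Y ** transpose ?G) - ?p (?G ** ?Z ** transpose ?G)) +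
    ((?p (?G ** ?Z ** transpose ?G) - ?p ?Z) + (?p ?Z - ?p ?Y))" by simp
  also have "\<dots> \<in> ?I" by (intro ideal.subspace_add[OF I] a b c)
  finally show ?thesis unfolding exotic_invariant_def s1 s2 .
qed

lemma pf_invariant_const: "m < CARD('n::finite) \<Longrightarrow> Poly_Mapping.lookup (pf_invariant m :: ('n exotic_coord, int) mpoly) 0 = 0"
proof -
  assume m: "m < CARD('n)"
  have "map_mat (eval_at (\<lambda>_. 0)) (\<chi> i j. (Var (Inr (i, j)) :: ('n exotic_coord, int) mpoly)) = 0"
    by (simp add: vec_eq_iff)
  then show ?thesis
    using m by (simp add: lookup_0_eval pf_invariant_def coeff_char_pf_hom[OF eval_at_hom] char_pf_0)
qed

lemma pf_invariant_exotic:
  assumes "m < CARD('n::finite)"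
  shows "Polynomial.coeff (char_pf (\<chi> i j. Var (Inr (i, j)))) m \<in> (exotic_nilcone :: ('n exotic_coord, 'k::field) mpoly set)"
proof -
  let ?h = "eval_hom (\<lambda>c. Const (of_int c)) Var :: ('n exotic_coord, int) mpoly \<Rightarrow> ('n exotic_coord, 'k) mpoly"
  have c: "ring_hom_on (\<lambda>c. Const (of_int c) :: ('n exotic_coord, 'k) mpoly)"
    by (rule ring_hom_on_comp[OF ring_hom_on_Const ring_hom_on_of_int])
  have h: "ring_hom_on ?h" by (rule ring_hom_on_eval_hom[OF c])
  have h': "?h (Var v) = Var v" for v by (rule eval_hom_Var[OF c])
  have "pf_invariant m \<in> (exotic_nilcone_int :: ('n exotic_coord, int) mpoly set)"
    unfolding exotic_nilcone_int_def
    by (intro ideal.span_base) (simp add: exotic_invariant_pf pf_invariant_const[OF assms])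
  then have "?h (pf_invariant m) \<in> exotic_nilcone"
    unfolding exotic_nilcone_def by (intro ideal.span_base imageI)
  also have "?h (pf_invariant m) = Polynomial.coeff (char_pf (\<chi> i j. Var (Inr (i, j)))) m"
    unfolding pf_invariant_def coeff_char_pf_hom[OF h]
    by (rule arg_cong[where f = "\<lambda>A. Polynomial.coeff (char_pf A) m"]) (simp add: vec_eq_iff h')
  finally show ?thesis .
qed

lemma alternating_relations_exotic: "alternating_relations \<subseteq> (exotic_nilcone :: ('n::finite exotic_coord, 'k::field) mpoly set)"
proof
  let ?h = "eval_hom (\<lambda>c. Const (of_int c)) Var :: ('n exotic_coord, int) mpoly \<Rightarrow> ('n exotic_coord, 'k) mpoly"
  have h: "ring_hom_on (\<lambda>c. Const (of_int c) :: ('n exotic_coord, 'k) mpoly)"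
    by (rule ring_hom_on_comp[OF ring_hom_on_Const ring_hom_on_of_int])
  have h': "?h (Var v) = Var v" "?h (p + q) = ?h p + ?h q" for v p q
    by (rule eval_hom_Var[OF h] eval_hom_simps(1)[OF h])+
  fix p :: "('n exotic_coord, 'k) mpoly" assume "p \<in> alternating_relations"
  then have "\<exists>p'\<in>alternating_relations. p = ?h p'"
  proof (unfold alternating_relations_def, elim UnE CollectE exE conjE)
    fix i assume "p = Var (Inr (i, i))"
    then have "p = ?h (Var (Inr (i, i)))" by (simp only: h')
    then show "\<exists>p'\<in>{Var (Inr (i, i)) |i. True} \<union> {Var (Inr (i, j)) + Var (Inr (j, i)) |i j. True}. p = ?h p'"
      by blast
  next
    fix i j assume "p = Var (Inr (i, j)) + Var (Inr (j, i))"
    then have "p = ?h (Var (Inr (i, j)) + Var (Inr (j, i)))" by (simp only: h')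
    then show "\<exists>p'\<in>{Var (Inr (i, i)) |i. True} \<union> {Var (Inr (i, j)) + Var (Inr (j, i)) |i j. True}. p = ?h p'"
      by blast
  qed
  then obtain p' where "p' \<in> alternating_relations" "p = ?h p'" by blast
  moreover have "p' \<in> exotic_nilcone_int" if "p' \<in> alternating_relations" for p' :: "('n exotic_coord, int) mpoly"
    using that unfolding exotic_nilcone_int_def by (intro ideal.span_base) auto
  ultimately show "p \<in> exotic_nilcone"
    unfolding exotic_nilcone_def by (auto intro!: ideal.span_base)
qed

section \<open>Leading monomials of the Pfaffian invariants\<close>

lemma coeff_prod_linear_sum:
  assumes "finite A"
  shows "Polynomial.coeff (\<Prod>a\<in>A. [:b a, c a :: 'r::comm_ring_1:]) m =
    (\<Sum>C\<in>{C\<in>Pow A. card C = m}. (\<Prod>a\<in>C. c a) * (\<Prod>a\<in>A - C. b a))"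
proof -
  have mon: "(\<Prod>a\<in>C. Polynomial.monom (c a) 1) = Polynomial.monom (\<Prod>a\<in>C. c a) (card C)" if "finite C" for C
    using that by (induction C) (auto simp: mult_monom Polynomial.monom_0 one_pCons)
  have con: "(\<Prod>a\<in>C. [:b a:]) = [:\<Prod>a\<in>C. b a:]" for C
    using ring_hom_onD(8)[OF ring_hom_on_const, of b C] by simp
  have "(\<Prod>a\<in>A. [:b a, c a:]) = (\<Prod>a\<in>A. Polynomial.monom (c a) 1 + [:b a:])"
    by (simp add: Polynomial.monom_altdef)
  also have "\<dots> = (\<Sum>C\<in>Pow A. (\<Prod>a\<in>C. Polynomial.monom (c a) 1) * (\<Prod>a\<in>A - C. [:b a:]))"
    by (rule prod_add[OF assms])
  also have "\<dots> = (\<Sum>C\<in>Pow A. Polynomial.monom ((\<Prod>a\<in>C. c a) * (\<Prod>a\<in>A - C. b a)) (card C))"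
    using assms by (intro sum.cong refl, subst mon) (auto simp: con smult_monom mult.commute intro: finite_subset)
  finally have "Polynomial.coeff (\<Prod>a\<in>A. [:b a, c a:]) m =
      (\<Sum>C\<in>Pow A. if card C = m then (\<Prod>a\<in>C. c a) * (\<Prod>a\<in>A - C. b a) else 0)"
    by (simp add: Polynomial.coeff_sum)
  also have "\<dots> = (\<Sum>C\<in>{C\<in>Pow A. card C = m}. (\<Prod>a\<in>C. c a) * (\<Prod>a\<in>A - C. b a))"
    using assms by (subst sum.inter_filter) auto
  finally show ?thesis .
qed

lemma char_two_neg: "(2::'k::comm_ring_1) = 0 \<Longrightarrow> - x = (x::'k)"
  by (metis add.right_neutral add_left_imp_eq eq_neg_iff_add_eq_0 mult_2 mult_zero_left)

section \<open>Positions, edges and weights\<close>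

definition pos :: "'n::finite \<Rightarrow> nat" where
  "pos = (SOME f. bij_betw f UNIV {..<CARD('n)})"

lemma bij_pos: "bij_betw (pos :: 'n::finite \<Rightarrow> nat) UNIV {..<CARD('n)}"
proof -
  have "\<exists>f. bij_betw f (UNIV :: 'n set) {..<CARD('n)}"
    using ex_bij_betw_finite_nat[of "UNIV :: 'n set"] by (auto simp: atLeast0LessThan)
  then show ?thesis unfolding pos_def by (rule someI_ex)
qed

lemma pos_eq [simp]: "pos a = pos b \<longleftrightarrow> a = b"
  using bij_pos by (auto simp: bij_betw_def inj_def)

lemma pos_less: "pos (a :: 'n::finite) < CARD('n)"
  using bij_pos by (auto simp: bij_betw_def)

lemma ex_pos: "i < CARD('n::finite) \<Longrightarrow> \<exists>a::'n. pos a = i"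
proof -
  assume "i < CARD('n)"
  then have "i \<in> range (pos :: 'n \<Rightarrow> nat)" using bij_pos[where 'n='n] by (auto simp: bij_betw_def)
  then show ?thesis by auto
qed

definition vl :: "'n::finite + 'n \<Rightarrow> nat" where "vl = case_sum pos pos"

lemma vl_simps [simp]: "vl (Inl a) = pos a" "vl (Inr a) = pos a" "vl (flip x) = vl x"
  by (auto simp: vl_def flip_def split: sum.splits)

text \<open>The free coordinate of an unordered edge, taken above the diagonal; in characteristic
  two the orientation carries no sign.\<close>

definition edge_var :: "'n::finite + 'n \<Rightarrow> 'n + 'n \<Rightarrow> 'n exotic_coord" where
  "edge_var x y = (if idx x < idx y then Inr (x, y) else Inr (y, x))"

lemma edge_var_eq: "edge_var x y = edge_var x' y' \<longleftrightarrow> {x, y} = {x', y'}"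
  by (auto simp: edge_var_def doubleton_eq_iff not_less antisym)

text \<open>The weight favours edges joining opposite sides and, through strict convexity, matchings of
  the first \<open>i + 1\<close> indices on each side whose edges all have position sum \<open>i\<close>.\<close>

definition wt :: "'n::finite exotic_coord \<Rightarrow> nat" where
  "wt = case_sum (\<lambda>_. 0) (\<lambda>(x, y). 8 * CARD('n)^2 + 1 - (2 * (vl x + vl y)^2 + (if isl x = isl y then 1 else 0)))"

text \<open>Positions are below \<open>CARD('n)\<close>, so \<open>8 * CARD('n)^2 + 1\<close> bounds
  what \<open>wt\<close> subtracts on an edge: the subtraction of naturals does not truncate and can
  be read over the integers.\<close>

lemma wt_edge_var:
  "int (wt (edge_var (x :: 'n::finite + 'n) y)) = int (8 * CARD('n)^2 + 1) -
    (2 * (int (vl x) + int (vl y))^2 + (if isl x = isl y then 1 else 0))"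
proof -
  have "vl x < CARD('n)" "vl y < CARD('n)" by (auto simp: vl_def pos_less split: sum.splits)
  then have "vl x + vl y \<le> 2 * CARD('n)" by simp
  then have "(vl x + vl y)^2 \<le> (2 * CARD('n))^2" by (rule power_mono) simp
  then have le: "2 * (vl x + vl y)^2 + (if isl x = isl y then 1 else 0) \<le> 8 * CARD('n)^2 + 1"
    by (simp add: power_mult_distrib)
  have "wt (edge_var x y) = 8 * CARD('n)^2 + 1 - (2 * (vl x + vl y)^2 + (if isl x = isl y then 1 else 0))"
    by (auto simp: wt_def edge_var_def add.commute)
  then have "int (wt (edge_var x y)) = int (8 * CARD('n)^2 + 1) - int (2 * (vl x + vl y)^2 + (if isl x = isl y then 1 else 0))"
    using le by (simp only: of_nat_diff)
  then show ?thesis by simp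
qed

lemma card_Compl_UNIV: "card (- A) = CARD('n::finite) - card (A :: 'n set)"
  by (simp add: Compl_eq_Diff_UNIV card_Diff_subset)

text \<open>The terms of the coefficient of \<open>X ^ m\<close> in the characteristic Pfaffian: a
  matching together with the \<open>m\<close> edges at which the entry of the symplectic form is
  taken.\<close>

definition good :: "nat \<Rightarrow> (('n + 'n \<Rightarrow> 'n + 'n) \<times> 'n::finite set) set" where
  "good m = {(\<tau>, C). \<tau> \<in> matchings \<and> card C = m \<and>
    (\<forall>a\<in>C. match_perm \<tau> (Inr a) = flip (match_perm \<tau> (Inl a)))}"

definition edge_at :: "('n + 'n \<Rightarrow> 'n + 'n) \<Rightarrow> 'n::finite \<Rightarrow> 'n exotic_coord" where
  "edge_at \<tau> a = edge_var (match_perm \<tau> (Inl a)) (match_perm \<tau> (Inr a))"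

definition pf_monom :: "('n + 'n \<Rightarrow> 'n + 'n) \<times> 'n::finite set \<Rightarrow> 'n exotic_coord \<Rightarrow>\<^sub>0 nat" where
  "pf_monom = (\<lambda>(\<tau>, C). \<Sum>a\<in>- C. Poly_Mapping.single (edge_at \<tau> a) 1)"

lemma match_perm_neq: "\<tau> \<in> matchings \<Longrightarrow> match_perm \<tau> (Inl a) \<noteq> match_perm \<tau> (Inr b)"
  using match_perm[of \<tau>] by (auto simp: bij_def inj_def)

text \<open>Signs disappear in characteristic two. A matching gives a product of linear polynomials;
  its coefficient at \<open>m\<close> runs over the sets \<open>C\<close> of edges contributing
  their entry of the symplectic form, while the other edges contribute a variable.\<close>

lemma coeff_char_pf_alt_mat:
  assumes two: "(2::'k::field) = 0"
  shows "Polynomial.coeff (char_pf (alt_mat (\<lambda>i j. Var (Inr (i, j))) :: ('n::finite exotic_coord, 'k) mpoly ^ ('n + 'n) ^ ('n + 'n))) m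
    = (\<Sum>t\<in>good m. Poly_Mapping.single (pf_monom t) 1)"
proof -
  let ?R = "alt_mat (\<lambda>i j. Var (Inr (i, j))) :: ('n::finite exotic_coord, 'k) mpoly ^ ('n + 'n) ^ ('n + 'n)"
  let ?J = "symplectic_form :: ('n exotic_coord, 'k) mpoly ^ ('n + 'n) ^ ('n + 'n)"
  have "(2 :: ('n exotic_coord, 'k) mpoly) = Const 2"
    using Const_hom(10)[of 2] by simp
  then have two': "(2 :: ('n exotic_coord, 'k) mpoly) = 0" using two by simp
  note neg = char_two_neg[OF two']
  have sgn: "of_int (sign p) = (1 :: ('n exotic_coord, 'k) mpoly)" for p :: "'n + 'n \<Rightarrow> 'n + 'n"
    by (cases p rule: sign_cases) (simp_all add: neg)
  have R: "?R $ x $ y = Var (edge_var x y)" if "x \<noteq> y" for x y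
    using that by (auto simp: alt_mat_def edge_var_def neg)
  have J: "?J $ x $ y = (if y = flip x then 1 else 0)" for x y
    by (cases x; cases y) (auto simp: symplectic_form_def neg)
  have "Polynomial.coeff (char_pf ?R) m = (\<Sum>\<tau>\<in>matchings. Polynomial.coeff (\<Prod>a\<in>UNIV.
    [:?R $ match_perm \<tau> (Inl a) $ match_perm \<tau> (Inr a), ?J $ match_perm \<tau> (Inl a) $ match_perm \<tau> (Inr a):]) m)"
    by (simp add: char_pf_def pf_def pf_term_def Polynomial.coeff_sum of_int_poly sgn)
  also have "\<dots> = (\<Sum>\<tau>\<in>matchings. \<Sum>C\<in>{C. card C = m \<and> (\<forall>a\<in>C. match_perm \<tau> (Inr a) = flip (match_perm \<tau> (Inl a)))}.
      Poly_Mapping.single (pf_monom (\<tau>, C)) 1)"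
  proof (rule sum.cong[OF refl])
    fix \<tau> :: "'n + 'n \<Rightarrow> 'n + 'n" assume \<tau>: "\<tau> \<in> matchings"
    have mono: "(\<Prod>a\<in>D. Var (edge_at \<tau> a)) = (Poly_Mapping.single (\<Sum>a\<in>D. Poly_Mapping.single (edge_at \<tau> a) 1) 1
        :: ('n exotic_coord, 'k) mpoly)" if "finite D" for D
      using that by (induction D) (auto simp: Var_def mult_single single_one)
    have trm: "(\<Prod>a\<in>C. ?J $ match_perm \<tau> (Inl a) $ match_perm \<tau> (Inr a)) *
        (\<Prod>a\<in>UNIV - C. ?R $ match_perm \<tau> (Inl a) $ match_perm \<tau> (Inr a)) =
        (if \<forall>a\<in>C. match_perm \<tau> (Inr a) = flip (match_perm \<tau> (Inl a)) then Poly_Mapping.single (pf_monom (\<tau>, C)) 1 else 0)"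
      for C
    proof -
      have "(\<Prod>a\<in>C. ?J $ match_perm \<tau> (Inl a) $ match_perm \<tau> (Inr a)) =
        (if \<forall>a\<in>C. match_perm \<tau> (Inr a) = flip (match_perm \<tau> (Inl a)) then 1 else 0)"
      proof (cases "\<forall>a\<in>C. match_perm \<tau> (Inr a) = flip (match_perm \<tau> (Inl a))")
        case True
        then show ?thesis by (simp add: J)
      next
        case False
        then have "\<exists>a\<in>C. ?J $ match_perm \<tau> (Inl a) $ match_perm \<tau> (Inr a) = 0" by (auto simp: J)
        then show ?thesis using False by (simp only: if_False) (intro prod_zero, simp_all)
      qed
      moreover have "(\<Prod>a\<in>UNIV - C. ?R $ match_perm \<tau> (Inl a) $ match_perm \<tau> (Inr a)) = Poly_Mapping.single (pf_monom (\<tau>, C)) 1"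
        by (simp add: R match_perm_neq[OF \<tau>] pf_monom_def Compl_eq_Diff_UNIV mono flip: edge_at_def)
      ultimately show ?thesis by simp
    qed
    show "Polynomial.coeff (\<Prod>a\<in>UNIV. [:?R $ match_perm \<tau> (Inl a) $ match_perm \<tau> (Inr a),
        ?J $ match_perm \<tau> (Inl a) $ match_perm \<tau> (Inr a):]) m =
      (\<Sum>C\<in>{C. card C = m \<and> (\<forall>a\<in>C. match_perm \<tau> (Inr a) = flip (match_perm \<tau> (Inl a)))}.
      Poly_Mapping.single (pf_monom (\<tau>, C)) 1)"
      unfolding coeff_prod_linear_sum[OF finite] trm
      by (rule sum.mono_neutral_cong_right) auto
  qed
  also have "\<dots> = (\<Sum>t\<in>good m. Poly_Mapping.single (pf_monom t) 1)"
    by (subst sum.Sigma) (auto simp: good_def matchings_def intro!: sum.cong)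
  finally show ?thesis .
qed

section \<open>The matching of greatest weight\<close>

lemma sum_distinct_nat: "finite A \<Longrightarrow> card A * (card A - 1) \<le> 2 * (\<Sum>x\<in>A. x :: nat)"
proof (induction "card A" arbitrary: A)
  case (Suc n)
  then have ne: "A \<noteq> {}" by auto
  have "A \<subseteq> {..Max A}" using Suc by auto
  then have "card A \<le> Suc (Max A)" using card_mono[of "{..Max A}" A] by simp
  then have m: "n \<le> Max A" using Suc by simp
  have "card (A - {Max A}) = n" using Suc ne by (simp add: card_Diff_singleton)
  with Suc have "n * (n - 1) \<le> 2 * (\<Sum>x\<in>A - {Max A}. x)" by (metis finite_Diff)
  moreover have "(\<Sum>x\<in>A. x) = Max A + (\<Sum>x\<in>A - {Max A}. x)"
    using Suc ne by (subst sum.remove[of _ "Max A"]) auto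
  moreover have "Suc n * n \<le> n * (n - 1) + 2 * n" by (cases n) auto
  moreover have "card A = Suc n" using Suc(2) by simp
  moreover have "n * (n - 1) + 2 * n \<le> 2 * (\<Sum>x\<in>A - {Max A}. x) + 2 * Max A"
    by (intro add_mono calculation(1) mult_left_mono m) simp
  ultimately show ?case by (simp only: diff_Suc_1) (rule order.trans, assumption, simp)
qed simp

text \<open>The antidiagonal matching of the positions up to \<open>i\<close>, completed by edges on
  which the symplectic form is nonzero. The antidiagonal edges have position sum \<open>i\<close>,
  which keeps the leading monomials for different \<open>i\<close> coprime.\<close>

definition refl_match :: "nat \<Rightarrow> 'n::finite + 'n \<Rightarrow> 'n + 'n" where
  "refl_match i x = (if vl x \<le> i then case_sum (\<lambda>b. Inr (inv_into UNIV pos (i - pos b))) (\<lambda>b. Inl (inv_into UNIV pos (i - pos b))) x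
    else flip x)"

lemma pos_inv: "i < CARD('n::finite) \<Longrightarrow> pos (inv_into (UNIV :: 'n set) pos (i - j)) = i - j"
  using ex_pos[of "i - j", where 'n='n] by (metis f_inv_into_f less_imp_diff_less rangeI)

lemma refl_match_flip: "i < CARD('n::finite) \<Longrightarrow> vl (x :: 'n + 'n) \<le> i \<Longrightarrow> vl (refl_match i x) = i - vl x"
  "i < CARD('n) \<Longrightarrow> vl x \<le> i \<Longrightarrow> isl (refl_match i x) \<longleftrightarrow> \<not> isl x"
  "\<not> vl x \<le> i \<Longrightarrow> refl_match i x = flip x"
  by (auto simp: refl_match_def pos_inv split: sum.splits)

lemma vl_isl_eq: "vl x = vl y \<Longrightarrow> isl x = isl y \<Longrightarrow> x = y"
  by (cases x; cases y) auto

lemma refl_match_matching: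
  assumes i: "i < CARD('n::finite)"
  shows "(refl_match i :: 'n + 'n \<Rightarrow> _) \<in> matchings"
proof -
  define \<pi> where "\<pi> = case_sum Inl (\<lambda>b. refl_match i (Inl b) :: 'n + 'n)"
  have r: "refl_match i (refl_match i x) = x" for x :: "'n + 'n"
  proof (cases "vl x \<le> i")
    case True
    then show ?thesis using i by (intro vl_isl_eq) (auto simp: refl_match_flip)
  qed (simp add: refl_match_flip)
  have isl: "isl (refl_match i x) \<longleftrightarrow> \<not> isl x" for x :: "'n + 'n"
    by (cases "vl x \<le> i") (auto simp: refl_match_flip i flip_def split: sum.splits)
  have inj: "inj \<pi>"
  proof (rule injI)
    fix x y assume xy: "\<pi> x = \<pi> y"
    have a: "\<not> isl (refl_match i (Inl b :: 'n + 'n))" for b using isl[of "Inl b"] by simp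
    have b: "refl_match i (Inl b) = refl_match i (Inl c :: 'n + 'n) \<longleftrightarrow> b = c" for b c by (metis r sum.inject(1))
    show "x = y" using xy a b by (cases x; cases y) (auto simp: \<pi>_def dest: arg_cong[of _ _ isl])
  qed
  then have bij: "bij \<pi>" by (simp add: bij_def finite_UNIV_inj_surj)
  have "refl_match i (\<pi> x) = \<pi> (flip x)" for x
    by (cases x) (auto simp: \<pi>_def r)
  then have "matching \<pi> = refl_match i"
    using bij by (auto simp: matching_def fun_eq_iff bij_is_surj surj_f_inv_f simp flip: \<open>\<And>x. refl_match i (\<pi> x) = \<pi> (flip x)\<close>)
  then show ?thesis using bij by (auto simp: matchings_def intro!: image_eqI[of _ matching \<pi>])
qed

text \<open>The \<open>i + 1\<close> edges that contribute variables to the leading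
  monomial.\<close>

definition low_pairs :: "nat \<Rightarrow> 'n::finite set" where
  "low_pairs i = {a. vl (match_perm (refl_match i) (Inl a :: 'n + 'n)) \<le> i}"

lemma card_vl_le:
  assumes "i < CARD('n::finite)"
  shows "card {x :: 'n + 'n. vl x \<le> i} = 2 * (i + 1)"
proof -
  have "x \<in> pos ` {a::'n. pos a \<le> i}" if "x \<le> i" for x
    using ex_pos[of x, where 'n='n] that assms by auto
  then have "bij_betw (pos :: 'n \<Rightarrow> nat) {a. pos a \<le> i} {..i}"
    by (auto simp: bij_betw_def inj_on_def)
  then have c: "card {a::'n. pos a \<le> i} = i + 1" by (simp add: bij_betw_same_card)
  have "x \<in> {x. vl x \<le> i} \<longleftrightarrow> x \<in> Inl ` {a. pos a \<le> i} \<union> Inr ` {a. pos a \<le> i}" for x :: "'n + 'n"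
    by (cases x) auto
  then have "{x :: 'n + 'n. vl x \<le> i} = Inl ` {a. pos a \<le> i} \<union> Inr ` {a. pos a \<le> i}"
    by blast
  moreover have "card (Inl ` {a::'n. pos a \<le> i} \<union> Inr ` {a::'n. pos a \<le> i}) = 2 * (i + 1)"
    by (subst card_Un_disjoint) (auto simp: card_image c)
  ultimately show ?thesis by simp
qed

lemma card_covered:
  assumes "bij (\<pi> :: 'n::finite + 'n \<Rightarrow> 'n + 'n)"
  shows "card (\<pi> ` (Inl ` D \<union> Inr ` D)) = 2 * card D"
proof -
  have "card (\<pi> ` (Inl ` D \<union> Inr ` D)) = card (Inl ` D \<union> Inr ` D)"
    using assms by (intro card_image) (auto simp: bij_def inj_on_def)
  also have "\<dots> = 2 * card D" by (subst card_Un_disjoint) (auto simp: card_image)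
  finally show ?thesis .
qed

lemma matching_apply: "\<tau> \<in> matchings \<Longrightarrow> \<tau> (match_perm \<tau> x) = match_perm \<tau> (flip x)"
proof -
  assume "\<tau> \<in> matchings"
  then have b: "bij (match_perm \<tau>)" and m: "matching (match_perm \<tau>) = \<tau>" using match_perm by auto
  have "\<tau> (match_perm \<tau> x) = matching (match_perm \<tau>) (match_perm \<tau> x)" by (simp only: m)
  also have "\<dots> = match_perm \<tau> (flip x)" using b by (simp add: matching_def bij_is_inj)
  finally show ?thesis .
qed

lemma refl_good:
  assumes i: "i < CARD('n::finite)"
  shows "(refl_match i, - low_pairs i :: 'n set) \<in> good (CARD('n) - 1 - i)"
proof -
  let ?\<tau> = "refl_match i :: 'n + 'n \<Rightarrow> 'n + 'n"
  let ?\<pi> = "match_perm ?\<tau>"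
  let ?D = "low_pairs i :: 'n set"
  have \<tau>: "?\<tau> \<in> matchings" using refl_match_matching[OF i] .
  have b: "bij ?\<pi>" using match_perm[OF \<tau>] by blast
  have r: "?\<pi> (Inr a) = ?\<tau> (?\<pi> (Inl a))" "?\<pi> (Inl a) = ?\<tau> (?\<pi> (Inr a))" for a
    using matching_apply[OF \<tau>, of "Inl a"] matching_apply[OF \<tau>, of "Inr a"] by auto
  have lr: "vl (?\<pi> (Inr a)) \<le> i \<longleftrightarrow> vl (?\<pi> (Inl a)) \<le> i" for a
    using r[of a] refl_match_flip(1,2)[OF i] refl_match_flip(3)[of _ i]
    by (metis diff_le_self vl_simps(3))
  have "{x. vl x \<le> i} = ?\<pi> ` (Inl ` ?D \<union> Inr ` ?D)"
  proof (intro equalityI subsetI)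
    fix x :: "'n + 'n" assume x: "x \<in> {x. vl x \<le> i}"
    obtain z where z: "x = ?\<pi> z" using b by (metis bij_pointE)
    then have "z \<in> Inl ` ?D \<union> Inr ` ?D"
      using x lr by (cases z) (auto simp: low_pairs_def)
    then show "x \<in> ?\<pi> ` (Inl ` ?D \<union> Inr ` ?D)" using z by blast
  qed (use lr in \<open>auto simp: low_pairs_def\<close>)
  then have "card ?D = i + 1" using card_vl_le[OF i] card_covered[OF b, of ?D] by simp
  then have "card (- ?D) = CARD('n) - 1 - i" by (simp add: card_Compl_UNIV)
  moreover have "?\<pi> (Inr a) = flip (?\<pi> (Inl a))" if "a \<in> - ?D" for a
    using that r(1)[of a] refl_match_flip(3)[of "?\<pi> (Inl a)" i] by (simp add: low_pairs_def)
  ultimately show ?thesis using \<tau> by (simp add: good_def)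
qed

lemma low_pairs_edge:
  assumes i: "i < CARD('n::finite)" and a: "a \<in> (low_pairs i :: 'n set)"
  shows "vl (match_perm (refl_match i) (Inl a)) + vl (match_perm (refl_match i) (Inr a)) = i"
    "isl (match_perm (refl_match i) (Inl a)) \<noteq> isl (match_perm (refl_match i) (Inr a))"
proof -
  have r: "match_perm (refl_match i) (Inr a) = refl_match i (match_perm (refl_match i) (Inl a))"
    using matching_apply[OF refl_match_matching[OF i], of "Inl a"] by simp
  show "vl (match_perm (refl_match i) (Inl a)) + vl (match_perm (refl_match i) (Inr a)) = i"
    "isl (match_perm (refl_match i) (Inl a)) \<noteq> isl (match_perm (refl_match i) (Inr a))"
    unfolding r using a by (auto simp: refl_match_flip(1,2)[OF i] low_pairs_def)
qed

lemma weight_pf_monom: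
  "int (weight wt (pf_monom (\<tau>, C))) = (\<Sum>a\<in>- C. int (8 * CARD('n)^2 + 1) -
    (2 * (int (vl (match_perm \<tau> (Inl a))) + int (vl (match_perm \<tau> (Inr a))))^2 +
     (if isl (match_perm \<tau> (Inl a)) = isl (match_perm \<tau> (Inr (a::'n::finite))) then 1 else 0)))"
  by (simp only: pf_monom_def prod.case weight_sum weight_single edge_at_def mult_1 of_nat_sum wt_edge_var)

text \<open>The \<open>i + 1\<close> edges outside \<open>C\<close> cover both copies of a set of
  \<open>i + 1\<close> positions, so their position sums add up to at least
  \<open>i (i + 1)\<close>. By convexity the sum of the squares is least exactly when every position
  sum is \<open>i\<close>. The extra unit in the weight then forces each edge to join the two
  sides.\<close>

lemma good_weight:
  assumes i: "i < CARD('n::finite)" and t: "(\<tau>, C :: 'n set) \<in> good (CARD('n) - 1 - i)"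
  shows "weight wt (pf_monom (\<tau>, C)) \<le> weight wt (pf_monom (refl_match i, - low_pairs i :: 'n set))"
    and "weight wt (pf_monom (\<tau>, C)) = weight wt (pf_monom (refl_match i, - low_pairs i :: 'n set)) \<Longrightarrow>
      \<tau> = refl_match i \<and> C = - low_pairs i"
proof -
  let ?\<pi> = "match_perm \<tau>"
  define K where "K = int (8 * CARD('n)^2 + 1)"
  define s where "s a = int (vl (?\<pi> (Inl a))) + int (vl (?\<pi> (Inr a)))" for a
  define e where "e a = (if isl (?\<pi> (Inl a)) = isl (?\<pi> (Inr a)) then 1 else 0 :: int)" for a
  have \<tau>: "\<tau> \<in> matchings" and cC: "card C = CARD('n) - 1 - i"
    and C: "\<And>a. a \<in> C \<Longrightarrow> ?\<pi> (Inr a) = flip (?\<pi> (Inl a))" using t by (auto simp: good_def)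
  have b: "bij ?\<pi>" using match_perm[OF \<tau>] by blast
  have cD: "card (- C) = i + 1" using i cC by (simp add: card_Compl_UNIV)
  define V where "V = ?\<pi> ` (Inl ` (- C) \<union> Inr ` (- C))"
  have cV: "card V = 2 * (i + 1)" unfolding V_def card_covered[OF b] cD ..
  have compl: "x \<notin> V \<longleftrightarrow> x \<in> ?\<pi> ` (Inl ` C \<union> Inr ` C)" for x
  proof -
    obtain z where "x = ?\<pi> z" using b by (metis bij_pointE)
    moreover have "?\<pi> z \<in> ?\<pi> ` A \<longleftrightarrow> z \<in> A" for A using b by (simp add: bij_is_inj inj_image_mem_iff)
    ultimately show ?thesis by (cases z) (auto simp: V_def)
  qed
  \<comment> \<open>The edges in \<open>C\<close> have the form \<open>x\<close>,
    \<open>flip x\<close>, so the set \<open>V\<close> of the remaining indices is stable under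
    \<open>flip\<close> and consists of both copies of a set of \<open>i + 1\<close>
    positions.\<close>
  have flipV: "flip x \<in> V \<longleftrightarrow> x \<in> V" for x
  proof -
    have "flip x \<notin> V" if "x \<notin> V" for x
    proof -
      obtain a where a: "a \<in> C" "x = ?\<pi> (Inl a) \<or> x = ?\<pi> (Inr a)" using \<open>x \<notin> V\<close> compl by blast
      then have "flip x = ?\<pi> (Inr a) \<or> flip x = ?\<pi> (Inl a)" using C by auto
      then show ?thesis using a unfolding compl by blast
    qed
    then show ?thesis by (metis flip_simps(3))
  qed
  define I where "I = {b. Inl b \<in> V}"
  have VI: "V = Inl ` I \<union> Inr ` I"
  proof (intro equalityI subsetI)
    fix x assume "x \<in> V"
    then show "x \<in> Inl ` I \<union> Inr ` I" using flipV[of x] by (cases x) (auto simp: I_def)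
  next
    fix x assume "x \<in> Inl ` I \<union> Inr ` I"
    then show "x \<in> V" using flipV[of x] by (auto simp: I_def)
  qed
  have "card V = 2 * card I" unfolding VI by (subst card_Un_disjoint) (auto simp: card_image)
  then have cI: "card I = i + 1" using cV by simp
  have "(\<Sum>x\<in>V. vl x) = 2 * (\<Sum>b\<in>I. pos b)"
    unfolding VI by (subst sum.union_disjoint) (auto simp: sum.reindex)
  moreover have "(\<Sum>b\<in>I. pos b) = (\<Sum>x\<in>pos ` I. x)" by (simp add: sum.reindex inj_on_def)
  moreover have "card (pos ` I) = i + 1" using cI by (simp add: card_image inj_on_def)
  ultimately have Vge: "(i + 1) * i \<le> (\<Sum>x\<in>V. vl x)"
    using sum_distinct_nat[of "pos ` I"] by simp
  have "(\<Sum>x\<in>V. vl x) = (\<Sum>z\<in>Inl ` (- C) \<union> Inr ` (- C). vl (?\<pi> z))"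
    unfolding V_def using b by (subst sum.reindex) (auto simp: bij_def inj_on_def)
  also have "\<dots> = (\<Sum>a\<in>- C. vl (?\<pi> (Inl a)) + vl (?\<pi> (Inr a)))"
    by (subst sum.union_disjoint) (auto simp: sum.reindex sum.distrib)
  finally have Vs: "int (\<Sum>x\<in>V. vl x) = (\<Sum>a\<in>- C. s a)" by (simp add: s_def)
  have sum_s: "(int i + 1) * int i \<le> (\<Sum>a\<in>- C. s a)"
    unfolding Vs[symmetric] using Vge by (metis of_nat_1 of_nat_add of_nat_le_iff of_nat_mult)
  have W: "int (weight wt (pf_monom (\<tau>, C))) = (\<Sum>a\<in>- C. K - (2 * (s a)^2 + e a))"
    unfolding weight_pf_monom by (simp add: K_def s_def e_def)
  have "(refl_match i, - low_pairs i :: 'n set) \<in> good (CARD('n) - 1 - i)" by (rule refl_good[OF i])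
  then have "card (- (low_pairs i :: 'n set)) = CARD('n) - 1 - i" by (simp add: good_def)
  then have cL: "card (low_pairs i :: 'n set) = i + 1"
    using i by (simp add: card_Compl_UNIV) (metis One_nat_def Suc_diff_Suc card_mono diff_diff_cancel finite top_greatest less_imp_le_nat diff_Suc_1 Suc_leI diff_le_self)
  have "int (weight wt (pf_monom (refl_match i, - low_pairs i :: 'n set))) = (\<Sum>a\<in>(low_pairs i :: 'n set). K - 2 * (int i)^2)"
    unfolding weight_pf_monom double_complement
  proof (rule sum.cong[OF refl])
    fix a assume a: "a \<in> (low_pairs i :: 'n set)"
    have "int (vl (match_perm (refl_match i) (Inl a))) + int (vl (match_perm (refl_match i) (Inr a))) = int i"
      using low_pairs_edge(1)[OF i a] by (metis of_nat_add)
    then show "int (8 * (card (UNIV :: 'n set))\<^sup>2 + 1) - (2 * (int (vl (match_perm (refl_match i) (Inl a))) + int (vl (match_perm (refl_match i) (Inr a))))\<^sup>2 +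
      (if isl (match_perm (refl_match i) (Inl a)) = isl (match_perm (refl_match i) (Inr a)) then 1 else 0)) = K - 2 * (int i)\<^sup>2"
      using low_pairs_edge(2)[OF i a] by (simp add: K_def)
  qed
  then have WL: "int (weight wt (pf_monom (refl_match i, - low_pairs i :: 'n set))) = (int i + 1) * (K - 2 * (int i)^2)"
    by (simp add: cL)
  \<comment> \<open>The excess of \<open>2 * (s a)^2 + e a\<close> over the tangent line of
    \<open>2 * s^2\<close> at \<open>s = i\<close>.\<close>
  define d where "d a = 2 * (s a - int i)^2 + e a" for a
  have d0: "d a \<ge> 0" for a by (auto simp: d_def e_def)
  have "(\<Sum>a\<in>- C. K - (2 * (s a)^2 + e a)) = (\<Sum>a\<in>- C. (K + 2 * (int i)^2) - 4 * int i * s a - d a)"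
    by (intro sum.cong refl) (simp add: d_def power2_eq_square algebra_simps)
  also have "\<dots> = (int i + 1) * (K + 2 * (int i)^2) - 4 * int i * (\<Sum>a\<in>- C. s a) - (\<Sum>a\<in>- C. d a)"
    by (simp add: sum_subtractf cD sum_distrib_left)
  finally have W': "int (weight wt (pf_monom (\<tau>, C))) = (int i + 1) * (K + 2 * (int i)^2) - 4 * int i * (\<Sum>a\<in>- C. s a) - (\<Sum>a\<in>- C. d a)"
    using W by simp
  have "4 * int i * ((int i + 1) * int i) \<le> 4 * int i * (\<Sum>a\<in>- C. s a)"
    by (intro mult_left_mono sum_s) simp
  then have main: "int (weight wt (pf_monom (\<tau>, C))) \<le>
      int (weight wt (pf_monom (refl_match i, - low_pairs i :: 'n set))) - (\<Sum>a\<in>- C. d a)"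
    unfolding W' WL by (simp add: power2_eq_square algebra_simps)
  moreover have ds: "(\<Sum>a\<in>- C. d a) \<ge> 0" by (intro sum_nonneg d0)
  ultimately show "weight wt (pf_monom (\<tau>, C)) \<le> weight wt (pf_monom (refl_match i, - low_pairs i :: 'n set))"
    by linarith
  assume "weight wt (pf_monom (\<tau>, C)) = weight wt (pf_monom (refl_match i, - low_pairs i :: 'n set))"
  then have "(\<Sum>a\<in>- C. d a) = 0" using main ds by linarith
  then have dz: "d a = 0" if "a \<in> - C" for a using that d0 by (simp add: sum_nonneg_eq_0_iff)
  have se: "s a = int i \<and> e a = 0" if "a \<in> - C" for a
  proof -
    have "2 * (s a - int i)^2 \<ge> 0" "e a \<ge> 0" by (auto simp: e_def)
    then have "2 * (s a - int i)^2 = 0" "e a = 0" using dz[OF that] unfolding d_def by linarith+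
    then show ?thesis by simp
  qed
  have pair: "\<tau> x = refl_match i x \<and> vl x \<le> i" if x: "x \<in> V" for x
  proof -
    obtain a where a: "a \<in> - C" "x = ?\<pi> (Inl a) \<or> x = ?\<pi> (Inr a)" using x by (auto simp: V_def)
    have sums: "vl (?\<pi> (Inl a)) + vl (?\<pi> (Inr a)) = i" "isl (?\<pi> (Inl a)) \<noteq> isl (?\<pi> (Inr a))"
      using se[OF a(1)] unfolding s_def e_def by (auto split: if_splits)
    have "\<tau> (?\<pi> (Inl a)) = ?\<pi> (Inr a)" "\<tau> (?\<pi> (Inr a)) = ?\<pi> (Inl a)"
      using matching_apply[OF \<tau>, of "Inl a"] matching_apply[OF \<tau>, of "Inr a"] by auto
    then have "vl x + vl (\<tau> x) = i" "isl x \<noteq> isl (\<tau> x)" using a(2) sums by auto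
    then have le: "vl x \<le> i" by linarith
    have "\<tau> x = refl_match i x"
    proof (rule vl_isl_eq)
      show "vl (\<tau> x) = vl (refl_match i x)"
        using \<open>vl x + vl (\<tau> x) = i\<close> refl_match_flip(1)[OF i le] by linarith
      show "isl (\<tau> x) = isl (refl_match i x)"
        using \<open>isl x \<noteq> isl (\<tau> x)\<close> refl_match_flip(2)[OF i le] by blast
    qed
    then show ?thesis using le by simp
  qed
  then have "V \<subseteq> {x. vl x \<le> i}" by blast
  then have V: "V = {x. vl x \<le> i}" using cV card_vl_le[OF i] by (intro card_subset_eq) auto
  have "\<tau> x = refl_match i x" for x
  proof (cases "x \<in> V")
    case False
    then obtain a where "a \<in> C" "x = ?\<pi> (Inl a) \<or> x = ?\<pi> (Inr a)" unfolding compl by blast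
    moreover have "\<tau> (?\<pi> (Inl a)) = ?\<pi> (Inr a)" "\<tau> (?\<pi> (Inr a)) = ?\<pi> (Inl a)" for a
      using matching_apply[OF \<tau>, of "Inl a"] matching_apply[OF \<tau>, of "Inr a"] by auto
    ultimately have "\<tau> x = flip x" using C by (metis flip_simps(3))
    then show ?thesis using False V by (simp add: refl_match_flip)
  qed (use pair in blast)
  then have e: "\<tau> = refl_match i" by blast
  have "a \<in> - C \<longleftrightarrow> ?\<pi> (Inl a) \<in> V" for a
  proof -
    have "?\<pi> z \<in> ?\<pi> ` A \<longleftrightarrow> z \<in> A" for A z using b by (simp add: bij_is_inj inj_image_mem_iff)
    then show ?thesis unfolding V_def by auto
  qed
  then have "- C = low_pairs i" unfolding V low_pairs_def e by blast
  then show "\<tau> = refl_match i \<and> C = - low_pairs i" using e by blast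
qed

definition lead_vars :: "nat \<Rightarrow> 'n::finite exotic_coord set" where
  "lead_vars i = edge_at (refl_match i) ` low_pairs i"

text \<open>The terms of the coefficient at \<open>CARD('n) - 1 - i\<close> have
  \<open>i + 1\<close> variables. A variable determines the position sum of its edge, hence the one
  \<open>i\<close> whose leading monomial can contain it.\<close>

lemma coprime_leading_pf:
  assumes two: "(2::'k::alg_closed_field) = 0"
  shows "coprime_leading (wt :: 'n::finite exotic_coord \<Rightarrow> nat) {..<CARD('n)}
    (\<lambda>i. Polynomial.coeff (char_pf (alt_mat (\<lambda>i j. Var (Inr (i, j))) :: ('n exotic_coord, 'k) mpoly ^ ('n + 'n) ^ ('n + 'n))) (CARD('n) - 1 - i))
    lead_vars"
proof
  fix i assume "i \<in> {..<CARD('n)}"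
  then have i: "i < CARD('n)" by simp
  let ?t = "(refl_match i, - low_pairs i :: 'n set)"
  have g: "?t \<in> good (CARD('n) - 1 - i)" by (rule refl_good[OF i])
  have \<tau>: "(refl_match i :: 'n + 'n \<Rightarrow> _) \<in> matchings" by (rule refl_match_matching[OF i])
  show "finite (lead_vars i :: 'n exotic_coord set)" by (simp add: lead_vars_def)
  have "card (- (low_pairs i :: 'n set)) \<noteq> CARD('n)" using g i by (simp add: good_def)
  then have "(low_pairs i :: 'n set) \<noteq> {}" by auto
  then show "(lead_vars i :: 'n exotic_coord set) \<noteq> {}" by (simp add: lead_vars_def)
  have inj: "inj_on (edge_at (refl_match i)) (low_pairs i :: 'n set)"
    unfolding edge_at_def edge_var_eq inj_on_def doubleton_eq_iff
    using match_perm[OF \<tau>] by (auto simp: bij_def inj_def)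
  have mon: "pf_monom ?t = (\<Sum>v\<in>lead_vars i. Poly_Mapping.single v 1)"
    by (simp add: pf_monom_def lead_vars_def sum.reindex[OF inj])
  have fin: "finite (good m :: (('n + 'n \<Rightarrow> 'n + 'n) \<times> 'n set) set)" for m by (rule finite)
  have "(\<Sum>t\<in>good (CARD('n) - 1 - i). Poly_Mapping.single (pf_monom t) (1::'k)) - Poly_Mapping.single (pf_monom ?t) 1 =
    (\<Sum>t\<in>good (CARD('n) - 1 - i) - {?t}. Poly_Mapping.single (pf_monom t) 1)"
    using sum.remove[OF fin g, of "\<lambda>t. Poly_Mapping.single (pf_monom t) (1::'k)"] by simp
  also have "\<dots> \<in> weight_below wt (weight wt (pf_monom ?t))"
  proof -
    have "(\<Sum>t\<in>A. Poly_Mapping.single (pf_monom t) (1::'k)) \<in> weight_below wt (weight wt (pf_monom ?t))"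
      if "finite A" "A \<subseteq> good (CARD('n) - 1 - i) - {?t}" for A
      using that
    proof (induction A)
      case (insert t A)
      obtain \<tau> C where t: "t = (\<tau>, C)" by (cases t)
      have "weight wt (pf_monom t) < weight wt (pf_monom ?t)"
        using insert.prems good_weight[OF i, of \<tau> C] unfolding t by (auto simp: le_less)
      then have "Poly_Mapping.single (pf_monom t) (1::'k) \<in> weight_below wt (weight wt (pf_monom ?t))"
        by (simp add: weight_below_def)
      then show ?case using insert by (auto intro: weight_below_add)
    qed simp
    from this[OF finite_Diff[OF fin] order.refl] show ?thesis .
  qed
  finally show "leading wt (\<Sum>v\<in>lead_vars i. Poly_Mapping.single v 1)
    (Polynomial.coeff (char_pf (alt_mat (\<lambda>i j. Var (Inr (i, j))) :: ('n exotic_coord, 'k) mpoly ^ ('n + 'n) ^ ('n + 'n))) (CARD('n) - 1 - i))"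
    unfolding leading_def coeff_char_pf_alt_mat[OF two] mon .
next
  fix i j assume "i \<in> {..<CARD('n)}" "j \<in> {..<CARD('n)}" and ij: "i \<noteq> j"
  then have i: "i < CARD('n)" and j: "j < CARD('n)" by auto
  have "i = j" if "edge_at (refl_match i) a = edge_at (refl_match j) b" "a \<in> low_pairs i" "b \<in> low_pairs j" for a b :: 'n
    using that(1) low_pairs_edge(1)[OF i that(2)] low_pairs_edge(1)[OF j that(3)]
    unfolding edge_at_def edge_var_eq doubleton_eq_iff by (auto simp: add.commute)
  then show "lead_vars i \<inter> (lead_vars j :: 'n exotic_coord set) = {}"
    using ij by (auto simp: lead_vars_def)
qed simp

text \<open>The substitution \<open>\<sigma>\<close> puts a generic alternating matrix in place of
  the coordinates. It is the identity modulo \<open>I\<close> and maps \<open>I\<close> into the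
  ideal of the Pfaffian coefficients in independent variables, which is radical by its leading
  monomials.\<close>

theorem radical_exotic_generators:
  assumes two: "(2::'k::alg_closed_field) = 0"
  defines "I \<equiv> ideal_gen (alternating_relations \<union>
    (\<lambda>m. Polynomial.coeff (char_pf (\<chi> i j. Var (Inr (i, j)))) m) ` {..<CARD('n)}) :: ('n::finite exotic_coord, 'k) mpoly set"
  shows "radical_ideal I = I"
proof (intro equalityI subsetI)
  fix f assume "f \<in> radical_ideal I"
  then obtain N where N: "f ^ N \<in> I" by (auto simp: radical_ideal_def)
  have I: "is_ideal I" unfolding I_def by (rule ideal.subspace_span)
  let ?V = "\<lambda>c. Var c :: ('n exotic_coord, 'k) mpoly"
  let ?Z = "alt_mat (\<lambda>i j. ?V (Inr (i, j)))"
  define \<sigma> where "\<sigma> = subst (case_sum (\<lambda>i. ?V (Inl i)) (\<lambda>(i, j). ?Z $ i $ j))"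
  have \<sigma>: "ring_hom_on \<sigma>" by (simp add: \<sigma>_def)
  have r1: "?V (Inr (i, i)) \<in> I" for i
    unfolding I_def by (intro ideal.span_base) (auto simp: alternating_relations_def)
  have r2: "?V (Inr (i, j)) + ?V (Inr (j, i)) \<in> I" for i j
    unfolding I_def by (intro ideal.span_base) (auto simp: alternating_relations_def)
  have ZV: "mat_cong I ?Z (\<chi> i j. ?V (Inr (i, j)))"
  proof -
    have "?Z $ i $ j - ?V (Inr (i, j)) \<in> I" for i j
    proof -
      have "idx i = idx j \<or> idx i < idx j \<or> idx j < idx i" by linarith
      then show ?thesis
        using r1[of i] r2[of i j] ideal.subspace_neg[OF I, of "?V (Inr (i, i))"] ideal.subspace_0[OF I]
          ideal.subspace_neg[OF I, of "?V (Inr (j, i)) + ?V (Inr (i, j))"] r2[of j i]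
        by (auto simp: alt_mat_def)
    qed
    then show ?thesis by (simp add: mat_cong_def)
  qed
  have \<sigma>I: "p - \<sigma> p \<in> I" for p
  proof -
    have "subst Var p - \<sigma> p \<in> I" unfolding \<sigma>_def
    proof (rule ideal_cong_subst[OF I])
      fix v show "?V v - case_sum (\<lambda>i. ?V (Inl i)) (\<lambda>(i, j). ?Z $ i $ j) v \<in> I"
        using mat_cong_sym[OF I ZV] by (cases v) (auto simp: mat_cong_def ideal.subspace_0[OF I])
    qed
    then show ?thesis by simp
  qed
  let ?q = "\<lambda>m. Polynomial.coeff (char_pf ?Z) m"
  interpret L: coprime_leading "wt :: 'n exotic_coord \<Rightarrow> nat" "{..<CARD('n)}" "\<lambda>i. ?q (CARD('n) - 1 - i)" lead_vars
    by (rule coprime_leading_pf[OF two])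
  let ?K = "ideal_gen ((\<lambda>i. ?q (CARD('n) - 1 - i)) ` {..<CARD('n)})"
  have K: "is_ideal ?K" by (rule ideal.subspace_span)
  have qK: "?q m \<in> ?K" if "m < CARD('n)" for m
    using that by (intro ideal.span_base image_eqI[of _ _ "CARD('n) - 1 - m"]) auto
  have "\<sigma> p \<in> ?K" if "p \<in> I" for p
  proof (rule hom_ideal_gen[OF \<sigma> K _ that[unfolded I_def]])
    fix p assume "p \<in> alternating_relations \<union> (\<lambda>m. Polynomial.coeff (char_pf (\<chi> i j. ?V (Inr (i, j)))) m) ` {..<CARD('n)}"
    then consider "p \<in> alternating_relations" | m where "m < CARD('n)" "p = Polynomial.coeff (char_pf (\<chi> i j. ?V (Inr (i, j)))) m"
      by blast
    then show "\<sigma> p \<in> ?K"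
    proof cases
      case 1
      then have "\<sigma> p = 0"
        using alternating_alt_mat[of "\<lambda>i j. ?V (Inr (i, j))"]
        by (auto simp: alternating_relations_def \<sigma>_def subst_simps alt_mat_def)
      then show ?thesis by (simp add: ideal.span_zero)
    next
      case 2
      have "map_mat \<sigma> (\<chi> i j. ?V (Inr (i, j))) = ?Z" by (simp add: vec_eq_iff \<sigma>_def)
      then show ?thesis using 2 qK by (simp add: coeff_char_pf_hom[OF \<sigma>])
    qed
  qed
  then have "\<sigma> f ^ N \<in> ?K" using N by (simp flip: ring_hom_onD(9)[OF \<sigma>])
  then have "\<sigma> f \<in> radical_ideal ?K" by (auto simp: radical_ideal_def)
  then have "\<sigma> f \<in> ?K" by (simp only: L.radical)
  moreover have "?K \<subseteq> I"
  proof -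
    have "?q m \<in> I" if m: "m < CARD('n)" for m
    proof -
      have "Polynomial.coeff (char_pf (\<chi> i j. ?V (Inr (i, j)))) m \<in> I"
        unfolding I_def by (intro ideal.span_base) (use m in auto)
      then show ?thesis using ideal_diff_mem_iff[OF I char_pf_cong[OF I ZV]] by blast
    qed
    then show ?thesis using I by (intro ideal.span_minimal) auto
  qed
  ultimately show "f \<in> I" using \<sigma>I[of f] ideal_diff_mem_iff[OF I] by blast
next
  fix f assume "f \<in> I"
  then show "f \<in> radical_ideal I" unfolding radical_ideal_def by (auto intro: exI[of _ 1])
qed

section \<open>Nilpotent matrices\<close>

abbreviation mat_iter :: "'r::comm_ring_1 ^ 'i::finite ^ 'i \<Rightarrow> nat \<Rightarrow> 'r ^ 'i \<Rightarrow> 'r ^ 'i" where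
  "mat_iter A n \<equiv> ((*v) A) ^^ n"

lemma mat_iter_power: "((**) A ^^ n) (mat 1) *v u = mat_iter A n u"
  by (induction n) (simp_all flip: matrix_vector_mul_assoc)

lemma mat_iter_commute: "mat_iter A n (A *v u) = A *v mat_iter A n u"
  by (induction n) auto

lemma mat_iter_0 [simp]: "mat_iter A n 0 = 0"
  by (induction n) auto

lemma mat_iter_add: "mat_iter A (m + n) u = mat_iter A m (mat_iter A n u)"
  by (simp add: funpow_add)

lemma mat_iter_vanish: "mat_iter A m u = 0 \<Longrightarrow> m \<le> n \<Longrightarrow> mat_iter A n u = 0"
  using mat_iter_add[where A = A and m = "n - m" and n = m and u = u] by simp

lemma matrix_eq_0_iff: "A = 0 \<longleftrightarrow> (\<forall>u. A *v u = 0)" for A :: "'r::comm_ring_1 ^ 'i::finite ^ 'm"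
proof
  assume a: "\<forall>u. A *v u = 0"
  have "A $ i $ j = (A *v axis j 1) $ i" for i j
    by (simp add: matrix_vector_mult_def axis_def if_distrib cong: if_cong)
  then show "A = 0" using a by (simp add: vec_eq_iff)
qed simp

definition poly_act :: "'k::field ^ 'i::finite ^ 'i \<Rightarrow> 'k poly \<Rightarrow> 'k ^ 'i \<Rightarrow> 'k ^ 'i" where
  "poly_act A q u = (\<Sum>i\<le>Polynomial.degree q. Polynomial.coeff q i *s mat_iter A i u)"

lemma poly_act_superset:
  "Polynomial.degree q \<le> n \<Longrightarrow> poly_act A q u = (\<Sum>i\<le>n. Polynomial.coeff q i *s mat_iter A i u)"
  unfolding poly_act_def by (rule sum.mono_neutral_left) (auto simp: Polynomial.coeff_eq_0)

lemma poly_act_pCons: "poly_act A (pCons c q) u = c *s u + A *v poly_act A q u"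
proof -
  have "poly_act A (pCons c q) u = (\<Sum>i\<le>Suc (Polynomial.degree q). Polynomial.coeff (pCons c q) i *s mat_iter A i u)"
    by (rule poly_act_superset) (rule degree_pCons_le)
  also have "\<dots> = c *s u + (\<Sum>i\<le>Polynomial.degree q. Polynomial.coeff q i *s (A *v mat_iter A i u))"
    unfolding sum.atMost_Suc_shift by simp
  also have "(\<Sum>i\<le>Polynomial.degree q. Polynomial.coeff q i *s (A *v mat_iter A i u)) = A *v poly_act A q u"
    by (simp add: poly_act_def vec.linear_sum[OF matrix_vector_mul_linear_gen] vec.linear_scale[OF matrix_vector_mul_linear_gen])
  finally show ?thesis .
qed

lemma poly_act_0 [simp]: "poly_act A 0 u = 0" by (simp add: poly_act_def)

lemma poly_act_add: "poly_act A (p + q) u = poly_act A p u + poly_act A q u"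
proof -
  let ?n = "max (Polynomial.degree p) (Polynomial.degree q)"
  have "Polynomial.degree (p + q) \<le> ?n" by (rule degree_add_le_max)
  then show ?thesis
    by (simp add: poly_act_superset[of _ ?n] vec.scale_left_distrib sum.distrib)
qed

lemma poly_act_smult: "poly_act A (Polynomial.smult a p) u = a *s poly_act A p u"
  by (simp add: poly_act_superset[of _ "Polynomial.degree p"] degree_smult_le vec.scale_sum_right)

lemma poly_act_linear_factor:
  "poly_act A ([:- a, 1:] * q) u = A *v poly_act A q u - a *s poly_act A q u"
proof -
  have "[:- a, 1:] * q = pCons 0 q + Polynomial.smult (- a) q" by simp
  then show ?thesis by (simp only: poly_act_add poly_act_smult poly_act_pCons) (simp add: vec.scale_minus_left)
qed

lemma poly_act_commute: "A *v poly_act A q u = poly_act A q (A *v u)"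
  by (simp add: poly_act_def vec.linear_sum[OF matrix_vector_mul_linear_gen]
    vec.linear_scale[OF matrix_vector_mul_linear_gen] mat_iter_commute)

lemma nilpotent_on_vector:
  fixes A :: "'k::alg_closed_field ^ 'i::finite ^ 'i"
  assumes eig: "\<And>a u. a \<noteq> 0 \<Longrightarrow> A *v u = a *s u \<Longrightarrow> u = 0"
    and "q \<noteq> 0" "poly_act A q u = 0"
  shows "mat_iter A (Polynomial.degree q) u = 0"
  using assms(2,3)
proof (induction "Polynomial.degree q" arbitrary: q u rule: less_induct)
  case less
  show ?case
  proof (cases "Polynomial.degree q = 0")
    case True
    then obtain c where "q = [:c:]" by (metis degree_eq_zeroE)
    then have "c \<noteq> 0" "c *s u = 0" using less.prems by (auto simp: poly_act_pCons)
    then show ?thesis using True by (simp add: vec.scale_eq_0_iff)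
  next
    case False
    then obtain a where "poly q a = 0" using alg_closed_imp_poly_has_root by blast
    then obtain r where q: "q = [:- a, 1:] * r" using poly_eq_0_iff_dvd by blast
    have r0: "r \<noteq> 0" using less.prems q by auto
    then have deg: "Polynomial.degree q = Suc (Polynomial.degree r)"
      unfolding q by (subst degree_mult_eq) auto
    have e: "A *v poly_act A r u = a *s poly_act A r u"
      using less.prems(2) unfolding q poly_act_linear_factor by simp
    show ?thesis
    proof (cases "a = 0")
      case True
      then have "poly_act A r (A *v u) = 0" using e by (simp add: poly_act_commute)
      then have "mat_iter A (Polynomial.degree r) (A *v u) = 0"
        using less.hyps[of r "A *v u"] deg r0 by simp
      then show ?thesis by (simp add: deg mat_iter_commute)
    next
      case False
      then have "poly_act A r u = 0" using eig e by blast
      then have "mat_iter A (Polynomial.degree r) u = 0" using less.hyps[of r u] deg r0 by simp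
      then show ?thesis using deg mat_iter_vanish by fastforce
    qed
  qed
qed

text \<open>The first \<open>CARD('i) + 1\<close> iterates of \<open>u\<close> are too many to be
  independent. If two of them coincide they form a smaller set, and a difference of two monomials is
  taken instead.\<close>

lemma ex_annihilator:
  fixes A :: "'k::field ^ 'i::finite ^ 'i"
  shows "\<exists>q. q \<noteq> 0 \<and> Polynomial.degree q \<le> CARD('i) \<and> poly_act A q u = 0"
proof (cases "inj_on (\<lambda>i. mat_iter A i u) {..CARD('i)}")
  case True
  let ?S = "(\<lambda>i. mat_iter A i u) ` {..CARD('i)}"
  have "card ?S = Suc (CARD('i))" using True by (simp add: card_image)
  then have "vec.dependent ?S"
    using vec.independent_card_le_dim[of ?S UNIV] by (auto simp: vec_dim_card card_cart_basis)
  then obtain c where c: "\<exists>v\<in>?S. c v \<noteq> 0" "(\<Sum>v\<in>?S. c v *s v) = 0"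
    using vec.dependent_finite[of ?S] by auto
  define q where "q = (\<Sum>i\<le>CARD('i). Polynomial.monom (c (mat_iter A i u)) i)"
  have co: "Polynomial.coeff q i = (if i \<le> CARD('i) then c (mat_iter A i u) else 0)" for i
    by (simp add: q_def Polynomial.coeff_sum)
  have deg: "Polynomial.degree q \<le> CARD('i)" by (rule degree_le) (simp add: co)
  have "poly_act A q u = (\<Sum>i\<le>CARD('i). c (mat_iter A i u) *s mat_iter A i u)"
    unfolding poly_act_superset[OF deg] by (rule sum.cong) (auto simp: co)
  also have "\<dots> = (\<Sum>v\<in>?S. c v *s v)" using True by (simp add: sum.reindex)
  finally have "poly_act A q u = 0" using c by simp
  moreover have "q \<noteq> 0" using c(1) co by (metis (no_types, lifting) atMost_iff coeff_0 imageE)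
  ultimately show ?thesis using deg by blast
next
  case False
  then obtain i j where ij: "i \<le> CARD('i)" "j \<le> CARD('i)" "i \<noteq> j" "mat_iter A i u = mat_iter A j u"
    by (auto simp: inj_on_def)
  have m: "poly_act A (Polynomial.monom 1 i) u = mat_iter A i u" for i
    by (induction i arbitrary: u) (simp_all add: poly_act_pCons Polynomial.monom_0 Polynomial.monom_Suc)
  define q where "q = Polynomial.monom 1 i + Polynomial.smult (- 1) (Polynomial.monom (1::'k) j)"
  have "poly_act A q u = 0" using ij unfolding q_def poly_act_add poly_act_smult m by (simp add: vec.scale_minus_left)
  moreover have "Polynomial.coeff q i = 1" using ij by (simp add: q_def)
  then have "q \<noteq> 0" by auto
  moreover have "Polynomial.degree q \<le> CARD('i)"
    using ij unfolding q_def by (intro degree_add_le order.trans[OF degree_smult_le] order.trans[OF degree_monom_le])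
  ultimately show ?thesis by blast
qed

text \<open>The eigenvalue form suits conjugation and perturbation; the form with a uniform exponent
  exhibits nilpotency as a closed condition.\<close>

lemma nilpotent_iff_eigenvalues:
  fixes A :: "'k::alg_closed_field ^ 'i::finite ^ 'i"
  shows "nilpotent_matrix A \<longleftrightarrow> (\<forall>a u. a \<noteq> 0 \<longrightarrow> A *v u = a *s u \<longrightarrow> u = 0)"
    and "nilpotent_matrix A \<longleftrightarrow> (\<forall>u. mat_iter A CARD('i) u = 0)"
proof -
  have 1: "u = 0" if "nilpotent_matrix A" "a \<noteq> 0" "A *v u = a *s u" for a u
  proof -
    obtain m where "((**) A ^^ m) (mat 1) = 0" using \<open>nilpotent_matrix A\<close> unfolding nilpotent_matrix_def by blast
    then have "mat_iter A m u = 0" by (metis mat_iter_power matrix_vector_mult_0)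
    moreover have "mat_iter A m u = a ^ m *s u"
      by (induction m) (auto simp: vec.linear_scale[OF matrix_vector_mul_linear_gen] that(3) mult.commute)
    ultimately show "u = 0" using that(2) by (simp add: vec.scale_eq_0_iff)
  qed
  have 2: "mat_iter A CARD('i) u = 0" if "\<forall>a u. a \<noteq> 0 \<longrightarrow> A *v u = a *s u \<longrightarrow> u = 0" for u
  proof -
    obtain q where q: "q \<noteq> 0" "Polynomial.degree q \<le> CARD('i)" "poly_act A q u = 0"
      using ex_annihilator by blast
    have "mat_iter A (Polynomial.degree q) u = 0" by (rule nilpotent_on_vector) (use that q in auto)
    then show ?thesis using mat_iter_vanish q by blast
  qed
  have 3: "nilpotent_matrix A" if "\<forall>u. mat_iter A CARD('i) u = 0"
    unfolding nilpotent_matrix_def matrix_eq_0_iff mat_iter_power using that by blast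
  let ?E = "\<forall>a u. a \<noteq> 0 \<longrightarrow> A *v u = a *s u \<longrightarrow> u = 0"
  let ?V = "\<forall>u. mat_iter A CARD('i) u = 0"
  have a: "nilpotent_matrix A \<Longrightarrow> ?E" by (intro allI impI) (rule 1)
  have b: "?E \<Longrightarrow> ?V" by (intro allI) (rule 2)
  show "nilpotent_matrix A \<longleftrightarrow> ?E" by (rule iffI[OF a]) (assumption, rule 3[OF b])
  show "nilpotent_matrix A \<longleftrightarrow> ?V" by (rule iffI[OF b[OF a]]) (assumption, rule 3)
qed

section \<open>Bilinear forms\<close>

definition bil :: "'r::comm_ring_1 ^ 'i::finite ^ 'i \<Rightarrow> 'r ^ 'i \<Rightarrow> 'r ^ 'i \<Rightarrow> 'r" where
  "bil M u w = (\<Sum>i\<in>UNIV. \<Sum>j\<in>UNIV. u $ i * M $ i $ j * w $ j)"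

lemma bil_add: "bil M (u + u') w = bil M u w + bil M u' w" "bil M u (w + w') = bil M u w + bil M u w'"
  by (simp_all add: bil_def algebra_simps sum.distrib)

lemma bil_scale: "bil M (c *s u) w = c * bil M u w" "bil M u (c *s w) = c * bil M u w"
  by (simp_all add: bil_def sum_distrib_left mult_ac)

lemma bil_0 [simp]: "bil M 0 w = 0" "bil M u 0 = 0"
  by (simp_all add: bil_def)

lemma bil_diff: "bil M (u - u') w = bil M u w - bil M u' w" "bil M u (w - w') = bil M u w - bil M u w'"
  by (simp_all add: bil_def algebra_simps sum_subtractf)

lemma bil_sum: "bil M (\<Sum>a\<in>A. h a) w = (\<Sum>a\<in>A. bil M (h a) w)" "bil M u (\<Sum>a\<in>A. h a) = (\<Sum>a\<in>A. bil M u (h a))"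
  by (induction A rule: infinite_finite_induct) (auto simp: bil_add)

lemma bil_mult: "bil M u (A *v w) = bil (M ** A) u w"
proof -
  have "bil (M ** A) u w = (\<Sum>i\<in>UNIV. \<Sum>j\<in>UNIV. \<Sum>k\<in>UNIV. u $ i * (M $ i $ k * A $ k $ j) * w $ j)"
    by (simp add: bil_def matrix_matrix_mult_def sum_distrib_left sum_distrib_right)
  also have "\<dots> = (\<Sum>i\<in>UNIV. \<Sum>k\<in>UNIV. \<Sum>j\<in>UNIV. u $ i * (M $ i $ k * A $ k $ j) * w $ j)"
    by (intro sum.cong refl sum.swap)
  also have "\<dots> = bil M u (A *v w)"
    by (simp add: bil_def matrix_vector_mult_def sum_distrib_left mult_ac)
  finally show ?thesis by simp
qed

lemma bil_alternating:
  assumes "alternating M"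
  shows "bil M u w = - bil M w u" "bil M u u = 0"
proof -
  have "bil M u w = (\<Sum>i\<in>UNIV. \<Sum>j\<in>UNIV. - (w $ j * M $ j $ i * u $ i))"
    unfolding bil_def by (intro sum.cong refl) (subst alternatingD(2)[OF assms], simp add: mult_ac)
  also have "\<dots> = - bil M w u" unfolding bil_def sum_negf by (subst sum.swap) simp
  finally show "bil M u w = - bil M w u" .
  show "bil M u u = 0" unfolding bil_def
  proof (rule sum_alternating)
    fix k l show "u $ k * M $ k $ l * u $ l = - (u $ l * M $ l $ k * u $ k)"
      by (subst alternatingD(2)[OF assms]) (simp add: mult_ac)
  qed (auto simp: alternatingD(1)[OF assms])
qed

lemma bil_entry: "(transpose b ** M ** c) $ k $ l = bil M (column k b) (column l c)"
  by (simp add: matrix_matrix_mult_def transpose_def bil_def column_def sum_distrib_right)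
    (rule sum.swap)

lemma bil_axis: "bil M (axis i 1) w = (M *v w) $ i"
proof -
  have "bil M (axis i 1) w = (\<Sum>k\<in>UNIV. axis i 1 $ k * (M *v w) $ k)"
    by (simp add: bil_def matrix_vector_mult_def sum_distrib_left mult.assoc)
  also have "\<dots> = (\<Sum>k\<in>UNIV. if k = i then (M *v w) $ k else 0)"
    by (rule sum.cong) (auto simp: axis_def)
  finally show ?thesis by simp
qed

abbreviation form :: "'r::comm_ring_1 ^ ('n + 'n::finite) \<Rightarrow> 'r ^ ('n + 'n) \<Rightarrow> 'r" where
  "form \<equiv> bil symplectic_form"

lemma form_nondegenerate:
  fixes w :: "'r::comm_ring_1 ^ ('n + 'n::finite)"
  assumes "\<And>u. form u w = 0"
  shows "w = 0"
proof -
  have "symplectic_form *v w = 0" using assms[of "axis _ 1"] by (simp add: bil_axis vec_eq_iff)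
  then have "symplectic_form *v (symplectic_form *v w) = 0" by simp
  then have "(- mat 1) *v w = 0" by (simp only: matrix_vector_mul_assoc symplectic_square)
  moreover have "(- mat 1) *v w = - w"
    by (simp add: vec_eq_iff matrix_vector_mult_def mat_def if_distrib[of "\<lambda>x. - x"] if_distribR
      if_distrib[of "\<lambda>x. x * _"] cong: if_cong)
  ultimately show ?thesis by simp
qed

section \<open>Points of the exotic nilpotent cone\<close>

definition vpart :: "('n::finite exotic_coord \<Rightarrow> 'r) \<Rightarrow> 'r ^ ('n + 'n)" where
  "vpart z = (\<chi> i. z (Inl i))"

definition mpart :: "('n::finite exotic_coord \<Rightarrow> 'r) \<Rightarrow> 'r ^ ('n + 'n) ^ ('n + 'n)" where
  "mpart z = (\<chi> i j. z (Inr (i, j)))"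

definition exotic_points :: "('n::finite exotic_coord \<Rightarrow> 'k::field) set" where
  "exotic_points = {z. alternating (mpart z) \<and> nilpotent_matrix (mpart z ** symplectic_form)}"

lemma parts_eqI: "vpart z = vpart z' \<Longrightarrow> mpart z = mpart z' \<Longrightarrow> z = z'"
  by (rule ext, rename_tac c, case_tac c) (auto simp: vpart_def mpart_def vec_eq_iff)

lemma vpart_act: "vpart (exotic_act g z) = g *v vpart z"
  and mpart_act: "mpart (exotic_act g z) = g ** mpart z ** transpose g"
  by (simp_all add: vpart_def mpart_def exotic_act_def vec_eq_iff)

lemma exotic_act_mult: "exotic_act (g ** h) z = exotic_act g (exotic_act h z)"
  by (rule parts_eqI) (simp_all add: vpart_act mpart_act matrix_vector_mul_assoc matrix_mul_assoc matrix_transpose_mul)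

lemma exotic_act_1 [simp]: "exotic_act (mat 1) z = z"
  by (rule parts_eqI) (simp_all add: vpart_act mpart_act)

section \<open>The symplectic group and its form\<close>

definition sp_inv :: "'r::comm_ring_1 ^ ('n + 'n::finite) ^ ('n + 'n) \<Rightarrow> 'r ^ ('n + 'n) ^ ('n + 'n)" where
  "sp_inv g = - (symplectic_form ** transpose g ** symplectic_form)"

lemma SpD: "g \<in> Sp \<Longrightarrow> transpose g ** symplectic_form ** g = symplectic_form"
  by (simp add: Sp_def)

lemma sp_inv_left: "g \<in> Sp \<Longrightarrow> sp_inv g ** g = mat 1"
proof -
  assume "g \<in> Sp"
  have "sp_inv g ** g = - (symplectic_form ** (transpose g ** symplectic_form ** g))"
    by (simp add: sp_inv_def matrix_mult_neg matrix_mul_assoc)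
  then show ?thesis by (simp add: SpD[OF \<open>g \<in> Sp\<close>] symplectic_square)
qed

lemma sp_inv_right: "g \<in> Sp \<Longrightarrow> g ** sp_inv g = (mat 1 :: 'k::field ^ ('n + 'n::finite) ^ ('n + 'n))"
  using sp_inv_left matrix_left_right_inverse by blast

lemma Sp_mult: "g \<in> Sp \<Longrightarrow> h \<in> Sp \<Longrightarrow> g ** h \<in> Sp"
proof -
  assume g: "g \<in> Sp" and h: "h \<in> Sp"
  have "transpose (g ** h) ** symplectic_form ** (g ** h) = transpose h ** (transpose g ** symplectic_form ** g) ** h"
    by (simp add: matrix_transpose_mul matrix_mul_assoc)
  then show ?thesis by (simp add: SpD[OF g] SpD[OF h] Sp_def)
qed

lemma Sp_1 [simp]: "mat 1 \<in> Sp"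
  by (simp add: Sp_def)

lemma Sp_sp_inv: "g \<in> Sp \<Longrightarrow> sp_inv g \<in> (Sp :: ('k::field ^ ('n + 'n::finite) ^ ('n + 'n)) set)"
proof -
  assume g: "g \<in> Sp"
  let ?h = "sp_inv g"
  have "transpose ?h ** symplectic_form ** ?h = transpose ?h ** (transpose g ** symplectic_form ** g) ** ?h"
    by (simp add: SpD[OF g])
  also have "\<dots> = transpose (g ** ?h) ** symplectic_form ** (g ** ?h)"
    by (simp add: matrix_transpose_mul matrix_mul_assoc)
  also have "\<dots> = symplectic_form" by (simp add: sp_inv_right[OF g])
  finally show ?thesis by (simp add: Sp_def)
qed

lemma form_Sp: "g \<in> Sp \<Longrightarrow> form (g *v u) (g *v w) = form u w"
proof -
  assume g: "g \<in> Sp"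
  have t: "bil M (g *v u) w = bil (transpose g ** M) u w" for M w
  proof -
    have "bil M (g *v u) w = bil (transpose M) w (g *v u)" for M :: "'a ^ ('b + 'b) ^ ('b + 'b)"
      unfolding bil_def transpose_def by (subst sum.swap) (simp add: mult_ac)
    moreover have "bil (transpose M ** g) w u = bil (transpose g ** M) u w"
      unfolding bil_def by (subst sum.swap) (simp add: transpose_def matrix_matrix_mult_def mult_ac)
    ultimately show ?thesis by (simp add: bil_mult)
  qed
  show ?thesis by (simp add: t bil_mult matrix_mul_assoc SpD[OF g])
qed

lemma alternating_neg: "alternating M \<Longrightarrow> alternating (- M)"
proof -
  assume M: "alternating M"
  have "(- M) $ i $ j = - (- M) $ j $ i" for i j using alternatingD(2)[OF M, of i j] by simp
  then show ?thesis unfolding alternating_def using alternatingD(1)[OF M] by simp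
qed

text \<open>\<open>J x J\<close> is alternating along with \<open>x\<close>, where \<open>J\<close>
  is the symplectic form.\<close>

lemma form_adjoint:
  fixes x :: "'r::comm_ring_1 ^ ('n + 'n::finite) ^ ('n + 'n)"
  assumes "alternating x"
  shows "form ((x ** symplectic_form) *v u) w = form u ((x ** symplectic_form) *v w)"
    and "form u ((x ** symplectic_form) *v u) = 0"
proof -
  let ?J = "symplectic_form :: 'r ^ ('n + 'n) ^ ('n + 'n)"
  have "?J ** x ** transpose ?J = - (?J ** x ** ?J)"
    by (simp add: transpose_symplectic matrix_mult_neg)
  then have alt: "alternating (?J ** x ** ?J)"
    using alternating_neg[OF alternating_congruence[OF assms, of ?J]] by simp
  have "form ((x ** ?J) *v u) w = - form w ((x ** ?J) *v u)" by (rule bil_alternating) simp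
  also have "\<dots> = form u ((x ** ?J) *v w)"
    using bil_alternating(1)[OF alt, of w u] by (simp add: bil_mult matrix_mul_assoc)
  finally show "form ((x ** ?J) *v u) w = form u ((x ** ?J) *v w)" .
  show "form u ((x ** ?J) *v u) = 0"
    using bil_alternating(2)[OF alt, of u] by (simp add: bil_mult matrix_mul_assoc)
qed

text \<open>Self-adjointness distributes the iterates evenly over both sides, leaving a value
  \<open>form w w\<close> or \<open>form w (A w)\<close>; both vanish.\<close>

lemma form_iter:
  fixes x :: "'r::comm_ring_1 ^ ('n + 'n::finite) ^ ('n + 'n)"
  assumes "alternating x"
  defines "A \<equiv> x ** symplectic_form"
  shows "form (mat_iter A i u) (mat_iter A j u) = 0"
proof -
  have adj: "form (mat_iter A i u) w = form u (mat_iter A i w)" for i u w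
    by (induction i arbitrary: w) (simp_all add: A_def form_adjoint(1)[OF assms(1)] mat_iter_commute)
  have e: "form (mat_iter A i u) (mat_iter A j u) = form u (mat_iter A (i + j) u)"
    by (simp add: adj mat_iter_add)
  define l where "l = (i + j) div 2"
  have "i + j = l + l \<or> i + j = l + Suc l" unfolding l_def by presburger
  then have "form u (mat_iter A (i + j) u) = form (mat_iter A l u) (mat_iter A l u) \<or>
    form u (mat_iter A (i + j) u) = form (mat_iter A l u) (A *v mat_iter A l u)"
    by (elim disjE) (simp_all only: adj mat_iter_add funpow.simps comp_apply, simp_all)
  then have "form u (mat_iter A (i + j) u) = 0"
    using form_adjoint(2)[OF assms(1)] bil_alternating(2)[OF alternating_symplectic] unfolding A_def by auto
  then show ?thesis using e by simp
qed

text \<open>A flag of isotropic subspaces that is strictly stable under a nilpotent \<open>A = x J\<close> and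
  orthogonal to \<open>v, A v, A\<^sup>2 v, \<dots>\<close> is built one hyperbolic pair at a time.\<close>

lemma adapted_symplectic_basis:
  fixes x :: "'k::field ^ ('n + 'n::finite) ^ ('n + 'n)" and v :: "'k ^ ('n + 'n)" and S :: "'n set"
  assumes x: "alternating x" and nil: "\<And>u. mat_iter (x ** symplectic_form) N u = 0"
  defines "A \<equiv> x ** symplectic_form"
  shows "\<exists>e f \<rho>. \<forall>a\<in>S. \<forall>c\<in>S. form (e a) (e c) = 0 \<and> form (f a) (f c) = 0 \<and>
     form (e a) (f c) = (if a = c then 1 else 0) \<and> (\<forall>j. form (e a) (mat_iter A j v) = 0) \<and>
     A *v e c = (\<Sum>b\<in>S. form (A *v e c) (f b) *s e b) \<and>
     (\<rho> a \<le> \<rho> c \<longrightarrow> form (A *v e c) (f a) = 0) \<and> \<rho> a + card S > CARD('n)"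
proof -
  have "finite S" by simp
  then show ?thesis
  proof (induction S)
  case empty
  show ?case by simp
next
  case (insert a0 S)
  then obtain e f :: "'n \<Rightarrow> 'k ^ ('n + 'n)" and \<rho> where
    ee: "\<And>a c. a \<in> S \<Longrightarrow> c \<in> S \<Longrightarrow> form (e a) (e c) = 0" and
    ff: "\<And>a c. a \<in> S \<Longrightarrow> c \<in> S \<Longrightarrow> form (f a) (f c) = 0" and
    ef: "\<And>a c. a \<in> S \<Longrightarrow> c \<in> S \<Longrightarrow> form (e a) (f c) = (if a = c then 1 else 0)" and
    ev: "\<And>a j. a \<in> S \<Longrightarrow> form (e a) (mat_iter A j v) = 0" and
    Ae: "\<And>c. c \<in> S \<Longrightarrow> A *v e c = (\<Sum>b\<in>S. form (A *v e c) (f b) *s e b)" and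
    Af: "\<And>a c. a \<in> S \<Longrightarrow> c \<in> S \<Longrightarrow> \<rho> a \<le> \<rho> c \<Longrightarrow> form (A *v e c) (f a) = 0" and
    \<rho>: "\<And>a. a \<in> S \<Longrightarrow> \<rho> a + card S > CARD('n)"
    by blast
  have S: "finite S" "card S < CARD('n)"
    using insert by (auto intro!: psubset_card_mono)
  note skew = bil_alternating(1)[OF alternating_symplectic]
  note self = bil_alternating(2)[OF alternating_symplectic]
  have fe: "form (f a) (e c) = (if a = c then - 1 else 0)" if "a \<in> S" "c \<in> S" for a c
    using ef[OF that(2,1)] by (subst skew) auto
  have sef: "(\<Sum>b\<in>S. h b * form (e b) (f c)) = h c" if "c \<in> S" for h c
  proof -
    have "(\<Sum>b\<in>S. h b * form (e b) (f c)) = (\<Sum>b\<in>S. if b = c then h c else 0)"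
      by (intro sum.cong refl) (simp add: ef[OF _ that])
    then show ?thesis using S that by simp
  qed
  have sfe: "(\<Sum>b\<in>S. h b * form (f b) (e c)) = - h c" if "c \<in> S" for h c
  proof -
    have "(\<Sum>b\<in>S. h b * form (f b) (e c)) = (\<Sum>b\<in>S. if b = c then - h c else 0)"
      by (intro sum.cong refl) (simp add: fe[OF _ that])
    then show ?thesis using S that by simp
  qed
  have adj: "form (A *v u) w = form u (A *v w)" for u w unfolding A_def by (rule form_adjoint(1)[OF x])
  \<comment> \<open>\<open>pr\<close> projects onto the span of the \<open>e\<close> and kills
    whatever is orthogonal to the \<open>f\<close>; with \<open>qr\<close> below,
    \<open>u - pr u + qr u\<close> is orthogonal to all pairs chosen so far.\<close>
  define pr where "pr u = (\<Sum>b\<in>S. form u (f b) *s e b)" for u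
  have pr_e: "pr (e c) = e c" if "c \<in> S" for c
  proof -
    have "pr (e c) = (\<Sum>b\<in>S. if b = c then e c else 0)"
      unfolding pr_def by (intro sum.cong refl) (simp add: ef[OF that])
    then show ?thesis using S that by simp
  qed
  have pr_diff: "pr (u - w) = pr u - pr w" for u w
    by (simp add: pr_def bil_diff vec.scale_left_diff_distrib sum_subtractf)
  have pr_scale: "pr (c *s u) = c *s pr u" for c u
    by (simp add: pr_def bil_scale vec.scale_sum_right)
  have pr_sum: "pr (\<Sum>b\<in>S. h b) = (\<Sum>b\<in>S. pr (h b))" for h
    unfolding pr_def bil_sum vec.scale_sum_left by (rule sum.swap)
  have pr_pr: "pr (pr u) = pr u" for u
    unfolding pr_def[of u] pr_sum pr_scale by (intro sum.cong refl) (simp add: pr_e)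
  have pr_form_e: "form (pr u) (e c) = 0" if "c \<in> S" for u c
    unfolding pr_def bil_sum bil_scale using that ee by simp
  have pr_form_f: "form (pr u) (f c) = form u (f c)" if "c \<in> S" for u c
    unfolding pr_def bil_sum bil_scale by (rule sef[OF that])
  have pr_form_v: "form (pr u) (mat_iter A j v) = 0" for u j
    unfolding pr_def bil_sum bil_scale using ev by simp
  have A_pr: "pr (A *v pr u) = A *v pr u" for u
  proof -
    have "A *v pr u = (\<Sum>b\<in>S. form u (f b) *s (A *v e b))"
      unfolding pr_def by (simp add: vec.linear_sum[OF matrix_vector_mul_linear_gen] vec.linear_scale[OF matrix_vector_mul_linear_gen])
    moreover have "pr (A *v e b) = A *v e b" if "b \<in> S" for b using Ae[OF that] by (simp add: pr_def)
    ultimately show ?thesis by (simp add: pr_sum pr_scale)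
  qed
  define qr where "qr u = (\<Sum>b\<in>S. form u (e b) *s f b)" for u
  have orth: "form (u - pr u + qr u) (e c) = 0" "form (u - pr u + qr u) (f c) = 0" if "c \<in> S" for u c
  proof -
    have "form (qr u) (e c) = - form u (e c)"
      unfolding qr_def bil_sum bil_scale by (rule sfe[OF that])
    moreover have "form (qr u) (f c) = 0"
      unfolding qr_def bil_sum bil_scale using that ff by simp
    ultimately show "form (u - pr u + qr u) (e c) = 0" "form (u - pr u + qr u) (f c) = 0"
      using that by (simp_all add: bil_add bil_diff pr_form_e pr_form_f)
  qed
  define W where "W = {u. (\<forall>a\<in>S. form u (e a) = 0) \<and> (\<forall>j. form u (mat_iter A j v) = 0)}"
  have W_A: "A *v u \<in> W" if "u \<in> W" for u
  proof -
    have "form (A *v u) (e a) = 0" if a: "a \<in> S" for a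
    proof -
      have "form (A *v u) (e a) = form u (\<Sum>b\<in>S. form (A *v e a) (f b) *s e b)"
        unfolding adj[of u] using arg_cong[OF Ae[OF a], of "form u"] .
      then show ?thesis using \<open>u \<in> W\<close> by (simp add: bil_sum bil_scale W_def)
    qed
    moreover have "form (A *v u) (mat_iter A j v) = 0" for j
    proof -
      have "form (A *v u) (mat_iter A j v) = form u (mat_iter A (Suc j) v)" by (simp add: adj)
      moreover have "\<forall>j. form u (mat_iter A j v) = 0" using that by (simp add: W_def)
      ultimately show ?thesis by (simp only:)
    qed
    ultimately show ?thesis by (simp add: W_def)
  qed
  \<comment> \<open>Suppose \<open>W\<close> lies in the span of the \<open>e\<close>. The iterates
    of \<open>v\<close> belong to \<open>W\<close>, hence to this span, so everything orthogonal to
    the span lies in \<open>W\<close> and thus in the span. The \<open>e\<close> and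
    \<open>f\<close> would then generate the whole space, but they are fewer than its
    dimension.\<close>
  have "\<exists>u\<in>W. pr u \<noteq> u"
  proof (rule ccontr)
    assume "\<not> ?thesis"
    then have WL: "\<And>u. u \<in> W \<Longrightarrow> pr u = u" by blast
    have vW: "mat_iter A j v \<in> W" for j
    proof -
      have "form (mat_iter A j v) (e a) = 0" if "a \<in> S" for a
        using ev[OF that, of j] skew[of "mat_iter A j v" "e a"] by simp
      moreover have "form (mat_iter A j v) (mat_iter A i v) = 0" for i
        unfolding A_def by (rule form_iter[OF x])
      ultimately show ?thesis by (simp add: W_def)
    qed
    have orthW: "u \<in> W" if "\<And>a. a \<in> S \<Longrightarrow> form u (e a) = 0" for u
    proof -
      have "form u (mat_iter A j v) = 0" for j
      proof -
        have "form u (mat_iter A j v) = form u (pr (mat_iter A j v))" using WL[OF vW] by simp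
        also have "\<dots> = 0" unfolding pr_def bil_sum bil_scale using that by simp
        finally show ?thesis .
      qed
      then show ?thesis using that by (simp add: W_def)
    qed
    have "y \<in> vec.span (e ` S \<union> f ` S)" for y
    proof -
      let ?y = "y - pr y + qr y"
      have "pr ?y = ?y" by (intro WL orthW) (rule orth(1))
      moreover have "pr ?y = 0" unfolding pr_def[of ?y] using orth(2)[of _ y] by simp
      ultimately have "y = pr y - qr y" by (simp add: algebra_simps add_eq_0_iff)
      moreover have "pr y \<in> vec.span (e ` S \<union> f ` S)" "qr y \<in> vec.span (e ` S \<union> f ` S)"
        unfolding pr_def qr_def by (intro vec.span_sum vec.span_scale vec.span_base, simp)+
      ultimately show ?thesis by (metis vec.span_diff)
    qed
    then have "(UNIV :: ('k ^ ('n + 'n)) set) \<subseteq> vec.span (e ` S \<union> f ` S)" by blast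
    then have "vec.dim (UNIV :: ('k ^ ('n + 'n)) set) \<le> card (e ` S \<union> f ` S)"
      using S by (intro vec.dim_le_card) auto
    moreover have "card (e ` S \<union> f ` S) \<le> card S + card S"
      using card_Un_le[of "e ` S" "f ` S"] card_image_le[OF S(1), of e] card_image_le[OF S(1), of f] by linarith
    ultimately show False using S(2) by (simp add: card_cart_basis)
  qed
  then obtain u where u: "u \<in> W" "pr u \<noteq> u" by blast
  have iterW: "mat_iter A k u \<in> W" for k by (induction k) (auto simp: u W_A)
  \<comment> \<open>Nilpotency drives the iterates of \<open>u\<close> into the span of the
    \<open>e\<close>; the last one outside it, made orthogonal to the \<open>f\<close>, is the next
    basis vector.\<close>
  have "pr (mat_iter A N u) = mat_iter A N u"
    using nil[of u] by (simp add: A_def pr_def)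
  then obtain k where k: "pr (mat_iter A (Suc k) u) = mat_iter A (Suc k) u" "pr (mat_iter A k u) \<noteq> mat_iter A k u"
    using u(2) by (induction N) auto
  define u1 where "u1 = mat_iter A k u"
  define u2 where "u2 = u1 - pr u1"
  have u1: "u1 \<in> W" "pr (A *v u1) = A *v u1" "pr u1 \<noteq> u1" using k iterW by (auto simp: u1_def)
  have u2_0: "u2 \<noteq> 0" using u1(3) by (simp add: u2_def)
  have u2e: "form u2 (e c) = 0" and u2f: "form u2 (f c) = 0" if "c \<in> S" for c
    using that u1(1) by (auto simp: u2_def bil_diff pr_form_e pr_form_f W_def)
  have u2v: "form u2 (mat_iter A j v) = 0" for j
    using u1(1) by (auto simp: u2_def bil_diff pr_form_v W_def)
  have Au2: "pr (A *v u2) = A *v u2"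
    by (simp add: u2_def matrix_vector_mult_diff_distrib pr_diff A_pr u1)
  obtain f0 where f0: "form u2 f0 \<noteq> 0"
  proof (rule ccontr)
    assume no: "\<not> thesis"
    have "form w u2 = 0" for w using no that[of w] skew[of w u2] by fastforce
    then show False using form_nondegenerate[of u2] u2_0 by blast
  qed
  define f1 where "f1 = inverse (form u2 f0) *s (f0 - pr f0 + qr f0)"
  have f1e: "form f1 (e c) = 0" and f1f: "form f1 (f c) = 0" if "c \<in> S" for c
    using orth[OF that, of f0] unfolding f1_def bil_scale by (simp_all only: mult_zero_right)
  have "form u2 (pr f0) = 0" "form u2 (qr f0) = 0"
    unfolding pr_def qr_def bil_sum bil_scale using u2e u2f by auto
  then have u2f1: "form u2 f1 = 1" using f0 unfolding f1_def bil_scale bil_add bil_diff by simp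
  have ef1: "form (e c) f1 = 0" and ff1: "form (f c) f1 = 0" and eu2: "form (e c) u2 = 0" and fu2: "form (f c) u2 = 0"
    if "c \<in> S" for c
    using f1e[OF that] f1f[OF that] u2e[OF that] u2f[OF that] skew[of "e c" f1] skew[of "f c" f1]
      skew[of "e c" u2] skew[of "f c" u2] by auto
  have prf1: "form (pr w) f1 = 0" for w unfolding pr_def bil_sum bil_scale using ef1 by simp
  have Aef1: "form (A *v e c) f1 = 0" if "c \<in> S" for c
    using prf1[of "A *v e c"] Ae[OF that] by (simp add: pr_def)
  have Au2f1: "form (A *v u2) f1 = 0" using prf1[of "A *v u2"] Au2 by simp
  \<comment> \<open>The new vector gets a rank below all earlier ones, since \<open>A\<close> maps
    it into their span: \<open>A\<close> raises ranks. Starting at \<open>CARD('n)\<close> keeps the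
    ranks positive until the basis is complete.\<close>
  let ?e = "e(a0 := u2)" and ?f = "f(a0 := f1)" and ?\<rho> = "\<rho>(a0 := CARD('n) - card S)"
  have a0: "a0 \<notin> S" using insert by blast
  then have ne: "c \<noteq> a0" if "c \<in> S" for c using that by blast
  have sum': "(\<Sum>b\<in>insert a0 S. form w (?f b) *s ?e b) = form w f1 *s u2 + pr w" for w
    using a0 S(1) by (simp add: pr_def) (intro sum.cong refl, auto)
  have "\<forall>a\<in>insert a0 S. \<forall>c\<in>insert a0 S. form (?e a) (?e c) = 0 \<and> form (?f a) (?f c) = 0 \<and>
     form (?e a) (?f c) = (if a = c then 1 else 0) \<and> (\<forall>j. form (?e a) (mat_iter A j v) = 0) \<and>
     A *v ?e c = (\<Sum>b\<in>insert a0 S. form (A *v ?e c) (?f b) *s ?e b) \<and>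
     (?\<rho> a \<le> ?\<rho> c \<longrightarrow> form (A *v ?e c) (?f a) = 0) \<and> ?\<rho> a + card (insert a0 S) > CARD('n)"
  proof (intro ballI conjI)
    fix a c assume a: "a \<in> insert a0 S" and c: "c \<in> insert a0 S"
    show "form (?e a) (?e c) = 0" "form (?f a) (?f c) = 0" "form (?e a) (?f c) = (if a = c then 1 else 0)"
      using a c ee ff ef u2e eu2 f1f ff1 u2f1 u2f ef1 self a0 by auto
    show "\<forall>j. form (?e a) (mat_iter A j v) = 0" using a u2v ev a0 by auto
    have Aec: "pr (A *v ?e c) = A *v ?e c" and Aec1: "form (A *v ?e c) f1 = 0"
      using c Au2 Ae Aef1 Au2f1 a0 by (auto simp: pr_def)
    show "A *v ?e c = (\<Sum>b\<in>insert a0 S. form (A *v ?e c) (?f b) *s ?e b)"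
      unfolding sum' Aec Aec1 by simp
    show "?\<rho> a \<le> ?\<rho> c \<longrightarrow> form (A *v ?e c) (?f a) = 0"
    proof
      assume le: "?\<rho> a \<le> ?\<rho> c"
      show "form (A *v ?e c) (?f a) = 0"
      proof (cases "a = a0")
        case True
        then show ?thesis using Aec1 by simp
      next
        case False
        then have "a \<in> S" using a by blast
        then have "c \<noteq> a0" using \<rho>[of a] le False S(2) by (cases "c = a0") simp_all
        then show ?thesis using Af[of a c] le False \<open>a \<in> S\<close> c by auto
      qed
    qed
    show "?\<rho> a + card (insert a0 S) > CARD('n)"
      using a \<rho> a0 S by (auto simp: less_Suc_eq)
  qed
  then show ?case by blast
  qed
qed

section \<open>Contraction of nilpotent pairs by a torus\<close>

definition eval_int :: "('v \<Rightarrow> 'k::field) \<Rightarrow> ('v, int) mpoly \<Rightarrow> 'k" where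
  "eval_int z p = eval_hom of_int z p"

text \<open>Specialising the universal pair to \<open>(g, z)\<close> kills the defining ideal, since
  \<open>g\<close> is symplectic and the matrix part of \<open>z\<close> is alternating.\<close>

lemma exotic_invariant_eval:
  fixes z :: "'n::finite exotic_coord \<Rightarrow> 'k::field"
  assumes p: "exotic_invariant p" and g: "g \<in> Sp" and z: "alternating (mpart z)"
  shows "eval_int (exotic_act g z) p = eval_int z p"
proof -
  let ?R = "\<lambda>c. Var (Inr c) :: (('n + 'n) \<times> ('n + 'n) + 'n exotic_coord, int) mpoly"
  define h where "h = eval_hom (of_int :: int \<Rightarrow> 'k) (case_sum (\<lambda>(i, j). g $ i $ j) z)"
  have h: "ring_hom_on h" by (simp add: h_def)
  have hV: "h (Var v) = (case_sum (\<lambda>(i, j). g $ i $ j) z) v" for v by (simp add: h_def eval_hom_Var)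
  have hs: "h (subst r q) = eval_int (\<lambda>v. h (r v)) q" for r and q :: "('n exotic_coord, int) mpoly"
    unfolding eval_int_def
    by (rule hom_unique[where f = "\<lambda>q. h (subst r q)"])
      (simp_all add: ring_hom_on_comp[OF h] h eval_hom_Var eval_hom_Const, simp add: h_def eval_hom_Const)
  have hG: "map_mat h generic_matrix = g" by (simp add: vec_eq_iff generic_matrix_def hV)
  have zero: "h q = 0" if "q \<in> ideal_gen
           ({(transpose generic_matrix ** symplectic_form ** generic_matrix - symplectic_form) $ i $ j
              | i j. True} \<union> subst ?R ` alternating_relations)" for q
  proof -
    have "h q \<in> {0}"
    proof (rule hom_ideal_gen[OF h is_ideal_zero _ that])
      fix q assume "q \<in> {(transpose generic_matrix ** symplectic_form ** generic_matrix - symplectic_form) $ i $ j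
              | i j. True} \<union> subst ?R ` alternating_relations"
      then consider i j where "q = (transpose generic_matrix ** symplectic_form ** generic_matrix - symplectic_form) $ i $ j"
        | r where "r \<in> alternating_relations" "q = subst ?R r" by blast
      then show "h q \<in> {0}"
      proof cases
        case 1
        have "h q = map_mat h (transpose generic_matrix ** symplectic_form ** generic_matrix - symplectic_form) $ i $ j"
          by (simp add: 1)
        also have "\<dots> = (transpose g ** symplectic_form ** g - symplectic_form) $ i $ j"
          by (simp add: map_mat_diff[OF h] map_mat_mult[OF h] map_mat_transpose hG h)
        finally show ?thesis by (simp add: SpD[OF g])
      next
        case 2
        then show ?thesis
          using alternatingD[OF z]
          by (auto simp: alternating_relations_def subst_simps ring_hom_onD[OF h] hV mpart_def eq_neg_iff_add_eq_0)
      qed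
    qed
    then show ?thesis by simp
  qed
  have hexo: "h (exotic_act generic_matrix ?R c) = exotic_act g z c" for c
  proof -
    have v: "h ((generic_matrix *v (\<chi> k. ?R (Inl k))) $ i) = (g *v vpart z) $ i" for i
      by (simp add: matrix_vector_mult_def ring_hom_onD[OF h] generic_matrix_def hV vpart_def)
    have mm: "map_mat h (\<chi> k l. ?R (Inr (k, l))) = mpart z" by (simp add: vec_eq_iff hV mpart_def)
    have m: "h ((generic_matrix ** (\<chi> k l. ?R (Inr (k, l))) ** transpose generic_matrix) $ i $ j) =
        (g ** mpart z ** transpose g) $ i $ j" for i j
      by (simp only: map_mat_nth[symmetric, of h] map_mat_mult[OF h] map_mat_transpose hG mm)
    show ?thesis by (cases c) (auto simp: exotic_act_def v m simp flip: vpart_def mpart_def)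
  qed
  have "h (subst (exotic_act generic_matrix ?R) p - subst ?R p) = 0"
    using p unfolding exotic_invariant_def by (rule zero)
  then have "eval_int (\<lambda>c. h (exotic_act generic_matrix ?R c)) p = eval_int (\<lambda>c. h (?R c)) p"
    by (simp add: ring_hom_onD[OF h] hs)
  then show ?thesis by (simp add: hexo hV)
qed

lemma symplectic_sandwich:
  fixes N :: "'r::comm_ring_1 ^ ('n + 'n::finite) ^ ('n + 'n)"
  shows "(symplectic_form ** N ** symplectic_form) $ i $ j =
    symplectic_form $ i $ flip i * N $ flip i $ flip j * symplectic_form $ flip j $ j"
proof -
  let ?J = "symplectic_form :: 'r ^ ('n + 'n) ^ ('n + 'n)"
  have z: "?J $ i $ k = 0" if "k \<noteq> flip i" for i k using that symplectic_nonzero by blast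
  have l: "(?J ** M) $ i $ l = ?J $ i $ flip i * M $ flip i $ l" for M and i l
  proof -
    have "(?J ** M) $ i $ l = (\<Sum>k\<in>UNIV. if k = flip i then ?J $ i $ k * M $ k $ l else 0)"
      unfolding matrix_matrix_mult_def vec_lambda_beta by (intro sum.cong refl) (simp add: z)
    then show ?thesis by simp
  qed
  have r: "(M ** ?J) $ i $ j = M $ i $ flip j * ?J $ flip j $ j" for M and i j
  proof -
    have z': "?J $ k $ j = 0" if "k \<noteq> flip j" for k using z[of j k] that by (metis flip_simps(3) z)
    have "(M ** ?J) $ i $ j = (\<Sum>k\<in>UNIV. if k = flip j then M $ i $ k * ?J $ k $ j else 0)"
      unfolding matrix_matrix_mult_def vec_lambda_beta by (intro sum.cong refl) (simp add: z')
    then show ?thesis by simp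
  qed
  show ?thesis by (simp add: l r)
qed

lemma mult_vec_bil: "(transpose b ** M *v v) $ k = bil M (column k b) v"
proof -
  have "(transpose b ** M *v v) $ k = (transpose b *v (M *v v)) $ k"
    by (simp add: matrix_vector_mul_assoc)
  also have "\<dots> = (\<Sum>i\<in>UNIV. \<Sum>j\<in>UNIV. b $ i $ k * M $ i $ j * v $ j)"
    by (simp add: matrix_vector_mult_def transpose_def sum_distrib_left mult.assoc)
  finally show ?thesis by (simp add: bil_def column_def)
qed

lemma symplectic_mult_vec: "(symplectic_form *v w) $ Inl a = w $ Inr a" "(symplectic_form *v w) $ Inr a = - w $ Inl a"
  for w :: "'r::comm_ring_1 ^ ('n + 'n::finite)"
proof -
  let ?J = "symplectic_form :: 'r ^ ('n + 'n) ^ ('n + 'n)"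
  have z: "?J $ i $ k = 0" if "k \<noteq> flip i" for i k using that symplectic_nonzero by blast
  have "(?J *v w) $ i = ?J $ i $ flip i * w $ flip i" for i
  proof -
    have "(?J *v w) $ i = (\<Sum>k\<in>UNIV. if k = flip i then ?J $ i $ k * w $ k else 0)"
      unfolding matrix_vector_mult_def vec_lambda_beta by (intro sum.cong refl) (simp add: z)
    then show ?thesis by simp
  qed
  then show "(?J *v w) $ Inl a = w $ Inr a" "(?J *v w) $ Inr a = - w $ Inl a"
    by (simp_all add: symplectic_form_def)
qed

definition torus :: "('n::finite \<Rightarrow> nat) \<Rightarrow> 'k::field \<Rightarrow> 'k ^ ('n + 'n) ^ ('n + 'n)" where
  "torus \<rho> s = (\<chi> i j. if i = j then case_sum (\<lambda>a. s ^ \<rho> a) (\<lambda>a. inverse s ^ \<rho> a) i else 0)"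

lemma torus_mult: "(torus \<rho> s ** M) $ i $ j = case_sum (\<lambda>a. s ^ \<rho> a) (\<lambda>a. inverse s ^ \<rho> a) i * M $ i $ j"
  and mult_torus: "(M ** torus \<rho> s) $ i $ j = M $ i $ j * case_sum (\<lambda>a. s ^ \<rho> a) (\<lambda>a. inverse s ^ \<rho> a) j"
  and torus_vec: "(torus \<rho> s *v w) $ i = case_sum (\<lambda>a. s ^ \<rho> a) (\<lambda>a. inverse s ^ \<rho> a) i * w $ i"
  by (simp_all add: torus_def matrix_matrix_mult_def matrix_vector_mult_def if_distrib[of "\<lambda>x. x * _"]
    if_distrib[of "\<lambda>x. _ * x"] cong: if_cong)

lemma transpose_torus [simp]: "transpose (torus \<rho> s) = torus \<rho> s"
  by (auto simp: vec_eq_iff transpose_def torus_def)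

lemma torus_Sp: "s \<noteq> 0 \<Longrightarrow> torus \<rho> s \<in> Sp"
proof -
  assume "s \<noteq> 0"
  then have "case_sum (\<lambda>a. s ^ \<rho> a) (\<lambda>a. inverse s ^ \<rho> a) i * symplectic_form $ i $ j *
    case_sum (\<lambda>a. s ^ \<rho> a) (\<lambda>a. inverse s ^ \<rho> a) j = symplectic_form $ i $ j" for i j
    by (cases i; cases j) (auto simp: symplectic_form_def power_inverse)
  then show ?thesis by (simp add: Sp_def vec_eq_iff torus_mult mult_torus)
qed

text \<open>In an adapted basis the point lies in the sum of the positive weight spaces of a torus, so
  that its orbit closure contains the origin.\<close>

lemma invariant_vanishes_on_nilpotents:
  fixes z :: "'n::finite exotic_coord \<Rightarrow> 'k::alg_closed_field"
  assumes p: "exotic_invariant p" "Poly_Mapping.lookup p 0 = 0" and z: "z \<in> exotic_points"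
  shows "eval_int z p = 0"
proof -
  let ?J = "symplectic_form :: 'k ^ ('n + 'n) ^ ('n + 'n)"
  let ?x = "mpart z" and ?v = "vpart z"
  let ?A = "?x ** ?J"
  have x: "alternating ?x" and "nilpotent_matrix ?A" using z by (auto simp: exotic_points_def)
  then have nil: "mat_iter ?A CARD('n + 'n) u = 0" for u using nilpotent_iff_eigenvalues(2) by blast
  obtain e f \<rho> where b: "\<forall>a\<in>(UNIV::'n set). \<forall>c\<in>UNIV. form (e a) (e c) = 0 \<and> form (f a) (f c) = 0 \<and>
     form (e a) (f c) = (if a = c then 1 else 0) \<and> (\<forall>j. form (e a) (mat_iter ?A j ?v) = 0) \<and>
     ?A *v e c = (\<Sum>b\<in>UNIV. form (?A *v e c) (f b) *s e b) \<and>
     (\<rho> a \<le> \<rho> c \<longrightarrow> form (?A *v e c) (f a) = 0) \<and> \<rho> a + card (UNIV :: 'n set) > CARD('n)"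
    using adapted_symplectic_basis[OF x nil, where S = UNIV and v = ?v] by blast
  have ee: "form (e a) (e c) = 0" and ff: "form (f a) (f c) = 0" and ef: "form (e a) (f c) = (if a = c then 1 else 0)"
    and ev: "form (e a) ?v = 0" and Ae: "?A *v e c = (\<Sum>b\<in>UNIV. form (?A *v e c) (f b) *s e b)"
    and Af: "\<rho> a \<le> \<rho> c \<Longrightarrow> form (?A *v e c) (f a) = 0" and \<rho>: "\<rho> a > 0" for a c
  proof -
    note * = b[rule_format, of a c, OF UNIV_I UNIV_I]
    show "form (e a) (e c) = 0" "form (f a) (f c) = 0" "form (e a) (f c) = (if a = c then 1 else 0)"
      "?A *v e c = (\<Sum>b\<in>UNIV. form (?A *v e c) (f b) *s e b)"
      "\<rho> a \<le> \<rho> c \<Longrightarrow> form (?A *v e c) (f a) = 0"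
      using * by blast+
    show "\<rho> a > 0" using * by linarith
    show "form (e a) ?v = 0" using * by (metis funpow_0)
  qed
  note skew = bil_alternating(1)[OF alternating_symplectic]
  have fe: "form (f a) (e c) = (if a = c then - 1 else 0)" for a c
    using ef[of c a] by (subst skew) auto
  define B where "B = (\<chi> i j. case_sum (\<lambda>a. e a $ i) (\<lambda>a. f a $ i) j)"
  have col: "column (Inl a) B = e a" "column (Inr a) B = f a" for a
    by (simp_all add: B_def column_def vec_eq_iff)
  have J: "?J $ Inl a $ Inl c = 0" "?J $ Inl a $ Inr c = (if a = c then 1 else 0)"
    "?J $ Inr a $ Inl c = (if a = c then - 1 else 0)" "?J $ Inr a $ Inr c = 0" for a c
    by (simp_all add: symplectic_form_def)
  have "(transpose B ** ?J ** B) $ k $ l = ?J $ k $ l" for k l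
    unfolding bil_entry by (cases k; cases l) (simp_all add: col ee ff ef fe J)
  then have B: "B \<in> Sp" by (simp add: Sp_def vec_eq_iff)
  define z' where "z' = exotic_act (sp_inv B) z"
  have zz': "eval_int z' p = eval_int z p"
    unfolding z'_def by (rule exotic_invariant_eval[OF p(1) Sp_sp_inv[OF B] x])
  have x': "alternating (mpart z')"
    unfolding z'_def mpart_act by (rule alternating_congruence[OF x])
  have neg_vec: "(- M) *v w = - (M *v w)" for M and w :: "'k ^ ('n + 'n)"
    by (simp add: vec_eq_iff matrix_vector_mult_def sum_negf)
  have "vpart z' = - (?J *v (transpose B ** ?J *v ?v))"
    by (simp add: z'_def vpart_act sp_inv_def neg_vec matrix_vector_mul_assoc matrix_mul_assoc)
  then have v0: "z' (Inl (Inr a)) = 0" for a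
    using ev[of a] by (simp add: vec_eq_iff vpart_def symplectic_mult_vec mult_vec_bil col)
  define N where "N = transpose B ** (?J ** ?x ** ?J) ** B"
  have "transpose (- M) = - transpose M" for M :: "'k ^ ('n + 'n) ^ ('n + 'n)"
    by (simp add: vec_eq_iff transpose_def)
  then have tr: "transpose (sp_inv B) = - (?J ** B ** ?J)"
    by (simp add: sp_inv_def matrix_transpose_mul transpose_symplectic matrix_mult_neg matrix_mul_assoc)
  have "mpart z' = ?J ** N ** ?J"
    unfolding z'_def mpart_act tr by (simp add: sp_inv_def N_def matrix_mult_neg matrix_mul_assoc)
  then have x0: "z' (Inr (i, j)) = 0" if "N $ flip i $ flip j = 0" for i j
    using that symplectic_sandwich[of N i j] by (simp add: mpart_def vec_eq_iff)
  have Nf: "N $ k $ l = form (column k B) (?A *v column l B)" for k l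
    unfolding N_def bil_entry by (simp add: bil_mult matrix_mul_assoc)
  have adj: "form (?A *v u) w = form u (?A *v w)" for u w by (rule form_adjoint(1)[OF x])
  have N1: "N $ Inl a $ Inl c = 0" for a c
    unfolding Nf col by (subst Ae) (simp add: bil_sum bil_scale ee)
  have N2: "N $ Inr a $ Inl c = 0" if "\<rho> a \<le> \<rho> c" for a c
    unfolding Nf col using Af[OF that] by (subst skew) simp
  have N3: "N $ Inl a $ Inr c = 0" if "\<rho> c \<le> \<rho> a" for a c
    unfolding Nf col using Af[OF that] adj by simp
  have z0: "z' (Inr (Inr a, Inr c)) = 0" "z' (Inr (Inl a, Inr c)) \<noteq> 0 \<Longrightarrow> \<rho> c < \<rho> a"
    "z' (Inr (Inr a, Inl c)) \<noteq> 0 \<Longrightarrow> \<rho> a < \<rho> c" for a c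
    using x0[of "Inr a" "Inr c"] x0[of "Inl a" "Inr c"] x0[of "Inr a" "Inl c"] N1 N2 N3
    by (simp_all add: not_le[symmetric]) blast+
  \<comment> \<open>Torus weights of the coordinates. The truncated differences are harmless:
    wherever \<open>\<rho> a - \<rho> c\<close> would not be positive, the coordinate of
    \<open>z'\<close> vanishes.\<close>
  define d :: "'n exotic_coord \<Rightarrow> nat" where "d = case_sum (case_sum \<rho> (\<lambda>_. 0))
    (\<lambda>(i, j). case i of Inl a \<Rightarrow> (case j of Inl c \<Rightarrow> \<rho> a + \<rho> c | Inr c \<Rightarrow> \<rho> a - \<rho> c)
      | Inr a \<Rightarrow> (case j of Inl c \<Rightarrow> \<rho> c - \<rho> a | Inr c \<Rightarrow> 0))"
  have dpos: "d c > 0" if "z' c \<noteq> 0" for c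
  proof (cases c)
    case (Inl i)
    then show ?thesis using that v0 \<rho> by (cases i) (auto simp: d_def)
  next
    case (Inr q)
    obtain i j where q: "q = (i, j)" by (cases q)
    show ?thesis
      using that \<rho> unfolding Inr q
      by (cases i; cases j) (auto simp: d_def z0(1) dest!: z0(2,3))
  qed
  have act: "exotic_act (torus \<rho> s) z' c = z' c * s ^ d c" if s: "s \<noteq> 0" for s c
  proof (cases c)
    case (Inl i)
    have "exotic_act (torus \<rho> s) z' c = vpart (exotic_act (torus \<rho> s) z') $ i" by (simp add: vpart_def Inl)
    also have "\<dots> = case_sum (\<lambda>a. s ^ \<rho> a) (\<lambda>a. inverse s ^ \<rho> a) i * z' c"
      unfolding vpart_act torus_vec by (simp add: vpart_def Inl)
    also have "\<dots> = z' c * s ^ d c" using v0 by (cases i) (auto simp: Inl d_def)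
    finally show ?thesis .
  next
    case (Inr q)
    obtain i j where q: "q = (i, j)" by (cases q)
    have "exotic_act (torus \<rho> s) z' c = mpart (exotic_act (torus \<rho> s) z') $ i $ j" by (simp add: mpart_def Inr q)
    also have "\<dots> = case_sum (\<lambda>a. s ^ \<rho> a) (\<lambda>a. inverse s ^ \<rho> a) i * z' c * case_sum (\<lambda>a. s ^ \<rho> a) (\<lambda>a. inverse s ^ \<rho> a) j"
      unfolding mpart_act transpose_torus mult_torus torus_mult by (simp add: mpart_def Inr q)
    also have "\<dots> = z' c * s ^ d c"
    proof (cases "z' c = 0")
      case False
      have pd: "s ^ (m - l) = s ^ m / s ^ l" if "l < m" for m l
        using that s by (simp add: power_diff)
      show ?thesis
        using s \<open>z' c \<noteq> 0\<close> unfolding Inr q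
        by (cases i; cases j) (auto simp: d_def power_add power_inverse field_simps pd z0(1) dest!: z0(2,3))
    qed simp
    finally show ?thesis .
  qed
  \<comment> \<open>The value of \<open>p\<close> along the torus orbit, as a polynomial in the
    parameter. It is constant off 0, hence also at 0, where the curve reaches the origin.\<close>
  define pq where "pq = eval_hom (\<lambda>n. [:of_int n :: 'k:]) (\<lambda>c. Polynomial.monom (z' c) (d c)) p"
  have hc: "ring_hom_on (\<lambda>n. [:of_int n :: 'k:])"
    by (rule ring_hom_on_comp[OF ring_hom_on_const ring_hom_on_of_int])
  have pq: "poly pq s = eval_int (\<lambda>c. z' c * s ^ d c) p" for s
    unfolding pq_def eval_int_def hom_eval_hom[OF ring_hom_on_poly hc]
    by (simp add: poly_monom)
  have "pq - [:eval_int z' p:] = 0"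
  proof (rule poly_zero_infinite[of "{0}"])
    fix s :: 'k assume "s \<notin> {0}"
    then have s: "s \<noteq> 0" by simp
    have "poly pq s = eval_int (exotic_act (torus \<rho> s) z') p"
      unfolding pq by (rule arg_cong[where f = "\<lambda>y. eval_int y p"]) (simp add: act[OF s] fun_eq_iff)
    then show "poly (pq - [:eval_int z' p:]) s = 0"
      using exotic_invariant_eval[OF p(1) torus_Sp[OF s] x'] by simp
  qed simp
  then have "eval_int z' p = poly pq 0" by simp
  also have "\<dots> = eval_int (\<lambda>c. 0) p"
    unfolding pq by (rule arg_cong[where f = "\<lambda>y. eval_int y p"]) (use dpos in \<open>force simp: fun_eq_iff\<close>)
  also have "\<dots> = of_int (eval_at (\<lambda>c. 0) p)"
    unfolding eval_int_def eval_at_def by (subst hom_eval_hom[OF ring_hom_on_of_int]) simp_all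
  also have "\<dots> = 0" using p(2) by (simp add: lookup_0_eval)
  finally show ?thesis using zz' by simp
qed

text \<open>An invertible \<open>g\<close> with \<open>w\<close> as row \<open>i\<close> makes row
  and column \<open>i\<close> of \<open>g y g^T\<close> vanish, and every matching has an edge at
  \<open>i\<close>.\<close>

lemma pf_singular:
  fixes y :: "'k::field ^ ('n + 'n::finite) ^ ('n + 'n)"
  assumes y: "alternating y" and w: "w \<noteq> 0" "y *v w = 0"
  shows "pf y = 0"
proof -
  obtain i where i: "w $ i \<noteq> 0" using w(1) by (auto simp: vec_eq_iff)
  define g :: "'k ^ ('n + 'n) ^ ('n + 'n)" where "g = (\<chi> k. if k = i then w else axis k 1)"
  have "w = (\<Sum>j\<in>UNIV. w $ j *s axis j 1)"
    by (simp add: vec_eq_iff axis_def if_distrib cong: if_cong)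
  from arg_cong[OF this, of "\<lambda>w. \<chi> k. if k = i then w else axis k 1"]
  have "g = (\<chi> k. if k = i then (\<Sum>j\<in>UNIV. w $ j *s axis j 1) else axis k 1)"
    unfolding g_def .
  then have "det g = (\<Sum>j\<in>UNIV. det (\<chi> k. (if k = i then w $ j *s axis j 1 else axis k 1 :: 'k ^ ('n + 'n))))"
    by (simp only: det_linear_row_sum[OF finite])
  also have "\<dots> = (\<Sum>j\<in>UNIV. w $ j * (if j = i then 1 else 0))"
  proof (rule sum.cong[OF refl])
    fix j
    have "det (\<chi> k. (if k = i then w $ j *s axis j 1 else axis k 1 :: 'k ^ ('n + 'n))) =
      w $ j * det (\<chi> k. (if k = i then axis j 1 else axis k 1 :: 'k ^ ('n + 'n)))"
      by (rule det_row_mul)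
    also have "det (\<chi> k. (if k = i then axis j 1 else axis k 1 :: 'k ^ ('n + 'n))) = (if j = i then 1 else 0)"
    proof (cases "j = i")
      case True
      then have "(\<chi> k. (if k = i then axis j 1 else axis k 1 :: 'k ^ ('n + 'n))) = mat 1"
        by (auto simp: vec_eq_iff mat_def axis_def)
      then show ?thesis using True by simp
    next
      case False
      then have "det (\<chi> k. (if k = i then axis j 1 else axis k 1 :: 'k ^ ('n + 'n))) = 0"
        by (intro det_identical_rows[of i j]) (auto simp: row_def)
      then show ?thesis using False by simp
    qed
    finally show "det (\<chi> k. (if k = i then w $ j *s axis j 1 else axis k 1 :: 'k ^ ('n + 'n))) = w $ j * (if j = i then 1 else 0)" .
  qed
  also have "\<dots> = w $ i" by (simp add: if_distrib cong: if_cong)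
  finally have det: "det g \<noteq> 0" using i by simp
  let ?Y = "g ** y ** transpose g"
  have row0: "?Y $ i $ l = 0" for l
  proof -
    have "(g ** y) $ i $ k = 0" for k
    proof -
      have "(g ** y) $ i $ k = (\<Sum>j\<in>UNIV. w $ j * y $ j $ k)" by (simp add: matrix_matrix_mult_def g_def)
      also have "\<dots> = - (\<Sum>j\<in>UNIV. y $ k $ j * w $ j)"
        unfolding sum_negf[symmetric]
        by (intro sum.cong refl) (subst alternatingD(2)[OF y], simp add: mult.commute)
      also have "\<dots> = 0" using w(2) by (simp add: vec_eq_iff matrix_vector_mult_def)
      finally show ?thesis .
    qed
    then show ?thesis by (simp add: matrix_matrix_mult_def[of "g ** y"])
  qed
  have Y: "alternating ?Y" by (rule alternating_congruence[OF y])
  have col0: "?Y $ l $ i = 0" for l using alternatingD(2)[OF Y, of l i] row0 by simp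
  have "pf_term ?Y (match_perm \<tau>) = 0" if \<tau>: "\<tau> \<in> matchings" for \<tau>
  proof -
    obtain q where q: "match_perm \<tau> q = i" using match_perm[OF \<tau>, THEN conjunct1] by (metis bij_pointE)
    have "\<exists>a. ?Y $ match_perm \<tau> (Inl a) $ match_perm \<tau> (Inr a) = 0"
      using q row0 col0 by (cases q) auto
    then have "(\<Prod>a\<in>UNIV. ?Y $ match_perm \<tau> (Inl a) $ match_perm \<tau> (Inr a)) = 0" by (intro prod_zero) simp_all
    then show ?thesis by (simp add: pf_term_def)
  qed
  then have "pf ?Y = 0" by (simp add: pf_def)
  then show ?thesis using pf_congruence[OF y, of g] det by simp
qed

text \<open>If \<open>x J u = a u\<close>, then \<open>J u\<close> is killed by
  \<open>x + a J\<close>, so \<open>a\<close> is a root of the characteristic Pfaffian, which the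
  hypotheses make a power of the variable.\<close>

lemma nilpotent_of_char_pf:
  fixes x :: "'k::alg_closed_field ^ ('n + 'n::finite) ^ ('n + 'n)"
  assumes x: "alternating x" and c: "\<And>m. m < CARD('n) \<Longrightarrow> Polynomial.coeff (char_pf x) m = 0"
  shows "nilpotent_matrix (x ** symplectic_form)"
  unfolding nilpotent_iff_eigenvalues(1)
proof (intro allI impI)
  let ?J = "symplectic_form :: 'k ^ ('n + 'n) ^ ('n + 'n)"
  fix a u assume a: "a \<noteq> 0" "x ** ?J *v u = a *s u"
  have "char_pf x = Polynomial.monom 1 CARD('n)"
  proof (rule poly_eqI)
    fix m
    show "Polynomial.coeff (char_pf x) m = Polynomial.coeff (Polynomial.monom 1 CARD('n)) m"
      using c[of m] char_pf_monic[of x] Polynomial.coeff_eq_0[of "char_pf x" m]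
      by (cases m "CARD('n)" rule: linorder_cases) auto
  qed
  then have nz: "poly (char_pf x) a \<noteq> 0" using a by (simp add: poly_monom)
  define w where "w = ?J *v u"
  have Jw: "?J *v w = - u"
  proof -
    have "?J *v w = (- mat 1) *v u" by (simp only: w_def matrix_vector_mul_assoc symplectic_square)
    also have "\<dots> = - u"
      by (simp add: vec_eq_iff matrix_vector_mult_def mat_def if_distrib[of "\<lambda>x. - x"] if_distribR
      if_distrib[of "\<lambda>x. x * _"] cong: if_cong)
    finally show ?thesis .
  qed
  define y where "y = (\<chi> i j. x $ i $ j + a * ?J $ i $ j)"
  have "y *v w = x *v w + a *s (?J *v w)"
    by (simp add: y_def vec_eq_iff matrix_vector_mult_def distrib_right sum.distrib sum_distrib_left mult.assoc)
  also have "x *v w = a *s u" by (simp only: w_def matrix_vector_mul_assoc a(2))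
  also have "a *s u + a *s (?J *v w) = 0" by (simp add: Jw vec_eq_iff)
  finally have yw: "y *v w = 0" .
  have y: "alternating y"
  proof -
    have sk: "?J $ i $ j = - ?J $ j $ i" for i j by (rule alternatingD(2)[OF alternating_symplectic])
    have d0: "?J $ i $ i = 0" for i by (rule alternatingD(1)[OF alternating_symplectic])
    have "y $ i $ j = - y $ j $ i" for i j
      using alternatingD(2)[OF x, of i j] sk[of i j]
      by (simp add: y_def)
    moreover have "y $ i $ i = 0" for i
      using alternatingD(1)[OF x, of i] d0[of i] by (simp add: y_def)
    ultimately show ?thesis unfolding alternating_def by blast
  qed
  have "w = 0"
  proof (rule ccontr)
    assume "w \<noteq> 0"
    then have "pf y = 0" by (rule pf_singular[OF y _ yw])
    then show False using nz by (simp add: poly_char_pf y_def)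
  qed
  then show "u = 0" using Jw by simp
qed

text \<open>The ideal of all invariants is squeezed between the ideal of the Pfaffian coefficients
  and the vanishing ideal, and these two agree.\<close>

theorem exotic_nilcone_eq:
  assumes two: "(2::'k::alg_closed_field) = 0"
  shows "exotic_nilcone = (vanishing_ideal exotic_points :: ('n::finite exotic_coord, 'k) mpoly set)"
proof (intro equalityI subsetI)
  fix f :: "('n exotic_coord, 'k) mpoly" assume f: "f \<in> exotic_nilcone"
  show "f \<in> vanishing_ideal exotic_points"
    unfolding vanishing_ideal_def
  proof (intro CollectI ballI)
    fix z :: "'n exotic_coord \<Rightarrow> 'k" assume z: "z \<in> exotic_points"
    have hc: "ring_hom_on (\<lambda>c. Const (of_int c) :: ('n exotic_coord, 'k) mpoly)"
      by (rule ring_hom_on_comp[OF ring_hom_on_Const ring_hom_on_of_int])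
    have e: "eval_at z (eval_hom (\<lambda>c. Const (of_int c)) Var q) = eval_int z q" for q
      unfolding eval_int_def by (subst hom_eval_hom[OF eval_at_hom hc]) simp
    have ei: "ring_hom_on (eval_int z)" unfolding eval_int_def[abs_def] by simp
    have "eval_int z q = 0" if "q \<in> exotic_nilcone_int" for q
    proof -
      have "eval_int z q \<in> {0}"
      proof (rule hom_ideal_gen[OF ei is_ideal_zero _ that[unfolded exotic_nilcone_int_def]])
        fix q :: "('n exotic_coord, int) mpoly"
        assume "q \<in> alternating_relations \<union> {p. exotic_invariant p \<and> Poly_Mapping.lookup p 0 = 0}"
        then show "eval_int z q \<in> {0}"
        proof
          assume "q \<in> alternating_relations"
          have alt: "alternating (mpart z)" using z by (simp add: exotic_points_def)
          have V: "eval_int z (Var v) = z v" for v by (simp add: eval_int_def eval_hom_Var)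
          show ?thesis
            using \<open>q \<in> alternating_relations\<close> alternatingD[OF alt]
            by (auto simp: alternating_relations_def ring_hom_onD[OF ei] V mpart_def eq_neg_iff_add_eq_0)
        next
          assume "q \<in> {p. exotic_invariant p \<and> Poly_Mapping.lookup p 0 = 0}"
          then show ?thesis using invariant_vanishes_on_nilpotents z by blast
        qed
      qed
      then show ?thesis by simp
    qed
    then show "eval_at z f = 0"
      using f unfolding exotic_nilcone_def by (elim eval_at_ideal_gen) (auto simp: e)
  qed
next
  let ?p = "\<lambda>m. Polynomial.coeff (char_pf (\<chi> i j. (Var (Inr (i, j)) :: ('n exotic_coord, 'k) mpoly))) m"
  let ?S = "alternating_relations \<union> ?p ` {..<CARD('n)}"
  fix f :: "('n exotic_coord, 'k) mpoly" assume f: "f \<in> vanishing_ideal exotic_points"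
  have "z \<in> exotic_points" if z: "z \<in> points (ideal_gen ?S)" for z
  proof -
    have e: "eval_at z q = 0" if "q \<in> ?S" for q
      using z that unfolding points_ideal_gen by (auto simp: points_def)
    have "z (Inr (i, i)) = 0" "z (Inr (i, j)) + z (Inr (j, i)) = 0" for i j
      using e[of "Var (Inr (i, i))"] e[of "Var (Inr (i, j)) + Var (Inr (j, i))"]
      by (auto simp: alternating_relations_def eval_at_simps)
    then have alt: "alternating (mpart z)" by (auto simp: alternating_def mpart_def eq_neg_iff_add_eq_0)
    have "map_mat (eval_at z) (\<chi> i j. Var (Inr (i, j))) = mpart z" by (simp add: vec_eq_iff mpart_def)
    then have "Polynomial.coeff (char_pf (mpart z)) m = 0" if "m < CARD('n)" for m
      using e[of "?p m"] that by (simp add: coeff_char_pf_hom[OF eval_at_hom])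
    then show ?thesis using alt nilpotent_of_char_pf[OF alt] by (simp add: exotic_points_def)
  qed
  then have "f \<in> vanishing_ideal (points (ideal_gen ?S))"
    using f by (auto simp: vanishing_ideal_def)
  also have "\<dots> = ideal_gen ?S"
    unfolding nullstellensatz[OF ideal.subspace_span] by (rule radical_exotic_generators[OF two])
  also have "\<dots> \<subseteq> exotic_nilcone"
  proof (rule ideal.span_minimal)
    show "?S \<subseteq> exotic_nilcone"
      using alternating_relations_exotic pf_invariant_exotic[where 'k='k] by auto
    show "is_ideal (exotic_nilcone :: ('n exotic_coord, 'k) mpoly set)"
      unfolding exotic_nilcone_def by (rule ideal.subspace_span)
  qed
  finally show "f \<in> exotic_nilcone" .
qed

text \<open>Since \<open>v\<^sup>T J A\<^sup>i v = 0\<close>, the rank one perturbation does not change the spectrum.\<close>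

lemma nilpotent_rank_one_perturbation:
  fixes x :: "'k::alg_closed_field ^ ('n + 'n::finite) ^ ('n + 'n)" and v c
  assumes x: "alternating x"
  defines "y \<equiv> \<chi> i j. x $ i $ j + c * (v $ i * v $ j)"
  shows "nilpotent_matrix (y ** symplectic_form) \<longleftrightarrow> nilpotent_matrix (x ** symplectic_form)"
proof -
  let ?J = "symplectic_form :: 'k ^ ('n + 'n) ^ ('n + 'n)"
  let ?A = "x ** ?J" and ?B = "y ** ?J"
  have B: "?B *v u = ?A *v u + (c * form v u) *s v" for u
  proof -
    have "y *v w = x *v w + (c * (\<Sum>j\<in>UNIV. v $ j * w $ j)) *s v" for w
      by (simp add: y_def vec_eq_iff matrix_vector_mult_def sum.distrib sum_distrib_left sum_distrib_right algebra_simps)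
    moreover have "(\<Sum>j\<in>UNIV. v $ j * (?J *v u) $ j) = form v u"
      by (simp add: bil_def matrix_vector_mult_def sum_distrib_left mult.assoc)
    ultimately show ?thesis by (simp flip: matrix_vector_mul_assoc)
  qed
  have vv: "form v (mat_iter ?A j v) = 0" for j using form_iter[OF x, of 0 v j] by simp
  have iter: "mat_iter ?B j v = mat_iter ?A j v" for j
    by (induction j) (simp_all add: B vv)
  have adj: "form (mat_iter ?A j v) (?A *v u) = form (mat_iter ?A (Suc j) v) u" for j u
    by (simp add: form_adjoint(1)[OF x])
  have A_vv: "form (mat_iter ?A j v) v = 0" for j using form_iter[OF x, of j v 0] by simp
  \<comment> \<open>Moving \<open>?A\<close> across the form gives
    \<open>a ^ j * form v u = form (mat_iter ?A j v) u\<close>, which is zero for large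
    \<open>j\<close>.\<close>
  have key: "form v u = 0" if nil: "mat_iter ?A N v = 0" and a: "a \<noteq> 0"
    and step: "\<And>j. a * form (mat_iter ?A j v) u = form (mat_iter ?A (Suc j) v) u" for N a u
  proof -
    have "a ^ j * form v u = form (mat_iter ?A j v) u" for j
    proof (induction j)
      case (Suc j)
      have "a ^ Suc j * form v u = a * (a ^ j * form v u)" by simp
      also have "\<dots> = form (mat_iter ?A (Suc j) v) u" unfolding Suc by (rule step)
      finally show ?case .
    qed simp
    from this[of N] show ?thesis using nil a by simp
  qed
  show ?thesis
  proof
    assume nil: "nilpotent_matrix ?B"
    then have "mat_iter ?A CARD('n + 'n) v = 0"
      using nilpotent_iff_eigenvalues(2)[of ?B] iter by metis
    note key = key[OF this]
    show "nilpotent_matrix ?A" unfolding nilpotent_iff_eigenvalues(1)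
    proof (intro allI impI)
      fix a u assume a: "a \<noteq> 0" "?A *v u = a *s u"
      have "form v u = 0" by (rule key[OF a(1)]) (metis a(2) adj bil_scale(2))
      then have "?B *v u = a *s u" by (simp add: B a)
      then show "u = 0" using nil a(1) nilpotent_iff_eigenvalues(1)[of ?B] by blast
    qed
  next
    assume nil: "nilpotent_matrix ?A"
    then have "mat_iter ?A CARD('n + 'n) v = 0"
      using nilpotent_iff_eigenvalues(2)[of ?A] by metis
    note key = key[OF this]
    show "nilpotent_matrix ?B" unfolding nilpotent_iff_eigenvalues(1)
    proof (intro allI impI)
      fix a u assume a: "a \<noteq> 0" "?B *v u = a *s u"
      have "form v u = 0"
      proof (rule key[OF a(1)])
        fix j
        have "form (mat_iter ?A j v) (?B *v u) = form (mat_iter ?A (Suc j) v) u"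
          unfolding B bil_add bil_scale adj A_vv by simp
        then show "a * form (mat_iter ?A j v) u = form (mat_iter ?A (Suc j) v) u"
          by (simp add: a bil_scale)
      qed
      then have "?A *v u = a *s u" using a(2) by (simp add: B)
      then show "u = 0" using nil a(1) nilpotent_iff_eigenvalues(1)[of ?A] by blast
    qed
  qed
qed

section \<open>Transvections\<close>

text \<open>The scalar usually attached to a transvection is absorbed into \<open>w\<close>, as an
  algebraically closed field contains square roots.\<close>

definition transvection :: "'r::comm_ring_1 ^ ('n + 'n::finite) \<Rightarrow> 'r ^ ('n + 'n) ^ ('n + 'n)" where
  "transvection w = (\<chi> i j. (if i = j then 1 else 0) + w $ i * (symplectic_form *v w) $ j)"

lemma form_eq: "form u w = (\<Sum>j\<in>UNIV. u $ j * (symplectic_form *v w) $ j)"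
  by (simp add: bil_def matrix_vector_mult_def sum_distrib_left mult.assoc)

lemma transvection_mult: "transvection w *v u = u + form u w *s w"
  unfolding form_eq
  by (simp add: transvection_def vec_eq_iff matrix_vector_mult_def[of "\<chi> i j. _ i j"] distrib_right sum.distrib
      if_distrib[of "\<lambda>x. x * _"] sum_distrib_left sum_distrib_right mult.assoc cong: if_cong)
    (simp add: mult_ac)

lemma column_eq: "column k M = M *v axis k 1"
  by (simp add: column_def vec_eq_iff matrix_vector_mult_def axis_def if_distrib cong: if_cong)

lemma SpI:
  fixes g :: "'r::comm_ring_1 ^ ('n + 'n::finite) ^ ('n + 'n)"
  assumes "\<And>u w. form (g *v u) (g *v w) = form u w"
  shows "g \<in> Sp"
proof -
  have "(transpose g ** symplectic_form ** g) $ k $ l = symplectic_form $ k $ l" for k l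
  proof -
    have "(transpose g ** symplectic_form ** g) $ k $ l = form (axis k 1) (axis l 1)"
      unfolding bil_entry column_eq assms ..
    also have "\<dots> = symplectic_form $ k $ l"
      using bil_entry[of "mat 1" "symplectic_form :: 'r ^ ('n + 'n) ^ ('n + 'n)" "mat 1" k l]
      by (simp add: column_eq transpose_mat)
    finally show ?thesis .
  qed
  then show ?thesis by (simp add: Sp_def vec_eq_iff)
qed

lemmas form_skew = bil_alternating(1)[OF alternating_symplectic]
lemmas form_self = bil_alternating(2)[OF alternating_symplectic]

lemma transvection_Sp: "transvection w \<in> Sp"
proof (rule SpI)
  fix u u'
  show "form (transvection w *v u) (transvection w *v u') = form u u'"
    using form_skew[of w u'] by (simp add: transvection_mult bil_add bil_scale form_self)
qed

text \<open>The direction must be \<open>e - u\<close>, scaled by a square root of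
  \<open>1 / form u e\<close>; a vector pairing equally with \<open>u\<close> and \<open>e\<close>
  is orthogonal to it and stays fixed.\<close>

lemma transvection_step:
  fixes u e :: "'k::alg_closed_field ^ ('n + 'n::finite)"
  assumes ue: "form u e \<noteq> 0" and C: "\<And>c. c \<in> C \<Longrightarrow> form c u = form c e"
  shows "\<exists>w. transvection w *v u = e \<and> (\<forall>c\<in>C. transvection w *v c = c)"
proof -
  obtain a where a: "a ^ 2 = 1 / form u e" using nth_root_exists[of 2] by auto
  have "transvection (a *s (e - u)) *v u = e"
  proof -
    have "transvection (a *s (e - u)) *v u = u + (a ^ 2 * form u e) *s (e - u)"
      by (simp add: transvection_mult bil_scale bil_diff form_self vec_eq_iff power2_eq_square)
    then show ?thesis using ue by (simp add: a)
  qed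
  moreover have "transvection (a *s (e - u)) *v c = c" if "c \<in> C" for c
    by (simp add: transvection_mult bil_scale bil_diff C[OF that])
  ultimately show ?thesis by blast
qed

text \<open>Orthogonal vectors are joined through an intermediate \<open>y\<close>; otherwise the
  second transvection is the trivial one, \<open>w' = 0\<close>, so that the number of factors is
  always two.\<close>

lemma transvection_two_steps:
  fixes u e :: "'k::alg_closed_field ^ ('n + 'n::finite)"
  assumes C: "\<And>c. c \<in> C \<Longrightarrow> form c u = form c e"
    and y: "form u e = 0 \<Longrightarrow> \<exists>y. form u y \<noteq> 0 \<and> form y e \<noteq> 0 \<and> (\<forall>c\<in>C. form c y = form c e)"
  shows "\<exists>w w'. transvection w' *v (transvection w *v u) = e \<and>
    (\<forall>c\<in>C. transvection w' *v (transvection w *v c) = c)"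
proof (cases "form u e = 0")
  case True
  then obtain y where y: "form u y \<noteq> 0" "form y e \<noteq> 0" "\<And>c. c \<in> C \<Longrightarrow> form c y = form c e"
    using y by blast
  obtain w where w: "transvection w *v u = y" "\<And>c. c \<in> C \<Longrightarrow> transvection w *v c = c"
    using transvection_step[OF y(1), of C] C y(3) by auto
  obtain w' where w': "transvection w' *v y = e" "\<And>c. c \<in> C \<Longrightarrow> transvection w' *v c = c"
    using transvection_step[OF y(2), of C] y(3) by auto
  then show ?thesis using w w' by (intro exI[of _ w] exI[of _ w']) simp
next
  case False
  obtain w where w: "transvection w *v u = e" "\<And>c. c \<in> C \<Longrightarrow> transvection w *v c = c"
    using transvection_step[OF False, of C] C by auto
  then show ?thesis by (intro exI[of _ w] exI[of _ 0]) (simp add: transvection_mult)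
qed

definition transvections :: "('r::comm_ring_1 ^ ('n + 'n::finite)) list \<Rightarrow> 'r ^ ('n + 'n) ^ ('n + 'n)" where
  "transvections ws = foldr (\<lambda>w M. transvection w ** M) ws (mat 1)"

lemma transvections_simps [simp]:
  "transvections [] = mat 1" "transvections (w # ws) = transvection w ** transvections ws"
  by (simp_all add: transvections_def)

lemma transvections_append: "transvections (ws @ ws') = transvections ws ** transvections ws'"
  by (induction ws) (simp_all add: matrix_mul_assoc)

lemma transvections_Sp: "transvections ws \<in> Sp"
  by (induction ws) (auto intro: Sp_mult transvection_Sp)

text \<open>Two transvections return the image of \<open>e\<close> to \<open>e\<close>, two more
  return the image of \<open>f\<close> to \<open>f\<close> while fixing \<open>e\<close>. The
  intermediate vectors are \<open>f\<close>, \<open>g *v f\<close> or their sum in the first case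
  and \<open>h *v f + e\<close> in the second.\<close>

lemma fix_hyperbolic_pair:
  fixes g :: "'k::alg_closed_field ^ ('n + 'n::finite) ^ ('n + 'n)"
  assumes g: "g \<in> Sp" and ef: "form e f = 1"
    and C: "\<And>c. c \<in> C \<Longrightarrow> g *v c = c \<and> form c e = 0 \<and> form c f = 0"
  shows "\<exists>ws. length ws = 4 \<and> transvections ws ** g *v e = e \<and> transvections ws ** g *v f = f \<and>
    (\<forall>c\<in>C. transvections ws ** g *v c = c)"
proof -
  have inv: "form c (h *v u) = form c u" if "h \<in> Sp" "h *v c = c" for h c u
    using form_Sp[OF that(1), of c u] that(2) by simp
  have "\<exists>w w'. transvection w' *v (transvection w *v (g *v e)) = e \<and>
    (\<forall>c\<in>C. transvection w' *v (transvection w *v c) = c)"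
  proof (rule transvection_two_steps)
    show "form c (g *v e) = form c e" if "c \<in> C" for c using inv[OF g] C[OF that] by simp
    assume 0: "form (g *v e) e = 0"
    have 1: "form (g *v e) (g *v f) = 1" using form_Sp[OF g] ef by simp
    have 2: "form f e \<noteq> 0" using ef form_skew[of f e] by simp
    have Cf: "form c f = form c e" "form c (g *v f) = form c e" if "c \<in> C" for c
      using inv[OF g, of c] C[OF that] by simp_all
    show "\<exists>y. form (g *v e) y \<noteq> 0 \<and> form y e \<noteq> 0 \<and> (\<forall>c\<in>C. form c y = form c e)"
    proof (cases "form (g *v e) f = 0 \<and> form (g *v f) e = 0")
      case True
      have "form (g *v e) (f + g *v f) \<noteq> 0" "form (f + g *v f) e \<noteq> 0"
        using True 1 2 by (simp_all add: bil_add)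
      moreover have "form c (f + g *v f) = form c e" if "c \<in> C" for c
        using Cf[OF that] C[OF that] by (simp add: bil_add)
      ultimately show ?thesis by blast
    next
      case False
      then show ?thesis using 1 2 Cf by (metis one_neq_zero)
    qed
  qed
  then obtain w w' where w: "transvection w' *v (transvection w *v (g *v e)) = e"
    "\<And>c. c \<in> C \<Longrightarrow> transvection w' *v (transvection w *v c) = c" by blast
  define h where "h = transvection w' ** (transvection w ** g)"
  have h: "h \<in> Sp" unfolding h_def by (intro Sp_mult transvection_Sp g)
  have hv: "h *v u = transvection w' *v (transvection w *v (g *v u))" for u
    by (simp add: h_def matrix_vector_mul_assoc)
  have he: "h *v e = e" and hC: "\<And>c. c \<in> C \<Longrightarrow> h *v c = c" using w C by (simp_all add: hv)
  have "\<exists>u u'. transvection u' *v (transvection u *v (h *v f)) = f \<and>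
    (\<forall>c\<in>insert e C. transvection u' *v (transvection u *v c) = c)"
  proof (rule transvection_two_steps)
    show "form c (h *v f) = form c f" if "c \<in> insert e C" for c
      using inv[OF h, of c f] he hC that by blast
    assume 0: "form (h *v f) f = 0"
    have 1: "form (h *v f) e = - 1" using form_Sp[OF h, of f e] he ef form_skew[of f e] by simp
    have "form (h *v f) (h *v f + e) \<noteq> 0" "form (h *v f + e) f \<noteq> 0"
      using 0 1 ef by (simp_all add: bil_add form_self)
    moreover have "form c (h *v f + e) = form c f" if "c \<in> insert e C" for c
      using inv[OF h, of c f] he hC C that by (auto simp: bil_add form_self)
    ultimately show "\<exists>y. form (h *v f) y \<noteq> 0 \<and> form y f \<noteq> 0 \<and> (\<forall>c\<in>insert e C. form c y = form c f)"
      by blast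
  qed
  then obtain u u' where u: "transvection u' *v (transvection u *v (h *v f)) = f"
    "\<And>c. c \<in> insert e C \<Longrightarrow> transvection u' *v (transvection u *v c) = c" by blast
  have t: "transvections [u', u, w', w] ** g *v c = transvection u' *v (transvection u *v (h *v c))" for c
    by (simp add: hv matrix_vector_mul_assoc matrix_mul_assoc)
  show ?thesis
    by (rule exI[of _ "[u', u, w', w]"]) (simp only: t, simp add: u he hC)
qed

text \<open>The length is the same for all \<open>g\<close>, so one affine space of parameters
  covers the whole group.\<close>

lemma Sp_transvections:
  fixes g :: "'k::alg_closed_field ^ ('n + 'n::finite) ^ ('n + 'n)"
  assumes "g \<in> Sp"
  shows "\<exists>ws. length ws = 4 * CARD('n) \<and> g = transvections ws"
proof -
  have ax: "form (axis (Inl a) 1) (axis (Inl c) 1 :: 'k ^ ('n + 'n)) = 0"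
    "form (axis (Inl a) 1) (axis (Inr c) 1 :: 'k ^ ('n + 'n)) = (if a = c then 1 else 0)"
    "form (axis (Inr a) 1) (axis (Inl c) 1 :: 'k ^ ('n + 'n)) = (if a = c then - 1 else 0)"
    "form (axis (Inr a) 1) (axis (Inr c) 1 :: 'k ^ ('n + 'n)) = 0" for a c
    by (simp_all add: bil_axis symplectic_mult_vec) (auto simp: axis_def)
  have claim: "\<exists>ws. length ws = 4 * card A \<and> transvections ws ** h = mat 1"
    if "finite A" "h \<in> Sp" "\<And>b. b \<notin> A \<Longrightarrow> h *v axis (Inl b) 1 = axis (Inl b) 1 \<and> h *v axis (Inr b) 1 = axis (Inr b) 1"
    for A :: "'n set" and h :: "'k ^ ('n + 'n) ^ ('n + 'n)"
    using that
  proof (induction A arbitrary: h rule: finite_induct)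
    case empty
    have "h *v axis i 1 = axis i 1" for i using empty(2) by (cases i) auto
    then have "column i h = column i (mat 1)" for i
      by (simp only: column_eq matrix_vector_mul_lid)
    then have "h = mat 1" by (simp add: column_def vec_eq_iff)
    then show ?case by simp
  next
    case (insert a A)
    let ?C = "{axis (Inl b) 1 | b. b \<notin> insert a A} \<union> {axis (Inr b) 1 | b. b \<notin> insert a A} :: ('k ^ ('n + 'n)) set"
    have "\<exists>ws. length ws = 4 \<and> transvections ws ** h *v axis (Inl a) 1 = axis (Inl a) 1 \<and>
        transvections ws ** h *v axis (Inr a) 1 = axis (Inr a) 1 \<and> (\<forall>c\<in>?C. transvections ws ** h *v c = c)"
      by (rule fix_hyperbolic_pair[OF insert.prems(1)]) (use insert.prems(2) in \<open>auto simp: ax\<close>)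
    then obtain ws where ws: "length ws = 4" "transvections ws ** h *v axis (Inl a) 1 = axis (Inl a) 1"
      "transvections ws ** h *v axis (Inr a) 1 = axis (Inr a) 1" "\<And>c. c \<in> ?C \<Longrightarrow> transvections ws ** h *v c = c"
      by blast
    have "\<exists>ws'. length ws' = 4 * card A \<and> transvections ws' ** (transvections ws ** h) = mat 1"
    proof (rule insert.IH)
      show "transvections ws ** h \<in> Sp" by (intro Sp_mult transvections_Sp insert.prems(1))
      show "transvections ws ** h *v axis (Inl b) 1 = axis (Inl b) 1 \<and> transvections ws ** h *v axis (Inr b) 1 = axis (Inr b) 1"
        if "b \<notin> A" for b
        using ws(2,3) ws(4)[of "axis (Inl b) 1"] ws(4)[of "axis (Inr b) 1"] that by (cases "b = a") auto
    qed
    then obtain ws' where "length ws' = 4 * card A" "transvections ws' ** (transvections ws ** h) = mat 1" by blast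
    then show ?case
      using ws(1) insert.hyps by (intro exI[of _ "ws' @ ws"]) (simp add: transvections_append matrix_mul_assoc)
  qed
  obtain ws where ws: "length ws = 4 * CARD('n)" "transvections ws ** sp_inv g = mat 1"
    using claim[of UNIV "sp_inv g"] Sp_sp_inv[OF assms] by auto
  have "transvections ws = transvections ws ** sp_inv g ** g"
    by (simp add: sp_inv_left[OF assms] flip: matrix_mul_assoc)
  then show ?thesis using ws by auto
qed

section \<open>Images of affine spaces\<close>

lemma polys_in_subst: "(\<And>v. f v \<in> polys_in W) \<Longrightarrow> subst f p \<in> polys_in W"
  by (induction p rule: mpoly_induct) (auto simp: subst_simps intro: polys_in.intros)

text \<open>A weak form of Chevalley's theorem on images of morphisms.\<close>

lemma image_contains_open:
  fixes \<psi> :: "'w \<Rightarrow> ('s, 'k::alg_closed_field) mpoly" and K :: "'s set"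
  assumes K: "finite K"
  defines "I \<equiv> {point_map \<psi> s | s. \<forall>i. i \<notin> K \<longrightarrow> s i = 0}"
  shows "\<exists>F. (\<exists>y\<in>I. eval_at y F \<noteq> 0) \<and> (\<forall>y\<in>points (vanishing_ideal I). eval_at y F \<noteq> 0 \<longrightarrow> y \<in> I)"
proof -
  define S where "S = {s :: 's \<Rightarrow> 'k. \<forall>i. i \<notin> K \<longrightarrow> s i = 0}"
  define gr where "gr s = case_sum (point_map \<psi> s) s" for s
  have gr: "eval_at (gr s) q = eval_at s (subst (case_sum \<psi> Var) q)" for s q
    unfolding eval_at_subst gr_def
    by (rule arg_cong[where f = "\<lambda>y. eval_at y q"]) (auto simp: fun_eq_iff point_map_def split: sum.split)
  \<comment> \<open>The ideal of the graph of the parametrisation; eliminating the parameters from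
    it gives the closure of the image.\<close>
  define P where "P = vanishing_ideal (gr ` S)"
  have memP: "q \<in> P \<longleftrightarrow> (\<forall>s\<in>S. eval_at (gr s) q = 0)" for q
    by (simp add: P_def vanishing_ideal_def)
  have prime: "prime_ideal P"
    unfolding prime_ideal_def
  proof (intro conjI allI impI)
    show "is_ideal P" by (simp add: P_def)
    have "(\<lambda>_. 0) \<in> S" by (simp add: S_def)
    then show "1 \<notin> P" by (auto simp: memP eval_at_simps)
    fix a b assume ab: "a * b \<in> P"
    show "a \<in> P \<or> b \<in> P"
    proof (rule ccontr)
      assume "\<not> (a \<in> P \<or> b \<in> P)"
      then obtain s s' where s: "s \<in> S" "eval_at (gr s) a \<noteq> 0" and s': "s' \<in> S" "eval_at (gr s') b \<noteq> 0"
        by (auto simp: memP)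
      \<comment> \<open>Two functions, each nonzero somewhere on the graph, are compared on the line
        joining the two parameters; there they are nonzero univariate polynomials, so their product
        is nonzero somewhere.\<close>
      define l where "l i = [:s i, s' i - s i:]" for i
      let ?al = "along l (subst (case_sum \<psi> Var) a)" and ?bl = "along l (subst (case_sum \<psi> Var) b)"
      have pl: "poly (along l (subst (case_sum \<psi> Var) q)) u = eval_at (gr (\<lambda>i. poly (l i) u)) q" for q u
        unfolding poly_along gr ..
      have "poly ?al 0 \<noteq> 0" "poly ?bl 1 \<noteq> 0" unfolding pl using s s' by (simp_all add: l_def)
      then have "?al * ?bl \<noteq> 0" by auto
      then obtain u where "poly (?al * ?bl) u \<noteq> 0" using poly_cofinite_nonzero[of _ "{}"] by blast
      moreover have "(\<lambda>i. poly (l i) u) \<in> S" using s(1) s'(1) by (simp add: S_def l_def)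
      ultimately show False using ab by (auto simp: memP pl eval_at_simps)
    qed
  qed
  have fin: "finite (Inr ` K :: ('w + 's) set)" and disj: "Inr ` K \<inter> range Inl = ({} :: ('w + 's) set)"
    using K by auto
  \<comment> \<open>Extension of points from the target coordinates to the graph, with \<beta> equal
    to 1: wherever \<open>\<alpha>\<close> is nonzero, a point of the closure of the image acquires
    parameters.\<close>
  have one: "1 \<in> polys_in (Inr ` K \<union> range Inl) - P"
    using prime by (simp add: prime_ideal_def)
  from extend_point[OF prime fin disj one] obtain \<alpha> where
    \<alpha>': "\<alpha> \<in> polys_in (range Inl) - P" and
    ext': "\<forall>x. (\<forall>p\<in>polys_in (range Inl) \<inter> P. eval_at x p = 0) \<longrightarrow> eval_at x \<alpha> \<noteq> 0 \<longrightarrow>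
      (\<exists>y. (\<forall>v\<in>range Inl. y v = x v) \<and>
        (\<forall>p\<in>polys_in (Inr ` K \<union> range Inl) \<inter> P. eval_at y p = 0) \<and> eval_at y 1 \<noteq> 0)"
    by (rule bexE)
  then have \<alpha>: "\<alpha> \<in> polys_in (range Inl)" "\<alpha> \<notin> P" by auto
  let ?r = "subst (case_sum Var (\<lambda>_. 0))"
  have r: "eval_at y (?r q) = eval_at (case_sum y (\<lambda>_. 0)) q" for y q
    unfolding eval_at_subst
    by (rule arg_cong[where f = "\<lambda>y. eval_at y q"]) (auto simp: fun_eq_iff eval_at_simps split: sum.split)
  have rs: "eval_at (point_map \<psi> s) (?r q) = eval_at (gr s) q" if "q \<in> polys_in (range Inl)" for s q
    unfolding r by (rule polys_in_eval_cong[OF that]) (auto simp: gr_def)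
  show ?thesis
  proof (rule exI[of _ "?r \<alpha>"], intro conjI ballI impI)
    obtain s where "s \<in> S" "eval_at (gr s) \<alpha> \<noteq> 0" using \<alpha>(2) by (auto simp: memP)
    then show "\<exists>y\<in>I. eval_at y (?r \<alpha>) \<noteq> 0" using rs[OF \<alpha>(1), of s]
      by (intro bexI[of _ "point_map \<psi> s"]) (auto simp: I_def S_def)
  next
    fix y assume y: "y \<in> points (vanishing_ideal I)" and nz: "eval_at y (?r \<alpha>) \<noteq> 0"
    have y0: "eval_at (case_sum y (\<lambda>_. 0)) p = 0" if "p \<in> polys_in (range Inl) \<inter> P" for p
    proof -
      have "?r p \<in> vanishing_ideal I"
        using that rs[of p] by (auto simp: vanishing_ideal_def I_def memP S_def)
      then show ?thesis using y by (auto simp: points_def r)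
    qed
    then obtain y' where y': "\<And>w. y' (Inl w) = y w" "\<And>p. p \<in> polys_in (Inr ` K \<union> range Inl) \<inter> P \<Longrightarrow> eval_at y' p = 0"
    proof -
      have "\<forall>p\<in>polys_in (range Inl) \<inter> P. eval_at (case_sum y (\<lambda>_. 0)) p = 0" using y0 by blast
      from ext'[rule_format, OF this[rule_format] nz[unfolded r]] obtain y' where
        "\<forall>v\<in>range Inl. y' v = case_sum y (\<lambda>_. 0) v" and
        "\<forall>p\<in>polys_in (Inr ` K \<union> range Inl) \<inter> P. eval_at y' p = 0" by blast
      then show thesis by (intro that[of y']) auto
    qed
    \<comment> \<open>Parameters outside \<open>K\<close> are set to 0, as they are on
      \<open>S\<close>; this keeps the graph equations within the finitely many parameters to which
      the point was extended.\<close>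
    define \<rho> :: "'s \<Rightarrow> ('w + 's, 'k) mpoly" where "\<rho> i = (if i \<in> K then Var (Inr i) else 0)" for i
    define s where "s i = eval_at y' (\<rho> i)" for i
    have "y w = eval_at s (\<psi> w)" for w
    proof -
      have "Var (Inl w) - subst \<rho> (\<psi> w) \<in> polys_in (Inr ` K \<union> range Inl)"
        by (intro polys_in_diff polys_in_subst polys_in.Var) (auto simp: \<rho>_def intro: polys_in.Var)
      moreover have "Var (Inl w) - subst \<rho> (\<psi> w) \<in> P"
        unfolding memP
      proof
        fix s assume "s \<in> S"
        then have "(\<lambda>i. eval_at (gr s) (\<rho> i)) = s"
          by (auto simp: S_def \<rho>_def gr_def eval_at_simps fun_eq_iff)
        then show "eval_at (gr s) (Var (Inl w) - subst \<rho> (\<psi> w)) = 0"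
          by (simp add: eval_at_simps eval_at_subst) (simp add: gr_def point_map_def)
      qed
      ultimately have "eval_at y' (Var (Inl w) - subst \<rho> (\<psi> w)) = 0" using y'(2) by blast
      then show ?thesis by (simp add: eval_at_simps eval_at_subst y'(1) s_def[abs_def])
    qed
    then have "y = point_map \<psi> s" by (simp add: point_map_def fun_eq_iff)
    moreover have "s i = 0" if "i \<notin> K" for i using that by (simp add: s_def \<rho>_def eval_at_simps)
    ultimately show "y \<in> I" by (auto simp: I_def)
  qed
qed

section \<open>Orbits are open in their closures\<close>

text \<open>Lets polynomial dependence be checked on values, by closure rules, without naming a
  polynomial.\<close>

definition poly_fun :: "(('s \<Rightarrow> 'k::comm_ring_1) \<Rightarrow> 'k) \<Rightarrow> bool" where
  "poly_fun \<phi> \<longleftrightarrow> (\<exists>p. \<phi> = (\<lambda>s. eval_at s p))"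

lemma poly_fun_const: "poly_fun (\<lambda>_. c)"
  unfolding poly_fun_def by (rule exI[of _ "Const c"]) simp

lemma poly_fun_var: "poly_fun (\<lambda>s. s i)"
  unfolding poly_fun_def by (rule exI[of _ "Var i"]) simp

lemma poly_fun_add: "poly_fun \<phi> \<Longrightarrow> poly_fun \<phi>' \<Longrightarrow> poly_fun (\<lambda>s. \<phi> s + \<phi>' s)"
  unfolding poly_fun_def
  by (elim exE, rename_tac p q, rule_tac x = "p + q" in exI) (simp add: eval_at_simps)

lemma poly_fun_mult: "poly_fun \<phi> \<Longrightarrow> poly_fun \<phi>' \<Longrightarrow> poly_fun (\<lambda>s. \<phi> s * \<phi>' s)"
  unfolding poly_fun_def
  by (elim exE, rename_tac p q, rule_tac x = "p * q" in exI) (simp add: eval_at_simps)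

lemma poly_fun_sum: "(\<And>a. a \<in> A \<Longrightarrow> poly_fun (\<phi> a)) \<Longrightarrow> poly_fun (\<lambda>s. \<Sum>a\<in>A. \<phi> a s)"
  by (induction A rule: infinite_finite_induct) (auto intro: poly_fun_const poly_fun_add)

lemma poly_fun_matrix_mult:
  "(\<And>i j. poly_fun (\<lambda>s. M s $ i $ j)) \<Longrightarrow> (\<And>i j. poly_fun (\<lambda>s. N s $ i $ j)) \<Longrightarrow>
    poly_fun (\<lambda>s. (M s ** N s) $ i $ j)"
  by (simp add: matrix_matrix_mult_def) (intro poly_fun_sum poly_fun_mult)

lemma poly_fun_matrix_vector_mult:
  "(\<And>i j. poly_fun (\<lambda>s. M s $ i $ j)) \<Longrightarrow> (\<And>i. poly_fun (\<lambda>s. u s $ i)) \<Longrightarrow>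
    poly_fun (\<lambda>s. (M s *v u s) $ i)"
  by (simp add: matrix_vector_mult_def) (intro poly_fun_sum poly_fun_mult)

lemma poly_fun_transvections:
  fixes h :: "'i \<Rightarrow> ('s \<Rightarrow> 'k::comm_ring_1) \<Rightarrow> 'k ^ ('n + 'n::finite)"
  assumes "\<And>m j. poly_fun (\<lambda>s. h m s $ j)"
  shows "poly_fun (\<lambda>s. transvections (map (\<lambda>m. h m s) ms) $ i $ j)"
proof (induction ms arbitrary: i j)
  case Nil
  then show ?case by (simp add: mat_def poly_fun_const)
next
  case (Cons m ms)
  have "poly_fun (\<lambda>s. transvection (h m s) $ i $ j)" for i j
    unfolding transvection_def vec_lambda_beta
    by (intro poly_fun_add poly_fun_mult poly_fun_matrix_vector_mult poly_fun_const assms)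
  then show ?case using Cons by (simp add: poly_fun_matrix_mult)
qed

lemma point_map_exotic_action [simp]: "point_map (exotic_action g) z = exotic_act g z"
proof -
  have "eval_at z (exotic_action g c) = exotic_act g z c" for c
    by (cases c) (auto simp: exotic_action_def exotic_act_def matrix_const_def matrix_vector_mult_def
        matrix_matrix_mult_def transpose_def eval_at_simps)
  then show ?thesis by (simp add: point_map_def fun_eq_iff)
qed

lemma orbit_exotic: "orbit exotic_action z = {exotic_act g z | g. g \<in> Sp}"
  by (simp add: orbit_def)

text \<open>As the image of an affine space, the orbit contains a nonempty open piece of its
  closure; a group element moves this piece to any given point of the orbit.\<close>

theorem orbit_locally_closed:
  fixes z :: "'n::finite exotic_coord \<Rightarrow> 'k::alg_closed_field"
  assumes o: "o' \<in> orbit exotic_action z"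
  shows "\<exists>F. eval_at o' F \<noteq> 0 \<and>
    (\<forall>y\<in>points (vanishing_ideal (orbit exotic_action z)). eval_at y F \<noteq> 0 \<longrightarrow> y \<in> orbit exotic_action z)"
proof -
  let ?O = "orbit exotic_action z"
  define N where "N = 4 * CARD('n)"
  define K :: "(nat \<times> ('n + 'n)) set" where "K = {..<N} \<times> UNIV"
  define T :: "(nat \<times> ('n + 'n) \<Rightarrow> 'k) \<Rightarrow> 'k ^ ('n + 'n) ^ ('n + 'n)" where
    "T s = transvections (map (\<lambda>m. (\<chi> j. s (m, j))) [0..<N])" for s
  have T: "poly_fun (\<lambda>s. T s $ i $ j)" for i j
    unfolding T_def by (rule poly_fun_transvections) (simp add: poly_fun_var)
  have "poly_fun (\<lambda>s. exotic_act (T s) z c)" for c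
    by (cases c) (auto simp: exotic_act_def intro!: poly_fun_matrix_mult poly_fun_matrix_vector_mult T poly_fun_const
      poly_fun_var simp: transpose_def)
  then obtain \<psi> where \<psi>: "\<And>c s. exotic_act (T s) z c = eval_at s (\<psi> c)" unfolding poly_fun_def by metis
  then have \<psi>: "point_map \<psi> s = exotic_act (T s) z" for s by (simp add: point_map_def fun_eq_iff)
  have surj: "\<exists>s. (\<forall>i. i \<notin> K \<longrightarrow> s i = 0) \<and> g = T s" if g: "g \<in> Sp" for g
  proof -
    obtain ws where ws: "length ws = N" "g = transvections ws" using Sp_transvections[OF g] by (auto simp: N_def)
    define s where "s = (\<lambda>(m, j). if m < N then ws ! m $ j else 0)"
    have "map (\<lambda>m. (\<chi> j. s (m, j))) [0..<N] = ws"
      by (rule nth_equalityI) (simp_all add: ws s_def vec_eq_iff)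
    then show ?thesis by (intro exI[of _ s]) (auto simp: T_def ws K_def s_def)
  qed
  have img: "{point_map \<psi> s | s. \<forall>i. i \<notin> K \<longrightarrow> s i = 0} = ?O"
  proof (intro equalityI subsetI)
    show "y \<in> ?O" if "y \<in> {point_map \<psi> s | s. \<forall>i. i \<notin> K \<longrightarrow> s i = 0}" for y
      using that transvections_Sp by (auto simp: orbit_exotic \<psi> T_def)
    show "y \<in> {point_map \<psi> s | s. \<forall>i. i \<notin> K \<longrightarrow> s i = 0}" if "y \<in> ?O" for y
      using that surj unfolding orbit_exotic \<psi> by fastforce
  qed
  have "finite K" by (simp add: K_def)
  from image_contains_open[OF this, of \<psi>, unfolded img]
  obtain F y0 where F: "y0 \<in> ?O" "eval_at y0 F \<noteq> 0"
    "\<And>y. y \<in> points (vanishing_ideal ?O) \<Longrightarrow> eval_at y F \<noteq> 0 \<Longrightarrow> y \<in> ?O" by blast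
  obtain g0 g1 where g0: "g0 \<in> Sp" "y0 = exotic_act g0 z" and g1: "g1 \<in> Sp" "o' = exotic_act g1 z"
    using F(1) o by (auto simp: orbit_exotic)
  define h where "h = g0 ** sp_inv g1"
  have h: "h \<in> Sp" unfolding h_def by (intro Sp_mult Sp_sp_inv g0 g1)
  have act_O: "exotic_act g y \<in> ?O" if "y \<in> ?O" "g \<in> Sp" for g y
    using that unfolding orbit_exotic by (auto simp: Sp_mult simp flip: exotic_act_mult)
  have e: "eval_at y (subst (exotic_action g) p) = eval_at (exotic_act g y) p" for y g p
    by (simp add: eval_at_subst_point_map)
  show ?thesis
  proof (rule exI[of _ "subst (exotic_action h) F"], intro conjI ballI impI)
    have "exotic_act h o' = y0"
      by (simp add: h_def g0 g1 sp_inv_left[OF g1(1)] flip: exotic_act_mult matrix_mul_assoc)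
    then show "eval_at o' (subst (exotic_action h) F) \<noteq> 0" using F(2) by (simp add: e)
  next
    fix y assume y: "y \<in> points (vanishing_ideal ?O)" and nz: "eval_at y (subst (exotic_action h) F) \<noteq> 0"
    have "exotic_act h y \<in> points (vanishing_ideal ?O)"
      unfolding points_def
    proof (intro CollectI ballI)
      fix p assume "p \<in> vanishing_ideal ?O"
      then have "subst (exotic_action h) p \<in> vanishing_ideal ?O"
        using act_O[OF _ h] by (auto simp: vanishing_ideal_def e)
      then show "eval_at (exotic_act h y) p = 0" using y by (auto simp: points_def e[symmetric])
    qed
    then have "exotic_act h y \<in> ?O" using F(3) nz by (simp add: e)
    then have "exotic_act (sp_inv h) (exotic_act h y) \<in> ?O" by (rule act_O[OF _ Sp_sp_inv[OF h]])
    then show "y \<in> ?O" by (simp add: sp_inv_left[OF h] flip: exotic_act_mult)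
  qed
qed

section \<open>Flatness over a line\<close>

lemma poly_ideal_principal:
  fixes a :: "'k::field poly set"
  assumes a: "is_ideal a"
  shows "\<exists>d\<in>a. \<forall>x\<in>a. d dvd x"
proof (cases "a \<subseteq> {0}")
  case True
  then show ?thesis using ideal.subspace_0[OF a] by auto
next
  case False
  then have "\<exists>d. d \<in> a \<and> d \<noteq> 0" by blast
  then obtain d where d: "d \<in> a" "d \<noteq> 0" and min: "\<And>x. x \<in> a \<Longrightarrow> x \<noteq> 0 \<Longrightarrow> Polynomial.degree d \<le> Polynomial.degree x"
    using ex_has_least_nat[of "\<lambda>d. d \<in> a \<and> d \<noteq> 0" _ Polynomial.degree] by blast
  have "d dvd x" if "x \<in> a" for x
  proof -
    have "x mod d = x - d * (x div d)" by (simp add: minus_mult_div_eq_mod)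
    then have "x mod d \<in> a" using a that d(1) by (auto intro: ideal.subspace_diff ideal_mult_right)
    then have "x mod d = 0" using min[of "x mod d"] degree_mod_less[OF d(2), of x] by force
    then show ?thesis by (simp add: dvd_eq_mod_eq_0)
  qed
  then show ?thesis using d by blast
qed

lemma tensor_relations_group:
  shows "u \<in> tensor_relations h a N \<Longrightarrow> - u \<in> tensor_relations h a N"
    and "u \<in> tensor_relations h a N \<Longrightarrow> w \<in> tensor_relations h a N \<Longrightarrow> u + w \<in> tensor_relations h a N"
proof -
  show m: "- u \<in> tensor_relations h a N" if "u \<in> tensor_relations h a N" for u
    using tensor_relations.diff[OF tensor_relations.zero that] by simp
  show "u + w \<in> tensor_relations h a N" if "u \<in> tensor_relations h a N" "w \<in> tensor_relations h a N"
    using tensor_relations.diff[OF that(1) m[OF that(2)]] by simp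
qed

lemma tensor_add:
  assumes "d \<in> a" "u - Poly_Mapping.single (d, m) 1 \<in> tensor_relations h a N"
    "u' - Poly_Mapping.single (d, m') 1 \<in> tensor_relations h a N"
  shows "u + u' - Poly_Mapping.single (d, m + m') 1 \<in> tensor_relations h a N"
proof -
  have "(u - Poly_Mapping.single (d, m) 1) + (u' - Poly_Mapping.single (d, m') 1) -
    (Poly_Mapping.single (d, m + m') 1 - Poly_Mapping.single (d, m) 1 - Poly_Mapping.single (d, m') 1) \<in> tensor_relations h a N"
    by (intro tensor_relations.diff tensor_relations_group(2) assms tensor_relations.add_right)
  then show ?thesis by (simp add: algebra_simps)
qed

lemma tensor_diff:
  assumes "d \<in> a" "u - Poly_Mapping.single (d, m) 1 \<in> tensor_relations h a N"
    "u' - Poly_Mapping.single (d, m') 1 \<in> tensor_relations h a N"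
  shows "u - u' - Poly_Mapping.single (d, m - m') 1 \<in> tensor_relations h a N"
proof -
  have "(u - Poly_Mapping.single (d, m) 1) - (u' - Poly_Mapping.single (d, m') 1) +
    (Poly_Mapping.single (d, (m - m') + m') 1 - Poly_Mapping.single (d, m - m') 1 - Poly_Mapping.single (d, m') 1) \<in> tensor_relations h a N"
    by (intro tensor_relations.diff tensor_relations_group(2) assms tensor_relations.add_right)
  then show ?thesis by (simp add: algebra_simps)
qed

lemma tensor_zero: "d \<in> a \<Longrightarrow> is_ideal N \<Longrightarrow> 0 - Poly_Mapping.single (d, 0) 1 \<in> tensor_relations h a N"
  using tensor_relations_group(1)[OF tensor_relations.quotient[of d a 0 N h]] by (simp add: ideal.subspace_0)

lemma tensor_scale_int:
  assumes d: "d \<in> a" and N: "is_ideal N"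
    and u: "Poly_Mapping.single k 1 - Poly_Mapping.single (d, m) 1 \<in> tensor_relations h a N"
  shows "Poly_Mapping.single k n - Poly_Mapping.single (d, of_int n * m) 1 \<in> tensor_relations h a N"
proof (induction n rule: int_induct[where k = 0])
  case base
  then show ?case using tensor_zero[OF d N] by simp
next
  case (step1 i)
  show ?case using tensor_add[OF d step1(2) u] by (simp add: single_add algebra_simps)
next
  case (step2 i)
  show ?case using tensor_diff[OF d step2(2) u] by (simp add: single_diff algebra_simps)
qed

text \<open>Ideals of the univariate polynomial ring are principal, so modulo the relations every
  tensor is a single pure tensor of the generator \<open>d\<close> with some \<open>m\<close>. If
  its image \<open>h d * m\<close> lies in \<open>N\<close>, torsion-freeness puts \<open>m\<close>
  in \<open>N\<close>.\<close>

theorem torsion_free_flat: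
  fixes h :: "'k::field poly \<Rightarrow> 'p::comm_ring_1"
  assumes h: "ring_hom_on h" and N: "is_ideal N"
    and torsion_free: "\<And>r m. r \<noteq> 0 \<Longrightarrow> h r * m \<in> N \<Longrightarrow> m \<in> N"
  shows "flat h N"
  unfolding flat_def
proof (intro allI impI)
  fix a :: "'k poly set" and z :: "'k poly \<times> 'p \<Rightarrow>\<^sub>0 int"
  assume a: "is_ideal a" and keys: "Poly_Mapping.keys z \<subseteq> a \<times> UNIV"
    and zN: "(\<Sum>(x, m)\<in>Poly_Mapping.keys z. of_int (Poly_Mapping.lookup z (x, m)) * (h x * m)) \<in> N"
  let ?R = "tensor_relations h a N"
  obtain d where d: "d \<in> a" "\<And>x. x \<in> a \<Longrightarrow> d dvd x" using poly_ideal_principal[OF a] by blast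
  define \<mu> where "\<mu> = (\<lambda>(x, m). of_int (Poly_Mapping.lookup z (x, m)) * (h (x div d) * m))"
  have hd: "h x = h d * h (x div d)" if "x \<in> a" for x
    using d(2)[OF that] by (simp flip: ring_hom_onD(2)[OF h])
  have single: "Poly_Mapping.single k (Poly_Mapping.lookup z k) - Poly_Mapping.single (d, \<mu> k) 1 \<in> ?R"
    if k: "k \<in> Poly_Mapping.keys z" for k
  proof -
    obtain x m where k': "k = (x, m)" "x \<in> a" using k keys by (cases k) auto
    have "Poly_Mapping.single (x, m) 1 - Poly_Mapping.single (d, h (x div d) * m) 1 \<in> ?R"
      using tensor_relations.scale[OF d(1), of "x div d" m h N] d(2)[OF k'(2)] by simp
    from tensor_scale_int[OF d(1) N this] show ?thesis by (simp add: k' \<mu>_def)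
  qed
  have sums: "(\<Sum>k\<in>K. Poly_Mapping.single k (Poly_Mapping.lookup z k)) - Poly_Mapping.single (d, \<Sum>k\<in>K. \<mu> k) 1 \<in> ?R"
    if "finite K" "K \<subseteq> Poly_Mapping.keys z" for K
    using that
  proof (induction K)
    case empty
    show ?case using tensor_zero[OF d(1) N, of h] by simp
  qed (auto intro!: tensor_add[OF d(1)] single)
  have z: "(\<Sum>k\<in>Poly_Mapping.keys z. Poly_Mapping.single k (Poly_Mapping.lookup z k)) = z"
    by (rule poly_mapping_eqI) (auto simp: lookup_sum lookup_single when_def in_keys_iff)
  have zM: "z - Poly_Mapping.single (d, sum \<mu> (Poly_Mapping.keys z)) 1 \<in> ?R"
    using sums[OF finite_keys subset_refl] unfolding z .
  have "Poly_Mapping.single (d, sum \<mu> (Poly_Mapping.keys z)) 1 \<in> ?R"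
  proof (cases "d = 0")
    case True
    \<comment> \<open>Torsion-freeness says nothing for the zero ideal, but there the scalar 0 moves
      across the tensor sign and kills the pure tensor.\<close>
    have "Poly_Mapping.single (0, 0) 1 \<in> ?R"
      using d(1) ideal.subspace_0[OF N] by (intro tensor_relations.quotient) (simp_all add: True)
    moreover have "Poly_Mapping.single (0, 0) 1 - Poly_Mapping.single (0, sum \<mu> (Poly_Mapping.keys z)) 1 \<in> ?R"
      if "Poly_Mapping.single (0, sum \<mu> (Poly_Mapping.keys z)) 1 - Poly_Mapping.single (0, 0) 1 \<in> ?R"
      using tensor_relations_group(1)[OF that] by simp
    moreover have "Poly_Mapping.single (0, sum \<mu> (Poly_Mapping.keys z)) 1 - Poly_Mapping.single (0, 0) 1 \<in> ?R"
      using tensor_relations.scale[of 0 a 0 "sum \<mu> (Poly_Mapping.keys z)" h N] d(1) by (simp add: True ring_hom_onD[OF h])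
    ultimately show ?thesis
      using tensor_relations_group(2)[of "Poly_Mapping.single (0, sum \<mu> (Poly_Mapping.keys z)) 1 - Poly_Mapping.single (0, 0) 1"] True by fastforce
  next
    case False
    have "h d * sum \<mu> (Poly_Mapping.keys z) =
      (\<Sum>(x, m)\<in>Poly_Mapping.keys z. of_int (Poly_Mapping.lookup z (x, m)) * (h x * m))"
      unfolding sum_distrib_left
    proof (intro sum.cong refl)
      fix k assume "k \<in> Poly_Mapping.keys z"
      then obtain x m where k: "k = (x, m)" "x \<in> a" using keys by (cases k) auto
      show "h d * \<mu> k = (case k of (x, m) \<Rightarrow> of_int (Poly_Mapping.lookup z (x, m)) * (h x * m))"
        by (simp add: k(1) \<mu>_def hd[OF k(2)] mult_ac)
    qed
    then have "sum \<mu> (Poly_Mapping.keys z) \<in> N" using torsion_free[OF False] zN by simp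
    then show ?thesis by (intro tensor_relations.quotient d(1))
  qed
  then show "z \<in> ?R" using tensor_relations_group(2)[OF zM] by fastforce
qed

lemma line_hom: "ring_hom_on (\<lambda>r. poly (map_poly Const r) \<pi>)"
  by (rule ring_hom_on_comp[OF ring_hom_on_poly ring_hom_on_map_poly[OF ring_hom_on_Const]])

lemma hom_line:
  assumes g: "ring_hom_on g" and c: "\<And>c. g (Const c) = k c"
  shows "g (poly (map_poly Const r) \<pi>) = poly (map_poly k r) (g \<pi>)"
proof -
  have k0: "k 0 = 0" using c[of 0] ring_hom_onD(4)[OF g] by simp
  show ?thesis
    by (induction r) (auto simp: map_poly_pCons k0 c ring_hom_onD[OF g])
qed

lemma eval_line: "eval_at x (poly (map_poly Const r) \<pi>) = poly r (eval_at x \<pi>)"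
  using hom_line[OF eval_at_hom, of _ "\<lambda>c. c"] by (simp add: map_poly_id')

lemma extend_var_line: "extend_var (poly (map_poly Const r) \<pi>) = poly (map_poly Const r) (extend_var \<pi>)"
  unfolding extend_var_def by (rule hom_line) simp_all

section \<open>Families swept out by sections\<close>

definition swept :: "('v \<Rightarrow> 'k::field) set \<Rightarrow> ('v, 'k) mpoly \<Rightarrow> bool" where
  "swept S \<pi> \<longleftrightarrow> (\<forall>x\<in>S. \<exists>y s\<^sub>0. (\<lambda>v. poly (y v) s\<^sub>0) = x \<and>
     (\<forall>s. (\<lambda>v. poly (y v) s) \<in> S \<and> eval_at (\<lambda>v. poly (y v) s) \<pi> = s))"

text \<open>Along a section of \<open>\<pi>\<close> the product becomes
  \<open>r * along y m\<close>, a product in a domain.\<close>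

lemma swept_torsion_free:
  fixes S :: "('v \<Rightarrow> 'k::alg_closed_field) set"
  assumes S: "swept S \<pi>" and r: "r \<noteq> 0" and m: "poly (map_poly Const r) \<pi> * m \<in> vanishing_ideal S"
  shows "m \<in> vanishing_ideal S"
  unfolding vanishing_ideal_def
proof (intro CollectI ballI)
  fix x assume "x \<in> S"
  then obtain y s\<^sub>0 where y: "(\<lambda>v. poly (y v) s\<^sub>0) = x"
    "\<And>s. (\<lambda>v. poly (y v) s) \<in> S" "\<And>s. eval_at (\<lambda>v. poly (y v) s) \<pi> = s"
    using S unfolding swept_def by metis
  have "r * along y m = 0"
  proof (rule poly_zero_infinite[of "{}"])
    fix s
    have "eval_at (\<lambda>v. poly (y v) s) (poly (map_poly Const r) \<pi> * m) = 0"
      using m y(2) by (simp add: vanishing_ideal_def)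
    then show "poly (r * along y m) s = 0" by (simp add: eval_at_simps eval_line y(3) poly_along)
  qed simp
  then have "along y m = 0" using r by simp
  then show "eval_at x m = 0" using poly_along[of y m s\<^sub>0] y(1) by simp
qed

lemma swept_flat:
  fixes S :: "('v \<Rightarrow> 'k::alg_closed_field) set"
  assumes "swept S \<pi>"
  shows "flat_over_line (vanishing_ideal S) \<pi>"
  unfolding flat_over_line_def
  by (rule torsion_free_flat[OF line_hom is_ideal_vanishing_ideal swept_torsion_free[OF assms]])

lemma extend_var_hom: "ring_hom_on extend_var"
  unfolding extend_var_def by simp

text \<open>The extra variable is an inverse of \<open>f\<close> modulo the ideal, so a power of
  \<open>f\<close> removes it.\<close>

lemma principal_open_clear_denominator:
  fixes m :: "('v option, 'k::field) mpoly"
  shows "\<exists>g N. m * extend_var f ^ N - extend_var g \<in> principal_open J f"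
proof -
  let ?P = "principal_open J f"
  note e = ring_hom_onD[OF extend_var_hom]
  have P: "is_ideal ?P" unfolding principal_open_def by (rule ideal.subspace_span)
  show ?thesis
  proof (induction m rule: mpoly_induct)
    case (Const c)
    show ?case by (rule exI[of _ "Const c"], rule exI[of _ 0]) (simp add: extend_var_def ideal.subspace_0[OF P])
  next
    case (Var v)
    show ?case
    proof (cases v)
      case None
      have "Var None * extend_var f - 1 \<in> ?P" unfolding principal_open_def by (intro ideal.span_base) simp
      then show ?thesis by (intro exI[of _ 1]) (simp add: None e)
    next
      case (Some w)
      show ?thesis
        by (rule exI[of _ "Var w"], rule exI[of _ 0]) (simp add: Some extend_var_def ideal.subspace_0[OF P])
    qed
  next
    case (add p q)
    obtain g N g' N' where 1: "p * extend_var f ^ N - extend_var g \<in> ?P" "q * extend_var f ^ N' - extend_var g' \<in> ?P"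
      using add by blast
    have "(p * extend_var f ^ N - extend_var g) * extend_var f ^ N' + (q * extend_var f ^ N' - extend_var g') * extend_var f ^ N \<in> ?P"
      by (intro ideal.subspace_add[OF P] ideal_mult_right[OF P] 1)
    then show ?case
      by (intro exI[of _ "g * f ^ N' + g' * f ^ N"] exI[of _ "N + N'"]) (simp add: e power_add algebra_simps)
  next
    case (mult p q)
    obtain g N g' N' where 1: "p * extend_var f ^ N - extend_var g \<in> ?P" "q * extend_var f ^ N' - extend_var g' \<in> ?P"
      using mult by blast
    have "(p * extend_var f ^ N - extend_var g) * (q * extend_var f ^ N') + (q * extend_var f ^ N' - extend_var g') * extend_var g \<in> ?P"
      by (intro ideal.subspace_add[OF P] ideal_mult_right[OF P] 1)
    then show ?case
      by (intro exI[of _ "g * g'"] exI[of _ "N + N'"]) (simp add: e power_add algebra_simps)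
  qed
qed

text \<open>Torsion-freeness passes to the localisation: after clearing denominators, the numerator
  times \<open>f\<close> satisfies the relation on all of \<open>S\<close>, and \<open>f\<close> is
  invertible there.\<close>

lemma swept_lc_flat:
  fixes S :: "('v \<Rightarrow> 'k::alg_closed_field) set"
  assumes S: "swept S \<pi>"
  shows "lc_flat_over_line (vanishing_ideal S) U \<pi>"
  unfolding lc_flat_over_line_def flat_over_line_def
proof (intro ballI torsion_free_flat[OF line_hom])
  fix f
  let ?J = "vanishing_ideal S"
  let ?P = "principal_open ?J f"
  note e = ring_hom_onD[OF extend_var_hom]
  show P: "is_ideal ?P" unfolding principal_open_def by (rule ideal.subspace_span)
  have yf: "Var None * extend_var f - 1 \<in> ?P" unfolding principal_open_def by (intro ideal.span_base) simp
  have J: "extend_var p \<in> ?P" if "p \<in> ?J" for p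
    unfolding principal_open_def using that by (intro ideal.span_base) simp
  have cancel: "m \<in> ?P" if "m * extend_var f \<in> ?P" for m
  proof -
    have "m * extend_var f * Var None - m * (Var None * extend_var f - 1) \<in> ?P"
      by (intro ideal.subspace_diff[OF P] ideal_mult_right[OF P] that ideal.subspace_scale[OF P] yf)
    then show ?thesis by (simp add: algebra_simps)
  qed
  have cancel: "m \<in> ?P" if "m * extend_var f ^ N \<in> ?P" for m N
    using that
  proof (induction N)
    case (Suc N)
    then show ?case using cancel[of "m * extend_var f ^ N"] by (simp add: mult_ac)
  qed simp
  have points: "eval_at x p = 0" if "extend_var p \<in> ?P" "x \<in> S" "eval_at x f \<noteq> 0" for p x
  proof -
    define x' where "x' = case_option (inverse (eval_at x f)) x"
    have ev: "eval_at x' (extend_var q) = eval_at x q" for q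
      by (simp add: extend_var_def eval_at_subst x'_def)
    have "eval_at x' (extend_var p) = 0"
    proof (rule eval_at_ideal_gen[OF that(1)[unfolded principal_open_def]])
      fix q assume "q \<in> insert (Var None * extend_var f - 1) (extend_var ` ?J)"
      then show "eval_at x' q = 0"
        using that(2,3) by (auto simp: ev eval_at_simps vanishing_ideal_def) (simp add: x'_def)
    qed
    then show ?thesis by (simp add: ev)
  qed
  fix r m
  assume r: "r \<noteq> 0" and rm: "poly (map_poly Const r) (extend_var \<pi>) * m \<in> ?P"
  obtain g N where g: "m * extend_var f ^ N - extend_var g \<in> ?P"
    using principal_open_clear_denominator by blast
  let ?h = "poly (map_poly Const r) \<pi>"
  have "(extend_var ?h * m) * extend_var f ^ N - extend_var ?h * (m * extend_var f ^ N - extend_var g) \<in> ?P"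
    by (rule ideal.subspace_diff[OF P ideal_mult_right[OF P] ideal.subspace_scale[OF P g]])
      (use rm in \<open>simp add: extend_var_line\<close>)
  then have "extend_var (?h * g) \<in> ?P" by (simp add: e algebra_simps)
  then have "eval_at x (?h * g) = 0 \<or> eval_at x f = 0" if "x \<in> S" for x using points[OF _ that] by blast
  then have "?h * (g * f) \<in> ?J" by (auto simp: vanishing_ideal_def eval_at_simps)
  then have "g * f \<in> ?J" by (rule swept_torsion_free[OF S r])
  then have "extend_var g * extend_var f \<in> ?P" using J e(2) by metis
  then have "extend_var g \<in> ?P" using cancel[of _ 1] by simp
  then have "m * extend_var f ^ N \<in> ?P" using ideal_diff_mem_iff[OF P g] by simp
  then show "m \<in> ?P" by (rule cancel)
qed

section \<open>The deformation\<close>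

lemma two_F2_bar: "(2 :: F2_bar) = 0"
proof -
  have "(2 :: F2_bar) = to_ac (2 :: bit)" by (simp only: to_ac_numeral)
  then show ?thesis by simp
qed

lemma two_mpoly: "(2 :: ('v, F2_bar) mpoly) = 0"
proof -
  have "(2 :: ('v, F2_bar) mpoly) = Const 1 + Const 1" by simp
  also have "\<dots> = Const 2" unfolding Const_hom(1)[symmetric] by simp
  finally show ?thesis by (simp add: two_F2_bar)
qed

lemma frobenius:
  assumes "(2 :: 'r::comm_ring_1) = 0"
  shows "ring_hom_on (\<lambda>x :: 'r. x ^ 2)"
proof (rule ring_hom_onI)
  fix a b :: 'r
  have "(a + b) ^ 2 = a ^ 2 + b ^ 2 + 2 * (a * b)" by (simp add: power2_eq_square algebra_simps)
  then show "(a + b) ^ 2 = a ^ 2 + b ^ 2" by (simp add: assms)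
qed (simp_all add: power_mult_distrib)

lemmas frob = frobenius[OF two_F2_bar]

lemma F2_bar_double: "a + a = (0 :: F2_bar)"
  using two_F2_bar by (metis mult_2 mult_zero_left)

lemma F2_bar_neg: "- a = (a :: F2_bar)"
  using F2_bar_double[of a] by (simp add: minus_unique)

lemma F2_bar_square_eq: "a ^ 2 = b ^ 2 \<longleftrightarrow> a = (b :: F2_bar)"
proof
  assume "a ^ 2 = b ^ 2"
  then have "(a + b) ^ 2 = 0" unfolding ring_hom_onD(1)[OF frob] by (simp add: F2_bar_double)
  then have "a = - b" by (simp add: eq_neg_iff_add_eq_0)
  then show "a = b" by (simp add: F2_bar_neg)
qed simp

text \<open>The ambient affine space must have coordinates numbered by naturals; \<open>None\<close>
  stands for the coordinate \<open>t\<close> of the line and receives the number 0.\<close>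

definition enc :: "'n::finite exotic_coord option \<Rightarrow> nat" where
  "enc = case_option 0 (\<lambda>c. Suc (to_nat_on UNIV c))"

lemma enc_None [simp]: "enc None = 0"
  by (simp add: enc_def)

lemma enc_bij: "bij_betw enc (UNIV :: 'n::finite exotic_coord option set) {..<CARD('n exotic_coord option)}"
proof (rule bij_betw_imageI)
  have b: "bij_betw (to_nat_on UNIV) (UNIV :: 'n exotic_coord set) {..<CARD('n exotic_coord)}"
    by (rule to_nat_on_finite) simp
  show "inj (enc :: 'n exotic_coord option \<Rightarrow> nat)"
    using bij_betw_imp_inj_on[OF b] by (auto simp: inj_on_def enc_def split: option.splits)
  have "range (enc :: 'n exotic_coord option \<Rightarrow> nat) = insert 0 (Suc ` to_nat_on UNIV ` (UNIV :: 'n exotic_coord set))"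
    by (auto simp: enc_def UNIV_option_conv image_iff)
  also have "\<dots> = {..<CARD('n exotic_coord option)}"
    unfolding bij_betw_imp_surj_on[OF b] by (simp add: card_UNIV_option lessThan_Suc_eq_insert_0 del: card_Plus)
  finally show "range (enc :: 'n exotic_coord option \<Rightarrow> nat) = {..<CARD('n exotic_coord option)}" .
qed

definition lift :: "('n::finite exotic_coord option \<Rightarrow> 'r::zero) \<Rightarrow> nat \<Rightarrow> 'r" where
  "lift y i = (if i < CARD('n exotic_coord option) then y (Hilbert_Choice.inv enc i) else 0)"

lemma lift_enc [simp]:
  fixes y :: "'n::finite exotic_coord option \<Rightarrow> 'r::zero"
  shows "lift y (enc c) = y c"
proof -
  have "enc c < CARD('n exotic_coord option)" using enc_bij[where 'n = 'n] by (auto simp: bij_betw_def)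
  moreover have "Hilbert_Choice.inv enc (enc c) = c" using enc_bij[where 'n = 'n] by (simp add: bij_betw_def)
  ultimately show ?thesis by (simp add: lift_def)
qed

lemma lift_0 [simp]: "lift y 0 = y None"
  using lift_enc[of y None] by simp

lemma lift_ge [simp]: "i \<ge> CARD('n::finite exotic_coord option) \<Longrightarrow> lift (y :: 'n exotic_coord option \<Rightarrow> 'r::zero) i = 0"
  by (simp add: lift_def)

lemma enc_cases:
  obtains (ge) "i \<ge> CARD('n::finite exotic_coord option)" | (enc) c :: "'n::finite exotic_coord option" where "i = enc c"
proof (cases "i < CARD('n exotic_coord option)")
  case True
  then have "i \<in> range (enc :: 'n exotic_coord option \<Rightarrow> nat)"
    using enc_bij[where 'n = 'n] by (auto simp: bij_betw_def)
  then show ?thesis using enc by blast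
qed (use ge in simp)

abbreviation "d_coord i \<equiv> enc (Some (Inl i))"
abbreviation "x_coord i j \<equiv> enc (Some (Inr (i, j)))"

definition coords ::
  "'r::zero \<Rightarrow> ('n::finite + 'n \<Rightarrow> 'r) \<Rightarrow> ('n + 'n \<Rightarrow> 'n + 'n \<Rightarrow> 'r) \<Rightarrow> nat \<Rightarrow> 'r" where
  "coords t d x = lift (case_option t (case_sum d (\<lambda>(i, j). x i j)))"

lemma coords_simps [simp]: "coords t d x 0 = t" "coords t d x (d_coord i) = d i" "coords t d x (x_coord i j) = x i j"
  by (simp_all add: coords_def)

lemma coords_ge [simp]: "i \<ge> CARD('n::finite exotic_coord option) \<Longrightarrow> coords t (d :: 'n + 'n \<Rightarrow> 'r::zero) x i = 0"
  by (simp add: coords_def)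

lemma coord_cases:
  obtains (ge) "i \<ge> CARD('n::finite exotic_coord option)" | (t) "i = 0"
    | (d) a where "i = d_coord (a :: 'n::finite + 'n)" | (x) a b where "i = x_coord (a :: 'n::finite + 'n) b"
proof (cases i rule: enc_cases[where 'n='n])
  case (enc c)
  show ?thesis
  proof (cases c)
    case None
    then show ?thesis using enc t by simp
  next
    case (Some q)
    then show ?thesis using enc d x by (cases q) auto
  qed
qed (rule ge)

lemma coords_eqI:
  fixes d :: "'n::finite + 'n \<Rightarrow> 'r::zero"
  assumes "z 0 = t" "\<And>i. z (d_coord i) = d i" "\<And>i j. z (x_coord i j) = x i j"
    "\<And>i. i \<ge> CARD('n exotic_coord option) \<Longrightarrow> z i = 0"
  shows "z = coords t d x"
proof
  fix i
  show "z i = coords t d x i" by (cases i rule: coord_cases[where 'n='n]) (simp_all add: assms)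
qed

lemma coords_map:
  fixes d :: "'n::finite + 'n \<Rightarrow> 'r::zero"
  assumes "h 0 = 0"
  shows "h (coords t d x i) = coords (h t) (\<lambda>i. h (d i)) (\<lambda>i j. h (x i j)) i"
  by (cases i rule: coord_cases[where 'n = 'n]) (simp_all add: assms)

text \<open>For \<open>t \<noteq> 0\<close> the coordinates \<open>d\<close> are redundant, as \<open>d\<^sub>i = X\<^sub>i\<^sub>i / t\<close> on the symmetric matrix \<open>X\<close>.\<close>

definition deform :: "('n::finite exotic_coord \<Rightarrow> F2_bar) \<Rightarrow> F2_bar \<Rightarrow> nat \<Rightarrow> F2_bar" where
  "deform z t = coords t (\<lambda>i. z (Inl i) ^ 2) (\<lambda>i j. z (Inr (i, j)) + t * (z (Inl i) * z (Inl j)))"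

definition x_matrix :: "(nat \<Rightarrow> 'r) \<Rightarrow> 'r ^ ('n::finite + 'n) ^ ('n + 'n)" where
  "x_matrix y = (\<chi> i j. y (x_coord i j))"

definition family :: "'n::finite itself \<Rightarrow> (nat \<Rightarrow> F2_bar) set" where
  "family TYPE('n) = {deform z t | z t. z \<in> (exotic_points :: ('n exotic_coord \<Rightarrow> F2_bar) set)}"

lemma deform_x_matrix:
  "x_matrix (deform z t) = (\<chi> i j. mpart z $ i $ j + t * (vpart z $ i * vpart z $ j))"
  by (simp add: x_matrix_def deform_def mpart_def vpart_def)

lemma alternating_F2_bar:
  "alternating (x :: F2_bar ^ 'i::finite ^ 'i) \<longleftrightarrow> (\<forall>i j. x $ i $ j = x $ j $ i) \<and> (\<forall>i. x $ i $ i = 0)"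
  unfolding alternating_def by (auto simp: F2_bar_neg)

text \<open>With a fixed exponent for nilpotency these are polynomial equations, which makes the
  family closed. Conversely \<open>v\<close> is recovered from \<open>d\<close> by square roots, and
  subtracting \<open>t v v^T\<close> leaves an alternating matrix; the rank one term preserves
  nilpotency in both directions.\<close>

lemma family_iff:
  "y \<in> family TYPE('n::finite) \<longleftrightarrow> (\<forall>i\<ge>CARD('n exotic_coord option). y i = 0) \<and>
    (\<forall>i j :: 'n + 'n. y (x_coord i j) = y (x_coord j i)) \<and>
    (\<forall>i :: 'n + 'n. y (x_coord i i) = y (0) * y (d_coord i)) \<and>
    nilpotent_matrix (x_matrix y ** (symplectic_form :: F2_bar ^ ('n + 'n) ^ ('n + 'n)))" (is "_ \<longleftrightarrow> ?R")
proof
  assume "y \<in> family TYPE('n)"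
  then obtain z :: "'n exotic_coord \<Rightarrow> F2_bar" and t where z: "z \<in> exotic_points" and y: "y = deform z t"
    by (auto simp: family_def)
  have alt: "alternating (mpart z)" using z by (simp add: exotic_points_def)
  then have "z (Inr (i, j)) = z (Inr (j, i))" "z (Inr (i, i)) = 0" for i j
    by (simp_all add: alternating_F2_bar mpart_def)
  moreover have "nilpotent_matrix (x_matrix y ** symplectic_form :: F2_bar ^ ('n + 'n) ^ ('n + 'n))"
    using z unfolding y deform_x_matrix nilpotent_rank_one_perturbation[OF alt] by (simp add: exotic_points_def)
  ultimately show ?R by (auto simp: y deform_def power2_eq_square mult.commute)
next
  assume R: ?R
  have "\<exists>v. v ^ 2 = y (d_coord i)" for i :: "'n + 'n" by (rule nth_root_exists) simp
  then obtain v where v: "\<And>i :: 'n + 'n. v i ^ 2 = y (d_coord i)" by metis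
  define t where "t = y (0)"
  define z :: "'n exotic_coord \<Rightarrow> F2_bar" where
    "z = case_sum v (\<lambda>(i, j). y (x_coord i j) - t * (v i * v j))"
  have yz: "y = deform z t"
    unfolding deform_def by (rule coords_eqI) (use R in \<open>simp_all add: z_def v t_def\<close>)
  have alt: "alternating (mpart z)"
    using R v by (auto simp: alternating_F2_bar mpart_def z_def mult.commute t_def power2_eq_square)
  have "nilpotent_matrix (mpart z ** symplectic_form)"
    using R unfolding yz deform_x_matrix nilpotent_rank_one_perturbation[OF alt] by blast
  then show "y \<in> family TYPE('n)" using alt yz by (auto simp: family_def exotic_points_def)
qed

lemma deform_inj: "deform z t = deform z' t' \<Longrightarrow> z = z' \<and> t = t'"
proof -
  assume eq: "deform z t = deform z' t'"
  have t: "t = t'" using fun_cong[OF eq, of 0] by (simp add: deform_def)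
  have v: "z (Inl i) = z' (Inl i)" for i
    using fun_cong[OF eq, of "d_coord i"] by (simp add: deform_def F2_bar_square_eq)
  have "z (Inr (i, j)) = z' (Inr (i, j))" for i j
    using fun_cong[OF eq, of "x_coord i j"] by (simp add: deform_def v t)
  then have "z c = z' c" for c using v by (cases c) auto
  then show ?thesis using t by blast
qed

section \<open>Closedness of the family and of the exotic points\<close>

lemma poly_fun_vanishes:
  assumes "poly_fun \<phi>" "\<And>x. x \<in> S \<Longrightarrow> \<phi> x = 0" "y \<in> points (vanishing_ideal S)"
  shows "\<phi> y = 0"
  using assms unfolding poly_fun_def points_def vanishing_ideal_def by auto

lemma poly_fun_mat_iter:
  assumes "\<And>i j. poly_fun (\<lambda>s. M s $ i $ j)"
  shows "poly_fun (\<lambda>s. mat_iter (M s) n u $ i)"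
  by (induction n arbitrary: i) (auto intro: poly_fun_const poly_fun_matrix_vector_mult assms)

lemma poly_fun_diff: "poly_fun \<phi> \<Longrightarrow> poly_fun \<phi>' \<Longrightarrow> poly_fun (\<lambda>s. \<phi> s - \<phi>' s)"
  using poly_fun_add[OF _ poly_fun_mult[OF poly_fun_const[of "- 1"]], of \<phi> \<phi>'] by simp

lemma points_family: "points (vanishing_ideal (family TYPE('n::finite))) = family TYPE('n)"
proof (intro equalityI subsetI)
  let ?S = "family TYPE('n)"
  let ?J = "symplectic_form :: F2_bar ^ ('n + 'n) ^ ('n + 'n)"
  fix y assume y: "y \<in> points (vanishing_ideal ?S)"
  note van = poly_fun_vanishes[OF _ _ y]
  have "y i = 0" if "i \<ge> CARD('n exotic_coord option)" for i
    by (rule van) (use that in \<open>auto simp: family_iff poly_fun_var\<close>)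
  moreover have "y (x_coord i j) - y (x_coord j i) = 0" for i j :: "'n + 'n"
    by (rule van[of "\<lambda>y. y (x_coord i j) - y (x_coord j i)"]) (auto simp: family_iff intro!: poly_fun_var poly_fun_diff)
  moreover have "y (x_coord i i) - y (0) * y (d_coord i) = 0" for i :: "'n + 'n"
    by (rule van[of "\<lambda>y. y (x_coord i i) - y (0) * y (d_coord i)"])
      (auto simp: family_iff intro!: poly_fun_var poly_fun_diff poly_fun_mult)
  moreover have "nilpotent_matrix (x_matrix y ** ?J)"
    unfolding nilpotent_iff_eigenvalues(2) vec_eq_iff
  proof (intro allI)
    fix u and i :: "'n + 'n"
    have "mat_iter (x_matrix y ** ?J) CARD('n + 'n) u $ i = 0"
    proof (rule van[of "\<lambda>y. mat_iter (x_matrix y ** ?J) CARD('n + 'n) u $ i"])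
      show "poly_fun (\<lambda>y. mat_iter (x_matrix y ** ?J) CARD('n + 'n) u $ i)"
        by (intro poly_fun_mat_iter poly_fun_matrix_mult) (simp_all add: x_matrix_def poly_fun_var poly_fun_const)
      show "mat_iter (x_matrix x ** ?J) CARD('n + 'n) u $ i = 0" if "x \<in> ?S" for x
        using that unfolding family_iff nilpotent_iff_eigenvalues(2) by simp
    qed
    then show "mat_iter (x_matrix y ** ?J) CARD('n + 'n) u $ i = 0 $ i" by simp
  qed
  ultimately show "y \<in> ?S" unfolding family_iff by simp
qed (auto simp: points_def vanishing_ideal_def)

lemma points_exotic: "points (exotic_nilcone :: ('n::finite exotic_coord, F2_bar) mpoly set) = exotic_points"
  unfolding exotic_nilcone_eq[OF two_F2_bar]
proof (intro equalityI subsetI)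
  let ?S = "exotic_points :: ('n exotic_coord \<Rightarrow> F2_bar) set"
  let ?J = "symplectic_form :: F2_bar ^ ('n + 'n) ^ ('n + 'n)"
  fix y assume y: "y \<in> points (vanishing_ideal ?S)"
  note van = poly_fun_vanishes[OF _ _ y]
  have "y (Inr (i, i)) = 0" for i
    by (rule van) (auto simp: exotic_points_def alternating_F2_bar mpart_def poly_fun_var)
  moreover have "y (Inr (i, j)) - y (Inr (j, i)) = 0" for i j
    by (rule van[of "\<lambda>y. y (Inr (i, j)) - y (Inr (j, i))"])
      (auto simp: exotic_points_def alternating_F2_bar mpart_def intro!: poly_fun_diff poly_fun_var)
  moreover have "nilpotent_matrix (mpart y ** ?J)"
    unfolding nilpotent_iff_eigenvalues(2) vec_eq_iff
  proof (intro allI)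
    fix u and i :: "'n + 'n"
    have "mat_iter (mpart y ** ?J) CARD('n + 'n) u $ i = 0"
    proof (rule van[of "\<lambda>y. mat_iter (mpart y ** ?J) CARD('n + 'n) u $ i"])
      show "poly_fun (\<lambda>y. mat_iter (mpart y ** ?J) CARD('n + 'n) u $ i)"
        by (intro poly_fun_mat_iter poly_fun_matrix_mult) (simp_all add: mpart_def poly_fun_var poly_fun_const)
      show "mat_iter (mpart x ** ?J) CARD('n + 'n) u $ i = 0" if "x \<in> ?S" for x
        using that unfolding exotic_points_def nilpotent_iff_eigenvalues(2) by simp
    qed
    then show "mat_iter (mpart y ** ?J) CARD('n + 'n) u $ i = 0 $ i" by simp
  qed
  ultimately show "y \<in> ?S" by (simp add: exotic_points_def alternating_F2_bar mpart_def)
qed (auto simp: points_def vanishing_ideal_def)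

section \<open>The group action on the family\<close>

lemma exotic_points_act:
  fixes z :: "'n::finite exotic_coord \<Rightarrow> 'k::alg_closed_field"
  assumes g: "g \<in> Sp" and z: "z \<in> exotic_points"
  shows "exotic_act g z \<in> exotic_points"
proof -
  let ?J = "symplectic_form :: 'k ^ ('n + 'n) ^ ('n + 'n)"
  let ?x = "mpart z"
  have "nilpotent_matrix (g ** ?x ** transpose g ** ?J)"
    unfolding nilpotent_iff_eigenvalues(1)
  proof (intro allI impI)
    fix a u assume a: "a \<noteq> 0" "g ** ?x ** transpose g ** ?J *v u = a *s u"
    define w where "w = sp_inv g *v u"
    have u: "u = g *v w" by (simp add: w_def matrix_vector_mul_assoc sp_inv_right[OF g])
    have "?x ** ?J *v w = sp_inv g ** g ** ?x ** (transpose g ** ?J ** g) *v w"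
      by (simp add: sp_inv_left[OF g] SpD[OF g])
    also have "\<dots> = sp_inv g *v (g ** ?x ** transpose g ** ?J *v u)"
      by (simp add: u matrix_vector_mul_assoc matrix_mul_assoc)
    also have "\<dots> = a *s w" by (simp add: a(2) w_def vector_scalar_commute)
    finally have "w = 0" using z a(1) unfolding exotic_points_def nilpotent_iff_eigenvalues(1) by blast
    then show "u = 0" by (simp add: u)
  qed
  then show ?thesis
    using z by (simp add: exotic_points_def mpart_act alternating_congruence)
qed

text \<open>The quadratic action on the coordinates \<open>d\<close> is the Frobenius twist of \<open>V\<^sub>1\<close>.\<close>

definition twisted_act :: "'r::comm_ring_1 ^ ('n::finite + 'n) ^ ('n + 'n) \<Rightarrow> (nat \<Rightarrow> 'r) \<Rightarrow> nat \<Rightarrow> 'r" where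
  "twisted_act g y = coords (y 0) (\<lambda>i. \<Sum>j\<in>UNIV. (g $ i $ j) ^ 2 * y (d_coord j))
     (\<lambda>i j. (g ** x_matrix y ** transpose g) $ i $ j)"

lemma coords_cong:
  "t = t' \<Longrightarrow> (\<And>i. d i = d' i) \<Longrightarrow> (\<And>i j. x i j = x' i j) \<Longrightarrow> coords t d x = coords t' d' x'"
  by presburger

lemma hom_twisted_act:
  assumes h: "ring_hom_on h"
  shows "h (twisted_act g y i) = twisted_act (\<chi> i j. h (g $ i $ j)) (\<lambda>i. h (y i)) i"
  unfolding twisted_act_def coords_map[of h, OF ring_hom_onD(4)[OF h]]
  by (rule fun_cong[OF coords_cong])
    (simp_all add: ring_hom_onD[OF h] x_matrix_def matrix_matrix_mult_def transpose_def)

definition family_action :: "(F2_bar, 'n::finite, nat) action" where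
  "family_action g = twisted_act (matrix_const g) Var"

lemma point_map_family_action: "point_map (family_action g) y = twisted_act g y"
  by (simp add: point_map_def family_action_def hom_twisted_act[OF eval_at_hom] matrix_const_def)

text \<open>Additivity of the Frobenius map lets the squares \<open>v_i^2\<close> transform linearly
  by the squared matrix entries, and \<open>g\<close> sends \<open>v v^T\<close> to the same
  expression in \<open>g v\<close>.\<close>

lemma twisted_act_deform: "twisted_act g (deform z t) = deform (exotic_act g z) t"
proof -
  have "(\<Sum>j\<in>UNIV. g $ i $ j * z (Inl j)) ^ 2 = (\<Sum>j\<in>UNIV. (g $ i $ j) ^ 2 * z (Inl j) ^ 2)" for i
    by (simp add: ring_hom_onD(7)[OF frob] power_mult_distrib)
  moreover have "(g ** x_matrix (deform z t) ** transpose g) $ i $ j =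
      (g ** mpart z ** transpose g) $ i $ j + t * ((g *v vpart z) $ i * (g *v vpart z) $ j)" for i j
    by (simp add: deform_x_matrix matrix_matrix_mult_def matrix_vector_mult_def transpose_def sum_distrib_left
        sum_distrib_right sum.distrib algebra_simps) 
  ultimately show ?thesis
    unfolding twisted_act_def deform_def[of "exotic_act g z"]
    by (intro coords_cong) (simp_all add: exotic_act_def deform_def[of z t] matrix_vector_mult_def mpart_def vpart_def)
qed

lemma family_memD:
  assumes "p \<in> vanishing_ideal (family TYPE('n::finite))" "(z :: 'n exotic_coord \<Rightarrow> F2_bar) \<in> exotic_points"
  shows "eval_at (deform z t) p = 0"
  using assms by (auto simp: vanishing_ideal_def family_def)

lemma family_memI:
  assumes "\<And>(z :: 'n::finite exotic_coord \<Rightarrow> F2_bar) t. z \<in> exotic_points \<Longrightarrow> eval_at (deform z t) p = 0"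
  shows "p \<in> vanishing_ideal (family TYPE('n))"
  using assms by (auto simp: vanishing_ideal_def family_def)

lemma algebraic_family_action:
  "algebraic_action (vanishing_ideal (family TYPE('n::finite))) (family_action :: (F2_bar, 'n, nat) action)"
  unfolding algebraic_action_def
proof (intro conjI ballI allI)
  let ?act = "family_action :: (F2_bar, 'n, nat) action"
  note pm = eval_at_subst_point_map point_map_family_action twisted_act_deform
  have ev: "eval_at y (?act g v) = twisted_act g y v" for y g v
    using fun_cong[OF point_map_family_action[of g y], of v] by (simp add: point_map_def)
  fix g :: "F2_bar ^ ('n + 'n) ^ ('n + 'n)" assume g: "g \<in> Sp"
  show "morphism (vanishing_ideal (family TYPE('n))) (vanishing_ideal (family TYPE('n))) (?act g)"
    unfolding morphism_def
    by (intro ballI family_memI) (simp add: pm family_memD exotic_points_act[OF g])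
  fix h :: "F2_bar ^ ('n + 'n) ^ ('n + 'n)" and v
  show "?act (g ** h) v - subst (?act h) (?act g v) \<in> vanishing_ideal (family TYPE('n))"
    by (rule family_memI) (simp add: eval_at_simps pm ev exotic_act_mult)
next
  let ?act = "family_action :: (F2_bar, 'n, nat) action"
  fix v
  have ev: "eval_at y (?act g v) = twisted_act g y v" for y g
    using fun_cong[OF point_map_family_action[of g y], of v] by (simp add: point_map_def)
  show "?act (mat 1) v - Var v \<in> vanishing_ideal (family TYPE('n))"
    by (rule family_memI) (simp add: eval_at_simps ev twisted_act_deform)
  let ?a = "twisted_act (\<chi> i j. Var (Inl (i, j))) (\<lambda>v. Var (Inr v)) v :: (('n + 'n) \<times> ('n + 'n) + nat, F2_bar) mpoly"
  have "?act g v = subst (case_sum (\<lambda>(i, j). Const (g $ i $ j)) Var) ?a" for g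
    unfolding family_action_def by (subst hom_twisted_act) (simp_all add: matrix_const_def)
  then show "\<exists>a. \<forall>g\<in>Sp. ?act g v - subst (case_sum (\<lambda>(i, j). Const (g $ i $ j)) Var) a \<in> vanishing_ideal (family TYPE('n))"
    by (intro exI[of _ ?a]) (simp add: ideal.subspace_0)
qed

text \<open>The section through a point keeps \<open>z\<close> fixed and lets \<open>t\<close>
  vary.\<close>

lemma deform_swept:
  fixes Z :: "('n::finite exotic_coord \<Rightarrow> F2_bar) set"
  shows "swept {deform z t | z t. z \<in> Z} (Var 0)"
  unfolding swept_def
proof
  fix y assume "y \<in> {deform z t | z t. z \<in> Z}"
  then obtain z t where z: "z \<in> Z" "y = deform z t" by blast
  define c where "c = coords [:0, 1:] (\<lambda>i. [:z (Inl i) ^ 2:]) (\<lambda>i j. [:z (Inr (i, j)), z (Inl i) * z (Inl j):])"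
  have c: "(\<lambda>v. poly (c v) s) = deform z s" for s
    unfolding c_def deform_def by (rule ext, subst coords_map[of "\<lambda>q. poly q s"]) simp_all
  have "eval_at (deform z s) (Var 0) = s" for s by (simp add: deform_def)
  then show "\<exists>y' s\<^sub>0. (\<lambda>v. poly (y' v) s\<^sub>0) = y \<and>
      (\<forall>s. (\<lambda>v. poly (y' v) s) \<in> {deform z t | z t. z \<in> Z} \<and> eval_at (\<lambda>v. poly (y' v) s) (Var 0) = s)"
    using z by (intro exI[of _ c] exI[of _ t]) (auto simp: c)
qed

section \<open>Membership in fibre ideals\<close>

lemma fibreI:
  assumes "is_ideal I" "e + q * (\<pi> - Const c) \<in> I"
  shows "e \<in> fibre I \<pi> c"
proof -
  have F: "is_ideal (fibre I \<pi> c)" unfolding fibre_def by (rule ideal.subspace_span)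
  have 1: "\<pi> - Const c \<in> fibre I \<pi> c" "e + q * (\<pi> - Const c) \<in> fibre I \<pi> c"
    unfolding fibre_def using assms(2) by (auto intro: ideal.span_base)
  have "(e + q * (\<pi> - Const c)) - q * (\<pi> - Const c) \<in> fibre I \<pi> c"
    by (intro ideal.subspace_diff[OF F] ideal.subspace_scale[OF F] 1)
  then show ?thesis by simp
qed

lemma fibreI0: "is_ideal I \<Longrightarrow> e \<in> I \<Longrightarrow> e \<in> fibre I \<pi> c"
  using fibreI[of I e 0] by simp

lemma points_fibre: "points (fibre I \<pi> c) = {y \<in> points I. eval_at y \<pi> = c}"
  unfolding fibre_def points_ideal_gen by (auto simp: points_def eval_at_simps)

lemma fibre_hom:
  assumes "ring_hom_on h" "is_ideal K" "h (\<pi> - Const c) \<in> K" "\<And>p. p \<in> I \<Longrightarrow> h p \<in> K" "p \<in> fibre I \<pi> c"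
  shows "h p \<in> K"
  by (rule hom_ideal_gen[OF assms(1,2) _ assms(5)[unfolded fibre_def]]) (use assms(3,4) in auto)

section \<open>The generic fibres\<close>

lemma symplectic_cancel:
  "A ** symplectic_form ** symplectic_form = - (A :: 'r::comm_ring_1 ^ ('n::finite + 'n) ^ ('n + 'n))"
  "A ** B ** symplectic_form ** symplectic_form = - (A ** B)"
  by (simp_all add: symplectic_square matrix_mult_neg flip: matrix_mul_assoc)

lemma F2_bar_matrix_neg: "- A = (A :: F2_bar ^ 'i ^ 'j)"
  by (simp add: vec_eq_iff F2_bar_neg)

lemma sp_Lie_iff:
  fixes x :: "F2_bar ^ ('n::finite + 'n) ^ ('n + 'n)"
  shows "x ** symplectic_form \<in> sp_Lie \<longleftrightarrow> transpose x = x"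
proof -
  let ?J = "symplectic_form :: F2_bar ^ ('n + 'n) ^ ('n + 'n)"
  have tJ: "transpose ?J = ?J" by (simp add: transpose_symplectic F2_bar_matrix_neg)
  have add0: "A + B = 0 \<longleftrightarrow> A = B" for A B :: "F2_bar ^ ('n + 'n) ^ ('n + 'n)"
    using F2_bar_matrix_neg[of B] by (metis eq_neg_iff_add_eq_0)
  have "x ** ?J \<in> sp_Lie \<longleftrightarrow> ?J ** transpose x ** ?J = ?J ** x ** ?J"
    by (simp add: sp_Lie_def matrix_transpose_mul tJ add0 matrix_mul_assoc)
  also have "\<dots> \<longleftrightarrow> transpose x = x"
  proof
    assume "?J ** transpose x ** ?J = ?J ** x ** ?J"
    then have "?J ** (?J ** transpose x ** ?J) ** ?J = ?J ** (?J ** x ** ?J) ** ?J" by simp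
    then show "transpose x = x"
      by (simp add: matrix_mul_assoc symplectic_square symplectic_cancel F2_bar_matrix_neg)
  qed simp
  finally show ?thesis .
qed

lemma nilcone_memI:
  assumes "\<And>A :: F2_bar ^ ('n::finite + 'n) ^ ('n + 'n). A \<in> sp_Lie \<Longrightarrow> nilpotent_matrix A \<Longrightarrow> eval_at (\<lambda>(i, j). A $ i $ j) p = 0"
  shows "p \<in> nilcone"
  using assms by (auto simp: nilcone_def vanishing_ideal_def)

text \<open>In characteristic two \<open>X J\<close> lies in the Lie algebra exactly for symmetric
  \<open>X\<close>. The congruence \<open>g X g^T\<close> becomes conjugation of \<open>X J\<close>
  because \<open>g^T J = J g^{-1}\<close> for symplectic \<open>g\<close>.\<close>

lemma generic_fibre:
  fixes t :: F2_bar
  assumes t: "t \<noteq> 0"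
  shows "equivariantly_isomorphic (fibre (vanishing_ideal (family TYPE('n::finite))) (Var 0) t)
    (family_action :: (F2_bar, 'n, nat) action) nilcone adjoint_action"
proof -
  let ?J = "symplectic_form :: F2_bar ^ ('n + 'n) ^ ('n + 'n)"
  let ?I = "vanishing_ideal (family TYPE('n))"
  let ?F = "fibre ?I (Var 0) t"
  let ?act = "family_action :: (F2_bar, 'n, nat) action"
  have I: "is_ideal ?I" by simp
  have nc: "is_ideal (nilcone :: (('n + 'n) \<times> ('n + 'n), F2_bar) mpoly set)" by (simp add: nilcone_def)
  have inI: "p \<in> ?I" if "\<And>y. y \<in> family TYPE('n) \<Longrightarrow> eval_at y p = 0" for p
    using that by (simp add: vanishing_ideal_def)
  have Isub: "e \<in> ?F" if "e \<in> ?I" for e by (rule fibreI0[OF I that])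
  define f :: "('n + 'n) \<times> ('n + 'n) \<Rightarrow> (nat, F2_bar) mpoly" where
    "f = (\<lambda>(i, j). (x_matrix Var ** matrix_const ?J) $ i $ j)"
  define f' :: "nat \<Rightarrow> (('n + 'n) \<times> ('n + 'n), F2_bar) mpoly" where
    "f' = (let x = (\<chi> i j. Var (i, j)) ** matrix_const ?J in
      coords (Const t) (\<lambda>i. Const (1 / t) * x $ i $ i) (\<lambda>i j. x $ i $ j))"
  have ev: "eval_at y (f ij) = (\<lambda>(i, j). (x_matrix y ** ?J) $ i $ j) ij" for y ij
    by (simp add: f_def matrix_matrix_mult_def eval_at_simps x_matrix_def matrix_const_def split: prod.split)
  have pf: "point_map f y = (\<lambda>(i, j). (x_matrix y ** ?J) $ i $ j)" for y
    by (simp add: point_map_def ev fun_eq_iff)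
  have pf': "point_map f' (\<lambda>(i, j). A $ i $ j) =
      coords t (\<lambda>i. 1 / t * (A ** ?J) $ i $ i) (\<lambda>i j. (A ** ?J) $ i $ j)" for A
    unfolding f'_def Let_def point_map_def coords_map[of "eval_at _", OF eval_at_simps(4)]
    by (rule ext, rule fun_cong[OF coords_cong])
      (simp_all add: eval_at_simps matrix_matrix_mult_def matrix_const_def)
  have x_coords: "x_matrix (coords c d (\<lambda>i j. x $ i $ j)) = x" for c d and x :: "F2_bar ^ ('n + 'n) ^ ('n + 'n)"
    by (simp add: x_matrix_def vec_eq_iff)
  have sub: "A ** ?J ** ?J = A" for A :: "F2_bar ^ ('n + 'n) ^ ('n + 'n)"
    by (simp add: symplectic_cancel F2_bar_matrix_neg)
  have famD: "transpose (x_matrix y) = (x_matrix y :: F2_bar ^ ('n + 'n) ^ ('n + 'n))"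
    "nilpotent_matrix (x_matrix y ** ?J)"
    if "y \<in> family TYPE('n)" for y
    using that unfolding family_iff by (auto simp: vec_eq_iff transpose_def x_matrix_def)
  have fam: "point_map f' (\<lambda>(i, j). A $ i $ j) \<in> family TYPE('n)" if "A \<in> sp_Lie" "nilpotent_matrix A" for A
  proof -
    have "transpose (A ** ?J) = A ** ?J" using that(1) unfolding sp_Lie_iff[symmetric] sub .
    then have "(A ** ?J) $ j $ i = (A ** ?J) $ i $ j" for i j by (simp add: vec_eq_iff transpose_def)
    then show ?thesis unfolding pf' family_iff x_coords sub using that(2) t by (simp add: field_simps)
  qed
  have m1: "morphism ?F nilcone f"
    unfolding morphism_def
  proof (intro ballI Isub inI)
    fix p :: "(('n + 'n) \<times> ('n + 'n), F2_bar) mpoly" and y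
    assume p: "p \<in> nilcone" and y: "y \<in> family TYPE('n)"
    have "x_matrix y ** ?J \<in> sp_Lie" using famD(1)[OF y] by (simp add: sp_Lie_iff)
    then show "eval_at y (subst f p) = 0"
      using p famD(2)[OF y] unfolding eval_at_subst_point_map pf nilcone_def vanishing_ideal_def by auto
  qed
  have m2: "morphism nilcone ?F f'"
    unfolding morphism_def
  proof
    fix p assume p: "p \<in> ?F"
    show "subst f' p \<in> nilcone"
    proof (rule fibre_hom[OF subst_hom nc _ _ p])
      show "subst f' (Var 0 - Const t) \<in> nilcone"
        by (simp add: subst_simps f'_def Let_def ideal.subspace_0[OF nc])
      show "subst f' p \<in> nilcone" if "p \<in> ?I" for p
      proof (rule nilcone_memI)
        fix A :: "F2_bar ^ ('n + 'n) ^ ('n + 'n)" assume "A \<in> sp_Lie" "nilpotent_matrix A"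
        from fam[OF this] show "eval_at (\<lambda>(i, j). A $ i $ j) (subst f' p) = 0"
          using that by (simp add: eval_at_subst_point_map vanishing_ideal_def)
      qed
    qed
  qed
  have i1: "subst f (f' v) - Var v \<in> ?F" for v
  proof -
    have e: "eval_at y (subst f (f' v)) = coords t (\<lambda>i. 1 / t * x $ i $ i) (\<lambda>i j. x $ i $ j) v"
      if "x = x_matrix y" for y and x :: "F2_bar ^ ('n + 'n) ^ ('n + 'n)"
    proof -
      have "eval_at y (subst f (f' v)) = point_map f' (\<lambda>(i, j). (x_matrix y ** ?J) $ i $ j) v"
        unfolding eval_at_subst_point_map pf by (simp add: point_map_def)
      then show ?thesis unfolding pf' sub that .
    qed
    \<comment> \<open>The multiple of \<open>Var 0 - Const t\<close> separating the two sides: on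
      the family \<open>X_ii\<close> is \<open>Var 0\<close> times \<open>d_i\<close>, so
      \<open>X_ii / t - d_i\<close> is \<open>d_i / t\<close> times this difference.\<close>
    define q where "q = coords 1 (\<lambda>i. - Const (1 / t) * Var (d_coord i)) (\<lambda>i j :: 'n + 'n. 0 :: (nat, F2_bar) mpoly) v"
    have "subst f (f' v) - Var v + q * (Var 0 - Const t) \<in> ?I"
    proof (rule inI)
      fix y assume y: "y \<in> family TYPE('n)"
      have q: "eval_at y q = coords 1 (\<lambda>i. - (1 / t) * y (d_coord i)) (\<lambda>i j :: 'n + 'n. 0) v"
        unfolding q_def by (subst coords_map[of "eval_at y"]) (simp_all add: eval_at_simps)
      show "eval_at y (subst f (f' v) - Var v + q * (Var 0 - Const t)) = 0"
        unfolding eval_at_simps e[OF refl] q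
        by (cases v rule: coord_cases[where 'n = 'n])
          (use y t in \<open>auto simp: family_iff x_matrix_def field_simps\<close>)
    qed
    then show ?thesis by (rule fibreI[OF I])
  qed
  have i2: "subst f' (f w) - Var w \<in> nilcone" for w
  proof (rule nilcone_memI)
    fix A :: "F2_bar ^ ('n + 'n) ^ ('n + 'n)"
    have "eval_at (\<lambda>(i, j). A $ i $ j) (subst f' (f w)) = (\<lambda>(i, j). A $ i $ j) w"
      unfolding eval_at_subst_point_map ev pf' x_coords sub ..
    then show "eval_at (\<lambda>(i, j). A $ i $ j) (subst f' (f w) - Var w) = 0"
      by (simp add: eval_at_simps)
  qed
  have eq: "equivariant ?F ?act adjoint_action f"
    unfolding equivariant_def
  proof (intro ballI allI Isub inI)
    fix g :: "F2_bar ^ ('n + 'n) ^ ('n + 'n)" and w :: "('n + 'n) \<times> ('n + 'n)" and y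
    assume g: "g \<in> Sp"
    obtain i j where w: "w = (i, j)" by (cases w)
    have gi: "matrix_inv g = sp_inv g"
    proof -
      have "g ** matrix_inv g = mat 1"
        unfolding matrix_inv_def using sp_inv_left[OF g] sp_inv_right[OF g]
        by (rule someI2[of _ "sp_inv g", OF conjI[rotated]]) simp
      then have "sp_inv g ** g ** matrix_inv g = sp_inv g" by (simp flip: matrix_mul_assoc)
      then show ?thesis by (simp add: sp_inv_left[OF g])
    qed
    have tg: "transpose g ** ?J = ?J ** sp_inv g"
    proof -
      have "transpose g ** ?J = transpose g ** ?J ** g ** sp_inv g"
        by (simp add: sp_inv_right[OF g] flip: matrix_mul_assoc)
      then show ?thesis by (simp add: SpD[OF g])
    qed
    have "eval_at y (subst f (adjoint_action g w)) = (g ** (x_matrix y ** ?J) ** sp_inv g) $ i $ j"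
      unfolding eval_at_subst_point_map pf
      by (simp add: adjoint_action_def w gi matrix_matrix_mult_def matrix_const_def eval_at_simps)
    moreover have "eval_at y (subst (?act g) (f w)) = (x_matrix (twisted_act g y) ** ?J) $ i $ j"
      unfolding eval_at_subst_point_map point_map_family_action ev w by simp
    moreover have "x_matrix (twisted_act g y) ** ?J = g ** (x_matrix y ** ?J) ** sp_inv g"
      unfolding twisted_act_def x_coords by (simp add: tg flip: matrix_mul_assoc)
    ultimately show "eval_at y (subst (?act g) (f w) - subst f (adjoint_action g w)) = 0"
      by (simp add: eval_at_simps)
  qed
  show ?thesis
    unfolding equivariantly_isomorphic_def inverse_morphisms_def
    using m1 m2 i1 i2 eq by blast
qed

section \<open>The special fibre\<close>

abbreviation family_ideal :: "'n::finite itself \<Rightarrow> (nat, F2_bar) mpoly set" where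
  "family_ideal ty \<equiv> vanishing_ideal (family ty)"

definition frobenius_isogeny :: "nat \<Rightarrow> ('n::finite exotic_coord, F2_bar) mpoly" where
  "frobenius_isogeny = coords 0 (\<lambda>i. Var (Inl i) ^ 2) (\<lambda>i j. Var (Inr (i, j)))"

lemma point_map_frobenius_isogeny: "point_map frobenius_isogeny z = deform z 0"
  unfolding point_map_def frobenius_isogeny_def deform_def coords_map[of "eval_at _", OF eval_at_simps(4)]
  by (rule coords_cong) (simp_all add: eval_at_simps)

lemma points_special_fibre:
  "points (fibre (family_ideal TYPE('n::finite)) (Var 0) t) = (\<lambda>z. deform z t) ` (exotic_points :: ('n exotic_coord \<Rightarrow> F2_bar) set)"
  unfolding points_fibre points_family by (auto simp: family_def deform_def[of _ t] deform_def)

text \<open>The squares of the \<open>v\<close> coordinates and all \<open>x\<close> coordinates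
  come from the target, so the squarefree monomials in the \<open>v\<close> coordinates generate:
  their span \<open>M\<close> contains 1 and is closed under multiplication by every
  variable.\<close>

lemma finite_frobenius_isogeny:
  fixes p :: "('n::finite exotic_coord, F2_bar) mpoly"
  defines "B \<equiv> (\<lambda>T. \<Prod>i\<in>T. Var (Inl i)) ` (UNIV :: ('n + 'n) set set)"
  shows "\<exists>c. p = (\<Sum>b\<in>B. subst frobenius_isogeny (c b) * b)"
proof -
  let ?s = "subst frobenius_isogeny :: (nat, F2_bar) mpoly \<Rightarrow> ('n exotic_coord, F2_bar) mpoly"
  define M where "M = {q. \<exists>c. q = (\<Sum>b\<in>B. ?s (c b) * b)}"
  have fin: "finite B" by (simp add: B_def)
  have add: "q + q' \<in> M" if q: "q \<in> M" "q' \<in> M" for q q'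
  proof -
    obtain c c' where "q = (\<Sum>b\<in>B. ?s (c b) * b)" "q' = (\<Sum>b\<in>B. ?s (c' b) * b)"
      using q by (auto simp: M_def)
    then have "q + q' = (\<Sum>b\<in>B. ?s (c b + c' b) * b)" by (simp add: subst_simps distrib_right sum.distrib)
    then show ?thesis unfolding M_def by (intro CollectI exI[of _ "\<lambda>b. c b + c' b"])
  qed
  have scale: "?s a * q \<in> M" if "q \<in> M" for a q
  proof -
    obtain c where "q = (\<Sum>b\<in>B. ?s (c b) * b)" using \<open>q \<in> M\<close> by (auto simp: M_def)
    then have "?s a * q = (\<Sum>b\<in>B. ?s (a * c b) * b)" by (simp add: subst_simps sum_distrib_left mult.assoc)
    then show ?thesis unfolding M_def by (intro CollectI exI[of _ "\<lambda>b. a * c b"])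
  qed
  have base: "b \<in> M" if "b \<in> B" for b
  proof -
    have "(\<Sum>b'\<in>B. ?s (if b' = b then 1 else 0) * b') = (\<Sum>b'\<in>B. if b' = b then b' else 0)"
      by (intro sum.cong refl) (simp add: subst_simps)
    then have "b = (\<Sum>b'\<in>B. ?s (if b' = b then 1 else 0) * b')" using that fin by simp
    then show ?thesis unfolding M_def by (intro CollectI exI[of _ "\<lambda>b'. if b' = b then 1 else 0"])
  qed
  have zero: "0 \<in> M" unfolding M_def by (intro CollectI exI[of _ "\<lambda>_. 0"]) (simp add: subst_simps)
  have sum: "sum h A \<in> M" if "\<And>a. a \<in> A \<Longrightarrow> h a \<in> M" for h :: "_ \<Rightarrow> _" and A
    using that by (induction A rule: infinite_finite_induct) (auto intro: add zero)
  have d: "Var (Inl i) ^ 2 = ?s (Var (d_coord i))" for i by (simp add: frobenius_isogeny_def)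
  have x: "Var (Inr (i, j)) = ?s (Var (x_coord i j))" for i j by (simp add: frobenius_isogeny_def)
  have v: "Var (Inl i) * b \<in> M" if b: "b \<in> B" for i b
  proof -
    obtain T where T: "b = (\<Prod>i\<in>T. Var (Inl i))" using b by (auto simp: B_def)
    show ?thesis
    proof (cases "i \<in> T")
      case True
      then have "Var (Inl i) * b = Var (Inl i) ^ 2 * (\<Prod>i\<in>T - {i}. Var (Inl i))"
        unfolding T by (simp add: prod.remove[of T i] power2_eq_square mult.assoc)
      moreover have "(\<Prod>i\<in>T - {i}. Var (Inl i)) \<in> B" by (simp add: B_def)
      ultimately show ?thesis unfolding d by (simp only: scale base)
    next
      case False
      then have "Var (Inl i) * b = (\<Prod>i\<in>insert i T. Var (Inl i))" unfolding T by simp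
      then show ?thesis by (simp add: base B_def del: prod.insert)
    qed
  qed
  have "\<forall>q\<in>M. p * q \<in> M"
  proof (induction p rule: mpoly_induct)
    case (Const c)
    then show ?case using scale[of _ "Const c"] by simp
  next
    case (Var w)
    show ?case
    proof (cases w)
      case (Inl i)
      show ?thesis
      proof
        fix q assume "q \<in> M"
        then obtain c where c: "q = (\<Sum>b\<in>B. ?s (c b) * b)" by (auto simp: M_def)
        have "Var w * q = (\<Sum>b\<in>B. ?s (c b) * (Var (Inl i) * b))"
          by (simp add: c Inl sum_distrib_left mult_ac)
        then show "Var w * q \<in> M" by (simp add: sum scale v)
      qed
    next
      case (Inr ij)
      then obtain i j where w: "w = Inr (i, j)" by (cases ij) simp
      show ?thesis unfolding w x using scale by blast
    qed
  next
    case (add p p')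
    then show ?case by (auto simp: distrib_right intro: \<open>\<And>q q'. q \<in> M \<Longrightarrow> q' \<in> M \<Longrightarrow> q + q' \<in> M\<close>)
  next
    case (mult p p')
    then show ?case by (simp add: mult.assoc)
  qed
  moreover have "1 \<in> M" by (rule base) (auto simp: B_def intro: image_eqI[of _ _ "{}"])
  ultimately have "p \<in> M" by (metis mult.right_neutral)
  then show ?thesis by (simp add: M_def)
qed

lemma frobenius_isogeny_isogeny:
  "isogeny exotic_nilcone exotic_action (fibre (family_ideal TYPE('n::finite)) (Var 0) 0)
    (family_action :: (F2_bar, 'n, nat) action) frobenius_isogeny"
proof -
  let ?E = "exotic_nilcone :: ('n exotic_coord, F2_bar) mpoly set"
  let ?F = "fibre (family_ideal TYPE('n)) (Var 0) 0"
  note E = exotic_nilcone_eq[OF two_F2_bar, where 'n = 'n]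
  have memE: "p \<in> ?E" if "\<And>z. z \<in> exotic_points \<Longrightarrow> eval_at z p = 0" for p
    using that by (simp add: E vanishing_ideal_def)
  let ?B = "(\<lambda>T. \<Prod>i\<in>T. Var (Inl i)) ` (UNIV :: ('n + 'n) set set) :: ('n exotic_coord, F2_bar) mpoly set"
  have "morphism ?E ?F frobenius_isogeny"
    unfolding morphism_def
  proof (intro ballI memE)
    fix p and z :: "'n exotic_coord \<Rightarrow> F2_bar" assume "p \<in> ?F" "z \<in> exotic_points"
    moreover from this have "deform z 0 \<in> points ?F" by (auto simp: points_special_fibre)
    ultimately show "eval_at z (subst frobenius_isogeny p) = 0"
      by (simp add: eval_at_subst_point_map point_map_frobenius_isogeny points_def)
  qed
  moreover have "\<exists>B. finite B \<and> (\<forall>p. \<exists>c. p - (\<Sum>b\<in>B. subst frobenius_isogeny (c b) * b) \<in> ?E)"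
  proof (intro exI[of _ ?B] conjI allI)
    show "finite ?B" by simp
    fix p :: "('n exotic_coord, F2_bar) mpoly"
    obtain c where c: "p = (\<Sum>b\<in>?B. subst frobenius_isogeny (c b) * b)"
      using finite_frobenius_isogeny by blast
    have "p - (\<Sum>b\<in>?B. subst frobenius_isogeny (c b) * b) = 0" by (subst (1) c) simp
    then show "\<exists>c. p - (\<Sum>b\<in>?B. subst frobenius_isogeny (c b) * b) \<in> ?E"
      by (intro exI[of _ c]) (simp add: E ideal.subspace_0)
  qed
  moreover have "equivariant ?E exotic_action (family_action :: (F2_bar, 'n, nat) action) frobenius_isogeny"
    unfolding equivariant_def
  proof (intro ballI allI memE)
    fix g :: "F2_bar ^ ('n + 'n) ^ ('n + 'n)" and w and z :: "'n exotic_coord \<Rightarrow> F2_bar"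
    assume "g \<in> Sp" "z \<in> exotic_points"
    have "eval_at z (subst (exotic_action g) (frobenius_isogeny w)) = point_map frobenius_isogeny (exotic_act g z) w"
      by (simp add: eval_at_subst_point_map point_map_def[of frobenius_isogeny])
    moreover have "eval_at z (subst frobenius_isogeny (family_action g w)) = point_map (family_action g) (deform z 0) w"
      by (simp add: eval_at_subst_point_map point_map_frobenius_isogeny point_map_def[of "family_action g"])
    ultimately show "eval_at z (subst (exotic_action g) (frobenius_isogeny w) - subst frobenius_isogeny (family_action g w)) = 0"
      by (simp add: eval_at_simps point_map_frobenius_isogeny point_map_family_action twisted_act_deform)
  qed
  moreover have "bij_betw (point_map frobenius_isogeny) (points ?E) (points ?F)"
    unfolding points_exotic points_special_fibre point_map_frobenius_isogeny
    by (rule bij_betw_imageI) (auto simp: inj_on_def dest: deform_inj)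
  ultimately show ?thesis unfolding isogeny_def finite_morphism_def by blast
qed

text \<open>Squaring is a ring homomorphism, so it acts separately on coefficients and
  variables.\<close>

lemma frobenius_coefficients:
  fixes e :: "'v \<Rightarrow> ('w, F2_bar) mpoly"
  shows "subst (\<lambda>v. e v ^ 2) (eval_hom (\<lambda>c. Const (c ^ 2)) Var p) = subst e p ^ 2"
proof -
  have h: "ring_hom_on (\<lambda>c :: F2_bar. Const (c ^ 2))"
    by (rule ring_hom_on_comp[OF ring_hom_on_Const frob])
  have "subst (\<lambda>v. e v ^ 2) (eval_hom (\<lambda>c. Const (c ^ 2)) Var p) = eval_hom (\<lambda>c. Const (c ^ 2)) (\<lambda>v. e v ^ 2) p"
    by (subst hom_eval_hom[OF subst_hom h]) simp
  also have "\<dots> = subst e p ^ 2"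
    unfolding subst_def by (subst hom_eval_hom[OF frobenius[OF two_mpoly] ring_hom_on_Const]) (simp add: Const_hom)
  finally show ?thesis .
qed

section \<open>The reduced special fibre\<close>

definition coordinate_morphism :: "'n::finite exotic_coord \<Rightarrow> (nat, F2_bar) mpoly" where
  "coordinate_morphism = case_sum (\<lambda>i. Var (d_coord i)) (\<lambda>(i, j). Var (x_coord i j))"

text \<open>If \<open>p\<close> vanishes on the exotic cone then, up to a multiple of \<open>t\<close>, its square in the coordinates
  \<open>(d, x)\<close> is the function whose value at the point of the family over \<open>(v, x, t)\<close> is \<open>p (v\<^sup>2, x)\<^sup>2\<close>.\<close>

lemma coordinate_morphism_square:
  fixes p :: "('n::finite exotic_coord, F2_bar) mpoly"
  assumes p: "p \<in> vanishing_ideal exotic_points"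
  shows "subst coordinate_morphism p ^ 2 \<in> fibre (family_ideal TYPE('n)) (Var 0) 0"
proof -
  let ?F = "fibre (family_ideal TYPE('n)) (Var 0) 0"
  let ?p = "eval_hom (\<lambda>c. Const (c ^ 2)) Var p :: ('n exotic_coord, F2_bar) mpoly"
  have F: "is_ideal ?F" unfolding fibre_def by (rule ideal.subspace_span)
  have tF: "Var 0 \<in> ?F" unfolding fibre_def by (intro ideal.span_base) simp
  \<comment> \<open>Adding \<open>t^2 d_i d_j\<close> cancels the square of
    \<open>t v_i v_j\<close>, so on the family \<open>e\<close> takes the squares of the coordinates
    of \<open>z'\<close> as values. Its extra term is a multiple of \<open>Var 0\<close>, hence
    \<open>e\<close> agrees with the square of \<open>coordinate_morphism\<close> over 0.\<close>
  define e :: "'n exotic_coord \<Rightarrow> (nat, F2_bar) mpoly" where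
    "e = case_sum (\<lambda>i. Var (d_coord i) ^ 2) (\<lambda>(i, j). Var (x_coord i j) ^ 2 + Var 0 * (Var 0 * Var (d_coord i) * Var (d_coord j)))"
  have "subst e ?p \<in> family_ideal TYPE('n)"
  proof (rule family_memI)
    fix z :: "'n exotic_coord \<Rightarrow> F2_bar" and t assume z: "z \<in> exotic_points"
    define z' where "z' = case_sum (\<lambda>i. z (Inl i) ^ 2) (\<lambda>ij. z (Inr ij))"
    have z': "z' \<in> exotic_points" using z by (simp add: exotic_points_def mpart_def z'_def)
    have "eval_at (deform z t) (e c) = z' c ^ 2" for c
    proof (cases c)
      case (Inr q)
      obtain i j where q: "q = (i, j)" by (cases q)
      let ?a = "z (Inr (i, j))" and ?b = "t * (z (Inl i) * z (Inl j))"
      have "eval_at (deform z t) (e c) = (?a + ?b) ^ 2 + ?b ^ 2"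
        by (simp add: e_def Inr q eval_at_simps deform_def power2_eq_square mult_ac)
      also have "\<dots> = ?a ^ 2 + (?b ^ 2 + ?b ^ 2)" by (simp add: ring_hom_onD(1)[OF frob])
      finally show ?thesis by (simp add: F2_bar_double z'_def Inr q)
    qed (simp add: e_def eval_at_simps deform_def z'_def)
    then have "eval_at (deform z t) (subst e ?p) = eval_at z' p ^ 2"
      unfolding eval_at_subst hom_eval_hom[OF eval_at_hom ring_hom_on_comp[OF ring_hom_on_Const frob]]
      unfolding eval_at_def hom_eval_hom[OF frob ring_hom_on_id] by (simp flip: eval_at_def)
    then show "eval_at (deform z t) (subst e ?p) = 0" using p z' by (simp add: vanishing_ideal_def)
  qed
  then have "subst e ?p \<in> ?F" by (intro fibreI0) simp_all
  moreover have "subst e ?p - subst (\<lambda>v. coordinate_morphism v ^ 2) ?p \<in> ?F"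
  proof (rule ideal_cong_subst[OF F])
    show "e c - coordinate_morphism c ^ 2 \<in> ?F" for c
      by (cases c) (auto simp: e_def coordinate_morphism_def ideal.subspace_0[OF F] ideal_mult_right[OF F tF])
  qed
  ultimately show ?thesis
    unfolding frobenius_coefficients using ideal_diff_mem_iff[OF F] by blast
qed

text \<open>Without the action, the coordinates \<open>d\<close> simply take the place of
  \<open>v\<close>. The squares of the equations lie in the fibre ideal, hence the equations in its
  radical.\<close>

lemma reduced_special_fibre:
  "isomorphic (radical_ideal (fibre (family_ideal TYPE('n::finite)) (Var 0) 0))
    (exotic_nilcone :: ('n exotic_coord, F2_bar) mpoly set)"
proof -
  let ?F = "fibre (family_ideal TYPE('n)) (Var 0) 0"
  let ?E = "exotic_nilcone :: ('n exotic_coord, F2_bar) mpoly set"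
  note E = exotic_nilcone_eq[OF two_F2_bar, where 'n = 'n]
  have F: "is_ideal ?F" unfolding fibre_def by (rule ideal.subspace_span)
  have rad: "p \<in> radical_ideal ?F" if "p \<in> ?F" for p
    using that unfolding radical_ideal_def by (intro CollectI exI[of _ 1]) simp
  let ?f = "coordinate_morphism :: 'n exotic_coord \<Rightarrow> (nat, F2_bar) mpoly"
  define f' :: "nat \<Rightarrow> ('n exotic_coord, F2_bar) mpoly" where
    "f' = coords 0 (\<lambda>i. Var (Inl i)) (\<lambda>i j. Var (Inr (i, j)))"
  have "morphism (radical_ideal ?F) ?E ?f"
    unfolding morphism_def radical_ideal_def E using coordinate_morphism_square by blast
  moreover have "morphism ?E (radical_ideal ?F) f'"
    unfolding morphism_def
  proof
    fix q assume "q \<in> radical_ideal ?F"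
    then obtain n where n: "q ^ n \<in> ?F" by (auto simp: radical_ideal_def)
    have "eval_at z (subst f' q) = 0" if z: "z \<in> exotic_points" for z
    proof -
      have pf: "point_map f' z = coords 0 (\<lambda>i. z (Inl i)) (\<lambda>i j. z (Inr (i, j)))"
        unfolding point_map_def f'_def coords_map[of "eval_at _", OF eval_at_simps(4)]
        by (rule coords_cong) (simp_all add: eval_at_simps)
      have "x_matrix (point_map f' z) = mpart z" by (simp add: pf x_matrix_def mpart_def)
      then have "point_map f' z \<in> family TYPE('n)"
        unfolding family_iff using z by (simp add: pf exotic_points_def alternating_F2_bar mpart_def)
      then have "point_map f' z \<in> points ?F"
        unfolding points_fibre points_family by (simp add: pf)
      then have "eval_at (point_map f' z) q ^ n = 0" using n by (auto simp: points_def simp flip: eval_at_simps)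
      then show ?thesis by (simp add: eval_at_subst_point_map)
    qed
    then show "subst f' q \<in> ?E" by (simp add: E vanishing_ideal_def)
  qed
  moreover have "subst ?f (f' v) - Var v \<in> radical_ideal ?F" for v
  proof (rule rad, rule fibreI[of _ _ "coords 1 (\<lambda>i :: 'n + 'n. 0) (\<lambda>i j. 0) v"])
    show "subst ?f (f' v) - Var v + coords 1 (\<lambda>i :: 'n + 'n. 0) (\<lambda>i j. 0) v * (Var 0 - Const 0) \<in> family_ideal TYPE('n)"
      by (cases v rule: coord_cases[where 'n = 'n])
        (simp_all add: f'_def coordinate_morphism_def subst_simps ideal.subspace_0 vanishing_ideal_def eval_at_simps family_iff)
  qed simp
  moreover have "subst f' (?f w) - Var w \<in> ?E" for w
    by (cases w) (auto simp: f'_def coordinate_morphism_def E vanishing_ideal_def eval_at_simps)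
  ultimately show ?thesis unfolding isomorphic_def inverse_morphisms_def by blast
qed

section \<open>Families of orbits\<close>

text \<open>The coordinates of \<open>z\<close> are not polynomials in those of
  \<open>deform z t\<close>, but their squares are. Squaring the coefficients as well yields the
  square of the value of \<open>p\<close>, whatever \<open>t\<close> is.\<close>

definition square_lift :: "('n::finite exotic_coord, F2_bar) mpoly \<Rightarrow> (nat, F2_bar) mpoly" where
  "square_lift p = eval_hom (\<lambda>c. Const (c ^ 2))
    (case_sum (\<lambda>i. Var (d_coord i)) (\<lambda>(i, j). Var (x_coord i j) ^ 2 + (Var 0) ^ 2 * (Var (d_coord i) * Var (d_coord j)))) p"

lemma eval_square_lift: "eval_at (deform z t) (square_lift p) = eval_at z p ^ 2"
proof -
  have e: "eval_at (deform z t) (case_sum (\<lambda>i. Var (d_coord i))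
      (\<lambda>(i, j). Var (x_coord i j) ^ 2 + (Var 0) ^ 2 * (Var (d_coord i) * Var (d_coord j))) c) = z c ^ 2" for c
  proof (cases c)
    case (Inr q)
    obtain i j where q: "q = (i, j)" by (cases q)
    let ?a = "z (Inr (i, j))" and ?b = "t * (z (Inl i) * z (Inl j))"
    have "(?a + ?b) ^ 2 + ?b ^ 2 = ?a ^ 2 + (?b ^ 2 + ?b ^ 2)" by (simp add: ring_hom_onD(1)[OF frob])
    then show ?thesis
      by (simp add: Inr q eval_at_simps deform_def power_mult_distrib F2_bar_double)
  qed (simp add: eval_at_simps deform_def)
  show ?thesis
    unfolding square_lift_def hom_eval_hom[OF eval_at_hom ring_hom_on_comp[OF ring_hom_on_Const frob]] e
    unfolding eval_at_def hom_eval_hom[OF frob ring_hom_on_id] by (simp flip: eval_at_def)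
qed

text \<open>A function and its square have the same zeros, so \<open>square_lift\<close> transports
  both the equations of the orbit closure and the open conditions cutting out the orbit.\<close>

lemma orbit_family:
  fixes x :: "'n::finite exotic_coord \<Rightarrow> F2_bar"
  assumes x: "x \<in> exotic_points"
  defines "Z \<equiv> orbit exotic_action x"
  defines "J \<equiv> vanishing_ideal {deform z t | z t. z \<in> Z}"
  defines "U \<equiv> square_lift ` {F. \<forall>y\<in>points (vanishing_ideal Z). eval_at y F \<noteq> 0 \<longrightarrow> y \<in> Z}"
  shows "family_ideal TYPE('n) \<subseteq> J" and "lc_points J U = {deform z t | z t. z \<in> Z}"
proof -
  have Z: "Z \<subseteq> exotic_points"
    using exotic_points_act[OF _ x] by (auto simp: Z_def orbit_exotic)
  then show sub: "family_ideal TYPE('n) \<subseteq> J"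
    by (auto simp: J_def vanishing_ideal_def family_def)
  show "lc_points J U = {deform z t | z t. z \<in> Z}"
  proof (intro equalityI subsetI)
    fix y assume "y \<in> lc_points J U"
    then obtain F where y: "y \<in> points J" and F: "\<forall>y\<in>points (vanishing_ideal Z). eval_at y F \<noteq> 0 \<longrightarrow> y \<in> Z"
      "eval_at y (square_lift F) \<noteq> 0"
      by (auto simp: lc_points_def U_def)
    have "y \<in> points (family_ideal TYPE('n))" using y sub by (auto simp: points_def)
    then obtain z :: "'n exotic_coord \<Rightarrow> F2_bar" and t where zt: "y = deform z t"
      unfolding points_family by (auto simp: family_def)
    have "eval_at z p = 0" if "p \<in> vanishing_ideal Z" for p
    proof -
      have "square_lift p \<in> J" using that by (auto simp: J_def vanishing_ideal_def eval_square_lift)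
      then have "eval_at z p ^ 2 = 0" using y by (auto simp: points_def zt simp flip: eval_square_lift[of z t])
      then show ?thesis by simp
    qed
    then have "z \<in> points (vanishing_ideal Z)" by (simp add: points_def)
    then show "y \<in> {deform z t | z t. z \<in> Z}" using F zt by (auto simp: eval_square_lift)
  next
    fix y assume "y \<in> {deform z t | z t. z \<in> Z}"
    then obtain z t where z: "z \<in> Z" and y: "y = deform z t" by blast
    obtain F where "eval_at z F \<noteq> 0" "\<forall>y\<in>points (vanishing_ideal Z). eval_at y F \<noteq> 0 \<longrightarrow> y \<in> Z"
      using orbit_locally_closed[OF z[unfolded Z_def]] unfolding Z_def by blast
    then have "square_lift F \<in> U" "eval_at y (square_lift F) \<noteq> 0" by (simp_all add: U_def y eval_square_lift)
    moreover have "y \<in> points J" using z by (auto simp: y points_def J_def vanishing_ideal_def)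
    ultimately show "y \<in> lc_points J U" by (auto simp: lc_points_def)
  qed
qed

theorem theorem2:
  shows "\<exists>(NS :: (nat, F2_bar) mpoly set) (act :: (F2_bar, 'n::finite, nat) action) \<pi>.
    affine_finite_type NS \<and> algebraic_action NS act \<and>
    invariant_function NS act \<pi> \<and> flat_over_line NS \<pi> \<and>
    (\<forall>t. t \<noteq> 0 \<longrightarrow> equivariantly_isomorphic (fibre NS \<pi> t) act nilcone adjoint_action) \<and>
    (\<exists>F1. isogeny exotic_nilcone exotic_action (fibre NS \<pi> 0) act F1 \<and>
      isomorphic (radical_ideal (fibre NS \<pi> 0)) (exotic_nilcone :: ('n exotic_coord, F2_bar) mpoly set) \<and>
      (\<forall>x\<in>points exotic_nilcone. \<exists>J U.
         is_ideal J \<and> NS \<subseteq> J \<and> radical_ideal J = J \<and>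
         lc_flat_over_line J U \<pi> \<and>
         (\<forall>t. \<exists>y\<in>points (fibre NS \<pi> t).
            lc_points J U \<inter> points (fibre NS \<pi> t) = orbit act y) \<and>
         lc_points J U \<inter> points (fibre NS \<pi> 0) = point_map F1 ` orbit exotic_action x))"
proof -
  let ?NS = "family_ideal TYPE('n)" and ?act = "family_action :: (F2_bar, 'n, nat) action"
  let ?\<pi> = "Var 0 :: (nat, F2_bar) mpoly"
  have "affine_finite_type ?NS"
    unfolding affine_finite_type_def
  proof (intro conjI exI allI impI)
    fix i assume "CARD('n exotic_coord option) \<le> i"
    then show "Var i \<in> ?NS" unfolding vanishing_ideal_def by (simp add: family_iff del: card_UNIV_option)
  qed simp
  moreover have "invariant_function ?NS ?act ?\<pi>"
    unfolding invariant_function_def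
    by (simp add: family_action_def twisted_act_def ideal.subspace_0)
  moreover have "flat_over_line ?NS ?\<pi>"
    unfolding family_def by (rule swept_flat[OF deform_swept])
  moreover have "\<exists>J U. is_ideal J \<and> ?NS \<subseteq> J \<and> radical_ideal J = J \<and> lc_flat_over_line J U ?\<pi> \<and>
      (\<forall>t. \<exists>y\<in>points (fibre ?NS ?\<pi> t). lc_points J U \<inter> points (fibre ?NS ?\<pi> t) = orbit ?act y) \<and>
      lc_points J U \<inter> points (fibre ?NS ?\<pi> 0) = point_map frobenius_isogeny ` orbit exotic_action x"
    if "x \<in> points (exotic_nilcone :: ('n exotic_coord, F2_bar) mpoly set)" for x
  proof -
    have x: "x \<in> exotic_points" using that by (simp add: points_exotic)
    let ?Z = "orbit exotic_action x"
    let ?J = "vanishing_ideal {deform z t | z t. z \<in> ?Z}"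
    let ?U = "square_lift ` {F. \<forall>y\<in>points (vanishing_ideal ?Z). eval_at y F \<noteq> 0 \<longrightarrow> y \<in> ?Z}"
    note Z = orbit_family[OF x]
    \<comment> \<open>Injectivity of \<open>deform\<close> separates the values of \<open>t\<close>,
      so each fibre meets the orbit family in one copy of the orbit.\<close>
    have fib: "lc_points ?J ?U \<inter> points (fibre ?NS ?\<pi> t) = (\<lambda>z. deform z t) ` ?Z" for t
      unfolding Z(2) points_special_fibre
      using exotic_points_act[OF _ x] by (auto simp: orbit_exotic dest!: deform_inj)
    have orb: "orbit ?act (deform x t) = (\<lambda>z. deform z t) ` ?Z" for t
      by (auto simp: orbit_exotic orbit_def[of ?act] point_map_family_action twisted_act_deform)
    have "deform x t \<in> points (fibre ?NS ?\<pi> t)" for t using x by (simp add: points_special_fibre)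
    then have "\<exists>y\<in>points (fibre ?NS ?\<pi> t). lc_points ?J ?U \<inter> points (fibre ?NS ?\<pi> t) = orbit ?act y" for t
      unfolding fib using orb by blast
    moreover have "lc_points ?J ?U \<inter> points (fibre ?NS ?\<pi> 0) = point_map frobenius_isogeny ` ?Z"
      unfolding fib by (simp add: point_map_frobenius_isogeny)
    moreover have "lc_flat_over_line ?J ?U ?\<pi>" by (rule swept_lc_flat[OF deform_swept])
    ultimately show ?thesis
      using Z(1) by (rule_tac x = ?J in exI, rule_tac x = ?U in exI) (simp add: radical_vanishing_ideal)
  qed
  ultimately show ?thesis
    using algebraic_family_action generic_fibre frobenius_isogeny_isogeny reduced_special_fibre
    by (intro exI[of _ ?NS] exI[of _ ?act] exI[of _ ?\<pi>] conjI exI[of _ frobenius_isogeny]) blast+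
qed

end
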